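(* Let $P$ be the truncated tetrahedron $P=T_1+T_2+T_3+T_4\subset\mathbb{R}^4$ (Minkowski sum), where $T_i=\mathrm{conv}\{e_j: j\in\{1,2,3,4\},\,j\ne i\}$, and let $\mathcal{A}$ be the associated $8\times12$ Cayley matrix. Then $P$ has exactly $1068$ mixed subdivisions, one for each triangulation of the Cayley polytope $\mathrm{conv}(\mathcal{A})$. Precisely $1002$ of the $1068$ triangulations are regular. The regular triangulations form $48$ symmetry classes, and the non-regular triangulations form $7$ symmetry classes.
   Context: Let $$A_1=\begin{bmatrix}0&1&0&0\\0&0&1&0\\0&0&0&1\end{bmatrix},\ A_2=\begin{bmatrix}1&0&0&0\\0&0&1&0\\0&0&0&1\end{bmatrix},\ A_3=\begin{bmatrix}1&0&0&0\\0&1&0&0\\0&0&0&1\end{bmatrix},\ A_4=\begin{bmatrix}1&0&0&0\\0&1&0&0\\0&0&1&0\end{bmatrix}.$$ The Cayley matrix is $$\mathcal{A}=\begin{bmatrix}A_1^T&A_2^T&A_3^T&A_4^T\\\mathbf1&\mathbf0&\mathbf0&\mathbf0\\\mathbf0&\mathbf1&\mathbf0&\mathbf0\\\mathbf0&\mathbf0&\mathbf1&\mathbf0\\\mathbf0&\mathbf0&\mathbf0&\mathbf1\end{bmatrix},\qquad\mathbf1=[1\,1\,1],\ \mathbf0=[0\,0\,0],$$ whose 12 columns are the vertices of the 6-dimensional polytope $\mathrm{conv}(\mathcal{A})$; the columns are labelled, in order, by the variables $x_1,y_1,z_1,x_2,y_2,z_2,x_3,y_3,z_3,x_4,y_4,z_4$.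 A triangulation of $\mathrm{conv}(\mathcal{A})$ is a triangulation whose vertices are among the columns of $\mathcal{A}$; it is regular if it is induced by a lifting (height) function on the columns. A mixed subdivision of $P$ here means a fine mixed subdivision with respect to the summands $T_1,\dots,T_4$, i.e. one corresponding under the Cayley trick to a triangulation of $\mathrm{conv}(\mathcal{A})$: the 6-simplex whose vertices in block $i$ form the nonempty vertex set of a face $F_i$ of $T_i$ corresponds to the 3-dimensional cell $F_1+F_2+F_3+F_4$ (labelled by $(F_1,\dots,F_4)$), which is a cube or a triangular prism. Symmetry classes: a triangulation is identified with its Stanley–Reisner ideal, a squarefree monomial ideal in the polynomial ring in the 12 variables $x_i,y_i,z_i$; two triangulations are in the same symmetry class if their ideals are in the same orbit under the natural action of $(S_3)^4\rtimes S_4$, where the $i$-th copy of $S_3$ permutes the variables $x_i,y_i,z_i$ and $S_4$ permutes the indices $1,2,3,4$. *)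

theory Defs
  imports "HOL-Analysis.Analysis" "HOL-Library.Poly_Mapping"
begin

section \<open>The Cayley configuration\<close>

text \<open>Elements of the numeral types \<open>4\<close> and \<open>3\<close> are written \<open>1, 2, 3, 4\<close> and \<open>1, 2, 3\<close>
  (with \<open>4 = 0\<close> and \<open>3 = 0\<close>, respectively); \<open>vector\<close> lists components \<open>1, 2, \<dots>\<close> in this order.
  The columns of the Cayley matrix are labelled by pairs: \<open>(i, 1)\<close>, \<open>(i, 2)\<close>, \<open>(i, 3)\<close> stand for the
  variables \<open>x_i\<close>, \<open>y_i\<close>, \<open>z_i\<close>.\<close>

type_synonym label = "4 \<times> 3"

definition block :: "4 \<Rightarrow> real^4^3" where
  "block i =
    (if i = 1 then vector [vector [0,1,0,0], vector [0,0,1,0], vector [0,0,0,1]]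
     else if i = 2 then vector [vector [1,0,0,0], vector [0,0,1,0], vector [0,0,0,1]]
     else if i = 3 then vector [vector [1,0,0,0], vector [0,1,0,0], vector [0,0,0,1]]
     else vector [vector [1,0,0,0], vector [0,1,0,0], vector [0,0,1,0]])"

text \<open>Rows \<open>Inl j\<close> are the four upper rows, made of the transposed blocks; rows \<open>Inr k\<close> are the
  four lower rows, made of the blocks of ones and zeros.\<close>

definition cayley_matrix :: "real^label^(4 + 4)" where
  "cayley_matrix = (\<chi> k v. case k of
      Inl j \<Rightarrow> transpose (block (fst v)) $ j $ snd v
    | Inr i \<Rightarrow> (if i = fst v then 1 else 0))"

abbreviation cayley_point :: "label \<Rightarrow> real^(4 + 4)" where
  "cayley_point v \<equiv> column v cayley_matrix"

definition cayley_polytope :: "(real^(4 + 4)) set" where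
  "cayley_polytope = convex hull (range cayley_point)"

section \<open>Triangulations\<close>

text \<open>A triangulation is given by all of its simplices, including the lower-dimensional ones and
  the empty simplex (the library's \<open>simplicial_complex\<close> is closed under faces, and the empty set
  is a face).\<close>

definition cayley_triangulations :: "(real^(4 + 4)) set set set" where
  "cayley_triangulations = {\<C>. simplicial_complex \<C> \<and> \<Union>\<C> = cayley_polytope \<and>
     (\<forall>S\<in>\<C>. \<forall>x. x extreme_point_of S \<longrightarrow> x \<in> range cayley_point)}"

definition vertex_labels :: "(real^(4 + 4)) set \<Rightarrow> label set" where
  "vertex_labels S = {v. cayley_point v extreme_point_of S}"

definition lifted_polytope :: "(label \<Rightarrow> real) \<Rightarrow> ((real^(4 + 4)) \<times> real) set" where
  "lifted_polytope \<omega> = convex hull (range (\<lambda>v. (cayley_point v, \<omega> v)))"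

text \<open>The nonempty lower faces of the lifted polytope: those on which some linear functional with
  last coefficient \<open>1\<close> is minimal.\<close>

definition lower_faces :: "(label \<Rightarrow> real) \<Rightarrow> ((real^(4 + 4)) \<times> real) set set" where
  "lower_faces \<omega> = {F. \<exists>c. F = {p \<in> lifted_polytope \<omega>.
     \<forall>q \<in> lifted_polytope \<omega>. c \<bullet> fst p + snd p \<le> c \<bullet> fst q + snd q}}"

definition regular_triangulation :: "(real^(4 + 4)) set set \<Rightarrow> bool" where
  "regular_triangulation \<C> \<longleftrightarrow> \<C> \<in> cayley_triangulations \<and>
     (\<exists>\<omega>. \<C> = insert {} ((\<lambda>F. fst ` F) ` lower_faces \<omega>))"

section \<open>Mixed subdivisions of the truncated tetrahedron\<close>

definition summand :: "4 \<Rightarrow> (real^4) set" where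
  "summand i = convex hull {axis j 1 | j. j \<noteq> i}"

text \<open>In the following, \<open>+\<close> and \<open>\<Sum>\<close> on sets are Minkowski sums.\<close>

definition truncated_tetrahedron :: "(real^4) set" where
  "truncated_tetrahedron = summand 1 + summand 2 + summand 3 + summand 4"

definition fine_mixed_cell :: "(4 \<Rightarrow> (real^4) set) \<Rightarrow> bool" where
  "fine_mixed_cell F \<longleftrightarrow> (\<forall>i. F i face_of summand i \<and> F i \<noteq> {}) \<and>
     aff_dim (\<Sum>i\<in>UNIV. F i) = 3 \<and> (\<Sum>i\<in>UNIV. aff_dim (F i)) = 3"

text \<open>A mixed subdivision is given by its full-dimensional labelled cells. Two cells have to meet in
  a common face as labelled cells: since the summands are simplices, \<open>F i \<inter> G i\<close> is always a
  common face of \<open>F i\<close> and \<open>G i\<close>, and the label of the intersection has to be the family of these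
  faces. If some \<open>F i \<inter> G i\<close> is empty, then so is the Minkowski sum, and the two cells have to be
  disjoint.\<close>

definition mixed_subdivisions :: "(4 \<Rightarrow> (real^4) set) set set" where
  "mixed_subdivisions = {M. (\<forall>F\<in>M. fine_mixed_cell F) \<and>
     (\<Union>F\<in>M. \<Sum>i\<in>UNIV. F i) = truncated_tetrahedron \<and>
     (\<forall>F\<in>M. \<forall>G\<in>M.
        (\<Sum>i\<in>UNIV. F i) \<inter> (\<Sum>i\<in>UNIV. G i) face_of (\<Sum>i\<in>UNIV. F i) \<and>
        (\<Sum>i\<in>UNIV. F i) \<inter> (\<Sum>i\<in>UNIV. G i) face_of (\<Sum>i\<in>UNIV. G i) \<and>
        (\<Sum>i\<in>UNIV. F i) \<inter> (\<Sum>i\<in>UNIV. G i) = (\<Sum>i\<in>UNIV. F i \<inter> G i))}"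

text \<open>The Cayley trick. The rows of \<open>block i\<close> are the vertices of \<open>summand i\<close>.\<close>

definition cayley_cell :: "(real^(4 + 4)) set \<Rightarrow> 4 \<Rightarrow> (real^4) set" where
  "cayley_cell S i = convex hull {row r (block i) | r. (i, r) \<in> vertex_labels S}"

definition cayley_trick :: "(real^(4 + 4)) set set \<Rightarrow> (4 \<Rightarrow> (real^4) set) set" where
  "cayley_trick \<C> = cayley_cell ` {S \<in> \<C>. 6 simplex S}"

section \<open>Stanley--Reisner ideals and symmetry classes\<close>

text \<open>Polynomials in the twelve variables over \<open>'k\<close>: finitely supported maps from exponent vectors
  to coefficients, with the convolution product.\<close>

type_synonym 'k polyring = "(label \<Rightarrow>\<^sub>0 nat) \<Rightarrow>\<^sub>0 'k"

definition var :: "label \<Rightarrow> 'k::field polyring" where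
  "var v = Poly_Mapping.single (Poly_Mapping.single v 1) 1"

text \<open>The ideal generated by a set is its span in the ring as a module over itself.\<close>

definition stanley_reisner_ideal :: "(real^(4 + 4)) set set \<Rightarrow> 'k::field polyring set" where
  "stanley_reisner_ideal \<C> =
     module.span (*) {\<Prod>v\<in>\<sigma>. var v | \<sigma>. \<sigma> \<notin> vertex_labels ` \<C>}"

text \<open>The group \<open>(S_3)^4 \<rtimes> S_4\<close> as a set of permutations of the variables.\<close>

definition label_perms :: "(label \<Rightarrow> label) set" where
  "label_perms = {\<lambda>(i, r). (\<sigma> i, \<rho> i r) | \<sigma> \<rho>. bij \<sigma> \<and> (\<forall>i. bij (\<rho> i))}"

text \<open>\<open>map_key f p\<close> has the coefficient of \<open>p\<close> at \<open>f k\<close> as its coefficient at \<open>k\<close> (for injective \<open>f\<close>),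
  so for a permutation \<open>\<pi>\<close> this substitutes \<open>var (\<pi> v)\<close> for \<open>var v\<close>.\<close>

definition rename_vars :: "(label \<Rightarrow> label) \<Rightarrow> 'k::field polyring \<Rightarrow> 'k polyring" where
  "rename_vars \<pi> = Poly_Mapping.map_key (Poly_Mapping.map_key \<pi>)"

lemma inj_map_key:
  assumes "bij \<pi>"
  shows "inj (Poly_Mapping.map_key \<pi> :: (label \<Rightarrow>\<^sub>0 nat) \<Rightarrow> _)"
proof (rule injI)
  fix m n :: "label \<Rightarrow>\<^sub>0 nat"
  assume eq: "Poly_Mapping.map_key \<pi> m = Poly_Mapping.map_key \<pi> n"
  show "m = n"
  proof (rule poly_mapping_eqI)
    fix v
    have "Poly_Mapping.lookup m (\<pi> (inv \<pi> v)) = Poly_Mapping.lookup n (\<pi> (inv \<pi> v))"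
      using arg_cong[OF eq, of "\<lambda>q. Poly_Mapping.lookup q (inv \<pi> v)"] assms
      by (simp add: map_key.rep_eq bij_is_inj)
    then show "Poly_Mapping.lookup m v = Poly_Mapping.lookup n v"
      using assms by (simp add: bij_is_surj surj_f_inv_f)
  qed
qed

lemma rename_vars_var:
  assumes "bij \<pi>"
  shows "rename_vars \<pi> (var v :: 'k::field polyring) = var (\<pi> v)"
proof -
  have *: "Poly_Mapping.map_key \<pi> (Poly_Mapping.single (\<pi> v) (1::nat)) = Poly_Mapping.single v 1"
    using assms by (simp add: map_key_single bij_is_inj)
  show ?thesis
    unfolding rename_vars_def var_def *[symmetric]
    by (rule map_key_single) (rule inj_map_key[OF assms])
qed

text \<open>Two triangulations are in the same symmetry class iff their Stanley--Reisner ideals are in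
  the same orbit; the argument only fixes the coefficient field.\<close>

definition symmetry_rel ::
    "'k::field itself \<Rightarrow> ((real^(4 + 4)) set set \<times> (real^(4 + 4)) set set) set" where
  "symmetry_rel _ = {(\<C>, \<D>). \<C> \<in> cayley_triangulations \<and> \<D> \<in> cayley_triangulations \<and>
     (\<exists>\<pi>\<in>label_perms. (stanley_reisner_ideal \<D> :: 'k polyring set) =
        rename_vars \<pi> ` stanley_reisner_ideal \<C>)}"

end

theory Submission
  imports Defs
begin

text \<open>The twelve columns are the edges of \<open>K\<^sub>4\<^sub>,\<^sub>4\<close> minus a perfect matching, the column \<open>v\<close> joining
  \<open>fst v\<close> to \<open>right v\<close>, and affine independence means acyclicity. So a triangulation is a set of
  spanning trees, any two of which are compatible: no point of the cone over the columns is a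
  nonnegative flow on one of them and a different flow on the other. Compatibility only has to be
  tested on matchings with the same ends.

  Two necessary conditions hold for triangulations and for mixed subdivisions alike. Every vector of
  right degrees of a spanning tree is the right degree of some tree in the family (the tree containing
  a generic point of the polytope), and the lattice points of the truncated tetrahedron have at most
  one expression as a sum of edges of trees in the family. An exhaustive search based on these
  conditions, up to the action of \<open>S\<^sub>4\<close>, leaves 55 families. Each of them is a triangulation, because the
  trees are compatible and every facet is shared or lies in the boundary: a segment from a point of a
  tree to any other point cannot leave the union. Regularity is equivalent to a system of strict
  inequalities between heights of matchings with the same ends; it is solved for 48 families and
  refuted by Farkas certificates for the other 7. An integer invariant under the group
  \<open>(S\<^sub>3)\<^sup>4 \<rtimes> S\<^sub>4\<close> takes 55 different values, which separates both the \<open>S\<^sub>4\<close>-orbits and the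
  symmetry classes; the orbit--stabilizer theorem for \<open>S\<^sub>4\<close> gives the counts.\<close>

subsection \<open>Edges, flows and matchings\<close>

text \<open>Neither count is derived from the other: the cells of every triangulation and of every
  mixed subdivision form an admissible family, the computation places admissible families among
  those listed, and each listed family gives one object of both kinds. So the search has to be
  complete only; that its leaves are triangulations rests on separate certificates. A triangulation
  may a priori have simplices in no full-dimensional one; purity follows once its trees are known to
  cover the polytope. The shift 3/4 in the test points makes all coordinates along a tree whose cone
  contains the point positive, so the simplex found there has full dimension. Permuting the labels
  of a single block can destroy affine dependencies, so the group of the symmetry classes acts on
  ideals but not on triangulations. It might merge several S_4-orbits; hence an invariant of the
  larger group is needed. The checks run by rewriting, which explains the lists of Booleans and the
  unary numbers.\<close>

definition right :: "label \<Rightarrow> 4" where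
  "right v =
    (if fst v = 1 then if snd v = 1 then 2 else if snd v = 2 then 3 else 4
     else if fst v = 2 then if snd v = 1 then 1 else if snd v = 2 then 3 else 4
     else if fst v = 3 then if snd v = 1 then 1 else if snd v = 2 then 2 else 4
     else if snd v = 1 then 1 else if snd v = 2 then 2 else 3)"

definition labels :: "label list" where
  "labels = [(1,1),(1,2),(1,3),(2,1),(2,2),(2,3),(3,1),(3,2),(3,3),(4,1),(4,2),(4,3)]"

lemma distinct_labels: "distinct labels"
  by (simp add: labels_def)

lemma set_labels: "set labels = UNIV"
proof -
  have "v \<in> set labels" for v :: label
    using exhaust_4[of "fst v"] exhaust_3[of "snd v"]
    by (cases v) (auto simp: labels_def)
  then show ?thesis by auto
qed

lemma all_label: "(\<forall>v. P v) \<longleftrightarrow> list_all P labels"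
  using set_labels by (auto simp: list_all_iff)

lemma vector_4:
  "(vector [w,x,y,z] :: 'a::zero^4) $ 1 = w"
  "(vector [w,x,y,z] :: 'a::zero^4) $ 2 = x"
  "(vector [w,x,y,z] :: 'a::zero^4) $ 3 = y"
  "(vector [w,x,y,z] :: 'a::zero^4) $ 4 = z"
  unfolding vector_def by simp_all

lemma block_row: "block i $ r = axis (right (i, r)) 1"
proof -
  have "\<forall>v. block (fst v) $ snd v = axis (right v) 1"
    unfolding all_label labels_def
    by (simp add: block_def right_def vec_eq_iff axis_def forall_4 vector_4 vector_3)
  then show ?thesis by (metis fst_conv snd_conv)
qed

lemma cayley_point_Inl: "cayley_point v $ Inl j = (if right v = j then 1 else 0)"
  by (auto simp: column_def cayley_matrix_def transpose_def block_row axis_def)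

lemma cayley_point_Inr: "cayley_point v $ Inr i = (if fst v = i then 1 else 0)"
  by (auto simp: column_def cayley_matrix_def)

lemma right_neq: "right v \<noteq> fst v"
proof -
  have "\<forall>v. right v \<noteq> fst v" unfolding all_label labels_def by (simp add: right_def)
  then show ?thesis by blast
qed

lemma label_eqI:
  assumes "fst u = fst v" "right u = right v" shows "u = v"
proof -
  have "\<forall>u. \<forall>v. fst u = fst v \<longrightarrow> right u = right v \<longrightarrow> u = v"
    unfolding all_label labels_def by (simp add: right_def)
  then show ?thesis using assms by blast
qed

lemma ex_label:
  assumes "i \<noteq> j" shows "\<exists>v. fst v = i \<and> right v = j"
proof -
  have "list_ex (\<lambda>v. fst v = i \<and> right v = j) labels"
    using assms exhaust_4[of i] exhaust_4[of j]
    by (auto simp: labels_def right_def)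
  then show ?thesis by (auto simp: list_ex_iff)
qed

text \<open>The vertex sums of the edge weights \<open>f\<close>: component \<open>Inr i\<close>
  collects the weights at the left vertex \<open>i\<close>, component \<open>Inl j\<close> those at
  the right vertex \<open>j\<close>.\<close>

definition marg :: "(label \<Rightarrow> real) \<Rightarrow> real^(4 + 4)" where
  "marg f = (\<Sum>v\<in>UNIV. f v *\<^sub>R cayley_point v)"

lemma marg_Inr: "marg f $ Inr i = (\<Sum>v | fst v = i. f v)"
  by (simp add: marg_def cayley_point_Inr if_distrib sum.If_cases cong: if_cong)

lemma marg_Inl: "marg f $ Inl j = (\<Sum>v | right v = j. f v)"
  by (simp add: marg_def cayley_point_Inl if_distrib sum.If_cases cong: if_cong)

lemma vec_sum_eqI:
  fixes x y :: "real^(4 + 4)"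
  assumes "\<And>i. x $ Inr i = y $ Inr i" "\<And>j. x $ Inl j = y $ Inl j"
  shows "x = y"
  unfolding vec_eq_iff using assms by (metis sum.exhaust)

lemma marg_add: "marg (\<lambda>v. f v + g v) = marg f + marg g"
  by (simp add: marg_def scaleR_add_left sum.distrib)

lemma marg_diff: "marg (\<lambda>v. f v - g v) = marg f - marg g"
  by (simp add: marg_def scaleR_diff_left sum_subtractf)

lemma marg_scale: "marg (\<lambda>v. c * f v) = c *\<^sub>R marg f"
  by (simp add: marg_def scaleR_sum_right)

lemma marg_sum: "marg (\<lambda>v. \<Sum>i\<in>I. f i v) = (\<Sum>i\<in>I. marg (f i))"
  unfolding marg_def scaleR_sum_left by (rule sum.swap)

lemma marg_indicator: "marg (indicat_real A) = (\<Sum>v\<in>A. cayley_point v)"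
  by (simp add: marg_def indicator_scaleR_eq_if sum.If_cases)

lemma marg_single: "marg (\<lambda>u. if u = v then 1 else 0) = cayley_point v"
proof -
  have "(\<lambda>u. if u = v then 1 else 0) = indicat_real {v}" by (auto simp: indicator_def)
  then show ?thesis by (simp add: marg_indicator)
qed

text \<open>All columns lie on the hyperplane \<open>total x = 1\<close>; this linear form mediates
  between the polytope and the cone over it.\<close>

definition total :: "real^(4 + 4) \<Rightarrow> real" where
  "total x = (\<Sum>i\<in>UNIV. x $ Inr i)"

lemma linear_total: "linear total"
  by (rule linearI) (simp_all add: total_def sum.distrib sum_distrib_left)

lemma total_point [simp]: "total (cayley_point v) = 1"
  by (simp add: total_def cayley_point_Inr)

lemma total_marg: "total (marg f) = sum f UNIV"
  by (simp add: marg_def linear_sum[OF linear_total] linear_cmul[OF linear_total])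

lemma linear_marg_eq: "linear h \<Longrightarrow> h (marg f) = (\<Sum>v\<in>UNIV. f v *\<^sub>R h (cayley_point v))"
  by (simp add: marg_def linear_sum linear_cmul)

lemma total_right: "(\<Sum>j\<in>UNIV. marg f $ Inl j) = total (marg f)"
proof -
  have l: "linear (\<lambda>x::real^(4+4). \<Sum>j\<in>UNIV. x $ Inl j)"
    by (rule linearI) (simp_all add: sum.distrib sum_distrib_left)
  show ?thesis
    using linear_marg_eq[OF l, of f] total_marg[of f] by (simp add: cayley_point_Inl)
qed

definition supported :: "label set \<Rightarrow> (label \<Rightarrow> real) \<Rightarrow> bool" where
  "supported A f \<longleftrightarrow> (\<forall>v. v \<notin> A \<longrightarrow> f v = 0)"

text \<open>No nonzero circulation lives on \<open>A\<close>: in terms of the graph,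
  \<open>A\<close> is a forest.\<close>

definition indep :: "label set \<Rightarrow> bool" where
  "indep A \<longleftrightarrow> (\<forall>f. supported A f \<longrightarrow> marg f = 0 \<longrightarrow> (\<forall>v. f v = 0))"

lemma indep_unique:
  assumes "indep A" "supported A f" "supported A g" "marg f = marg g"
  shows "f = g"
proof -
  have "supported A (\<lambda>v. f v - g v)" "marg (\<lambda>v. f v - g v) = 0"
    using assms by (auto simp: supported_def marg_diff)
  then have "f v - g v = 0" for v using assms(1) unfolding indep_def by blast
  then show ?thesis by auto
qed

lemma indep_subset: "indep B \<Longrightarrow> A \<subseteq> B \<Longrightarrow> indep A"
  unfolding indep_def supported_def by blast

section \<open>Matchings with the same ends and alternating cycles\<close>

definition matching :: "label set \<Rightarrow> bool" where
  "matching m \<longleftrightarrow> inj_on fst m \<and> inj_on right m"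

definition same_ends :: "label set \<Rightarrow> label set \<Rightarrow> bool" where
  "same_ends m n \<longleftrightarrow> fst ` m = fst ` n \<and> right ` m = right ` n"

text \<open>The symmetric difference of two matchings with the same ends consists of cycles
  alternating between them, so this excludes cycles whose edges lie alternately in \<open>A\<close>
  and in \<open>B\<close>. For \<open>A = B\<close> it is acyclicity.\<close>

definition compatible :: "label set \<Rightarrow> label set \<Rightarrow> bool" where
  "compatible A B \<longleftrightarrow> (\<forall>m n. m \<subseteq> A \<longrightarrow> n \<subseteq> B \<longrightarrow> matching m \<longrightarrow> matching n \<longrightarrow> same_ends m n \<longrightarrow> m = n)"

lemma card_fibre:
  fixes g :: "label \<Rightarrow> 4"
  assumes "inj_on g m" shows "(\<Sum>v | g v = i. indicat_real m v) = (if i \<in> g ` m then 1 else 0)"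
    (is "?s = _")
proof -
  have *: "?s = card (m \<inter> {v. g v = i})"
    using sum.inter_restrict[of "{v. g v = i}" "\<lambda>v. 1::real" m, OF finite]
    by (simp add: indicator_def of_bool_def Int_commute)
  show ?thesis
  proof (cases "i \<in> g ` m")
    case True
    then obtain v where "v \<in> m" "g v = i" by auto
    then have "m \<inter> {v. g v = i} = {v}" using assms by (auto dest: inj_onD)
    then show ?thesis using * True by simp
  next
    case False
    then have "m \<inter> {v. g v = i} = {}" by auto
    then show ?thesis using * False by simp
  qed
qed

lemma marg_same_ends:
  assumes "matching m" "matching n" "same_ends m n"
  shows "marg (indicat_real m) = marg (indicat_real n)"
  using assms
  by (intro vec_sum_eqI) (auto simp: marg_Inr marg_Inl card_fibre matching_def same_ends_def)

lemma indicator_inj: "indicat_real m = indicat_real n \<Longrightarrow> m = n"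
  unfolding fun_eq_iff indicator_def of_bool_eq_iff by blast

text \<open>Matchings with the same ends have the same vertex sums, and on a forest these determine
  the weights.\<close>

lemma indep_imp_compatible:
  assumes "indep A" shows "compatible A A"
  unfolding compatible_def
proof (intro allI impI)
  fix m n assume *: "m \<subseteq> A" "n \<subseteq> A" "matching m" "matching n" "same_ends m n"
  have "indicat_real m = indicat_real n"
    by (rule indep_unique[OF assms])
      (use * in \<open>auto simp: supported_def marg_same_ends indicator_def\<close>)
  then show "m = n" by (rule indicator_inj)
qed

text \<open>A nonempty set of least cardinality that \<open>h\<close> maps into itself will do: its
  image is again such a set, hence not smaller.\<close>

lemma ex_invariant_subset:
  fixes h :: "'a::finite \<Rightarrow> 'a"
  assumes "L \<noteq> {}" "h ` L \<subseteq> L"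
  obtains Z where "Z \<noteq> {}" "Z \<subseteq> L" "h ` Z = Z"
proof -
  define P where "P Z \<longleftrightarrow> Z \<noteq> {} \<and> Z \<subseteq> L \<and> h ` Z \<subseteq> Z" for Z
  obtain Z where Z: "P Z" "\<And>Y. P Y \<Longrightarrow> card Z \<le> card Y"
    using ex_has_least_nat[of P L card] assms unfolding P_def by blast
  have "P (h ` Z)" using Z(1) unfolding P_def by blast
  then have "card Z \<le> card (h ` Z)" by (rule Z(2))
  then have "h ` Z = Z" using Z(1) unfolding P_def by (intro card_seteq) simp_all
  then show ?thesis using Z(1) that unfolding P_def by blast
qed

text \<open>Following alternately an edge where \<open>f > 0\<close> and an edge where \<open>f < 0\<close> maps the left vertices
  touched by the support to themselves; on an invariant set this map is bijective, and the two kinds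
  of edges form matchings with the same end points.\<close>

lemma circulation_matchings:
  assumes f: "marg f = 0" and nz: "f v0 \<noteq> 0"
  obtains m n where "matching m" "matching n" "same_ends m n" "m \<noteq> {}"
    "m \<subseteq> {v. f v > 0}" "n \<subseteq> {v. f v < 0}"
proof -
  \<comment> \<open>A positive entry in a vanishing sum forces a negative one. Applied to
    \<open>f\<close> and to \<open>- f\<close>, this lets the alternating walk continue at each
    vertex it reaches.\<close>
  have balance0: "\<exists>u. g u = g v \<and> F u < 0" if "F v > 0" "(\<Sum>u | g u = g v. F u) = 0"
    for g :: "label \<Rightarrow> 4" and v and F :: "label \<Rightarrow> real"
  proof (rule ccontr)
    assume "\<not> ?thesis"
    then have "\<forall>u\<in>{u. g u = g v}. F u \<ge> 0" by force
    then have "\<forall>u\<in>{u. g u = g v}. F u = 0"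
      using that(2) sum_nonneg_eq_0_iff[of "{u. g u = g v}" F, OF finite] by blast
    then have "F v = 0" by blast
    then show False using that(1) by simp
  qed
  have balance: "\<exists>u. g u = g v \<and> f u < 0" if "f v > 0" "(\<Sum>u | g u = g v. f u) = 0"
    for g :: "label \<Rightarrow> 4" and v
    using balance0[of f, OF that] .
  have balance': "\<exists>u. g u = g v \<and> f u > 0" if "f v < 0" "(\<Sum>u | g u = g v. f u) = 0"
    for g :: "label \<Rightarrow> 4" and v
    using balance0[of "\<lambda>v. - f v" v g] that by (simp add: sum_negf)
  have sums: "(\<Sum>u | fst u = i. f u) = 0" "(\<Sum>u | right u = i. f u) = 0" for i
    using marg_Inr[of f i] marg_Inl[of f i] f by (simp_all only: zero_index)
  define L where "L = fst ` {v. f v > 0}"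
  have "\<exists>v. f v > 0"
    using nz balance'[of v0 fst, OF _ sums(1)] linorder_neqE_linordered_idom[of "f v0" 0] by blast
  then have "L \<noteq> {}" by (auto simp: L_def)
  define a where "a i = (SOME v. fst v = i \<and> f v > 0)" for i
  have a: "fst (a i) = i \<and> f (a i) > 0" if "i \<in> L" for i
  proof -
    have "\<exists>v. fst v = i \<and> f v > 0" using that unfolding L_def by blast
    then show ?thesis unfolding a_def by (rule someI_ex)
  qed
  define b where "b i = (SOME v. right v = right (a i) \<and> f v < 0)" for i
  have b: "right (b i) = right (a i) \<and> f (b i) < 0" if "i \<in> L" for i
  proof -
    have "\<exists>v. right v = right (a i) \<and> f v < 0"
      using balance[of "a i" right, OF _ sums(2)] a[OF that] by blast
    then show ?thesis unfolding b_def by (rule someI_ex)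
  qed
  \<comment> \<open>\<open>h i\<close> is the left vertex reached from \<open>i\<close> along one
    positive and one negative edge.\<close>
  define h where "h i = fst (b i)" for i
  have "h i \<in> L" if iL: "i \<in> L" for i
  proof -
    obtain u where "fst u = fst (b i)" "f u > 0"
      using balance'[of "b i" fst, OF _ sums(1)] b[OF iL] by blast
    then show ?thesis unfolding h_def L_def by (intro image_eqI[of _ _ u]) simp_all
  qed
  then have "h ` L \<subseteq> L" by blast
  then obtain Z where Z: "Z \<noteq> {}" "Z \<subseteq> L" "h ` Z = Z"
    by (rule ex_invariant_subset[OF \<open>L \<noteq> {}\<close>])
  have injh: "inj_on h Z" using Z(3) by (simp add: eq_card_imp_inj_on)
  \<comment> \<open>The edge \<open>b i\<close> depends on \<open>i\<close> only through
    \<open>right (a i)\<close>, so a coincidence of right ends would contradict the injectivity of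
    \<open>h\<close> on \<open>Z\<close>.\<close>
  have ra: "inj_on (\<lambda>i. right (a i)) Z"
  proof (rule inj_onI)
    fix i j assume "i \<in> Z" "j \<in> Z" "right (a i) = right (a j)"
    then have "b i = b j" unfolding b_def by simp
    then show "i = j" using injh \<open>i \<in> Z\<close> \<open>j \<in> Z\<close> by (auto simp: h_def inj_on_def)
  qed
  have aZ: "fst (a i) = i" "f (a i) > 0" "right (b i) = right (a i)" "f (b i) < 0" if "i \<in> Z" for i
    using a b Z(2) that by blast+
  have "inj_on (fst \<circ> a) Z" "inj_on (right \<circ> a) Z" "inj_on (fst \<circ> b) Z" "inj_on (right \<circ> b) Z"
    using ra injh aZ unfolding inj_on_def h_def comp_def by simp_all
  then have "matching (a ` Z)" "matching (b ` Z)"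
    unfolding matching_def by (simp_all only: inj_on_imageI simp_thms)
  moreover have "fst ` a ` Z = Z"
  proof -
    have "(\<lambda>i. fst (a i)) ` Z = (\<lambda>i. i) ` Z" using aZ(1) by (intro image_cong) simp_all
    then show ?thesis by (simp add: image_image)
  qed
  moreover have "fst ` b ` Z = Z" using Z(3) by (simp add: h_def image_image)
  moreover have "right ` b ` Z = right ` a ` Z"
    unfolding image_image using aZ(3) by (intro image_cong) simp_all
  moreover have "a ` Z \<subseteq> {v. f v > 0}" "b ` Z \<subseteq> {v. f v < 0}" using aZ by blast+
  ultimately show ?thesis
    using that[of "a ` Z" "b ` Z"] Z(1) by (simp add: same_ends_def)
qed

text \<open>Where \<open>f - g\<close> is positive, \<open>f\<close> is nonzero; where it is
  negative, \<open>g\<close> is. So the alternating matchings found in a nonzero difference lie in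
  \<open>A\<close> and in \<open>B\<close>.\<close>

lemma compatible_flows_eq:
  assumes "compatible A B" "supported A f" "supported B g"
    "\<And>v. f v \<ge> 0" "\<And>v. g v \<ge> 0" "marg f = marg g"
  shows "f = g"
proof (rule ccontr)
  assume "f \<noteq> g"
  then obtain v0 where "f v0 \<noteq> g v0" by (meson ext)
  then have "f v0 - g v0 \<noteq> 0" by simp
  have c: "marg (\<lambda>v. f v - g v) = 0" using assms(6) by (simp add: marg_diff)
  obtain m n where mn: "matching m" "matching n" "same_ends m n" "m \<noteq> {}"
    "m \<subseteq> {v. f v - g v > 0}" "n \<subseteq> {v. f v - g v < 0}"
    by (rule circulation_matchings[OF c \<open>f v0 - g v0 \<noteq> 0\<close>])
  have "v \<in> A" if "v \<in> m" for v
  proof (rule ccontr)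
    assume "v \<notin> A"
    then have "f v = 0" using assms(2) unfolding supported_def by blast
    moreover have "f v - g v > 0" using mn(5) that by blast
    ultimately show False using assms(5)[of v] by simp
  qed
  then have "m \<subseteq> A" by blast
  moreover have "v \<in> B" if "v \<in> n" for v
  proof (rule ccontr)
    assume "v \<notin> B"
    then have "g v = 0" using assms(3) unfolding supported_def by blast
    moreover have "f v - g v < 0" using mn(6) that by blast
    ultimately show False using assms(4)[of v] by simp
  qed
  then have "n \<subseteq> B" by blast
  ultimately have "m = n" using assms(1) mn(1-3) unfolding compatible_def by blast
  moreover obtain v where "v \<in> m" using mn(4) by blast
  ultimately have "f v - g v > 0" "f v - g v < 0" using mn(5,6) by blast+
  then show False by simp
qed

text \<open>The positive and the negative part of a circulation are two nonnegative flows on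
  \<open>A\<close> with the same vertex sums.\<close>

lemma compatible_imp_indep:
  assumes "compatible A A" shows "indep A"
  unfolding indep_def
proof (intro allI impI)
  fix f v assume f: "supported A f" "marg f = 0"
  define p where "p v = max 0 (f v)" for v
  define q where "q v = max 0 (- f v)" for v
  have "marg (\<lambda>v. p v - q v) = marg f" by (rule arg_cong[of _ _ marg]) (auto simp: p_def q_def)
  then have "marg p = marg q" using f(2) by (simp add: marg_diff)
  then have "p = q"
    by (intro compatible_flows_eq[OF assms]) (use f(1) in \<open>auto simp: p_def q_def supported_def\<close>)
  then have "p v = q v" by simp
  then show "f v = 0" by (auto simp: p_def q_def max_def split: if_splits)
qed

subsection \<open>Cones and spanning trees\<close>

text \<open>Labels are treated as single objects; otherwise the simplifier would split every
  quantifier over them into block and position.\<close>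

declare split_paired_All [simp del] split_paired_Ex [simp del]

lemma supportedD: "supported A f \<Longrightarrow> v \<notin> A \<Longrightarrow> f v = 0"
  unfolding supported_def by blast

lemma cayley_point_axis: "cayley_point v = axis (Inr (fst v)) 1 + axis (Inl (right v)) 1"
  by (rule vec_sum_eqI) (simp_all add: cayley_point_Inr cayley_point_Inl axis_def)

lemma inj_cayley_point: "inj cayley_point"
proof (rule injI)
  fix u v assume *: "cayley_point u = cayley_point v"
  have "cayley_point u $ Inr (fst v) = 1" "cayley_point u $ Inl (right v) = 1"
    unfolding * by (simp_all add: cayley_point_Inr cayley_point_Inl)
  then have "fst u = fst v" "right u = right v"
    by (simp_all add: cayley_point_Inr cayley_point_Inl split: if_splits)
  then show "u = v" by (rule label_eqI)
qed

lemma sum_labels: "sum g UNIV = sum_list (map g labels)"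
  unfolding set_labels[symmetric] by (rule sum.distinct_set_conv_list[OF distinct_labels])

lemma sum_over_points:
  "(\<Sum>x\<in>cayley_point ` A. h x) = (\<Sum>v\<in>A. h (cayley_point v))"
  by (subst sum.reindex) (auto intro: inj_on_subset[OF inj_cayley_point])

lemma marg_supported: "supported A f \<Longrightarrow> marg f = (\<Sum>v\<in>A. f v *\<^sub>R cayley_point v)"
  unfolding marg_def by (rule sum.mono_neutral_right) (auto simp: supported_def)

lemma sum_supported: "supported A f \<Longrightarrow> sum f UNIV = sum f A"
  by (rule sum.mono_neutral_right) (auto simp: supported_def)

definition restr :: "label set \<Rightarrow> (real^(4 + 4) \<Rightarrow> real) \<Rightarrow> label \<Rightarrow> real" where
  "restr A U v = (if v \<in> A then U (cayley_point v) else 0)"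

lemma supported_restr: "supported A (restr A U)"
  by (simp add: supported_def restr_def)

lemma marg_restr: "marg (restr A U) = (\<Sum>x\<in>cayley_point ` A. U x *\<^sub>R x)"
  by (simp add: marg_supported[OF supported_restr] sum_over_points restr_def)

lemma indep_independent: "indep A \<longleftrightarrow> independent (cayley_point ` A)"
proof
  assume A: "indep A"
  have "U x = 0" if U: "(\<Sum>x\<in>cayley_point ` A. U x *\<^sub>R x) = 0" and x: "x \<in> cayley_point ` A" for U x
  proof -
    have "\<forall>v. restr A U v = 0"
      using A supported_restr[of A U] U unfolding indep_def marg_restr[symmetric] by blast
    then show ?thesis using x by (auto simp: restr_def split: if_splits)
  qed
  then show "independent (cayley_point ` A)"
    by (subst dependent_finite) auto
next
  assume A: "independent (cayley_point ` A)"
  show "indep A" unfolding indep_def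
  proof (intro allI impI)
    fix f v assume f: "supported A f" "marg f = 0"
    define U where "U x = f (inv cayley_point x)" for x
    have "U (cayley_point v) = f v" for v
      by (simp add: U_def inv_f_f[OF inj_cayley_point])
    then have "restr A U = f"
      using f(1) by (auto simp: restr_def supported_def)
    then have "\<forall>x\<in>cayley_point ` A. U x = 0"
      using A marg_restr[of A U] f(2) by (subst (asm) dependent_finite) auto
    then show "f v = 0" using f(1) \<open>\<And>v. U (cayley_point v) = f v\<close>
      unfolding supported_def by (metis imageI)
  qed
qed

text \<open>On the hyperplane \<open>total x = 1\<close> the coefficients of a linear relation add
  up to 0, so linear and affine dependence agree.\<close>

lemma indep_affine: "indep A \<longleftrightarrow> \<not> affine_dependent (cayley_point ` A)"
proof
  assume "indep A"
  then have "independent (cayley_point ` A)" by (simp add: indep_independent)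
  then show "\<not> affine_dependent (cayley_point ` A)"
    using affine_dependent_imp_dependent by blast
next
  assume A: "\<not> affine_dependent (cayley_point ` A)"
  have "(\<forall>x\<in>cayley_point ` A. U x = 0)" if "(\<Sum>x\<in>cayley_point ` A. U x *\<^sub>R x) = 0" for U
  proof -
    have "total (\<Sum>x\<in>cayley_point ` A. U x *\<^sub>R x) = (\<Sum>x\<in>cayley_point ` A. U x)"
      by (simp add: linear_sum[OF linear_total] linear_cmul[OF linear_total] sum_over_points)
    then have "sum U (cayley_point ` A) = 0"
      using that linear_0[OF linear_total] by simp
    then show ?thesis
      using A that affine_dependent_explicit_finite[of "cayley_point ` A"] by auto
  qed
  then show "indep A"
    unfolding indep_independent by (subst dependent_finite) auto
qed

section \<open>Cones over edge sets\<close>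

definition nonneg :: "(label \<Rightarrow> real) \<Rightarrow> bool" where
  "nonneg f \<longleftrightarrow> (\<forall>v. f v \<ge> 0)"

definition edge_cone :: "label set \<Rightarrow> (real^(4 + 4)) set" where
  "edge_cone A = {marg f | f. supported A f \<and> nonneg f}"

abbreviation simp_of :: "label set \<Rightarrow> (real^(4 + 4)) set" where
  "simp_of A \<equiv> convex hull (cayley_point ` A)"

lemma nonnegD: "nonneg f \<Longrightarrow> f v \<ge> 0"
  by (simp add: nonneg_def)

lemma cone_mono: "A \<subseteq> B \<Longrightarrow> edge_cone A \<subseteq> edge_cone B"
  unfolding edge_cone_def supported_def by blast

text \<open>A simplex is the slice of its cone at height 1; the geometric arguments take place in
  the cones, where nothing has to be normalised.\<close>

lemma simp_of_iff: "x \<in> simp_of A \<longleftrightarrow> x \<in> edge_cone A \<and> total x = 1"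
proof
  assume "x \<in> simp_of A"
  then obtain U where U: "\<forall>x\<in>cayley_point ` A. 0 \<le> U x" "sum U (cayley_point ` A) = 1"
    "(\<Sum>x\<in>cayley_point ` A. U x *\<^sub>R x) = x"
    by (auto simp: convex_hull_finite)
  have "marg (restr A U) = x" using U(3) by (simp add: marg_restr)
  moreover have "nonneg (restr A U)" using U(1) by (auto simp: restr_def nonneg_def)
  moreover have "total (marg (restr A U)) = 1"
    using U(2) unfolding total_marg sum_supported[OF supported_restr] sum_over_points
    by (simp add: restr_def)
  ultimately show "x \<in> edge_cone A \<and> total x = 1"
    using supported_restr[of A U] unfolding edge_cone_def by blast
next
  assume "x \<in> edge_cone A \<and> total x = 1"
  then obtain f where f: "supported A f" "nonneg f" "marg f = x" "total x = 1"
    unfolding edge_cone_def by blast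
  have "sum f A = 1" using f(4) total_marg[of f] sum_supported[OF f(1)] f(3) by simp
  then have "(\<Sum>v\<in>A. f v *\<^sub>R cayley_point v) \<in> simp_of A"
    using f(2) by (intro convex_sum) (auto simp: nonneg_def hull_inc)
  then show "x \<in> simp_of A" using f(3) marg_supported[OF f(1)] by simp
qed

lemma cayley_polytope_simp_of: "cayley_polytope = simp_of UNIV"
  by (simp add: cayley_polytope_def)

text \<open>Every column has equal weight on the left and on the right, one linear equation in eight
  dimensions; an explicit spanning tree gives the lower bound.\<close>

lemma dim_points: "dim (range cayley_point) = 7"
proof -
  define h :: "real^(4+4)" where "h = (\<chi> k. case k of Inl j \<Rightarrow> 1 | Inr i \<Rightarrow> -1)"
  have "h \<bullet> cayley_point v = 0" for v
  proof -
    have "h \<bullet> cayley_point v = h $ Inr (fst v) + h $ Inl (right v)"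
      by (simp add: cayley_point_axis inner_add_right inner_axis)
    then show ?thesis by (simp add: h_def)
  qed
  then have subvec: "range cayley_point \<subseteq> {x. h \<bullet> x = 0}" by auto
  have "h $ Inl 1 \<noteq> 0" by (simp add: h_def)
  then have "h \<noteq> 0" by (metis zero_index)
  then have "dim {x. h \<bullet> x = 0} = 7" by (simp add: dim_hyperplane)
  then have le: "dim (range cayley_point) \<le> 7" using dim_subset[OF subvec] by simp
  \<comment> \<open>Two stars, centred at the left and at the right vertex 1, joined by the edge
    from the left vertex 2 to the right vertex 3. Vanishing vertex sums kill the weights from the
    leaves inwards.\<close>
  define T :: "label set" where "T = {(1,1),(1,2),(1,3),(2,1),(3,1),(4,1),(2,2)}"
  have "indep T" unfolding indep_def
  proof (intro allI impI)
    fix f v assume f: "supported T f" "marg f = 0"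
    have z: "f (2,3) = 0" "f (3,2) = 0" "f (3,3) = 0" "f (4,2) = 0" "f (4,3) = 0"
      using f(1) by (auto simp: supported_def T_def)
    have s: "(\<Sum>v\<in>UNIV. if fst v = i then f v else 0) = 0" "(\<Sum>v\<in>UNIV. if right v = i then f v else 0) = 0" for i
      using marg_Inr[of f i] marg_Inl[of f i] f(2) by (simp_all add: sum.If_cases)
    have "f (3,1) = 0" "f (4,1) = 0" "f (1,1) = 0" "f (1,3) = 0"
      using s(1)[of 3] s(1)[of 4] s(2)[of 2] s(2)[of 4] z
      by (simp_all add: sum_labels labels_def right_def)
    moreover from this have "f (1,2) = 0" "f (2,1) = 0"
      using s(1)[of 1] s(2)[of 1] z by (simp_all add: sum_labels labels_def right_def)
    moreover from this have "f (2,2) = 0"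
      using s(1)[of 2] z by (simp_all add: sum_labels labels_def right_def)
    ultimately have "list_all (\<lambda>v. f v = 0) labels" using z by (simp add: labels_def)
    then have "\<forall>v. f v = 0" by (simp only: all_label)
    then show "f v = 0" by blast
  qed
  then have "independent (cayley_point ` T)" by (simp add: indep_independent)
  then have "card (cayley_point ` T) \<le> dim (range cayley_point)"
    by (intro independent_card_le_dim) auto
  moreover have "card (cayley_point ` T) = card T"
    by (rule card_image) (rule inj_on_subset[OF inj_cayley_point subset_UNIV])
  moreover have "card T = 7" by (simp add: T_def)
  ultimately show ?thesis using le by simp
qed

text \<open>Seven edges without a cycle on eight vertices are the spanning trees; acyclicity is put
  in the form that can be tested on matchings.\<close>

definition trees :: "label set set" where
  "trees = {T. card T = 7 \<and> compatible T T}"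

lemma tree_indep: "T \<in> trees \<Longrightarrow> indep T"
  by (simp add: trees_def compatible_imp_indep)

lemma treeI: "indep T \<Longrightarrow> card T = 7 \<Longrightarrow> T \<in> trees"
  by (simp add: trees_def indep_imp_compatible)

lemma card_points: "card (cayley_point ` A) = card A"
  by (rule card_image) (rule inj_on_subset[OF inj_cayley_point subset_UNIV])

text \<open>The columns of a forest extend to a basis of the span of all columns, and every such
  basis has seven elements.\<close>

lemma indep_extend:
  assumes "indep A" obtains T where "T \<in> trees" "A \<subseteq> T"
proof -
  obtain B where B: "cayley_point ` A \<subseteq> B" "B \<subseteq> range cayley_point" "independent B"
    "range cayley_point \<subseteq> span B"
    using maximal_independent_subset_extend[of "cayley_point ` A" "range cayley_point"]
      assms unfolding indep_independent by auto
  define T where "T = cayley_point -` B"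
  have BT: "B = cayley_point ` T" using B(2) by (auto simp: T_def)
  have "card B = dim (range cayley_point)" using basis_card_eq_dim[OF B(2,4,3)] by simp
  then have "card T = 7" using card_points[of T] by (simp add: BT dim_points)
  moreover have "indep T" using B(3) by (simp add: indep_independent BT)
  moreover have "A \<subseteq> T" using B(1) by (auto simp: T_def)
  ultimately show ?thesis using that treeI by blast
qed

text \<open>The seven columns of a tree span all columns, so every vector of vertex sums has
  coordinates along the tree, possibly negative ones.\<close>

lemma tree_flow:
  assumes "T \<in> trees" obtains f where "supported T f" "marg f = marg g"
proof -
  have i: "independent (cayley_point ` T)" using assms by (simp add: tree_indep flip: indep_independent)
  have "range cayley_point \<subseteq> span (cayley_point ` T)"
    by (rule card_ge_dim_independent[OF _ i])
      (use assms in \<open>auto simp: dim_points card_points trees_def\<close>)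
  then have "marg g \<in> span (cayley_point ` T)"
    unfolding marg_def by (intro span_sum span_scale) auto
  then obtain U where "marg g = (\<Sum>x\<in>cayley_point ` T. U x *\<^sub>R x)"
    by (auto simp: span_finite)
  then show ?thesis using that[OF supported_restr, of U] by (simp add: marg_restr)
qed

lemma interpolate:
  assumes "indep A" obtains h :: "real^(4+4) \<Rightarrow> real" where "linear h" "\<And>v. v \<in> A \<Longrightarrow> h (cayley_point v) = g v"
proof -
  obtain h :: "real^(4+4) \<Rightarrow> real" where h: "linear h"
    "\<forall>x\<in>cayley_point ` A. h x = g (inv cayley_point x)"
    using linear_independent_extend[of "cayley_point ` A" "\<lambda>x. g (inv cayley_point x)"] assms
    unfolding indep_independent by blast
  then show ?thesis using that[of h] by (simp add: inv_f_f[OF inj_cayley_point])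
qed

text \<open>Deleting \<open>e\<close> disconnects the tree. The functional that is 1 at
  \<open>e\<close> and 0 at the other tree edges is a potential that is constant along those, and
  its level set through \<open>fst e\<close> gives the two parts \<open>I\<close> and
  \<open>J\<close> of one side.\<close>

lemma tree_cut:
  assumes "indep T" "e \<in> T"
  obtains I J where "fst e \<in> I" "right e \<notin> J" "\<And>v. v \<in> T \<Longrightarrow> v \<noteq> e \<Longrightarrow> fst v \<in> I \<longleftrightarrow> right v \<in> J"
proof -
  obtain h :: "real^(4+4) \<Rightarrow> real" where h: "linear h"
    "\<And>v. v \<in> T \<Longrightarrow> h (cayley_point v) = (if v = e then 1 else 0)"
    using interpolate[OF assms(1), of "\<lambda>v. if v = e then 1 else 0"] by blast
  define a where "a i = h (axis (Inr i) 1)" for i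
  define b where "b j = h (axis (Inl j) 1)" for j
  have ab: "h (cayley_point v) = a (fst v) + b (right v)" for v
    unfolding cayley_point_axis a_def b_def by (rule linear_add[OF h(1)])
  show ?thesis
  proof (rule that[of "{i. a i = a (fst e)}" "{j. - b j = a (fst e)}"])
    show "right e \<notin> {j. - b j = a (fst e)}" using h(2)[OF assms(2)] ab[of e] by auto
    fix v assume "v \<in> T" "v \<noteq> e"
    then have "a (fst v) = - b (right v)" using h(2)[of v] ab[of v] by simp
    then show "fst v \<in> {i. a i = a (fst e)} \<longleftrightarrow> right v \<in> {j. - b j = a (fst e)}" by simp
  qed simp
qed

text \<open>The net flow across a cut is visible in the vertex sums alone.\<close>

lemma sum_marg_cut:
  "(\<Sum>i\<in>I. marg f $ Inr i) - (\<Sum>j\<in>J. marg f $ Inl j)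
     = (\<Sum>v\<in>UNIV. f v * ((if fst v \<in> I then 1 else 0) - (if right v \<in> J then 1 else 0)))"
proof -
  have l: "linear (\<lambda>x::real^(4+4). (\<Sum>i\<in>I. x $ Inr i) - (\<Sum>j\<in>J. x $ Inl j))"
    by (rule linearI) (simp_all add: sum.distrib sum_distrib_left algebra_simps)
  show ?thesis
    using linear_marg_eq[OF l, of f] by (simp add: cayley_point_Inr cayley_point_Inl)
qed

section \<open>Right degrees of trees and test points\<close>

definition deg :: "label set \<Rightarrow> 4 \<Rightarrow> nat" where
  "deg T j = card {v \<in> T. right v = j}"

lemma sum_deg: "(\<Sum>j\<in>UNIV. deg T j) = card T"
proof -
  have "card T = (\<Sum>j\<in>UNIV. card {v \<in> T. right v = j})"
    using sum.group[of T "UNIV :: 4 set" right "\<lambda>_. 1::nat"] by simp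
  then show ?thesis by (simp add: deg_def)
qed

text \<open>In a flow with right marginals congruent to 1/4 modulo 1, the flow through an edge is
  an integer minus a quarter of the number of right vertices that the edge cuts off. For the edges
  at a fixed right vertex these numbers add up to 3.\<close>

lemma tree_test_point:
  fixes r :: "4 \<Rightarrow> nat"
  assumes T: "T \<in> trees" and f: "supported T f" "nonneg f"
    and mL: "\<And>i. marg f $ Inr i = 1" and mR: "\<And>j. marg f $ Inl j = real (r j) - 3/4"
  shows "deg T = r" "\<And>v. v \<in> T \<Longrightarrow> f v > 0"
proof -
  note iT = tree_indep[OF T]
  have "\<forall>e\<in>T. \<exists>I J. fst e \<in> I \<and> right e \<notin> J \<and> (\<forall>v\<in>T. v \<noteq> e \<longrightarrow> (fst v \<in> I \<longleftrightarrow> right v \<in> J))"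
    by (metis tree_cut[OF iT])
  then obtain I J where IJ: "\<And>e. e \<in> T \<Longrightarrow> fst e \<in> I e" "\<And>e. e \<in> T \<Longrightarrow> right e \<notin> J e"
    "\<And>e v. e \<in> T \<Longrightarrow> v \<in> T \<Longrightarrow> v \<noteq> e \<Longrightarrow> fst v \<in> I e \<longleftrightarrow> right v \<in> J e"
    by metis
  \<comment> \<open>The signed crossing of the cut belonging to \<open>e\<close>; among the tree
    edges only \<open>e\<close> crosses it.\<close>
  define br where "br e v = (if fst v \<in> I e then 1 else 0) - (if right v \<in> J e then 1 else (0::real))" for e v
  have br: "br e v = (if v = e then 1 else 0)" if "e \<in> T" "v \<in> T" for e v
    using IJ that unfolding br_def by auto
  \<comment> \<open>Each right vertex in \<open>J e\<close> contributes 3/4 = 1 - 1/4: the 1 goes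
    into the integer \<open>n e\<close>, the quarter stays outside.\<close>
  define n where "n e = int (card (I e)) - int (\<Sum>j\<in>J e. r j) + int (card (J e))" for e
  have fe: "f e = of_int (n e) - real (card (J e)) / 4" if e: "e \<in> T" for e
  proof -
    have "(\<Sum>v\<in>UNIV. f v * br e v) = (\<Sum>v\<in>UNIV. if v = e then f v else 0)"
    proof (rule sum.cong)
      fix v show "f v * br e v = (if v = e then f v else 0)"
        using br[OF e, of v] supportedD[OF f(1), of v] e by (cases "v \<in> T") auto
    qed simp
    then have "f e = (\<Sum>i\<in>I e. marg f $ Inr i) - (\<Sum>j\<in>J e. marg f $ Inl j)"
      unfolding sum_marg_cut br_def[symmetric] by simp
    also have "\<dots> = of_int (n e) - real (card (J e)) / 4"
      by (simp add: mL mR n_def sum_subtractf algebra_simps)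
    finally show ?thesis .
  qed
  have cJ: "card (J e) \<le> 3" if "e \<in> T" for e
  proof -
    have "card (J e) \<le> card (UNIV - {right e})" using IJ(2)[OF that] by (intro card_mono) auto
    then show ?thesis by (simp add: card_Diff_singleton)
  qed
  \<comment> \<open>If \<open>J e\<close> is empty, \<open>n e\<close> counts the left vertices of
    \<open>I e\<close>, among them \<open>fst e\<close>. Otherwise \<open>f e \<ge> 0\<close> makes
    \<open>n e\<close> at least a positive number of quarters.\<close>
  have n1: "n e \<ge> 1" if e: "e \<in> T" for e
  proof (cases "J e = {}")
    case True
    have "card (I e) > 0" using IJ(1)[OF e] by (auto simp: card_gt_0_iff)
    then show ?thesis using True unfolding n_def by simp
  next
    case False
    then have "card (J e) > 0" by (simp add: card_gt_0_iff)
    moreover have "f e \<ge> 0" using f(2) by (rule nonnegD)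
    ultimately have "real_of_int (n e) > 0" using fe[OF e] by linarith
    then show ?thesis by linarith
  qed
  \<comment> \<open>At most three right vertices are cut off, so at most 3/4 is subtracted from an
    integer that is at least 1.\<close>
  show "f v > 0" if "v \<in> T" for v
    using fe[OF that] cJ[OF that] n1[OF that] by linarith
  have le: "deg T j0 \<le> r j0" for j0
  proof -
    define E where "E = {v \<in> T. right v = j0}"
    have ET: "E \<subseteq> T" by (auto simp: E_def)
    \<comment> \<open>\<open>NL\<close> and \<open>NR\<close> count how many of the cuts belonging
      to edges at \<open>j0\<close> have a given left or right vertex on the inner side.\<close>
    define NL where "NL i = real (card {e \<in> E. i \<in> I e})" for i
    define NR where "NR j = real (card {e \<in> E. j \<in> J e})" for j
    have sbr: "(\<Sum>e\<in>E. br e v) = NL (fst v) - NR (right v)" for v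
      by (simp add: br_def sum_subtractf NL_def NR_def sum.If_cases Int_def)
    \<comment> \<open>The sum of the crossings over \<open>E\<close> and the indicator of the edges
      at \<open>j0\<close> both extend linearly to all columns. They agree on the tree, hence at
      every label.\<close>
    have NLR: "NL (fst v) - NR (right v) = (if right v = j0 then 1 else 0)" for v
    proof -
      obtain g where g: "supported T g" "marg g = cayley_point v"
        using tree_flow[OF T] marg_single by metis
      have "(\<Sum>u\<in>UNIV. g u * (\<Sum>e\<in>E. br e u)) = (\<Sum>u\<in>UNIV. g u * (if right u = j0 then 1 else 0))"
      proof (rule sum.cong)
        fix u
        show "g u * (\<Sum>e\<in>E. br e u) = g u * (if right u = j0 then 1 else 0)"
        proof (cases "u \<in> T")
          case True
          have "(\<Sum>e\<in>E. br e u) = (\<Sum>e\<in>E. if u = e then 1 else 0)"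
          proof (rule sum.cong)
            fix e assume "e \<in> E"
            then show "br e u = (if u = e then 1 else 0)" using ET br[of e u] True by blast
          qed simp
          then show ?thesis using True by (simp add: E_def)
        next
          case False
          then show ?thesis using g(1) by (simp add: supported_def)
        qed
      qed simp
      moreover have "(\<Sum>u\<in>UNIV. g u * (\<Sum>e\<in>E. br e u)) = (\<Sum>e\<in>E. \<Sum>u\<in>UNIV. g u * br e u)"
        unfolding sum_distrib_left by (rule sum.swap)
      moreover have "(\<Sum>u\<in>UNIV. g u * br e u) = br e v" for e
        unfolding br_def sum_marg_cut[symmetric] g(2) by (simp add: cayley_point_Inl cayley_point_Inr)
      moreover have "(\<Sum>u\<in>UNIV. g u * (if right u = j0 then 1 else 0)) = marg g $ Inl j0"
        by (simp add: marg_Inl if_distrib sum.If_cases cong: if_cong)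
      ultimately have "(\<Sum>e\<in>E. br e v) = (if right v = j0 then 1 else 0)"
        unfolding g(2) by (simp add: cayley_point_Inl)
      then show ?thesis unfolding sbr .
    qed
    have NR0: "NR j0 = 0"
    proof -
      have "{e \<in> E. j0 \<in> J e} = {}" using IJ(2) by (auto simp: E_def)
      then show ?thesis by (simp only: NR_def) simp
    qed
    have NL1: "NL i = 1" if ij: "i \<noteq> j0" for i
    proof -
      obtain v where "fst v = i" "right v = j0" using ex_label[OF ij] by blast
      then show ?thesis using NLR[of v] NR0 by simp
    qed
    \<comment> \<open>A left vertex different from \<open>j\<close> and \<open>j0\<close> has edges
      to both of them: the edge to \<open>j0\<close> shows that its \<open>NL\<close> is 1, the edge
      to \<open>j\<close> then gives \<open>NR j\<close>.\<close>
    have NR1: "NR j \<le> 1" for j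
    proof (cases "j = j0")
      case False
      have "\<exists>i. i \<noteq> j \<and> i \<noteq> j0"
      proof -
        have "UNIV \<noteq> {j, j0}"
        proof
          assume *: "UNIV = {j, j0}"
          have "card (UNIV :: 4 set) \<le> 2" unfolding * by (simp add: card_insert_if)
          then show False by simp
        qed
        then show ?thesis by blast
      qed
      then obtain i where "i \<noteq> j" "i \<noteq> j0" by blast
      then obtain v where "fst v = i" "right v = j" using ex_label by blast
      then show ?thesis using NLR[of v] NL1[OF \<open>i \<noteq> j0\<close>] False by simp
    qed (simp add: NR0)
    have "(\<Sum>e\<in>E. real (card (J e))) = (\<Sum>e\<in>E. \<Sum>j\<in>UNIV. if j \<in> J e then 1 else 0)"
      by (simp add: sum.If_cases)
    also have "\<dots> = (\<Sum>j\<in>UNIV. NR j)"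
      by (subst sum.swap) (simp add: NR_def sum.If_cases Int_def)
    also have "\<dots> = (\<Sum>j\<in>UNIV - {j0}. NR j)" by (rule sum.mono_neutral_right) (auto simp: NR0)
    also have "\<dots> \<le> (\<Sum>j\<in>UNIV - {j0}. 1)" by (rule sum_mono) (rule NR1)
    also have "\<dots> = 3" by (simp add: card_Diff_singleton)
    finally have J3: "(\<Sum>e\<in>E. real (card (J e))) \<le> 3" .
    have "real (r j0) - 3/4 = (\<Sum>v\<in>E. f v)"
      unfolding mR[symmetric] marg_Inl
      by (rule sum.mono_neutral_right) (use supportedD[OF f(1)] in \<open>auto simp: E_def\<close>)
    also have "\<dots> = (\<Sum>v\<in>E. of_int (n v)) - (\<Sum>e\<in>E. real (card (J e))) / 4"
    proof -
      have "(\<Sum>v\<in>E. f v) = (\<Sum>v\<in>E. of_int (n v) - real (card (J v)) / 4)"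
        using ET fe by (intro sum.cong) blast+
      then show ?thesis by (simp add: sum_subtractf sum_divide_distrib)
    qed
    finally have 1: "real (r j0) \<ge> (\<Sum>v\<in>E. real_of_int (n v))" using J3 by linarith
    have "(\<Sum>v\<in>E. real_of_int (n v)) \<ge> (\<Sum>v\<in>E. 1)"
    proof (rule sum_mono)
      fix v assume "v \<in> E"
      then show "1 \<le> real_of_int (n v)" using n1[of v] ET by auto
    qed
    then have "real (card E) \<le> real (r j0)" using 1 by simp
    then show "deg T j0 \<le> r j0" by (simp add: deg_def E_def)
  qed
  \<comment> \<open>Both degree vectors add up to 7, so the inequality at each right vertex is an
    equality.\<close>
  have "(\<Sum>j\<in>UNIV. real (r j) - 3/4) = (\<Sum>i\<in>(UNIV :: 4 set). 1)"
    using total_right[of f] by (simp add: total_def mL mR)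
  then have "real (\<Sum>j\<in>UNIV. r j) = real 7" by (simp add: sum_subtractf)
  then have "(\<Sum>j\<in>UNIV. r j) = 7" by linarith
  moreover have "(\<Sum>j\<in>UNIV. deg T j) = 7" using T by (simp add: sum_deg trees_def)
  ultimately have s: "(\<Sum>j\<in>UNIV. deg T j) = (\<Sum>j\<in>UNIV. r j)" by simp
  have "deg T j = r j" for j
  proof (rule ccontr)
    assume "deg T j \<noteq> r j"
    then have "deg T j < r j" using le[of j] by simp
    then have "(\<Sum>j\<in>UNIV. deg T j) < (\<Sum>j\<in>UNIV. r j)"
      using le by (intro sum_strict_mono_ex1) auto
    then show False using s by simp
  qed
  then show "deg T = r" by auto
qed

subsection \<open>Families that cover the polytope\<close>

text \<open>The three kinds of boundary faces. The last one stems from the missing edges, which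
  would join the left vertex \<open>j\<close> to the right vertex \<open>j\<close>.\<close>

definition boundary :: "label set \<Rightarrow> bool" where
  "boundary A \<longleftrightarrow> (\<exists>i. i \<notin> fst ` A) \<or> (\<exists>j. j \<notin> right ` A) \<or> (\<exists>j. \<forall>v\<in>A. fst v = j \<or> right v = j)"

text \<open>A finite condition sufficient for a triangulation: compatibility controls the
  intersections, and the condition on facets leaves no gap, as \<open>good_covers\<close>
  shows.\<close>

definition good :: "label set set \<Rightarrow> bool" where
  "good M \<longleftrightarrow> M \<subseteq> trees \<and> M \<noteq> {} \<and> (\<forall>T\<in>M. \<forall>U\<in>M. compatible T U) \<and>
     (\<forall>T\<in>M. \<forall>e\<in>T. boundary (T - {e}) \<or> (\<exists>U\<in>M. U \<noteq> T \<and> T - {e} \<subseteq> U))"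

lemma linear_on_tree:
  assumes "linear (h :: real^(4+4) \<Rightarrow> real)" "supported T f" "\<And>v. v \<in> T \<Longrightarrow> v \<noteq> e \<Longrightarrow> h (cayley_point v) = 0"
  shows "h (marg f) = f e * h (cayley_point e)"
proof -
  have "h (marg f) = (\<Sum>v\<in>UNIV. f v * h (cayley_point v))"
    using linear_marg_eq[OF assms(1)] by simp
  also have "\<dots> = (\<Sum>v\<in>UNIV. if v = e then f v * h (cayley_point v) else 0)"
  proof (rule sum.cong)
    fix v show "f v * h (cayley_point v) = (if v = e then f v * h (cayley_point v) else 0)"
      using assms(3)[of v] supportedD[OF assms(2), of v] by (cases "v \<in> T") auto
  qed simp
  finally show ?thesis by simp
qed

text \<open>If \<open>h\<close> vanished at \<open>e\<close> too, it would vanish on all columns, as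
  those of \<open>T\<close> span them; so it is positive at \<open>e\<close>. Its nonnegative value
  at the given point is \<open>f e\<close> times that number.\<close>

lemma supporting_functional_coordinate:
  assumes T: "T \<in> trees" and h: "linear (h :: real^(4+4) \<Rightarrow> real)" "\<And>v. h (cayley_point v) \<ge> 0"
    "\<And>v. v \<in> T \<Longrightarrow> v \<noteq> e \<Longrightarrow> h (cayley_point v) = 0" "h (cayley_point w) \<noteq> 0"
    and f: "supported T f" "nonneg g" "marg f = marg g"
  shows "f e \<ge> 0"
proof -
  obtain k where k: "supported T k" "marg k = cayley_point w"
    using tree_flow[OF T] marg_single by metis
  have "h (cayley_point e) \<noteq> 0"
    using linear_on_tree[OF h(1) k(1) h(3)] h(4) k(2) by auto
  then have "h (cayley_point e) > 0" using h(2)[of e] by simp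
  moreover have "f e * h (cayley_point e) \<ge> 0"
  proof -
    have "h (marg g) = (\<Sum>v\<in>UNIV. g v * h (cayley_point v))" using linear_marg_eq[OF h(1)] by simp
    also have "\<dots> \<ge> 0" using f(2) h(2) by (intro sum_nonneg) (simp add: nonnegD)
    finally show ?thesis using linear_on_tree[OF h(1) f(1) h(3)] f(3) by simp
  qed
  ultimately show ?thesis by (simp add: zero_le_mult_iff)
qed

text \<open>Each kind of boundary face lies in the zero set of a functional that is nonnegative on
  all columns: a left coordinate, a right coordinate, or \<open>total\<close> minus the two
  coordinates at \<open>j\<close>.\<close>

lemma boundary_coordinate:
  assumes T: "T \<in> trees" and b: "boundary (T - {e})"
    and f: "supported T f" "nonneg g" "marg f = marg g"
  shows "f e \<ge> 0"
proof -
  consider (1) i where "i \<notin> fst ` (T - {e})" | (2) j where "j \<notin> right ` (T - {e})"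
    | (3) j where "\<forall>v\<in>T - {e}. fst v = j \<or> right v = j"
    using b unfolding boundary_def by blast
  then show ?thesis
  proof cases
    case 1
    obtain w :: label where w: "fst w = i" by (rule that[of "(i, 1)"]) simp
    have l: "linear (\<lambda>x::real^(4+4). x $ Inr i)" by (rule linearI) simp_all
    have "fst v \<noteq> i" if "v \<in> T" "v \<noteq> e" for v using 1 that by blast
    then show ?thesis
      by (intro supporting_functional_coordinate[OF T l _ _ _ f, of _ w])
        (simp_all add: cayley_point_Inr w)
  next
    case 2
    obtain i where "i \<noteq> j" using right_neq by metis
    then obtain w where w: "right w = j" using ex_label by blast
    have l: "linear (\<lambda>x::real^(4+4). x $ Inl j)" by (rule linearI) simp_all
    have "right v \<noteq> j" if "v \<in> T" "v \<noteq> e" for v using 2 that by blast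
    then show ?thesis
      by (intro supporting_functional_coordinate[OF T l _ _ _ f, of _ w])
        (simp_all add: cayley_point_Inl w)
  next
    case 3
    define h :: "real^(4+4) \<Rightarrow> real" where "h x = total x - x $ Inr j - x $ Inl j" for x
    have l: "linear h" unfolding h_def
      by (rule linearI) (simp_all add: linear_add[OF linear_total] linear_cmul[OF linear_total] algebra_simps)
    have hp: "h (cayley_point v) = (if fst v = j \<or> right v = j then 0 else 1)" for v
      using right_neq[of v] by (auto simp: h_def cayley_point_Inl cayley_point_Inr)
    have "card {j} < card (UNIV :: 4 set)" by simp
    then obtain i where i: "i \<noteq> j" by (metis card_mono finite finite.emptyI finite_insert insertCI leD subsetI)
    have "\<exists>k. k \<noteq> i \<and> k \<noteq> j"
    proof (rule ccontr)
      assume "\<not> ?thesis"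
      then have "(UNIV :: 4 set) \<subseteq> {i, j}" by blast
      then have "card (UNIV :: 4 set) \<le> card {i, j}" by (intro card_mono) simp_all
      then show False using i by simp
    qed
    then obtain w where w: "fst w = i" "right w \<noteq> j" using ex_label by metis
    have "fst v = j \<or> right v = j" if "v \<in> T" "v \<noteq> e" for v using 3 that by blast
    then show ?thesis
      using w i by (intro supporting_functional_coordinate[OF T l _ _ _ f, of _ w])
        (simp_all add: hp)
  qed
qed

text \<open>On the curve with coordinates 1, t, ..., t^6 along the tree, each functional becomes a
  nonzero polynomial of degree at most 6, and finitely many roots can be avoided by some positive
  t.\<close>

lemma generic_point:
  assumes T: "T \<in> trees" and fin: "finite \<Phi>"
    and \<Phi>: "\<And>h. h \<in> \<Phi> \<Longrightarrow> linear h" "\<And>h. h \<in> \<Phi> \<Longrightarrow> \<exists>v\<in>T. h (cayley_point v) \<noteq> (0::real)"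
  obtains f where "supported T f" "nonneg f" "\<And>h. h \<in> \<Phi> \<Longrightarrow> h (marg f) \<noteq> 0"
proof -
  obtain xs where xs: "set xs = T" "distinct xs" using finite_distinct_list[of T] by auto
  define n where "n = length xs"
  have "n = 7" using T xs distinct_card[of xs] by (simp add: trees_def n_def)
  define p where "p t = (\<Sum>k<n. t ^ k *\<^sub>R cayley_point (xs ! k))" for t :: real
  define f where "f t v = (\<Sum>k<n. if v = xs ! k then t ^ k else 0)" for t :: real and v
  have mf: "marg (f t) = p t" for t
  proof -
    have "marg (f t) = (\<Sum>k<n. marg (\<lambda>v. if v = xs ! k then t ^ k else 0))"
      unfolding f_def by (rule marg_sum)
    also have "\<dots> = (\<Sum>k<n. marg (\<lambda>v. t ^ k * (if v = xs ! k then 1 else 0)))"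
      by (intro sum.cong arg_cong[of _ _ marg]) auto
    finally show ?thesis unfolding marg_scale marg_single p_def .
  qed
  have "finite {t. h (p t) = 0}" if h: "h \<in> \<Phi>" for h
  proof -
    have "h (p t) = (\<Sum>k\<le>6. h (cayley_point (xs ! k)) * t ^ k)" for t
    proof -
      have "h (p t) = (\<Sum>k<n. t ^ k * h (cayley_point (xs ! k)))"
        unfolding p_def by (simp add: linear_sum[OF \<Phi>(1)[OF h]] linear_cmul[OF \<Phi>(1)[OF h]])
      moreover have "{..<n} = {..6}" using \<open>n = 7\<close> by auto
      ultimately show ?thesis by (simp add: mult.commute)
    qed
    moreover have "\<exists>k\<le>6. h (cayley_point (xs ! k)) \<noteq> 0"
    proof -
      obtain v where v: "v \<in> T" "h (cayley_point v) \<noteq> 0" using \<Phi>(2)[OF h] by blast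
      then obtain k where "k < n" "xs ! k = v" using xs(1) by (metis in_set_conv_nth n_def)
      then show ?thesis using v \<open>n = 7\<close> by (intro exI[of _ k]) auto
    qed
    ultimately show ?thesis using polyfun_finite_roots[of "\<lambda>k. h (cayley_point (xs ! k))" 6] by auto
  qed
  then have "finite (\<Union>h\<in>\<Phi>. {t. h (p t) = 0})" using fin by blast
  moreover have "infinite {0<..(1::real)}" by simp
  ultimately have "\<not> {0<..1} \<subseteq> (\<Union>h\<in>\<Phi>. {t. h (p t) = 0})" by (meson finite_subset)
  then obtain t where "t \<in> {0<..1}" "t \<notin> (\<Union>h\<in>\<Phi>. {t. h (p t) = 0})" by blast
  then have t: "t > 0" "\<And>h. h \<in> \<Phi> \<Longrightarrow> h (p t) \<noteq> 0" by (simp, blast)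
  show ?thesis
  proof (rule that[of "f t"])
    show "supported T (f t)" unfolding supported_def f_def
    proof (intro allI impI sum.neutral ballI)
      fix v k assume "v \<notin> T" "k \<in> {..<n}"
      then show "(if v = xs ! k then t ^ k else 0) = 0" using xs(1) n_def nth_mem by auto
    qed
    show "nonneg (f t)" using t(1) unfolding nonneg_def f_def by (intro allI sum_nonneg) simp
    show "h (marg (f t)) \<noteq> 0" if "h \<in> \<Phi>" for h using t(2)[OF that] by (simp add: mf)
  qed
qed

lemma affine_positive_beyond:
  fixes a b :: "'k \<Rightarrow> real"
  assumes "finite K" "s < 1" "\<And>k. k \<in> K \<Longrightarrow> a k + s * b k > 0"
  obtains t where "s < t" "t < 1" "\<And>k. k \<in> K \<Longrightarrow> a k + t * b k > 0"
proof -
  have "\<forall>\<^sub>F t in at_right s. a k + t * b k > 0" if "k \<in> K" for k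
  proof -
    have "((\<lambda>t. a k + t * b k) \<longlongrightarrow> a k + s * b k) (at_right s)"
      by (intro tendsto_intros)
    then show ?thesis using assms(3)[OF that] order_tendstoD(1) by blast
  qed
  then have "\<forall>\<^sub>F t in at_right s. \<forall>k\<in>K. a k + t * b k > 0"
    using assms(1) by (simp add: eventually_ball_finite)
  moreover have "\<forall>\<^sub>F t in at_right s. t \<in> {s<..<1}" using assms(2) by (rule eventually_at_right_real)
  ultimately have "\<forall>\<^sub>F t in at_right s. (\<forall>k\<in>K. a k + t * b k > 0) \<and> t \<in> {s<..<1}"
    by (rule eventually_conj)
  then have "\<exists>t. (\<forall>k\<in>K. a k + t * b k > 0) \<and> t \<in> {s<..<1}"
    by (rule eventually_happens'[rotated]) simp
  then show ?thesis using that by auto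
qed

text \<open>Two compatible trees with a common facet lie on opposite sides of it: the new edge
  \<open>w\<close> has a negative coordinate at the edge \<open>e\<close> it replaces.\<close>

lemma neighbour_coordinate_neg:
  assumes T: "T \<in> trees" "U \<in> trees" "compatible T U" "U \<noteq> T" "e \<in> T" "T - {e} \<subseteq> U"
  obtains w k where "w \<in> U" "w \<notin> T" "U = insert w (T - {e})" "supported T k" "marg k = cayley_point w" "k e < 0"
proof -
  have c: "card T = 7" "card U = 7" using T(1,2) by (simp_all add: trees_def)
  have "card (U - (T - {e})) = 1" using c T(5,6) by (simp add: card_Diff_subset card_Diff_singleton)
  then obtain w where w: "U - (T - {e}) = {w}" by (auto simp: card_1_singleton_iff)
  then have U: "U = insert w (T - {e})" using T(6) by blast
  have "w \<noteq> e" using U T(4,5) by blast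
  then have wT: "w \<notin> T" using w by blast
  obtain k where k: "supported T k" "marg k = cayley_point w"
    using tree_flow[OF T(1)] marg_single by metis
  have "k e < 0"
  proof (rule ccontr)
    assume "\<not> k e < 0"
    \<comment> \<open>If \<open>k e\<close> were nonnegative, moving the negative terms of
      \<open>cayley_point w = marg k\<close> to the other side would give nonnegative flows,
      \<open>F\<close> on \<open>U\<close> and \<open>G\<close> on \<open>T\<close>, with equal
      vertex sums but different values at \<open>w\<close>.\<close>
    define F where "F v = (if v = w then 1 else 0) + max 0 (- k v)" for v
    define G where "G v = max 0 (k v)" for v
    have "(\<lambda>v. F v - G v) = (\<lambda>v. (if v = w then 1 else 0) - k v)" by (auto simp: F_def G_def)
    then have "marg (\<lambda>v. F v - G v) = 0" using k(2) by (simp add: marg_diff marg_single)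
    then have "marg G = marg F" by (simp add: marg_diff)
    moreover have "supported T G" using supportedD[OF k(1)] by (simp add: supported_def G_def)
    moreover have "supported U F"
    proof -
      have "F v = 0" if "v \<notin> U" for v
      proof -
        have "v \<noteq> w" "v = e \<or> v \<notin> T" using that U by blast+
        then have "k v \<ge> 0" using \<open>\<not> k e < 0\<close> supportedD[OF k(1), of v] by auto
        then show ?thesis using \<open>v \<noteq> w\<close> by (simp add: F_def)
      qed
      then show ?thesis by (simp add: supported_def)
    qed
    ultimately have "G = F"
      by (intro compatible_flows_eq[OF T(3)]) (simp_all add: F_def G_def)
    then have "G w = F w" by simp
    then show False using supportedD[OF k(1) wT] by (simp add: F_def G_def)
  qed
  then show ?thesis using that[OF _ wT U k] U by blast
qed

text \<open>Walk from a generic point \<open>p\<close> of one cone towards \<open>q\<close>. At the last covered point of the segment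
  at most one coordinate vanishes, so the segment leaves through a facet; that facet is either
  contained in the boundary or shared with a cone on its other side.\<close>

lemma good_covers:
  assumes M: "good M" shows "edge_cone UNIV \<subseteq> (\<Union>T\<in>M. edge_cone T)"
proof
  fix q assume "q \<in> edge_cone UNIV"
  then obtain g where g: "nonneg g" "marg g = q" unfolding edge_cone_def by blast
  show "q \<in> (\<Union>T\<in>M. edge_cone T)"
  proof (rule ccontr)
    assume nq: "q \<notin> (\<Union>T\<in>M. edge_cone T)"
    have tr: "T \<in> trees" if "T \<in> M" for T using M that by (auto simp: good_def)
    obtain T0 where T0: "T0 \<in> M" using M by (auto simp: good_def)
    have "\<forall>T. T \<in> M \<longrightarrow> (\<exists>f. supported T f \<and> marg f = q)"
      using tree_flow[OF tr, of _ g] g(2) by metis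
    then obtain Q where Q: "\<And>T. T \<in> M \<Longrightarrow> supported T (Q T)" "\<And>T. T \<in> M \<Longrightarrow> marg (Q T) = q"
      by metis
    have "\<forall>T e. \<exists>h::real^(4+4) \<Rightarrow> real. T \<in> M \<longrightarrow> linear h \<and> (\<forall>v\<in>T. h (cayley_point v) = (if v = e then 1 else 0))"
    proof (intro allI)
      fix T e
      show "\<exists>h::real^(4+4) \<Rightarrow> real. T \<in> M \<longrightarrow> linear h \<and> (\<forall>v\<in>T. h (cayley_point v) = (if v = e then 1 else 0))"
        using interpolate[OF tree_indep[OF tr], of T "\<lambda>v. if v = e then 1 else 0"] by metis
    qed
    then obtain c :: "label set \<Rightarrow> label \<Rightarrow> real^(4+4) \<Rightarrow> real" where
      c: "\<And>T e. T \<in> M \<Longrightarrow> linear (c T e)"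
        "\<And>T e v. T \<in> M \<Longrightarrow> v \<in> T \<Longrightarrow> c T e (cayley_point v) = (if v = e then 1 else 0)"
      by metis
    have cf: "c T e (marg f) = f e" if "T \<in> M" "e \<in> T" "supported T f" for T e f
      using linear_on_tree[OF c(1)[OF that(1)] that(3), of e e] c(2)[OF that(1)] that(2) by simp
    \<comment> \<open>\<open>\<Phi>1\<close> keeps all tree coordinates of the starting point
      nonzero. \<open>\<Phi>2\<close> prevents two coordinates along one tree from vanishing at the
      same point of the segment; pairs that both vanish at the end point are left out, since their
      functional would be zero.\<close>
    define \<Phi>1 where "\<Phi>1 = (\<Union>T\<in>M. \<Union>e\<in>T. {c T e})"
    define \<Phi>2 where "\<Phi>2 = (\<Union>T\<in>M. \<Union>e\<in>T. \<Union>e'\<in>{e' \<in> T. e \<noteq> e' \<and> (Q T e \<noteq> 0 \<or> Q T e' \<noteq> 0)}.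
      {\<lambda>x. Q T e' * c T e x - Q T e * c T e' x})"
    have nonzero: "\<exists>v\<in>T0. h (cayley_point v) \<noteq> 0"
      if h: "linear h" "h (cayley_point w) \<noteq> 0" for h :: "real^(4+4) \<Rightarrow> real" and w
    proof (rule ccontr)
      assume no: "\<not> ?thesis"
      obtain f where f: "supported T0 f" "marg f = cayley_point w"
        using tree_flow[OF tr[OF T0]] marg_single by metis
      have "h (marg f) = 0"
        using linear_on_tree[OF h(1) f(1), of w] no supportedD[OF f(1), of w] by (cases "w \<in> T0") auto
      then show False using h(2) f(2) by simp
    qed
    have lin1: "linear h" and nz1: "\<exists>v\<in>T0. h (cayley_point v) \<noteq> 0" if hin: "h \<in> \<Phi>1" for h
    proof -
      obtain T e where Te: "T \<in> M" "e \<in> T" "h = c T e" using hin unfolding \<Phi>1_def by blast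
      show l: "linear h" using c(1) Te by simp
      show "\<exists>v\<in>T0. h (cayley_point v) \<noteq> 0" by (rule nonzero[OF l, of e]) (use c(2) Te in simp)
    qed
    have lin2: "linear h" and nz2: "\<exists>v\<in>T0. h (cayley_point v) \<noteq> 0" if hin: "h \<in> \<Phi>2" for h
    proof -
      obtain T e e' where Te: "T \<in> M" "e \<in> T" "e' \<in> T" "e \<noteq> e'" "Q T e \<noteq> 0 \<or> Q T e' \<noteq> 0"
        "h = (\<lambda>x. Q T e' * c T e x - Q T e * c T e' x)" using hin unfolding \<Phi>2_def by blast
      show l: "linear h" unfolding Te(6)
        by (rule linearI) (simp_all add: linear_add[OF c(1)[OF Te(1)]] linear_cmul[OF c(1)[OF Te(1)]] algebra_simps)
      have "h (cayley_point e) = Q T e'" "h (cayley_point e') = - Q T e"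
        unfolding Te(6) using c(2)[OF Te(1,2)] c(2)[OF Te(1,3)] Te(4) by simp_all
      then show "\<exists>v\<in>T0. h (cayley_point v) \<noteq> 0"
        using nonzero[OF l, of e] nonzero[OF l, of e'] Te(5) by auto
    qed
    have "finite \<Phi>1" "finite \<Phi>2" unfolding \<Phi>1_def \<Phi>2_def by simp_all
    then obtain f0 where f0: "supported T0 f0" "nonneg f0" "\<And>h. h \<in> \<Phi>1 \<union> \<Phi>2 \<Longrightarrow> h (marg f0) \<noteq> 0"
      using generic_point[OF tr[OF T0], of "\<Phi>1 \<union> \<Phi>2"] lin1 lin2 nz1 nz2 by blast
    define p where "p = marg f0"
    have "\<forall>T. T \<in> M \<longrightarrow> (\<exists>f. supported T f \<and> marg f = p)"
      using tree_flow[OF tr, of _ f0] unfolding p_def by metis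
    then obtain P where P: "\<And>T. T \<in> M \<Longrightarrow> supported T (P T)" "\<And>T. T \<in> M \<Longrightarrow> marg (P T) = p"
      by metis
    have Pnz: "P T e \<noteq> 0" if "T \<in> M" "e \<in> T" for T e
    proof -
      have "c T e \<in> \<Phi>1" unfolding \<Phi>1_def using that by blast
      then show ?thesis using f0(3)[of "c T e"] cf[OF that P(1)[OF that(1)]] P(2)[OF that(1)] by (simp add: p_def)
    qed
    have PQ: "Q T e' * P T e \<noteq> Q T e * P T e'"
      if "T \<in> M" "e \<in> T" "e' \<in> T" "e \<noteq> e'" "Q T e \<noteq> 0 \<or> Q T e' \<noteq> 0" for T e e'
    proof -
      have "(\<lambda>x. Q T e' * c T e x - Q T e * c T e' x) \<in> \<Phi>2" unfolding \<Phi>2_def using that by blast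
      from f0(3)[OF UnI2[OF this]] show ?thesis
        using cf[OF that(1,2) P(1)[OF that(1)]] cf[OF that(1,3) P(1)[OF that(1)]] P(2)[OF that(1)]
        by (simp add: p_def)
    qed
    \<comment> \<open>The coordinates along \<open>T\<close> of the point of the segment at
      parameter \<open>s\<close>.\<close>
    define l where "l T s v = P T v + s * (Q T v - P T v)" for T s v
    have lsup: "supported T (l T s)" if "T \<in> M" for T s
      using supportedD[OF P(1)[OF that]] supportedD[OF Q(1)[OF that]] by (simp add: supported_def l_def)
    have lm: "marg (l T s) = p + s *\<^sub>R (q - p)" if "T \<in> M" for T s
      unfolding l_def by (simp add: marg_add marg_scale marg_diff P(2)[OF that] Q(2)[OF that])
    \<comment> \<open>The covered parameters form a compact set, so there is a last one.\<close>
    define S where "S = {s \<in> {0..1}. \<exists>T\<in>M. \<forall>v. l T s v \<ge> 0}"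
    have "S = (\<Union>T\<in>M. {0..1} \<inter> (\<Inter>v. {s. 0 \<le> l T s v}))" by (auto simp: S_def)
    moreover have "closed {s. 0 \<le> l T s v}" for T v
      unfolding l_def by (intro closed_Collect_le continuous_intros)
    then have "compact ({0..1} \<inter> (\<Inter>v. {s. 0 \<le> l T s v}))" for T
      by (intro compact_Int_closed compact_Icc closed_INT) simp
    ultimately have "compact S" by (simp only: compact_UN finite)
    moreover have "P T0 = f0"
      by (rule indep_unique[OF tree_indep[OF tr[OF T0]] P(1)[OF T0] f0(1)]) (simp add: P(2)[OF T0] p_def)
    then have "0 \<in> S" using f0(2) T0 by (auto simp: S_def l_def nonneg_def)
    ultimately obtain s where s: "s \<in> S" "\<And>t. t \<in> S \<Longrightarrow> t \<le> s"
      using compact_attains_sup[of S] by blast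
    then obtain T where T: "T \<in> M" "\<And>v. l T s v \<ge> 0" and s01: "0 \<le> s" "s \<le> 1"
      by (auto simp: S_def)
    have "s \<noteq> 1"
    proof
      assume "s = 1"
      then have "marg (l T s) = q" by (simp add: lm[OF T(1)])
      then have "q \<in> edge_cone T" using T(2) lsup[OF T(1)] by (auto simp: edge_cone_def nonneg_def)
      then show False using nq T(1) by blast
    qed
    then have s1: "s < 1" using s01 by simp
    have contra: False if "s < t" "t < 1" "U \<in> M" "supported U f" "nonneg f" "marg f = p + t *\<^sub>R (q - p)" for t U f
    proof -
      have "l U t = f"
        by (rule indep_unique[OF tree_indep[OF tr[OF that(3)]] lsup[OF that(3)] that(4)])
          (simp add: lm that)
      then have "t \<in> S" using that s01 by (auto simp: S_def nonneg_def)
      then show False using s(2) that(1) by force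
    qed
    \<comment> \<open>Two coordinates vanishing together would make their values at the two ends of
      the segment proportional.\<close>
    have unique: "e = e'" if "e \<in> T" "e' \<in> T" "l T s e = 0" "l T s e' = 0" for e e'
    proof (rule ccontr)
      assume "e \<noteq> e'"
      have 1: "(1 - s) * P T e = - s * Q T e" "(1 - s) * P T e' = - s * Q T e'"
        using that(3,4) by (simp_all add: l_def algebra_simps)
      then have "Q T e \<noteq> 0 \<or> Q T e' \<noteq> 0" using Pnz[OF T(1) that(1)] s1 by auto
      have "(1 - s) * (Q T e' * P T e) = Q T e' * ((1 - s) * P T e)" by simp
      also have "\<dots> = Q T e * (- s * Q T e')" by (simp add: 1)
      also have "\<dots> = (1 - s) * (Q T e * P T e')" unfolding 1(2)[symmetric] by simp
      finally have "Q T e' * P T e = Q T e * P T e'" using s1 by simp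
      then show False using PQ[OF T(1) that(1,2) \<open>e \<noteq> e'\<close> \<open>_ \<or> _\<close>] by blast
    qed
    show False
    proof (cases "\<exists>e\<in>T. l T s e = 0 \<and> Q T e - P T e \<le> 0")
      case False
      \<comment> \<open>Here no vanishing coordinate is going to decrease, and the positive ones
        stay positive for a while, so \<open>T\<close> itself covers more of the segment.\<close>
      define K where "K = {v \<in> T. l T s v > 0}"
      obtain t where t: "s < t" "t < 1" "\<And>v. v \<in> K \<Longrightarrow> P T v + t * (Q T v - P T v) > 0"
        by (rule affine_positive_beyond[of K s "P T" "\<lambda>v. Q T v - P T v"])
          (use s1 in \<open>simp_all add: K_def l_def\<close>)
      have "l T t v \<ge> 0" for v
      proof -
        consider "v \<notin> T" | "v \<in> K" | "v \<in> T" "l T s v = 0"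
          using T(2)[of v] unfolding K_def by fastforce
        then show ?thesis
        proof cases
          case 1 then show ?thesis using supportedD[OF lsup[OF T(1)]] by simp
        next
          case 2 then show ?thesis using t(3)[of v] by (simp add: l_def)
        next
          case 3
          then have "\<not> Q T v - P T v \<le> 0" using False by blast
          then have "Q T v - P T v > 0" by simp
          moreover have "l T t v = l T s v + (t - s) * (Q T v - P T v)" by (simp add: l_def algebra_simps)
          ultimately show ?thesis using 3 t(1) by simp
        qed
      qed
      then show False using contra[OF t(1,2) T(1) lsup[OF T(1)] _ lm[OF T(1)]] by (simp add: nonneg_def)
    next
      case True
      then obtain e where e: "e \<in> T" "l T s e = 0" "Q T e - P T e \<le> 0" by blast
      have "P T e + s * (Q T e - P T e) = 0" using e(2) by (simp add: l_def)
      then have neg: "Q T e - P T e < 0" using Pnz[OF T(1) e(1)] e(3) by (cases "Q T e = P T e") auto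
      have Qe: "Q T e < 0"
      proof -
        have "Q T e = l T s e + (1 - s) * (Q T e - P T e)" by (simp add: l_def algebra_simps)
        moreover have "(1 - s) * (Q T e - P T e) < 0" by (rule mult_pos_neg) (use neg s1 in simp_all)
        ultimately show ?thesis using e(2) by linarith
      qed
      have "\<not> boundary (T - {e})"
      proof
        assume b: "boundary (T - {e})"
        have "Q T e \<ge> 0"
          by (rule boundary_coordinate[OF tr[OF T(1)] b Q(1)[OF T(1)] g(1)])
            (simp add: Q(2)[OF T(1)] g(2))
        then show False using Qe by simp
      qed
      then obtain U where U: "U \<in> M" "U \<noteq> T" "T - {e} \<subseteq> U"
        using M T(1) e(1) unfolding good_def by blast
      have comp: "compatible T U" using M T(1) U(1) unfolding good_def by blast
      obtain w k where wk: "w \<in> U" "w \<notin> T" "U = insert w (T - {e})" "supported T k"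
        "marg k = cayley_point w" "k e < 0"
        by (rule neighbour_coordinate_neg[OF tr[OF T(1)] tr[OF U(1)] comp U(2) e(1) U(3)])
      \<comment> \<open>The same point in the coordinates of \<open>U\<close>: \<open>e\<close> is
        exchanged for \<open>w\<close> so that the coefficient at \<open>e\<close> cancels. Beyond
        \<open>s\<close> the coefficient at \<open>w\<close> is a quotient of a nonpositive and a
        negative number.\<close>
      define f where "f t v = l T t v + l T t e / k e * ((if v = w then 1 else 0) - k v)" for t v
      have fm: "marg (f t) = p + t *\<^sub>R (q - p)" for t
        unfolding f_def marg_add marg_scale marg_diff marg_single wk(5) lm[OF T(1)] by simp
      have fsup: "supported U (f t)" for t
      proof -
        have "f t v = 0" if v: "v \<notin> U" for v
        proof (cases "v = e")
          case True
          then have "v \<noteq> w" using v wk(1) by blast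
          then show ?thesis using True wk(6) by (simp add: f_def)
        next
          case False
          then have "v \<notin> T" "v \<noteq> w" using v wk(1,3) by blast+
          then show ?thesis using supportedD[OF wk(4)] supportedD[OF lsup[OF T(1)]] by (simp add: f_def)
        qed
        then show ?thesis by (simp add: supported_def)
      qed
      have lin: "f t v = (P T v - P T e / k e * k v) + t * ((Q T v - P T v) - (Q T e - P T e) / k e * k v)"
        if "v \<noteq> w" for t v
        using that wk(6) by (simp add: f_def l_def field_simps)
      obtain t where t: "s < t" "t < 1" "\<And>v. v \<in> T - {e} \<Longrightarrow>
          (P T v - P T e / k e * k v) + t * ((Q T v - P T v) - (Q T e - P T e) / k e * k v) > 0"
      proof (rule affine_positive_beyond[of "T - {e}" s "\<lambda>v. P T v - P T e / k e * k v"
            "\<lambda>v. (Q T v - P T v) - (Q T e - P T e) / k e * k v"])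
        fix v assume v: "v \<in> T - {e}"
        then have "v \<noteq> w" using wk(2) by blast
        have "l T s v \<noteq> 0" using unique[of v e] v e by blast
        then have "f s v > 0" using T(2)[of v] \<open>v \<noteq> w\<close> e(2) by (simp add: f_def)
        then show "(P T v - P T e / k e * k v) + s * ((Q T v - P T v) - (Q T e - P T e) / k e * k v) > 0"
          unfolding lin[OF \<open>v \<noteq> w\<close>] .
      qed (use s1 in auto)
      have "f t v \<ge> 0" for v
      proof -
        consider "v \<notin> U" | "v = w" | "v \<in> T - {e}" using wk(3) by blast
        then show ?thesis
        proof cases
          case 1 then show ?thesis using supportedD[OF fsup] by simp
        next
          case 2
          have "l T t e = l T s e + (t - s) * (Q T e - P T e)" by (simp add: l_def algebra_simps)
          then have "l T t e \<le> 0" using e t(1) by (simp add: mult_nonneg_nonpos)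
          then have "l T t e / k e \<ge> 0" using wk(6) by (simp add: divide_nonpos_neg)
          then show ?thesis using 2 wk(2) supportedD[OF lsup[OF T(1)]] supportedD[OF wk(4)] by (simp add: f_def)
        next
          case 3
          then have "v \<noteq> w" using wk(2) by blast
          then show ?thesis using t(3)[OF 3] lin[of v t] by simp
        qed
      qed
      then show False using contra[OF t(1,2) U(1) fsup _ fm] by (simp add: nonneg_def)
    qed
  qed
qed

subsection \<open>Triangulations\<close>

lemma coneI: "supported A f \<Longrightarrow> nonneg f \<Longrightarrow> marg f \<in> edge_cone A"
  unfolding edge_cone_def by blast

text \<open>A common point has the same nonnegative flow on both sides, which is then supported on
  \<open>A\<close> and on \<open>B\<close>.\<close>

lemma simp_of_Int:
  assumes "compatible T U" "A \<subseteq> T" "B \<subseteq> U"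
  shows "simp_of A \<inter> simp_of B = simp_of (A \<inter> B)"
proof
  show "simp_of (A \<inter> B) \<subseteq> simp_of A \<inter> simp_of B"
    by (intro Int_greatest hull_mono image_mono) simp_all
  show "simp_of A \<inter> simp_of B \<subseteq> simp_of (A \<inter> B)"
  proof
    fix x assume x: "x \<in> simp_of A \<inter> simp_of B"
    then obtain f g where f: "supported A f" "nonneg f" "marg f = x"
      and g: "supported B g" "nonneg g" "marg g = x"
      by (auto simp: simp_of_iff edge_cone_def)
    have "supported T f" "supported U g" using f(1) g(1) assms(2,3) unfolding supported_def by blast+
    then have "f = g" using compatible_flows_eq[OF assms(1)] f g by (simp add: nonneg_def)
    then have "supported (A \<inter> B) f" using f(1) g(1) by (auto simp: supported_def)
    then show "x \<in> simp_of (A \<inter> B)" using f x by (auto simp: simp_of_iff edge_cone_def)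
  qed
qed

lemma vertex_labels_simp_of:
  assumes "indep A" shows "vertex_labels (simp_of A) = A"
  using assms
  by (auto simp: vertex_labels_def indep_affine extreme_point_of_convex_hull_affine_independent
      inj_image_mem_iff[OF inj_cayley_point])

lemma simp_of_inj: "indep A \<Longrightarrow> indep B \<Longrightarrow> simp_of A = simp_of B \<Longrightarrow> A = B"
  by (metis vertex_labels_simp_of)

lemma face_of_simp_of:
  assumes "indep A" shows "F face_of simp_of A \<longleftrightarrow> (\<exists>B\<subseteq>A. F = simp_of B)"
  using face_of_convex_hull_affine_independent[of "cayley_point ` A" F] assms
  by (auto simp: indep_affine subset_image_iff)

definition faces :: "label set set \<Rightarrow> label set set" where
  "faces M = {A. \<exists>T\<in>M. A \<subseteq> T}"

definition complex_of :: "label set set \<Rightarrow> (real^(4+4)) set set" where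
  "complex_of M = simp_of ` faces M"

definition tree_sets :: "(real^(4+4)) set set \<Rightarrow> label set set" where
  "tree_sets \<C> = {T \<in> trees. simp_of T \<in> \<C>}"

lemma faces_indep: "M \<subseteq> trees \<Longrightarrow> A \<in> faces M \<Longrightarrow> indep A"
  unfolding faces_def using tree_indep indep_subset by blast

lemma tree_sets_complex_of:
  assumes "M \<subseteq> trees" shows "tree_sets (complex_of M) = M"
proof
  show "M \<subseteq> tree_sets (complex_of M)"
    using assms unfolding tree_sets_def complex_of_def faces_def by blast
  show "tree_sets (complex_of M) \<subseteq> M"
  proof
    fix T assume "T \<in> tree_sets (complex_of M)"
    then obtain A U where *: "T \<in> trees" "simp_of T = simp_of A" "U \<in> M" "A \<subseteq> U"
      unfolding tree_sets_def complex_of_def faces_def by blast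
    have "indep A" using assms * faces_indep unfolding faces_def by blast
    then have "T = A" using simp_of_inj tree_indep * by blast
    then have "T \<subseteq> U" "card T = card U" using * assms by (auto simp: trees_def)
    then have "T = U" by (intro card_subset_eq) simp_all
    then show "T \<in> M" using * by simp
  qed
qed

lemma vertex_labels_complex_of:
  assumes "M \<subseteq> trees" shows "vertex_labels ` complex_of M = faces M"
  using faces_indep[OF assms] vertex_labels_simp_of by (force simp: complex_of_def)

lemma simplex_simp_of: "indep A \<Longrightarrow> n simplex simp_of A \<longleftrightarrow> n = int (card A) - 1"
proof -
  assume A: "indep A"
  have "(int (card A) - 1) simplex simp_of A"
    using A by (intro simplex_convex_hull) (simp add: indep_affine card_points)
  then show ?thesis using aff_dim_simplex by metis
qed

text \<open>Compatibility makes the simplices meet in common faces; \<open>good_covers\<close> makes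
  them fill the polytope.\<close>

lemma good_triangulation:
  assumes M: "good M" shows "complex_of M \<in> cayley_triangulations"
proof -
  have Mt: "M \<subseteq> trees" and comp: "\<And>T U. T \<in> M \<Longrightarrow> U \<in> M \<Longrightarrow> compatible T U"
    using M by (auto simp: good_def)
  have "simplicial_complex (complex_of M)" unfolding simplicial_complex_def
  proof (intro conjI ballI allI impI; (elim conjE)?)
    show "finite (complex_of M)" by (simp add: complex_of_def)
    fix S assume "S \<in> complex_of M"
    then obtain A where "A \<in> faces M" "S = simp_of A" by (auto simp: complex_of_def)
    then show "\<exists>n. n simplex S" using simplex_simp_of[OF faces_indep[OF Mt]] by blast
  next
    fix F S assume "S \<in> complex_of M" "F face_of S"
    then obtain A B where "A \<in> faces M" "B \<subseteq> A" "F = simp_of B"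
      using face_of_simp_of[OF faces_indep[OF Mt]] unfolding complex_of_def by blast
    then show "F \<in> complex_of M" unfolding complex_of_def faces_def by blast
  next
    fix S S' assume "S \<in> complex_of M" "S' \<in> complex_of M"
    then obtain A B where *: "A \<in> faces M" "B \<in> faces M" "S = simp_of A" "S' = simp_of B"
      unfolding complex_of_def by blast
    then obtain T U where "T \<in> M" "U \<in> M" "A \<subseteq> T" "B \<subseteq> U" unfolding faces_def by blast
    then have "S \<inter> S' = simp_of (A \<inter> B)" using simp_of_Int[OF comp] * by simp
    then show "S \<inter> S' face_of S" using face_of_simp_of[OF faces_indep[OF Mt *(1)]] * by auto
  qed
  moreover have "\<Union>(complex_of M) = cayley_polytope"
  proof
    show "\<Union>(complex_of M) \<subseteq> cayley_polytope"
      unfolding complex_of_def cayley_polytope_simp_of by (intro Union_least) (auto dest: hull_mono[of _ "range cayley_point" convex, OF image_mono[OF subset_UNIV], THEN subsetD])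
    show "cayley_polytope \<subseteq> \<Union>(complex_of M)"
    proof
      fix x assume "x \<in> cayley_polytope"
      then have x: "x \<in> edge_cone UNIV" "total x = 1" by (simp_all add: cayley_polytope_simp_of simp_of_iff)
      then obtain T where "T \<in> M" "x \<in> edge_cone T" using good_covers[OF M] by blast
      then have "x \<in> simp_of T" "T \<in> faces M" using x by (auto simp: simp_of_iff faces_def)
      then show "x \<in> \<Union>(complex_of M)" unfolding complex_of_def by blast
    qed
  qed
  moreover have "x \<in> range cayley_point" if "S \<in> complex_of M" "x extreme_point_of S" for S x
    using that extreme_point_of_convex_hull unfolding complex_of_def by blast
  ultimately show ?thesis by (simp add: cayley_triangulations_def)
qed

lemma triangulation_simplex:
  assumes "\<C> \<in> cayley_triangulations" "S \<in> \<C>"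
  obtains A where "indep A" "S = simp_of A"
proof -
  obtain n where "n simplex S" using assms by (auto simp: cayley_triangulations_def simplicial_complex_def)
  then obtain X where X: "\<not> affine_dependent X" "S = convex hull X" unfolding simplex_def by blast
  have "X \<subseteq> range cayley_point"
  proof
    fix x assume "x \<in> X"
    then have "x extreme_point_of S" using X by (simp add: extreme_point_of_convex_hull_affine_independent)
    then show "x \<in> range cayley_point" using assms unfolding cayley_triangulations_def by blast
  qed
  then obtain A where "X = cayley_point ` A" by (auto simp: subset_image_iff)
  then show ?thesis using X that by (simp add: indep_affine)
qed

section \<open>Necessary conditions on the full-dimensional cells\<close>

lemma scaleR_cone: "x \<in> edge_cone A \<Longrightarrow> c \<ge> 0 \<Longrightarrow> c *\<^sub>R x \<in> edge_cone A"
proof -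
  assume "x \<in> edge_cone A" "c \<ge> 0"
  then obtain f where "supported A f" "nonneg f" "marg f = x" by (auto simp: edge_cone_def)
  then have "supported A (\<lambda>v. c * f v)" "nonneg (\<lambda>v. c * f v)" "marg (\<lambda>v. c * f v) = c *\<^sub>R x"
    using \<open>c \<ge> 0\<close> by (simp_all add: supported_def nonneg_def marg_scale)
  then show ?thesis using coneI by metis
qed

text \<open>The slice of the cone in which the Cayley trick takes place. Its points have total 4,
  hence the factor 1/4 on the way to the polytope.\<close>

definition level_one :: "(real^(4+4)) set" where
  "level_one = {x. \<forall>i. x $ Inr i = 1}"

lemma level_one_simp_of: "x \<in> level_one \<Longrightarrow> (1/4) *\<^sub>R x \<in> simp_of A \<longleftrightarrow> x \<in> edge_cone A"
proof -
  assume x: "x \<in> level_one"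
  have "total ((1/4) *\<^sub>R x) = 1" using x by (simp add: total_def level_one_def)
  moreover have "(1/4) *\<^sub>R x \<in> edge_cone A \<longleftrightarrow> x \<in> edge_cone A"
    using scaleR_cone[of "(1/4) *\<^sub>R x" A 4] scaleR_cone[of x A "1/4"] by auto
  ultimately show ?thesis by (simp add: simp_of_iff)
qed

text \<open>The right sums \<open>r j - 3/4\<close> add up to the left total 4 precisely when
  \<open>r\<close> adds up to 7, the number of edges of a tree.\<close>

definition attainable :: "(4 \<Rightarrow> nat) \<Rightarrow> bool" where
  "attainable r \<longleftrightarrow> (\<exists>x \<in> edge_cone UNIV \<inter> level_one. \<forall>j. x $ Inl j = real (r j) - 3/4)"

text \<open>An edge set with vertex sums in \<open>level_one\<close> has one edge in each block, so
  it is an expression of a lattice point of the Minkowski sum.\<close>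

definition admissible :: "label set set \<Rightarrow> bool" where
  "admissible M \<longleftrightarrow> M \<subseteq> trees \<and> (\<forall>r. attainable r \<longrightarrow> (\<exists>T\<in>M. deg T = r)) \<and>
     (\<forall>T\<in>M. \<forall>U\<in>M. \<forall>\<phi> \<psi>. \<phi> \<subseteq> T \<longrightarrow> \<psi> \<subseteq> U \<longrightarrow> marg (indicat_real \<phi>) \<in> level_one \<longrightarrow>
        marg (indicat_real \<phi>) = marg (indicat_real \<psi>) \<longrightarrow> \<phi> = \<psi>)"

lemma supported_indicator_iff: "supported A (indicat_real B) \<longleftrightarrow> B \<subseteq> A"
  by (auto simp: supported_def indicator_def)

text \<open>The flow on the common edges is a flow on either tree, so it equals both
  indicators.\<close>

lemma common_transversal_eq:
  assumes "indep T" "indep U" "\<phi> \<subseteq> T" "\<psi> \<subseteq> U" "marg (indicat_real \<phi>) = marg (indicat_real \<psi>)"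
    and "marg (indicat_real \<phi>) \<in> edge_cone (T \<inter> U)"
  shows "\<phi> = \<psi>"
proof -
  obtain h where h: "supported (T \<inter> U) h" "marg h = marg (indicat_real \<phi>)"
    using assms(6) by (auto simp: edge_cone_def)
  then have hTU: "supported T h" "supported U h" by (auto simp: supported_def)
  have "h = indicat_real \<phi>"
    by (rule indep_unique[OF assms(1) hTU(1)]) (use assms h in \<open>simp_all add: supported_indicator_iff\<close>)
  moreover have "h = indicat_real \<psi>"
    by (rule indep_unique[OF assms(2) hTU(2)]) (use assms h in \<open>simp_all add: supported_indicator_iff\<close>)
  ultimately show ?thesis by (metis indicator_inj)
qed

lemma indicator_in_cone: "\<phi> \<subseteq> A \<Longrightarrow> marg (indicat_real \<phi>) \<in> edge_cone A"
  unfolding edge_cone_def by (auto simp: supported_indicator_iff nonneg_def)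

lemma triangulation_admissible:
  assumes C: "\<C> \<in> cayley_triangulations" shows "admissible (tree_sets \<C>)"
  unfolding admissible_def
proof (intro conjI allI impI ballI)
  show "tree_sets \<C> \<subseteq> trees" by (auto simp: tree_sets_def)
next
  fix r assume "attainable r"
  then obtain x where x: "x \<in> edge_cone UNIV" "x \<in> level_one" "\<And>j. x $ Inl j = real (r j) - 3/4"
    by (auto simp: attainable_def)
  have "(1/4) *\<^sub>R x \<in> cayley_polytope" using x by (simp add: cayley_polytope_simp_of level_one_simp_of)
  then obtain S where S: "S \<in> \<C>" "(1/4) *\<^sub>R x \<in> S" using C unfolding cayley_triangulations_def by blast
  obtain A where A: "indep A" "S = simp_of A" using triangulation_simplex[OF C S(1)] by blast
  have "x \<in> edge_cone A" using S(2) x(2) A(2) by (simp add: level_one_simp_of)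
  then obtain f where f: "supported A f" "nonneg f" "marg f = x" by (auto simp: edge_cone_def)
  obtain T where T: "T \<in> trees" "A \<subseteq> T" using indep_extend[OF A(1)] by blast
  have fT: "supported T f" using f(1) T(2) unfolding supported_def by blast
  have m: "\<And>i. marg f $ Inr i = 1" "\<And>j. marg f $ Inl j = real (r j) - 3/4"
    using x f(3) by (simp_all add: level_one_def)
  \<comment> \<open>All coordinates of the test point along \<open>T\<close> are positive, but the
    flow is supported on \<open>A\<close>: the simplex found is that of the whole tree.\<close>
  have "T \<subseteq> A"
  proof
    fix v assume "v \<in> T"
    then have "f v > 0" using tree_test_point(2)[OF T(1) fT f(2) m] by blast
    then show "v \<in> A" using supportedD[OF f(1), of v] by force
  qed
  then have "A = T" using T(2) by blast
  then have "T \<in> tree_sets \<C>" using S(1) A(2) T(1) by (simp add: tree_sets_def)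
  then show "\<exists>T\<in>tree_sets \<C>. deg T = r" using tree_test_point(1)[OF T(1) fT f(2) m] by blast
next
  fix T U \<phi> \<psi>
  assume T: "T \<in> tree_sets \<C>" "U \<in> tree_sets \<C>" and subvec: "\<phi> \<subseteq> T" "\<psi> \<subseteq> U"
    and m: "marg (indicat_real \<phi>) \<in> level_one" "marg (indicat_real \<phi>) = marg (indicat_real \<psi>)"
  have i: "indep T" "indep U" using T by (auto simp: tree_sets_def tree_indep)
  have "simp_of T \<in> \<C>" "simp_of U \<in> \<C>" using T by (auto simp: tree_sets_def)
  \<comment> \<open>The common face is spanned by edges that belong to both trees.\<close>
  then have "simp_of T \<inter> simp_of U face_of simp_of T" "simp_of U \<inter> simp_of T face_of simp_of U"
    using C by (auto simp: cayley_triangulations_def simplicial_complex_def)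
  then obtain A B where AB: "A \<subseteq> T" "simp_of T \<inter> simp_of U = simp_of A" "B \<subseteq> U" "simp_of U \<inter> simp_of T = simp_of B"
    using face_of_simp_of i by meson
  then have "A = B" using simp_of_inj indep_subset i by (metis Int_commute)
  let ?x = "marg (indicat_real \<phi>)"
  have "(1/4) *\<^sub>R ?x \<in> simp_of T \<inter> simp_of U"
    using level_one_simp_of[OF m(1)] indicator_in_cone[OF subvec(1)] indicator_in_cone[OF subvec(2)] m(2) by simp
  then have "?x \<in> edge_cone A" using AB(2) level_one_simp_of[OF m(1)] by simp
  then have "?x \<in> edge_cone (T \<inter> U)" using AB(1,3) \<open>A = B\<close> cone_mono[of A "T \<inter> U"] by blast
  then show "\<phi> = \<psi>" using common_transversal_eq[OF i subvec m(2)] by blast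
qed

text \<open>As the trees cover the polytope, the barycentre of a simplex \<open>S\<close> lies in
  the simplex of some tree. The two meet in a face of \<open>S\<close> that contains the barycentre,
  hence in \<open>S\<close>, which is thereby a face of the tree simplex.\<close>

lemma triangulation_pure:
  assumes C: "\<C> \<in> cayley_triangulations" and M: "good (tree_sets \<C>)"
  shows "\<C> = complex_of (tree_sets \<C>)"
proof
  let ?M = "tree_sets \<C>"
  show "complex_of ?M \<subseteq> \<C>"
  proof
    fix S assume "S \<in> complex_of ?M"
    then obtain A T where *: "T \<in> ?M" "A \<subseteq> T" "S = simp_of A" unfolding complex_of_def faces_def by blast
    then have "indep T" by (auto simp: tree_sets_def tree_indep)
    then have "S face_of simp_of T" using face_of_simp_of * by blast
    then show "S \<in> \<C>" using C * by (auto simp: cayley_triangulations_def simplicial_complex_def tree_sets_def)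
  qed
  show "\<C> \<subseteq> complex_of ?M"
  proof
    fix S assume S: "S \<in> \<C>"
    obtain A where A: "indep A" "S = simp_of A" using triangulation_simplex[OF C S] by blast
    have Mt: "?M \<subseteq> trees" "?M \<noteq> {}" using M by (auto simp: good_def)
    show "S \<in> complex_of ?M"
    proof (cases "A = {}")
      case True
      then show ?thesis using Mt(2) A(2) unfolding complex_of_def faces_def by blast
    next
      case False
      then have "card A > 0" by (simp add: card_gt_0_iff)
      define f where "f v = indicat_real A v / card A" for v
      have f: "supported A f" "nonneg f" by (simp_all add: f_def supported_def nonneg_def)
      have "sum f UNIV = 1"
        unfolding sum_supported[OF f(1)] using \<open>card A > 0\<close> False by (simp add: f_def)
      then have y: "marg f \<in> simp_of A" using f by (auto simp: simp_of_iff edge_cone_def total_marg)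
      then have "marg f \<in> cayley_polytope" using C S A(2) by (auto simp: cayley_triangulations_def)
      then have "marg f \<in> edge_cone UNIV" "total (marg f) = 1" by (simp_all add: cayley_polytope_simp_of simp_of_iff)
      then obtain T where T: "T \<in> ?M" "marg f \<in> simp_of T" using good_covers[OF M] by (auto simp: simp_of_iff)
      have TC: "simp_of T \<in> \<C>" and iT: "indep T" using T(1) by (auto simp: tree_sets_def tree_indep)
      have "S \<inter> simp_of T face_of S" "simp_of T \<inter> S face_of simp_of T"
        using C S TC by (auto simp: cayley_triangulations_def simplicial_complex_def)
      then obtain B B' where B: "B \<subseteq> A" "S \<inter> simp_of T = simp_of B" "B' \<subseteq> T" "simp_of T \<inter> S = simp_of B'"
        using face_of_simp_of A iT by meson
      have "marg f \<in> edge_cone B" using y T(2) B(2) A(2) by (auto simp: simp_of_iff)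
      then obtain g where g: "supported B g" "marg g = marg f" by (auto simp: edge_cone_def)
      have "supported A g" using g(1) B(1) unfolding supported_def by blast
      then have "g = f" using indep_unique[OF A(1) _ f(1) g(2)] by blast
      have "A \<subseteq> B"
      proof
        fix v assume "v \<in> A"
        then have "f v \<noteq> 0" using \<open>card A > 0\<close> False by (simp add: f_def)
        then show "v \<in> B" using supportedD[OF g(1)] \<open>g = f\<close> by blast
      qed
      then have "S = simp_of B'" using B A(2) by (metis Int_commute subset_antisym)
      then show ?thesis using B(3) T(1) unfolding complex_of_def faces_def by blast
    qed
  qed
qed

subsection \<open>Mixed subdivisions\<close>

text \<open>\<open>down\<close> and \<open>up\<close> identify the slice \<open>level_one\<close>,
  whose left coordinates are all 1, with the target space of the right coordinates; the cone over
  all columns is cut in a copy of the Minkowski sum.\<close>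

definition down :: "real^(4+4) \<Rightarrow> real^4" where
  "down x = (\<chi> j. x $ Inl j)"

definition up :: "real^4 \<Rightarrow> real^(4+4)" where
  "up x = (\<chi> k. case k of Inl j \<Rightarrow> x $ j | Inr i \<Rightarrow> 1)"

lemma up_nth [simp]: "up x $ Inl j = x $ j" "up x $ Inr i = 1"
  by (simp_all add: up_def)

lemma up_level_one: "up x \<in> level_one"
  by (simp add: level_one_def)

lemma up_down: "x \<in> level_one \<Longrightarrow> up (down x) = x"
  by (rule vec_sum_eqI) (simp_all add: level_one_def down_def)

lemma down_up [simp]: "down (up x) = x"
  by (simp add: down_def)

lemma linear_down: "linear down"
  by (rule linearI) (simp_all add: down_def vec_eq_iff)

lemma down_point: "down (cayley_point v) = axis (right v) 1"
  by (simp add: down_def vec_eq_iff cayley_point_Inl axis_def)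

definition in_block :: "label set \<Rightarrow> 4 \<Rightarrow> label set" where
  "in_block T i = {v \<in> T. fst v = i}"

definition mcell :: "label set \<Rightarrow> 4 \<Rightarrow> (real^4) set" where
  "mcell T i = down ` simp_of (in_block T i)"

definition mixed_cell :: "label set \<Rightarrow> (real^4) set" where
  "mixed_cell T = (\<Sum>i\<in>UNIV. mcell T i)"

lemma mcell_hull: "mcell T i = convex hull ((\<lambda>j. axis j 1) ` right ` in_block T i)"
  by (simp add: mcell_def convex_hull_linear_image[OF linear_down] image_image down_point)

lemma hull_axes:
  "convex hull ((\<lambda>j. axis j 1) ` J) = {x::real^4. (\<forall>j. x $ j \<ge> 0) \<and> (\<Sum>j\<in>J. x $ j) = 1 \<and> (\<forall>j. j \<notin> J \<longrightarrow> x $ j = 0)}"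
    (is "_ = ?R")
proof
  have inj: "inj_on (\<lambda>j. axis j 1 :: real^4) J" by (auto simp: inj_on_def axis_eq_axis)
  show "convex hull ((\<lambda>j. axis j 1) ` J) \<subseteq> ?R"
  proof
    fix x :: "real^4" assume "x \<in> convex hull ((\<lambda>j. axis j 1) ` J)"
    then obtain u where u: "\<forall>j\<in>J. 0 \<le> u (axis j 1 :: real^4)" "(\<Sum>j\<in>J. u (axis j 1)) = 1"
      "(\<Sum>j\<in>J. u (axis j 1) *\<^sub>R axis j 1) = x"
      by (auto simp: convex_hull_finite sum.reindex[OF inj])
    have "x $ j = (if j \<in> J then u (axis j 1) else 0)" for j
      unfolding u(3)[symmetric] by (simp add: axis_def if_distrib sum.If_cases cong: if_cong)
    then show "x \<in> ?R" using u(1,2) by simp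
  qed
  show "?R \<subseteq> convex hull ((\<lambda>j. axis j 1) ` J)"
  proof
    fix x assume x: "x \<in> ?R"
    have "x = (\<Sum>j\<in>J. x $ j *\<^sub>R axis j 1)"
      using x by (simp add: vec_eq_iff axis_def if_distrib sum.If_cases cong: if_cong)
    also have "\<dots> \<in> convex hull ((\<lambda>j. axis j 1) ` J)"
      using x by (intro convex_sum) (auto simp: hull_inc)
    finally show "x \<in> convex hull ((\<lambda>j. axis j 1) ` J)" .
  qed
qed

lemma hull_axes_Int:
  "convex hull ((\<lambda>j. axis j 1 :: real^4) ` I) \<inter> convex hull ((\<lambda>j. axis j 1) ` J)
     = convex hull ((\<lambda>j. axis j 1) ` (I \<inter> J))"
proof -
  have "(\<Sum>j\<in>I. x $ j) = (\<Sum>j\<in>I \<inter> J. x $ j)" if "\<forall>j. j \<notin> J \<longrightarrow> x $ j = 0" for x :: "real^4" and I J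
    using that by (intro sum.mono_neutral_right) auto
  from this[of J _ I] this[of I _ J] show ?thesis
    unfolding hull_axes by (auto simp: Int_commute)
qed

lemma right_in_block: "right v \<in> right ` in_block T (fst v) \<longleftrightarrow> v \<in> T"
proof
  assume "right v \<in> right ` in_block T (fst v)"
  then obtain u where u: "right v = right u" "fst u = fst v" "u \<in> T" unfolding in_block_def by blast
  then have "u = v" by (intro label_eqI) simp_all
  then show "v \<in> T" using u by simp
qed (auto simp: in_block_def)

lemma right_image_block_Int:
  "right ` in_block (T \<inter> U) i = right ` in_block T i \<inter> right ` in_block U i"
proof (intro equalityI subsetI)
  fix j assume "j \<in> right ` in_block T i \<inter> right ` in_block U i"
  then obtain u v where "u \<in> in_block T i" "v \<in> in_block U i" "right u = j" "right v = j" by auto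
  moreover from this have "u = v" by (intro label_eqI) (simp_all add: in_block_def)
  ultimately show "j \<in> right ` in_block (T \<inter> U) i" by (auto simp: in_block_def)
qed (auto simp: in_block_def)

lemma mcell_Int: "mcell T i \<inter> mcell U i = mcell (T \<inter> U) i"
  unfolding mcell_hull hull_axes_Int right_image_block_Int ..

lemma axes_affine_independent: "\<not> affine_dependent ((\<lambda>j. axis j 1 :: real^4) ` J)"
proof -
  have "(\<lambda>j. axis j 1 :: real^4) ` J \<subseteq> Basis" by auto
  then have "independent ((\<lambda>j. axis j 1 :: real^4) ` J)" using independent_Basis independent_mono by blast
  then show ?thesis using affine_dependent_imp_dependent by blast
qed

text \<open>A label belongs to the edge set exactly if its vertex lies in the summand of its
  block.\<close>

lemma mcell_inj: "mcell T = mcell U \<Longrightarrow> T = U"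
proof -
  assume eq: "mcell T = mcell U"
  have *: "v \<in> A \<longleftrightarrow> axis (right v) 1 \<in> mcell A (fst v)" for v A
  proof -
    have "axis (right v) 1 \<in> mcell A (fst v) \<longleftrightarrow> right v \<in> right ` in_block A (fst v)"
      unfolding mcell_hull hull_axes by (auto simp: axis_def sum.If_cases cong: if_cong)
    then show ?thesis by (simp add: right_in_block)
  qed
  show ?thesis unfolding set_eq_iff * eq by simp
qed

text \<open>The Cayley trick for one cell: a nonnegative flow with left sums 1 splits by blocks into
  convex combinations of the chosen vertices, and such combinations add up to a flow.\<close>

lemma mixed_cell_iff: "x \<in> mixed_cell T \<longleftrightarrow> up x \<in> edge_cone T"
proof
  assume "x \<in> mixed_cell T"
  then obtain s where s: "x = sum s UNIV" "\<And>i. s i \<in> mcell T i"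
    unfolding mixed_cell_def set_sum_alt[OF finite] by blast
  have "\<exists>f. supported (in_block T i) f \<and> nonneg f \<and> total (marg f) = 1 \<and> s i = down (marg f)" for i
    using s(2)[of i] unfolding mcell_def by (auto simp: simp_of_iff edge_cone_def)
  then obtain f where f: "\<And>i. supported (in_block T i) (f i)" "\<And>i. nonneg (f i)"
    "\<And>i. total (marg (f i)) = 1" "\<And>i. s i = down (marg (f i))" by metis
  define g where "g v = (\<Sum>i\<in>UNIV. f i v)" for v
  have "supported T g" using f(1) unfolding supported_def g_def in_block_def
    by (intro allI impI sum.neutral) blast
  moreover have "nonneg g" using f(2) unfolding nonneg_def g_def by (intro allI sum_nonneg) blast
  moreover have "marg g = up x"
  proof (rule vec_sum_eqI)
    fix j
    show "marg g $ Inl j = up x $ Inl j"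
      unfolding g_def marg_sum s(1) f(4) by (simp add: down_def)
  next
    fix i
    have "marg (f k) $ Inr i = (if k = i then 1 else 0)" for k
    proof (cases "k = i")
      case True
      have "sum (f i) UNIV = (\<Sum>v | fst v = i. f i v)"
        using supportedD[OF f(1)[of i]] by (intro sum.mono_neutral_right) (auto simp: in_block_def)
      then show ?thesis using True f(3)[of i] by (simp add: marg_Inr total_marg)
    next
      case False
      have "(\<Sum>v | fst v = i. f k v) = 0"
        using supportedD[OF f(1)[of k]] False by (intro sum.neutral) (auto simp: in_block_def)
      then show ?thesis using False by (simp add: marg_Inr)
    qed
    then show "marg g $ Inr i = up x $ Inr i" unfolding g_def marg_sum by simp
  qed
  ultimately show "up x \<in> edge_cone T" using coneI by metis
next
  assume "up x \<in> edge_cone T"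
  then obtain f where f: "supported T f" "nonneg f" "marg f = up x" by (auto simp: edge_cone_def)
  define g where "g i v = (if fst v = i then f v else 0)" for i v
  have g: "supported (in_block T i) (g i)" "nonneg (g i)" for i
    using f(1,2) by (auto simp: supported_def nonneg_def g_def in_block_def)
  have tg: "total (marg (g i)) = 1" for i
    using marg_Inr[of f i] f(3) by (simp add: total_marg g_def sum.If_cases)
  have "f = (\<lambda>v. \<Sum>i\<in>UNIV. g i v)" by (simp add: g_def fun_eq_iff)
  then have "up x = (\<Sum>i\<in>UNIV. marg (g i))" using f(3) marg_sum[of g UNIV] by metis
  then have "x = (\<Sum>i\<in>UNIV. down (marg (g i)))"
    using linear_sum[OF linear_down, of "\<lambda>i. marg (g i)" UNIV] by (metis down_up)
  moreover have "down (marg (g i)) \<in> mcell T i" for i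
    unfolding mcell_def using coneI[OF g] tg by (simp add: simp_of_iff)
  ultimately show "x \<in> mixed_cell T"
    unfolding mixed_cell_def set_sum_alt[OF finite] by blast
qed

lemma summand_mcell: "summand i = mcell UNIV i"
proof -
  have "j \<in> right ` in_block UNIV i \<longleftrightarrow> j \<noteq> i" for j
  proof
    assume "j \<noteq> i"
    then obtain v where "fst v = i" "right v = j" using ex_label by metis
    then show "j \<in> right ` in_block UNIV i" by (auto simp: in_block_def)
  qed (use right_neq in \<open>auto simp: in_block_def\<close>)
  then have "right ` in_block UNIV i = {j. j \<noteq> i}" by blast
  moreover have "{axis j 1 | j. j \<noteq> i} = (\<lambda>j. axis j 1 :: real^4) ` {j. j \<noteq> i}" by blast
  ultimately show ?thesis unfolding summand_def mcell_hull by simp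
qed

lemma truncated_tetrahedron_mixed_cell: "truncated_tetrahedron = mixed_cell UNIV"
  unfolding truncated_tetrahedron_def mixed_cell_def summand_mcell sum_4 ..

lemma mixed_cell_Int: "(\<Sum>i\<in>UNIV. mcell T i \<inter> mcell U i) = mixed_cell (T \<inter> U)"
  by (simp add: mcell_Int mixed_cell_def)

lemma cayley_cell_simp_of:
  assumes "indep T" shows "cayley_cell (simp_of T) = mcell T"
proof
  fix i
  have "{row r (block i) | r. (i, r) \<in> T} = (\<lambda>j. axis j 1) ` right ` in_block T i"
  proof -
    have "row r (block i) = axis (right (i, r)) 1" for r
      by (simp add: row_def block_row vec_eq_iff)
    moreover have "in_block T i = {(i, r) | r. (i, r) \<in> T}" by (auto simp: in_block_def)
    ultimately show ?thesis by (auto simp: image_iff)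
  qed
  then show "cayley_cell (simp_of T) i = mcell T i"
    by (simp add: cayley_cell_def vertex_labels_simp_of[OF assms] mcell_hull)
qed

text \<open>The flow at an inner point of a segment is the convex combination of the nonnegative
  flows at its ends; where it vanishes, both of them do.\<close>

lemma mixed_cell_face:
  assumes T: "indep T" and A: "A \<subseteq> T" shows "mixed_cell A face_of mixed_cell T"
  unfolding face_of_def
proof (intro conjI ballI impI)
  show "mixed_cell A \<subseteq> mixed_cell T" using cone_mono[OF A] by (auto simp: mixed_cell_iff)
  show "convex (mixed_cell A)" unfolding mixed_cell_def by (rule convex_set_sum) (simp add: mcell_hull)
next
  fix a b x assume *: "a \<in> mixed_cell T" "b \<in> mixed_cell T" "x \<in> mixed_cell A" "x \<in> open_segment a b"
  obtain f g h where f: "supported T f" "nonneg f" "marg f = up a"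
    and g: "supported T g" "nonneg g" "marg g = up b"
    and h: "supported A h" "nonneg h" "marg h = up x"
    using * by (auto simp: mixed_cell_iff edge_cone_def)
  obtain u where u: "0 < u" "u < 1" "x = (1 - u) *\<^sub>R a + u *\<^sub>R b" using *(4) by (auto simp: in_segment)
  have ux: "up x = (1 - u) *\<^sub>R up a + u *\<^sub>R up b"
    by (rule vec_sum_eqI) (simp_all add: u(3))
  have "h = (\<lambda>v. (1 - u) * f v + u * g v)"
  proof (rule indep_unique[OF T])
    show "supported T h" using h(1) A unfolding supported_def by blast
    show "supported T (\<lambda>v. (1 - u) * f v + u * g v)" using f(1) g(1) by (simp add: supported_def)
    show "marg h = marg (\<lambda>v. (1 - u) * f v + u * g v)"
      using f(3) g(3) h(3) ux by (simp add: marg_add marg_scale)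
  qed
  then have z: "(1 - u) * f v + u * g v = 0" if "v \<notin> A" for v
    using supportedD[OF h(1) that] by (simp add: fun_eq_iff)
  have "f v = 0 \<and> g v = 0" if "v \<notin> A" for v
  proof -
    have "(1 - u) * f v \<ge> 0" "u * g v \<ge> 0" using u f(2) g(2) by (simp_all add: nonnegD)
    then have "(1 - u) * f v = 0" "u * g v = 0" using z[OF that] by linarith+
    then show ?thesis using u by simp
  qed
  then have "supported A f" "supported A g" by (simp_all add: supported_def)
  then have "marg f \<in> edge_cone A" "marg g \<in> edge_cone A" using f(2) g(2) by (simp_all only: coneI)
  then show "a \<in> mixed_cell A" "b \<in> mixed_cell A" by (simp_all only: mixed_cell_iff f(3) g(3))
qed

lemma sum_card_blocks: "(\<Sum>i\<in>UNIV. card (in_block T i)) = card T"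
  using sum.group[of T "UNIV :: 4 set" fst "\<lambda>_. 1::nat"] by (simp add: in_block_def)

lemma aff_dim_mcell: "aff_dim (mcell T i) = int (card (in_block T i)) - 1"
proof -
  have "inj_on right (in_block T i)" by (rule inj_onI) (rule label_eqI, simp_all add: in_block_def)
  then have "inj_on ((\<lambda>j. axis j 1 :: real^4) \<circ> right) (in_block T i)"
    by (auto simp: inj_on_def axis_eq_axis)
  then have "card ((\<lambda>j. axis j 1 :: real^4) ` right ` in_block T i) = card (in_block T i)"
    unfolding image_comp by (rule card_image)
  then show ?thesis
    using aff_dim_affine_independent[OF axes_affine_independent, of "right ` in_block T i"]
    by (simp add: mcell_hull aff_dim_convex_hull)
qed

lemma tree_block_nonempty:
  assumes "T \<in> trees" shows "in_block T i \<noteq> {}"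
proof
  assume empty: "in_block T i = {}"
  obtain f where f: "supported T f" "marg f = cayley_point (i, 1)"
    using tree_flow[OF assms] marg_single by metis
  have "(\<Sum>v | fst v = i. f v) = 0"
    using supportedD[OF f(1)] empty by (intro sum.neutral) (auto simp: in_block_def)
  moreover have "marg f $ Inr i = 1" by (simp add: f(2) cayley_point_Inr)
  ultimately show False by (simp add: marg_Inr)
qed

text \<open>Fix one edge in each block. As the left sums are 1, every point is a fixed point plus a
  combination of the differences belonging to the remaining \<open>card B - 4\<close> edges.\<close>

lemma aff_dim_flows_le:
  assumes ne: "\<And>i. in_block B i \<noteq> {}" and X: "\<And>x. x \<in> X \<Longrightarrow> \<exists>f. supported B f \<and> marg f = up x"
  shows "aff_dim X \<le> int (card B) - 4"
proof -
  have "\<forall>i. \<exists>v. v \<in> in_block B i" using ne by blast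
  then obtain u where u: "\<And>i. u i \<in> in_block B i" by metis
  then have fu: "fst (u i) = i" and uB: "u i \<in> B" for i by (auto simp: in_block_def)
  define d where "d v = down (cayley_point v) - down (cayley_point (u (fst v)))" for v
  define V where "V = d ` (B - range u)"
  define c where "c = (\<Sum>i\<in>UNIV. down (cayley_point (u i)))"
  have "inj u" by (metis injI fu)
  then have "card (range u) = 4" by (simp add: card_image)
  moreover have "range u \<subseteq> B" using uB by blast
  ultimately have cB: "card (B - range u) = card B - 4" "4 \<le> card B"
    using card_mono[of B "range u"] by (simp_all add: card_Diff_subset)
  have "X \<subseteq> (+) c ` span V"
  proof
    fix x assume "x \<in> X"
    then obtain f where f: "supported B f" "marg f = up x" using X by blast
    have "(\<Sum>v\<in>UNIV. f v *\<^sub>R down (cayley_point (u (fst v))))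
        = (\<Sum>i\<in>UNIV. \<Sum>v | fst v = i. f v *\<^sub>R down (cayley_point (u (fst v))))"
      using sum.group[of UNIV "UNIV :: 4 set" fst "\<lambda>v. f v *\<^sub>R down (cayley_point (u (fst v)))"] by simp
    also have "\<dots> = (\<Sum>i\<in>UNIV. (\<Sum>v | fst v = i. f v) *\<^sub>R down (cayley_point (u i)))"
      unfolding scaleR_sum_left by (intro sum.cong) auto
    also have "\<dots> = c" by (simp add: c_def flip: marg_Inr, simp add: f(2))
    finally have c: "(\<Sum>v\<in>UNIV. f v *\<^sub>R down (cayley_point (u (fst v)))) = c" .
    have "x = (\<Sum>v\<in>UNIV. f v *\<^sub>R down (cayley_point v))"
      using f(2) unfolding marg_def
      by (metis (no_types, lifting) down_up linear_cmul[OF linear_down] linear_sum[OF linear_down] sum.cong)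
    then have "x - c = (\<Sum>v\<in>UNIV. f v *\<^sub>R d v)"
      unfolding c[symmetric] d_def by (simp add: scaleR_diff_right sum_subtractf)
    also have "\<dots> \<in> span V"
    proof (rule span_sum)
      fix v
      consider "v \<notin> B" | i where "v = u i" | "v \<in> B - range u" by blast
      then show "f v *\<^sub>R d v \<in> span V"
      proof cases
        case 1 then show ?thesis using supportedD[OF f(1)] by (simp add: span_zero)
      next
        case 2 then show ?thesis by (simp add: d_def fu span_zero)
      next
        case 3 then show ?thesis unfolding V_def by (intro span_scale span_base) blast
      qed
    qed
    finally show "x \<in> (+) c ` span V" by (intro image_eqI[of _ _ "x - c"]) simp_all
  qed
  then have "aff_dim X \<le> aff_dim ((+) c ` span V)" by (rule aff_dim_subset)
  also have "\<dots> = int (dim V)" by (simp add: aff_dim_translation_eq aff_dim_subspace)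
  also have "\<dots> \<le> int (card V)" using dim_le_card'[of V] by (simp add: V_def)
  also have "\<dots> \<le> int (card B) - 4"
    using card_image_le[of "B - range u" d] cB by (simp add: V_def)
  finally show ?thesis .
qed

lemma mixed_cell_flows: "x \<in> mixed_cell T \<Longrightarrow> \<exists>f. supported T f \<and> marg f = up x"
  unfolding mixed_cell_iff edge_cone_def by auto

lemma aff_dim_mixed_cell:
  assumes T: "T \<in> trees" shows "aff_dim (mixed_cell T) = 3"
proof (rule antisym)
  have c7: "card T = 7" using T by (simp add: trees_def)
  show "aff_dim (mixed_cell T) \<le> 3"
    using aff_dim_flows_le[OF tree_block_nonempty[OF T] mixed_cell_flows] c7 by simp
  have "\<forall>i. \<exists>v. v \<in> in_block T i" using tree_block_nonempty[OF T] by blast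
  then obtain u where u: "\<And>i. u i \<in> in_block T i" by metis
  then have fu: "fst (u i) = i" and uT: "u i \<in> T" for i by (auto simp: in_block_def)
  define x where "x g = down (marg g)" for g
  \<comment> \<open>One edge from each block, and for \<open>f v\<close> the same choice with the
    edge in the block of \<open>v\<close> replaced by \<open>v\<close>. The three edges outside the
    choice yield three directions in the cell.\<close>
  define f0 where "f0 w = (if w \<in> range u then 1 else (0::real))" for w
  define f where "f v w = f0 w + (if w = v then 1 else 0) - (if w = u (fst v) then 1 else (0::real))" for v w
  have m0: "marg f0 $ Inr i = 1" for i
  proof -
    have "f0 = indicat_real (range u)" by (auto simp: f0_def)
    moreover have "inj_on fst (range u)" by (rule inj_on_imageI) (simp add: comp_def fu inj_on_def)
    ultimately show ?thesis
      unfolding marg_Inr using card_fibre[of fst "range u" i] by (simp add: image_image fu)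
  qed
  have mf: "marg (f v) = marg f0 + cayley_point v - cayley_point (u (fst v))" for v
    unfolding f_def by (simp add: marg_add marg_diff marg_single)
  have in0: "x f0 \<in> mixed_cell T"
  proof -
    have "marg f0 \<in> edge_cone T" using uT by (intro coneI) (auto simp: supported_def nonneg_def f0_def)
    moreover have "up (x f0) = marg f0" unfolding x_def by (rule up_down) (simp add: level_one_def m0)
    ultimately show ?thesis by (simp add: mixed_cell_iff)
  qed
  have inf: "x (f v) \<in> mixed_cell T" if v: "v \<in> T - range u" for v
  proof -
    have "supported T (f v)" using uT v unfolding supported_def f_def f0_def by auto
    moreover have "nonneg (f v)" using v unfolding nonneg_def f_def f0_def by auto
    ultimately have "marg (f v) \<in> edge_cone T" by (rule coneI)
    moreover have "up (x (f v)) = marg (f v)"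
      unfolding x_def by (rule up_down) (simp add: level_one_def m0 mf cayley_point_Inr fu)
    ultimately show ?thesis by (simp add: mixed_cell_iff)
  qed
  define d where "d v = cayley_point v - cayley_point (u (fst v))" for v
  have xd: "x (f v) - x f0 = down (d v)" for v
    unfolding x_def mf d_def
    by (simp add: linear_diff[OF linear_down] linear_add[OF linear_down])
  \<comment> \<open>A relation between these directions lifts to a circulation on the tree, which
    must vanish.\<close>
  have zero: "\<forall>v\<in>T - range u. a v = 0" if a: "(\<Sum>v\<in>T - range u. a v *\<^sub>R down (d v)) = 0" for a
  proof -
    define b where "b v = (if v \<in> T - range u then a v else 0)" for v
    define h where "h w = b w - (\<Sum>v\<in>UNIV. b v * (if w = u (fst v) then 1 else 0))" for w
    have "marg h = (\<Sum>v\<in>UNIV. b v *\<^sub>R cayley_point v) - (\<Sum>v\<in>UNIV. b v *\<^sub>R cayley_point (u (fst v)))"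
      unfolding h_def marg_diff marg_sum marg_scale marg_single by (simp add: marg_def)
    also have "\<dots> = (\<Sum>v\<in>UNIV. b v *\<^sub>R d v)" by (simp add: d_def scaleR_diff_right sum_subtractf)
    finally have mh: "marg h = (\<Sum>v\<in>UNIV. b v *\<^sub>R d v)" .
    have "down (marg h) = (\<Sum>v\<in>UNIV. b v *\<^sub>R down (d v))"
      unfolding mh by (simp add: linear_sum[OF linear_down] linear_cmul[OF linear_down])
    also have "\<dots> = (\<Sum>v\<in>T - range u. a v *\<^sub>R down (d v))"
      by (rule sum.mono_neutral_cong_right) (auto simp: b_def)
    finally have "down (marg h) = 0" using a by simp
    then have "marg h $ Inl j = 0" for j by (simp add: down_def vec_eq_iff)
    moreover have "marg h $ Inr i = 0" for i unfolding mh by (simp add: d_def cayley_point_Inr fu)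
    ultimately have "marg h = 0" by (intro vec_sum_eqI) simp_all
    moreover have "supported T h"
      unfolding supported_def
    proof (intro allI impI)
      fix w assume "w \<notin> T"
      then have "w \<noteq> u i" for i using uT by blast
      then have "(\<Sum>v\<in>UNIV. b v * (if w = u (fst v) then 1 else 0)) = 0" by (intro sum.neutral) simp
      then show "h w = 0" using \<open>w \<notin> T\<close> by (simp add: h_def) (simp add: b_def)
    qed
    ultimately have h0: "h w = 0" for w using tree_indep[OF T] unfolding indep_def by blast
    show ?thesis
    proof
      fix v assume v: "v \<in> T - range u"
      then have "v \<noteq> u i" for i by blast
      then have "(\<Sum>w\<in>UNIV. b w * (if v = u (fst w) then 1 else 0)) = 0" by (intro sum.neutral) simp
      then have "h v = b v" by (simp add: h_def)
      then show "a v = 0" using h0[of v] v by (simp add: b_def)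
    qed
  qed
  have injd: "inj_on (\<lambda>v. down (d v)) (T - range u)"
  proof (rule inj_onI, rule ccontr)
    fix v w assume *: "v \<in> T - range u" "w \<in> T - range u" "down (d v) = down (d w)" "v \<noteq> w"
    let ?a = "\<lambda>y. (if y = v then 1 else 0) - (if y = w then 1 else (0::real))"
    have "(\<Sum>y\<in>T - range u. ?a y *\<^sub>R down (d y)) = down (d v) - down (d w)"
      using *(1,2) by (simp add: scaleR_diff_left sum_subtractf if_distrib[of "\<lambda>z. z *\<^sub>R _"] cong: if_cong)
    then have "(\<Sum>y\<in>T - range u. ?a y *\<^sub>R down (d y)) = 0" using *(3) by (simp only: right_minus_eq)
    then have "?a v = 0" using *(1) by (rule zero[THEN bspec])
    then show False using *(4) by simp
  qed
  let ?V = "(\<lambda>v. down (d v)) ` (T - range u)"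
  have ind: "independent ?V"
  proof (subst dependent_finite)
    show "\<not> (\<exists>U. (\<exists>v\<in>?V. U v \<noteq> 0) \<and> (\<Sum>v\<in>?V. U v *\<^sub>R v) = 0)"
    proof clarify
      fix U v assume v: "v \<in> T" "v \<notin> range u" "U (down (d v)) \<noteq> 0" and "(\<Sum>v\<in>?V. U v *\<^sub>R v) = 0"
      then have "(\<Sum>v\<in>T - range u. U (down (d v)) *\<^sub>R down (d v)) = 0" by (simp add: sum.reindex[OF injd])
      then have "\<forall>v\<in>T - range u. U (down (d v)) = 0" by (rule zero)
      then show False using v by blast
    qed
  qed simp
  have "inj u" by (metis injI fu)
  then have "card (range u) = 4" by (simp add: card_image)
  moreover have "range u \<subseteq> T" using uT by blast
  ultimately have "card (T - range u) = 3" using c7 by (simp add: card_Diff_subset)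
  then have cV: "card ?V = 3" using injd by (simp add: card_image)
  have "?V \<subseteq> (+) (- x f0) ` mixed_cell T"
  proof
    fix y assume "y \<in> ?V"
    then obtain v where v: "v \<in> T - range u" "y = down (d v)" by blast
    then have "y = - x f0 + x (f v)" using xd[of v] by simp
    then show "y \<in> (+) (- x f0) ` mixed_cell T" using inf[OF v(1)] by blast
  qed
  then have "3 \<le> dim ((+) (- x f0) ` mixed_cell T)"
    using independent_card_le_dim[OF _ ind] cV by metis
  then show "3 \<le> aff_dim (mixed_cell T)"
    using aff_dim_eq_dim[of "x f0" "mixed_cell T"] in0 by (simp add: hull_inc)
qed

section \<open>Fine mixed cells as spanning trees\<close>

lemma fine_mixed_cell_mcell:
  assumes T: "T \<in> trees" shows "fine_mixed_cell (mcell T)"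
  unfolding fine_mixed_cell_def
proof (intro conjI allI)
  fix i
  have "(\<lambda>j. axis j 1 :: real^4) ` right ` in_block T i \<subseteq> (\<lambda>j. axis j 1) ` right ` in_block UNIV i"
    by (intro image_mono) (auto simp: in_block_def)
  then have "mcell T i face_of mcell UNIV i"
    unfolding mcell_hull face_of_convex_hull_affine_independent[OF axes_affine_independent] by blast
  then show "mcell T i face_of summand i" by (simp add: summand_mcell)
  show "mcell T i \<noteq> {}" using tree_block_nonempty[OF T] by (simp add: mcell_hull)
next
  show "aff_dim (\<Sum>i\<in>UNIV. mcell T i) = 3" using aff_dim_mixed_cell[OF T] by (simp add: mixed_cell_def)
  have "(\<Sum>i\<in>UNIV. aff_dim (mcell T i)) = int (\<Sum>i\<in>UNIV. card (in_block T i)) - 4"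
    by (simp add: aff_dim_mcell sum_subtractf)
  then show "(\<Sum>i\<in>UNIV. aff_dim (mcell T i)) = 3" using T by (simp add: sum_card_blocks trees_def)
qed

text \<open>The dimensions of the faces add up to 3 exactly if seven edges are chosen, and the
  dimension of the Minkowski sum then excludes cycles.\<close>

lemma fine_mixed_cell_tree:
  assumes F: "fine_mixed_cell F" obtains T where "T \<in> trees" "F = mcell T"
proof -
  define T where "T = {v. axis (right v) 1 \<in> F (fst v)}"
  have FT: "F i = mcell T i" and ne: "in_block T i \<noteq> {}" for i
  proof -
    have "F i face_of mcell UNIV i" "F i \<noteq> {}" using F by (simp_all add: fine_mixed_cell_def summand_mcell)
    then obtain c where c: "c \<subseteq> (\<lambda>j. axis j 1) ` right ` in_block UNIV i" "F i = convex hull c"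
      unfolding mcell_hull using face_of_convex_hull_affine_independent[OF axes_affine_independent] by blast
    then obtain J where J: "J \<subseteq> right ` in_block UNIV i" "F i = convex hull ((\<lambda>j. axis j 1) ` J)"
      by (auto simp: subset_image_iff)
    have axJ: "axis j 1 \<in> F i \<longleftrightarrow> j \<in> J" for j
      unfolding J(2) hull_axes by (auto simp: axis_def sum.If_cases cong: if_cong)
    have "right ` in_block T i = J"
    proof (intro equalityI subsetI)
      fix j assume "j \<in> right ` in_block T i"
      then show "j \<in> J" using axJ by (auto simp: in_block_def T_def)
    next
      fix j assume j: "j \<in> J"
      then obtain v where v: "fst v = i" "right v = j" using J(1) by (auto simp: in_block_def)
      then have "v \<in> in_block T i" using axJ j by (simp add: in_block_def T_def)
      then show "j \<in> right ` in_block T i" using v by blast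
    qed
    then show "F i = mcell T i" "in_block T i \<noteq> {}" using J(2) \<open>F i \<noteq> {}\<close> by (auto simp: mcell_hull)
  qed
  then have "F = mcell T" by blast
  have "(\<Sum>i\<in>UNIV. aff_dim (F i)) = int (\<Sum>i\<in>UNIV. card (in_block T i)) - 4"
    by (simp add: FT aff_dim_mcell sum_subtractf)
  then have "int (card T) - 4 = 3" using F unfolding sum_card_blocks by (simp add: fine_mixed_cell_def)
  then have c7: "card T = 7" by simp
  have "indep T"
  proof (rule ccontr)
    assume "\<not> indep T"
    \<comment> \<open>A multiple of the circulation can be subtracted from every flow to free the
      edge \<open>v0\<close>. The remaining six edges give dimension at most 2 instead of 3.\<close>
    then obtain g v0 where g: "supported T g" "marg g = 0" "g v0 \<noteq> 0" by (auto simp: indep_def)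
    then have v0: "v0 \<in> T" using supportedD by metis
    define B where "B = T - {v0}"
    have "in_block B i \<noteq> {}" for i
    proof (cases "i = fst v0")
      case True
      show ?thesis
      proof
        assume "in_block B i = {}"
        then have "\<And>v. fst v = fst v0 \<Longrightarrow> v \<noteq> v0 \<Longrightarrow> g v = 0"
          using True supportedD[OF g(1)] by (auto simp: in_block_def B_def)
        then have "(\<Sum>v | fst v = fst v0. g v) = (\<Sum>v | fst v = fst v0. if v = v0 then g v0 else 0)"
          by (intro sum.cong) auto
        then have "marg g $ Inr (fst v0) = g v0" by (simp add: marg_Inr)
        then show False using g by simp
      qed
    next
      case False
      then have "in_block B i = in_block T i" by (auto simp: in_block_def B_def)
      then show ?thesis using ne by simp
    qed
    moreover have "\<exists>f. supported B f \<and> marg f = up x" if x: "x \<in> mixed_cell T" for x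
    proof -
      obtain f where f: "supported T f" "marg f = up x" using mixed_cell_flows[OF x] by blast
      define f' where "f' v = f v - f v0 / g v0 * g v" for v
      have "marg f' = up x" unfolding f'_def marg_diff marg_scale g(2) f(2) by simp
      moreover have "f' v = 0" if "v \<notin> B" for v
      proof (cases "v = v0")
        case True then show ?thesis using g(3) by (simp add: f'_def)
      next
        case False
        then have "v \<notin> T" using that by (simp add: B_def)
        then show ?thesis using supportedD[OF f(1)] supportedD[OF g(1)] by (simp add: f'_def)
      qed
      ultimately show ?thesis unfolding supported_def by blast
    qed
    ultimately have "aff_dim (mixed_cell T) \<le> int (card B) - 4" by (rule aff_dim_flows_le)
    moreover have "card B = 6" using v0 c7 by (simp add: B_def)
    moreover have "aff_dim (mixed_cell T) = 3" using F FT by (simp add: fine_mixed_cell_def mixed_cell_def)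
    ultimately show False by simp
  qed
  then show ?thesis using that treeI c7 \<open>F = mcell T\<close> by blast
qed

lemma good_mixed:
  assumes M: "good M" shows "mcell ` M \<in> mixed_subdivisions"
proof -
  have Mt: "\<And>T. T \<in> M \<Longrightarrow> T \<in> trees" and comp: "\<And>T U. T \<in> M \<Longrightarrow> U \<in> M \<Longrightarrow> compatible T U"
    using M by (auto simp: good_def)
  have cov: "(\<Union>T\<in>M. mixed_cell T) = mixed_cell UNIV"
  proof
    show "(\<Union>T\<in>M. mixed_cell T) \<subseteq> mixed_cell UNIV"
      using cone_mono[OF subset_UNIV, THEN subsetD] by (auto simp: mixed_cell_iff)
    show "mixed_cell UNIV \<subseteq> (\<Union>T\<in>M. mixed_cell T)"
    proof
      fix x assume "x \<in> mixed_cell UNIV"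
      then obtain T where "T \<in> M" "up x \<in> edge_cone T" using good_covers[OF M] by (auto simp: mixed_cell_iff)
      then show "x \<in> (\<Union>T\<in>M. mixed_cell T)" by (auto simp: mixed_cell_iff)
    qed
  qed
  have int: "mixed_cell T \<inter> mixed_cell U = mixed_cell (T \<inter> U)" if "T \<in> M" "U \<in> M" for T U
  proof -
    have "x \<in> edge_cone T \<and> x \<in> edge_cone U \<longleftrightarrow> x \<in> edge_cone (T \<inter> U)" if "x \<in> level_one" for x
      using simp_of_Int[OF comp, of T U T U] \<open>T \<in> M\<close> \<open>U \<in> M\<close>
      unfolding level_one_simp_of[OF that, symmetric] by blast
    from this[OF up_level_one] show ?thesis by (simp add: mixed_cell_iff set_eq_iff)
  qed
  have face: "mixed_cell (T \<inter> U) face_of mixed_cell T" "mixed_cell (T \<inter> U) face_of mixed_cell U"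
    if "T \<in> M" "U \<in> M" for T U
    using mixed_cell_face[OF tree_indep[OF Mt]] that by (simp_all add: Int_lower1 Int_lower2)
  show ?thesis
    unfolding mixed_subdivisions_def
    using Mt fine_mixed_cell_mcell cov int face
    by (simp add: truncated_tetrahedron_mixed_cell mixed_cell_Int flip: mixed_cell_def)
qed

text \<open>The argument for triangulations carries over; the prescribed label of an intersection
  takes the place of the common face.\<close>

lemma mixed_admissible:
  assumes "\<M> \<in> mixed_subdivisions"
  obtains M where "admissible M" "\<M> = mcell ` M"
proof -
  define M where "M = {T \<in> trees. mcell T \<in> \<M>}"
  have eq: "\<M> = mcell ` M"
  proof
    show "\<M> \<subseteq> mcell ` M"
    proof
      fix F assume "F \<in> \<M>"
      then have "fine_mixed_cell F" using assms by (auto simp: mixed_subdivisions_def)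
      then obtain T where "T \<in> trees" "F = mcell T" by (rule fine_mixed_cell_tree)
      then show "F \<in> mcell ` M" using \<open>F \<in> \<M>\<close> by (simp add: M_def)
    qed
  qed (auto simp: M_def)
  have cov: "(\<Union>T\<in>M. mixed_cell T) = mixed_cell UNIV"
    using assms unfolding eq mixed_subdivisions_def
    by (simp add: truncated_tetrahedron_mixed_cell flip: mixed_cell_def)
  have int: "mixed_cell T \<inter> mixed_cell U = mixed_cell (T \<inter> U)" if "T \<in> M" "U \<in> M" for T U
    using assms that unfolding eq mixed_subdivisions_def
    by (simp add: mixed_cell_Int flip: mixed_cell_def)
  have "admissible M" unfolding admissible_def
  proof (intro conjI allI impI ballI)
    show "M \<subseteq> trees" by (auto simp: M_def)
  next
    fix r assume "attainable r"
    then obtain x where x: "x \<in> edge_cone UNIV" "x \<in> level_one" "\<And>j. x $ Inl j = real (r j) - 3/4"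
      by (auto simp: attainable_def)
    then have "down x \<in> mixed_cell UNIV" by (simp add: mixed_cell_iff up_down)
    then obtain T where T: "T \<in> M" "down x \<in> mixed_cell T" using cov by blast
    then have "x \<in> edge_cone T" using x(2) by (simp add: mixed_cell_iff up_down)
    then obtain f where f: "supported T f" "nonneg f" "marg f = x" by (auto simp: edge_cone_def)
    have m: "\<And>i. marg f $ Inr i = 1" "\<And>j. marg f $ Inl j = real (r j) - 3/4"
      using x f(3) by (simp_all add: level_one_def)
    have "T \<in> trees" using T(1) by (simp add: M_def)
    then show "\<exists>T\<in>M. deg T = r" using tree_test_point(1)[OF _ f(1,2) m] T(1) by blast
  next
    fix T U \<phi> \<psi>
    assume T: "T \<in> M" "U \<in> M" and subvec: "\<phi> \<subseteq> T" "\<psi> \<subseteq> U"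
      and m: "marg (indicat_real \<phi>) \<in> level_one" "marg (indicat_real \<phi>) = marg (indicat_real \<psi>)"
    let ?x = "marg (indicat_real \<phi>)"
    have i: "indep T" "indep U" using T by (auto simp: M_def tree_indep)
    have "?x \<in> edge_cone T" "?x \<in> edge_cone U" using indicator_in_cone subvec m(2) by metis+
    then have "down ?x \<in> mixed_cell T \<inter> mixed_cell U" using m(1) by (simp add: mixed_cell_iff up_down)
    then have "?x \<in> edge_cone (T \<inter> U)" unfolding int[OF T] using m(1) by (simp add: mixed_cell_iff up_down)
    then show "\<phi> = \<psi>" using common_transversal_eq[OF i subvec m(2)] by blast
  qed
  then show ?thesis using that eq by blast
qed

lemma cayley_trick_complex_of:
  assumes "M \<subseteq> trees" shows "cayley_trick (complex_of M) = mcell ` M"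
proof -
  have "{S \<in> complex_of M. 6 simplex S} = simp_of ` M"
  proof (intro equalityI subsetI)
    fix S assume "S \<in> {S \<in> complex_of M. 6 simplex S}"
    then obtain A T where *: "S = simp_of A" "A \<subseteq> T" "T \<in> M" "6 simplex S"
      unfolding complex_of_def faces_def by blast
    then have "indep A" using assms tree_indep indep_subset by blast
    then have "card A = 7" using simplex_simp_of * by simp
    then have "A = T" using * assms by (intro card_subset_eq) (auto simp: trees_def)
    then show "S \<in> simp_of ` M" using * by blast
  next
    fix S assume "S \<in> simp_of ` M"
    then obtain T where T: "T \<in> M" "S = simp_of T" by blast
    then have "T \<in> trees" using assms by blast
    then have "6 simplex S" using T simplex_simp_of[OF tree_indep] by (simp add: trees_def)
    then show "S \<in> {S \<in> complex_of M. 6 simplex S}"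
      using T unfolding complex_of_def faces_def by blast
  qed
  then show ?thesis
    unfolding cayley_trick_def
    using cayley_cell_simp_of[OF tree_indep] assms by (auto simp: image_image subset_iff intro!: image_cong)
qed

subsection \<open>Regularity\<close>

text \<open>The value on a lifted column of the functional with last coefficient 1 that selects a
  lower face; the labels of least cost span that face.\<close>

definition cost :: "real^(4+4) \<Rightarrow> (label \<Rightarrow> real) \<Rightarrow> label \<Rightarrow> real" where
  "cost c \<omega> v = c \<bullet> cayley_point v + \<omega> v"

definition cheapest :: "real^(4+4) \<Rightarrow> (label \<Rightarrow> real) \<Rightarrow> label set" where
  "cheapest c \<omega> = {v. \<forall>u. cost c \<omega> v \<le> cost c \<omega> u}"

lemma hull_range:
  fixes P :: "label \<Rightarrow> 'a::real_vector"
  assumes "inj P"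
  shows "convex hull (range P) = {\<Sum>v\<in>UNIV. f v *\<^sub>R P v | f. nonneg f \<and> sum f UNIV = 1}"
proof -
  have "\<exists>f. nonneg f \<and> sum f UNIV = 1 \<and> y = (\<Sum>v\<in>UNIV. f v *\<^sub>R P v)"
    if y: "y \<in> convex hull (range P)" for y
  proof -
    obtain u where "\<forall>x\<in>range P. 0 \<le> u x" "sum u (range P) = 1" "(\<Sum>x\<in>range P. u x *\<^sub>R x) = y"
      using y unfolding convex_hull_finite[OF finite_imageI[OF finite]] by blast
    then show ?thesis
      by (intro exI[of _ "\<lambda>v. u (P v)"]) (simp add: sum.reindex[OF assms] nonneg_def)
  qed
  moreover have "(\<Sum>v\<in>UNIV. f v *\<^sub>R P v) \<in> convex hull (range P)" if "nonneg f" "sum f UNIV = 1" for f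
    using that by (intro convex_sum) (auto simp: nonneg_def hull_inc)
  ultimately show ?thesis by blast
qed

lemma lifted_polytope_eq:
  "lifted_polytope \<omega> = {(marg f, \<Sum>v\<in>UNIV. f v * \<omega> v) | f. nonneg f \<and> sum f UNIV = 1}"
proof -
  have "inj (\<lambda>v. (cayley_point v, \<omega> v))" using inj_cayley_point by (simp add: inj_def)
  moreover have "(\<Sum>v\<in>UNIV. f v *\<^sub>R (cayley_point v, \<omega> v)) = (marg f, \<Sum>v\<in>UNIV. f v * \<omega> v)" for f
    by (simp add: prod_eq_iff fst_sum snd_sum marg_def)
  ultimately show ?thesis unfolding lifted_polytope_def by (simp add: hull_range)
qed

lemma cost_marg: "c \<bullet> marg f + (\<Sum>v\<in>UNIV. f v * \<omega> v) = (\<Sum>v\<in>UNIV. f v * cost c \<omega> v)"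
  by (simp add: marg_def inner_sum_right cost_def sum.distrib algebra_simps)

lemma cheapest_nonempty: "cheapest c \<omega> \<noteq> {}"
proof -
  have "Min (range (cost c \<omega>)) \<in> range (cost c \<omega>)" by (rule Min_in) simp_all
  then obtain v where v: "cost c \<omega> v = Min (range (cost c \<omega>))" by force
  have "cost c \<omega> v \<le> cost c \<omega> u" for u unfolding v by (rule Min_le) simp_all
  then show ?thesis unfolding cheapest_def by blast
qed

lemma cost_ge_cheapest:
  assumes "w \<in> cheapest c \<omega>" "nonneg f" "sum f UNIV = 1"
  shows "(\<Sum>v\<in>UNIV. f v * cost c \<omega> v) \<ge> cost c \<omega> w"
    and "(\<Sum>v\<in>UNIV. f v * cost c \<omega> v) = cost c \<omega> w \<longleftrightarrow> supported (cheapest c \<omega>) f"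
proof -
  have eq: "(\<Sum>v\<in>UNIV. f v * (cost c \<omega> v - cost c \<omega> w)) = (\<Sum>v\<in>UNIV. f v * cost c \<omega> v) - cost c \<omega> w"
    using assms(3) by (simp add: right_diff_distrib sum_subtractf flip: sum_distrib_right)
  have le: "cost c \<omega> w \<le> cost c \<omega> u" for u using assms(1) by (simp add: cheapest_def)
  have nn: "f v * (cost c \<omega> v - cost c \<omega> w) \<ge> 0" for v using le nonnegD[OF assms(2)] by simp
  then have "(\<Sum>v\<in>UNIV. f v * (cost c \<omega> v - cost c \<omega> w)) \<ge> 0" by (intro sum_nonneg)
  then show "(\<Sum>v\<in>UNIV. f v * cost c \<omega> v) \<ge> cost c \<omega> w" unfolding eq by simp
  have "(\<Sum>v\<in>UNIV. f v * cost c \<omega> v) = cost c \<omega> w \<longleftrightarrow> (\<forall>v. f v * (cost c \<omega> v - cost c \<omega> w) = 0)"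
    using sum_nonneg_eq_0_iff[of UNIV "\<lambda>v. f v * (cost c \<omega> v - cost c \<omega> w)", OF finite nn] eq by simp
  also have "\<dots> \<longleftrightarrow> supported (cheapest c \<omega>) f"
  proof -
    have "v \<in> cheapest c \<omega> \<longleftrightarrow> cost c \<omega> v = cost c \<omega> w" for v
    proof
      assume "v \<in> cheapest c \<omega>"
      then have "cost c \<omega> v \<le> cost c \<omega> w" by (simp add: cheapest_def)
      then show "cost c \<omega> v = cost c \<omega> w" using le[of v] by simp
    next
      assume "cost c \<omega> v = cost c \<omega> w"
      then show "v \<in> cheapest c \<omega>" using le by (simp add: cheapest_def)
    qed
    then show ?thesis unfolding supported_def by (metis eq_iff_diff_eq_0 mult_eq_0_iff)
  qed
  finally show "(\<Sum>v\<in>UNIV. f v * cost c \<omega> v) = cost c \<omega> w \<longleftrightarrow> supported (cheapest c \<omega>) f" .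
qed

lemma simp_of_flows: "simp_of A = {marg f | f. supported A f \<and> nonneg f \<and> sum f UNIV = 1}"
  unfolding set_eq_iff simp_of_iff edge_cone_def mem_Collect_eq using total_marg by metis

text \<open>The cost of a convex combination is the average of the costs, so it is minimal exactly
  if only cheapest labels occur.\<close>

lemma lower_faces_simp_of: "(\<lambda>F. fst ` F) ` lower_faces \<omega> = range (\<lambda>c. simp_of (cheapest c \<omega>))"
proof -
  define F where "F c = {p \<in> lifted_polytope \<omega>. \<forall>q \<in> lifted_polytope \<omega>. c \<bullet> fst p + snd p \<le> c \<bullet> fst q + snd q}" for c
  have "fst ` F c = simp_of (cheapest c \<omega>)" for c
  proof -
    obtain w where w: "w \<in> cheapest c \<omega>" using cheapest_nonempty by blast
    have "(\<forall>q \<in> lifted_polytope \<omega>. (\<Sum>v\<in>UNIV. f v * cost c \<omega> v) \<le> c \<bullet> fst q + snd q) \<longleftrightarrow> supported (cheapest c \<omega>) f"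
      if f: "nonneg f" "sum f UNIV = 1" for f
    proof
      assume *: "\<forall>q \<in> lifted_polytope \<omega>. (\<Sum>v\<in>UNIV. f v * cost c \<omega> v) \<le> c \<bullet> fst q + snd q"
      have "(cayley_point w, \<omega> w) \<in> lifted_polytope \<omega>" unfolding lifted_polytope_def by (intro hull_inc) blast
      then have "(\<Sum>v\<in>UNIV. f v * cost c \<omega> v) \<le> cost c \<omega> w" using * by (force simp: cost_def)
      then show "supported (cheapest c \<omega>) f" using cost_ge_cheapest[OF w f] by simp
    next
      assume "supported (cheapest c \<omega>) f"
      then have "(\<Sum>v\<in>UNIV. f v * cost c \<omega> v) = cost c \<omega> w" using cost_ge_cheapest(2)[OF w f] by simp
      then show "\<forall>q \<in> lifted_polytope \<omega>. (\<Sum>v\<in>UNIV. f v * cost c \<omega> v) \<le> c \<bullet> fst q + snd q"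
        using cost_ge_cheapest(1)[OF w] by (auto simp: lifted_polytope_eq cost_marg)
    qed
    note * = this
    have Fc: "(marg f, \<Sum>v\<in>UNIV. f v * \<omega> v) \<in> F c \<longleftrightarrow> supported (cheapest c \<omega>) f"
      if f: "nonneg f" "sum f UNIV = 1" for f
    proof -
      have "(marg f, \<Sum>v\<in>UNIV. f v * \<omega> v) \<in> lifted_polytope \<omega>"
        unfolding lifted_polytope_eq using f by blast
      then show ?thesis using *[OF f] unfolding F_def by (simp add: cost_marg)
    qed
    show ?thesis
    proof (intro equalityI subsetI)
      fix x assume "x \<in> fst ` F c"
      then obtain p where p: "p \<in> F c" "x = fst p" by blast
      then have "p \<in> lifted_polytope \<omega>" by (simp add: F_def)
      then obtain f where f: "p = (marg f, \<Sum>v\<in>UNIV. f v * \<omega> v)" "nonneg f" "sum f UNIV = 1"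
        unfolding lifted_polytope_eq by blast
      then show "x \<in> simp_of (cheapest c \<omega>)" using p Fc[of f] unfolding simp_of_flows by auto
    next
      fix x assume "x \<in> simp_of (cheapest c \<omega>)"
      then obtain f where f: "x = marg f" "supported (cheapest c \<omega>) f" "nonneg f" "sum f UNIV = 1"
        unfolding simp_of_flows by blast
      then show "x \<in> fst ` F c" using Fc[of f] by (intro image_eqI[of _ _ "(marg f, \<Sum>v\<in>UNIV. f v * \<omega> v)"]) simp_all
    qed
  qed
  moreover have "lower_faces \<omega> = range F" unfolding lower_faces_def F_def by blast
  ultimately show ?thesis by (simp add: image_image)
qed

text \<open>A linear functional has the same value on matchings with the same ends, so these
  inequalities contain the heights alone and no unknown functional.\<close>

definition lifts :: "label set set \<Rightarrow> (label \<Rightarrow> real) \<Rightarrow> bool" where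
  "lifts M \<omega> \<longleftrightarrow> (\<forall>m n. matching m \<longrightarrow> matching n \<longrightarrow> same_ends m n \<longrightarrow> m \<noteq> n \<longrightarrow> m \<in> faces M
     \<longrightarrow> sum \<omega> m < sum \<omega> n)"

lemma cost_same_ends:
  assumes "matching m" "matching n" "same_ends m n"
  shows "sum (cost c \<omega>) n - sum (cost c \<omega>) m = sum \<omega> n - sum \<omega> m"
proof -
  have "sum (cost c \<omega>) k = c \<bullet> marg (indicat_real k) + sum \<omega> k" for k
    by (simp add: cost_def sum.distrib marg_indicator inner_sum_right)
  then show ?thesis using marg_same_ends[OF assms] by simp
qed

text \<open>Every column is a vertex of the polytope. Hence the hull of a set of columns determines
  the set, even if it is dependent, as the cheapest labels might be.\<close>

lemma point_in_simp_of: "cayley_point v \<in> simp_of A \<longleftrightarrow> v \<in> A"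
proof
  assume "cayley_point v \<in> simp_of A"
  then obtain f where f: "supported A f" "nonneg f" "sum f UNIV = 1" "marg f = cayley_point v"
    unfolding simp_of_flows by auto
  have "f u = 0" if u: "u \<noteq> v" for u
  proof -
    have z: "f u = 0" if "(\<Sum>w | g w = g u. f w) = 0" for g :: "label \<Rightarrow> 4"
      using that sum_nonneg_eq_0_iff[of "{w. g w = g u}" f, OF finite nonnegD[OF f(2)]] by blast
    have "fst u \<noteq> fst v \<or> right u \<noteq> right v" using label_eqI u by blast
    then have "marg f $ Inr (fst u) = 0 \<or> marg f $ Inl (right u) = 0"
      unfolding f(4) by (auto simp: cayley_point_Inl cayley_point_Inr)
    then show ?thesis unfolding marg_Inr marg_Inl using z by blast
  qed
  then have "sum f UNIV = (\<Sum>u\<in>UNIV. if u = v then f v else 0)" by (intro sum.cong) auto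
  then have "f v = 1" using f(3) by simp
  then show "v \<in> A" using supportedD[OF f(1), of v] by force
qed (simp add: hull_inc)

text \<open>A tree consists of the cheapest labels for some functional. A matching with the same
  ends as one in the tree cannot lie in it, so it uses an edge of larger cost.\<close>

lemma regular_lifts:
  assumes M: "M \<subseteq> trees" and eq: "complex_of M = insert {} ((\<lambda>F. fst ` F) ` lower_faces \<omega>)"
  shows "lifts M \<omega>"
  unfolding lifts_def
proof (intro allI impI)
  fix m n assume mn: "matching m" "matching n" "same_ends m n" "m \<noteq> n" "m \<in> faces M"
  then obtain T where T: "T \<in> M" "m \<subseteq> T" by (auto simp: faces_def)
  then have tT: "T \<in> trees" using M by blast
  then have "T \<noteq> {}" by (auto simp: trees_def)
  then have "simp_of T \<noteq> {}" by simp
  moreover have "simp_of T \<in> complex_of M" using T(1) unfolding complex_of_def faces_def by blast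
  ultimately obtain c where c: "simp_of T = simp_of (cheapest c \<omega>)" unfolding eq lower_faces_simp_of by blast
  have Tc: "T = cheapest c \<omega>" using point_in_simp_of[of _ T] point_in_simp_of[of _ "cheapest c \<omega>"] c by blast
  obtain w where w: "w \<in> T" using \<open>T \<noteq> {}\<close> by blast
  have le: "cost c \<omega> w \<le> cost c \<omega> v" for v using w Tc by (simp add: cheapest_def)
  have less: "cost c \<omega> w < cost c \<omega> v" if "v \<notin> T" for v
  proof -
    obtain u where "cost c \<omega> u < cost c \<omega> v" using \<open>v \<notin> T\<close> Tc by (auto simp: cheapest_def not_le)
    then show ?thesis using le[of u] by simp
  qed
  have "\<not> n \<subseteq> T" using mn T(2) tT unfolding trees_def compatible_def by blast
  then obtain v where "v \<in> n" "v \<notin> T" by blast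
  have "sum (cost c \<omega>) m = (\<Sum>v\<in>m. cost c \<omega> w)"
  proof (rule sum.cong)
    fix v assume "v \<in> m"
    then have "cost c \<omega> v \<le> cost c \<omega> w" using T(2) Tc by (auto simp: cheapest_def)
    then show "cost c \<omega> v = cost c \<omega> w" using le[of v] by simp
  qed simp
  moreover have "sum (cost c \<omega>) n > (\<Sum>v\<in>n. cost c \<omega> w)"
    using le less \<open>v \<in> n\<close> \<open>v \<notin> T\<close> by (intro sum_strict_mono_ex1 ballI bexI[of _ v]) simp_all
  moreover have "card m = card n"
    using mn(1-3) unfolding matching_def same_ends_def by (metis card_image)
  ultimately have "sum (cost c \<omega>) n - sum (cost c \<omega>) m > 0" by simp
  then show "sum \<omega> m < sum \<omega> n" unfolding cost_same_ends[OF mn(1-3)] by simp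
qed

text \<open>Make the cost 0 on the tree. An edge \<open>v\<close> outside it closes a cycle, and the
  two alternating matchings on the cycle differ in height by the cost of \<open>v\<close>.\<close>

lemma lifts_tree:
  assumes l: "lifts M \<omega>" and T: "T \<in> M" "T \<in> trees"
  obtains c where "\<And>v. v \<in> T \<Longrightarrow> cost c \<omega> v = 0" "\<And>v. v \<notin> T \<Longrightarrow> cost c \<omega> v > 0"
proof -
  obtain h :: "real^(4+4) \<Rightarrow> real" where h: "linear h" "\<And>v. v \<in> T \<Longrightarrow> h (cayley_point v) = - \<omega> v"
    using interpolate[OF tree_indep[OF T(2)], of "\<lambda>v. - \<omega> v"] by blast
  \<comment> \<open>The vector representing the functional \<open>h\<close>.\<close>
  define c where "c = adjoint h 1"
  have "c \<bullet> x = h x" for x unfolding c_def using adjoint_works[OF h(1), of x 1] by (simp add: inner_commute)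
  then have zero: "cost c \<omega> v = 0" if "v \<in> T" for v using h(2)[OF that] by (simp add: cost_def)
  have pos: "cost c \<omega> v > 0" if v: "v \<notin> T" for v
  proof -
    obtain k where k: "supported T k" "marg k = cayley_point v" using tree_flow[OF T(2)] marg_single by metis
    define f where "f u = k u - (if u = v then 1 else 0)" for u
    have "marg f = 0" unfolding f_def by (simp add: marg_diff marg_single k(2))
    moreover have "f v \<noteq> 0" using supportedD[OF k(1) v] by (simp add: f_def)
    ultimately obtain m n where mn: "matching m" "matching n" "same_ends m n" "m \<noteq> {}"
      "m \<subseteq> {u. f u > 0}" "n \<subseteq> {u. f u < 0}" by (rule circulation_matchings)
    have "u \<in> T" if "u \<in> m" for u
    proof (rule ccontr)
      assume "u \<notin> T"
      then have "f u \<le> 0" using supportedD[OF k(1)] by (simp add: f_def)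
      then show False using mn(5) that by force
    qed
    then have mT: "m \<subseteq> T" by blast
    have "u \<in> T \<or> u = v" if "u \<in> n" for u
    proof (rule ccontr)
      assume "\<not> (u \<in> T \<or> u = v)"
      then have "f u = 0" using supportedD[OF k(1)] by (simp add: f_def)
      then show False using mn(6) that by force
    qed
    then have nT: "n \<subseteq> insert v T" by blast
    obtain x where "x \<in> m" using mn(4) by blast
    then have "x \<notin> n" using mn(5,6) by force
    then have "m \<noteq> n" using \<open>x \<in> m\<close> by blast
    then have "\<not> n \<subseteq> T" using mn mT T(2) unfolding trees_def compatible_def by blast
    then have "v \<in> n" using nT by blast
    have "sum (cost c \<omega>) m = 0" using zero mT by (intro sum.neutral) blast
    moreover have "sum (cost c \<omega>) n = (\<Sum>u\<in>n. if u = v then cost c \<omega> v else 0)"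
      using zero nT by (intro sum.cong) auto
    then have "sum (cost c \<omega>) n = cost c \<omega> v" using \<open>v \<in> n\<close> by simp
    moreover have "m \<in> faces M" using mT T(1) by (auto simp: faces_def)
    then have "sum \<omega> m < sum \<omega> n" using l mn(1-3) \<open>m \<noteq> n\<close> unfolding lifts_def by blast
    ultimately show ?thesis using cost_same_ends[OF mn(1-3), of c \<omega>] by simp
  qed
  show ?thesis using that zero pos by blast
qed

text \<open>Add to the functional of the tree a small multiple of one that vanishes on
  \<open>A\<close> and is 1 on the rest of the tree; the positive costs outside the tree
  survive.\<close>

lemma lifts_face:
  assumes l: "lifts M \<omega>" and T: "T \<in> M" "T \<in> trees" and A: "A \<subseteq> T" "A \<noteq> {}"
  obtains c where "cheapest c \<omega> = A"
proof -
  obtain c where c: "\<And>v. v \<in> T \<Longrightarrow> cost c \<omega> v = 0" "\<And>v. v \<notin> T \<Longrightarrow> cost c \<omega> v > 0"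
    using lifts_tree[OF l T] by blast
  obtain h :: "real^(4+4) \<Rightarrow> real" where h: "linear h"
    "\<And>v. v \<in> T \<Longrightarrow> h (cayley_point v) = (if v \<in> A then 0 else 1)"
    using interpolate[OF tree_indep[OF T(2)], of "\<lambda>v. if v \<in> A then 0 else 1"] by blast
  define b where "b = adjoint h 1"
  have bh: "b \<bullet> x = h x" for x unfolding b_def using adjoint_works[OF h(1), of x 1] by (simp add: inner_commute)
  have "\<forall>\<^sub>F e in at_right 0. \<forall>v\<in>-T. cost c \<omega> v + e * h (cayley_point v) > 0"
  proof (rule eventually_ball_finite)
    show "\<forall>v\<in>-T. \<forall>\<^sub>F e in at_right 0. cost c \<omega> v + e * h (cayley_point v) > 0"
    proof
      fix v assume "v \<in> -T"
      have "((\<lambda>e. cost c \<omega> v + e * h (cayley_point v)) \<longlongrightarrow> cost c \<omega> v + 0 * h (cayley_point v)) (at_right 0)"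
        by (intro tendsto_intros)
      moreover have "cost c \<omega> v + 0 * h (cayley_point v) > 0" using c(2) \<open>v \<in> -T\<close> by simp
      ultimately show "\<forall>\<^sub>F e in at_right 0. cost c \<omega> v + e * h (cayley_point v) > 0"
        by (rule order_tendstoD(1))
    qed
  qed simp
  then have "\<forall>\<^sub>F e in at_right (0::real). (\<forall>v\<in>-T. cost c \<omega> v + e * h (cayley_point v) > 0) \<and> 0 < e"
    by (intro eventually_conj) (simp_all add: eventually_at_right_less)
  then have "\<exists>e. (\<forall>v\<in>-T. cost c \<omega> v + e * h (cayley_point v) > 0) \<and> 0 < e"
    by (rule eventually_happens'[rotated]) simp
  then obtain e where e: "\<And>v. v \<notin> T \<Longrightarrow> cost c \<omega> v + e * h (cayley_point v) > 0" "e > 0" by auto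
  have ce: "cost (c + e *\<^sub>R b) \<omega> v = cost c \<omega> v + e * h (cayley_point v)" for v
    by (simp add: cost_def inner_add_left bh)
  have zero: "cost (c + e *\<^sub>R b) \<omega> v = 0" if "v \<in> A" for v
    using that A(1) c(1)[of v] h(2)[of v] by (auto simp: ce)
  have pos: "cost (c + e *\<^sub>R b) \<omega> v > 0" if "v \<notin> A" for v
  proof (cases "v \<in> T")
    case True then show ?thesis using that c(1)[OF True] h(2)[OF True] e(2) by (simp add: ce)
  next
    case False then show ?thesis using e(1) by (simp add: ce)
  qed
  have "cheapest (c + e *\<^sub>R b) \<omega> = A"
  proof (intro equalityI subsetI)
    fix v assume "v \<in> A"
    have "cost (c + e *\<^sub>R b) \<omega> u \<ge> 0" for u using zero[of u] pos[of u] by (cases "u \<in> A") auto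
    then show "v \<in> cheapest (c + e *\<^sub>R b) \<omega>" using zero[OF \<open>v \<in> A\<close>] by (simp add: cheapest_def)
  next
    fix v assume v: "v \<in> cheapest (c + e *\<^sub>R b) \<omega>"
    obtain u where "u \<in> A" using A(2) by blast
    have "cost (c + e *\<^sub>R b) \<omega> v \<le> cost (c + e *\<^sub>R b) \<omega> u" using v unfolding cheapest_def by blast
    then have "cost (c + e *\<^sub>R b) \<omega> v \<le> 0" using zero[OF \<open>u \<in> A\<close>] by simp
    then show "v \<in> A" using pos[of v] by force
  qed
  then show ?thesis using that by blast
qed

text \<open>For the inclusion not given by \<open>lifts_face\<close>: the barycentre of the cheapest
  labels also has a flow on some tree of \<open>M\<close>. The first flow is not higher than the
  second, so for the functional of that tree it costs nothing and uses tree edges only.\<close>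

lemma lifts_regular:
  assumes M: "good M" and l: "lifts M \<omega>"
  shows "complex_of M = insert {} ((\<lambda>F. fst ` F) ` lower_faces \<omega>)"
proof -
  have Mt: "M \<subseteq> trees" "M \<noteq> {}" using M by (auto simp: good_def)
  have "simp_of A \<in> insert {} (range (\<lambda>c. simp_of (cheapest c \<omega>)))" if A: "A \<in> faces M" for A
  proof (cases "A = {}")
    case False
    obtain T where T: "T \<in> M" "A \<subseteq> T" using A by (auto simp: faces_def)
    then have "T \<in> trees" using Mt by blast
    obtain c where "cheapest c \<omega> = A" using lifts_face[OF l T(1) \<open>T \<in> trees\<close> T(2) False] by blast
    then show ?thesis by blast
  qed simp
  moreover have "cheapest c \<omega> \<in> faces M" for c
  proof -
    let ?A = "cheapest c \<omega>"
    have "card ?A > 0" using cheapest_nonempty by (simp add: card_gt_0_iff)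
    define f where "f v = indicat_real ?A v / card ?A" for v
    have f: "supported ?A f" "nonneg f" by (simp_all add: f_def supported_def nonneg_def)
    have f1: "sum f UNIV = 1"
      unfolding sum_supported[OF f(1)] using \<open>card ?A > 0\<close> cheapest_nonempty by (simp add: f_def)
    have "marg f \<in> edge_cone UNIV" using f(2) by (intro coneI) (simp_all add: supported_def)
    then obtain T where T: "T \<in> M" "marg f \<in> edge_cone T" using good_covers[OF M] by blast
    then obtain g where g: "supported T g" "nonneg g" "marg g = marg f" by (auto simp: edge_cone_def)
    have g1: "sum g UNIV = 1" using f1 g(3) total_marg by metis
    obtain w where w: "w \<in> ?A" using cheapest_nonempty by blast
    have "(\<Sum>v\<in>UNIV. f v * cost c \<omega> v) = cost c \<omega> w" using cost_ge_cheapest(2)[OF w f(2) f1] f(1) by simp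
    also have "\<dots> \<le> (\<Sum>v\<in>UNIV. g v * cost c \<omega> v)" by (rule cost_ge_cheapest(1)[OF w g(2) g1])
    finally have fg: "(\<Sum>v\<in>UNIV. f v * \<omega> v) \<le> (\<Sum>v\<in>UNIV. g v * \<omega> v)"
      unfolding cost_marg[symmetric] g(3) by simp
    have tT: "T \<in> trees" using T(1) Mt by blast
    obtain d where d: "\<And>v. v \<in> T \<Longrightarrow> cost d \<omega> v = 0" "\<And>v. v \<notin> T \<Longrightarrow> cost d \<omega> v > 0"
      using lifts_tree[OF l T(1) tT] by blast
    have "g v * cost d \<omega> v = 0" for v using d(1)[of v] supportedD[OF g(1), of v] by (cases "v \<in> T") auto
    then have "(\<Sum>v\<in>UNIV. g v * cost d \<omega> v) = 0" by (intro sum.neutral ballI)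
    then have "(\<Sum>v\<in>UNIV. f v * cost d \<omega> v) \<le> 0"
      using fg cost_marg[of d f \<omega>] cost_marg[of d g \<omega>] unfolding g(3) by linarith
    moreover have nn: "f v * cost d \<omega> v \<ge> 0" for v
      using d(1)[of v] d(2)[of v] nonnegD[OF f(2), of v] by (cases "v \<in> T") auto
    ultimately have "(\<Sum>v\<in>UNIV. f v * cost d \<omega> v) = 0" by (intro antisym sum_nonneg)
    then have z: "f v * cost d \<omega> v = 0" for v
      using sum_nonneg_eq_0_iff[of UNIV "\<lambda>v. f v * cost d \<omega> v", OF finite nn] by blast
    have "?A \<subseteq> T"
    proof
      fix v assume "v \<in> ?A"
      then have "f v \<noteq> 0" using \<open>card ?A > 0\<close> cheapest_nonempty by (simp add: f_def)
      then show "v \<in> T" using z[of v] d(2)[of v] by force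
    qed
    then show ?thesis using T(1) by (auto simp: faces_def)
  qed
  moreover have "{} \<in> complex_of M" using Mt(2) unfolding complex_of_def faces_def by force
  ultimately show ?thesis unfolding lower_faces_simp_of complex_of_def by blast
qed

lemma regular_iff:
  assumes "good M" shows "regular_triangulation (complex_of M) \<longleftrightarrow> (\<exists>\<omega>. lifts M \<omega>)"
proof -
  have "M \<subseteq> trees" using assms by (simp add: good_def)
  show ?thesis
  proof
    assume "regular_triangulation (complex_of M)"
    then obtain \<omega> where "complex_of M = insert {} ((\<lambda>F. fst ` F) ` lower_faces \<omega>)"
      unfolding regular_triangulation_def by blast
    then show "\<exists>\<omega>. lifts M \<omega>" using regular_lifts[OF \<open>M \<subseteq> trees\<close>] by blast
  next
    assume "\<exists>\<omega>. lifts M \<omega>"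
    then obtain \<omega> where "lifts M \<omega>" by blast
    then show "regular_triangulation (complex_of M)"
      unfolding regular_triangulation_def using good_triangulation[OF assms] lifts_regular[OF assms] by blast
  qed
qed

subsection \<open>Monomial ideals\<close>

definition mono_support :: "(label \<Rightarrow>\<^sub>0 nat) \<Rightarrow> label set" where
  "mono_support m = {v. Poly_Mapping.lookup m v \<noteq> 0}"

definition squarefree_mono :: "label set \<Rightarrow> label \<Rightarrow>\<^sub>0 nat" where
  "squarefree_mono \<sigma> = (\<Sum>v\<in>\<sigma>. Poly_Mapping.single v 1)"

lemma lookup_squarefree_mono: "Poly_Mapping.lookup (squarefree_mono \<sigma>) v = (if v \<in> \<sigma> then 1 else 0)"
  by (simp add: squarefree_mono_def lookup_sum lookup_single when_def)

lemma mono_support_squarefree: "mono_support (squarefree_mono \<sigma>) = \<sigma>"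
  by (simp add: mono_support_def lookup_squarefree_mono)

lemma prod_var: "(\<Prod>v\<in>\<sigma>. var v :: 'k::field polyring) = Poly_Mapping.single (squarefree_mono \<sigma>) 1"
proof (induction \<sigma> rule: finite_induct[OF finite])
  case 1 then show ?case by (simp add: squarefree_mono_def)
next
  case (2 v \<sigma>)
  then show ?case by (simp add: squarefree_mono_def var_def mult_single)
qed

definition down_closed :: "label set set \<Rightarrow> bool" where
  "down_closed F \<longleftrightarrow> (\<forall>\<sigma>\<in>F. \<forall>\<tau>\<subseteq>\<sigma>. \<tau> \<in> F)"

lemma ring_module: "module ((*) :: 'a::comm_ring_1 \<Rightarrow> 'a \<Rightarrow> 'a)"
  by (rule module.intro) (simp_all add: algebra_simps)

text \<open>Multiples of a nonface monomial have nonface support, as faces are closed under subsets;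
  conversely, a monomial with nonface support is a multiple of the squarefree monomial on its
  support.\<close>

lemma stanley_reisner_ideal_eq:
  assumes down: "down_closed (vertex_labels ` \<C>)"
  shows "(stanley_reisner_ideal \<C> :: 'k::field polyring set)
    = {p. \<forall>m\<in>Poly_Mapping.keys p. mono_support m \<notin> vertex_labels ` \<C>}" (is "_ = ?I")
proof -
  interpret module "(*) :: 'k polyring \<Rightarrow> 'k polyring \<Rightarrow> 'k polyring" by (rule ring_module)
  have subvec: "subspace ?I"
  proof (rule subspaceI)
    show "0 \<in> ?I" by simp
    show "p + q \<in> ?I" if "p \<in> ?I" "q \<in> ?I" for p q
      using that Poly_Mapping.keys_add[of p q] by blast
    show "c * p \<in> ?I" if p: "p \<in> ?I" for c p
    proof -
      have "mono_support m \<notin> vertex_labels ` \<C>" if m: "m \<in> Poly_Mapping.keys (c * p)" for m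
      proof -
        obtain a b where ab: "m = a + b" "b \<in> Poly_Mapping.keys p" using keys_mult[of c p] m by blast
        have "mono_support b \<subseteq> mono_support m" by (auto simp: mono_support_def ab(1) lookup_add)
        then show ?thesis using p ab(2) down unfolding down_closed_def by blast
      qed
      then show ?thesis by blast
    qed
  qed
  let ?G = "{\<Prod>v\<in>\<sigma>. var v | \<sigma>. \<sigma> \<notin> vertex_labels ` \<C>} :: 'k polyring set"
  have "?G \<subseteq> ?I" by (auto simp: prod_var mono_support_squarefree)
  then have "span ?G \<subseteq> ?I" by (rule span_minimal[OF _ subvec])
  moreover have "?I \<subseteq> span ?G"
  proof
    fix p assume p: "p \<in> ?I"
    have "p = (\<Sum>m\<in>Poly_Mapping.keys p. Poly_Mapping.single m (Poly_Mapping.lookup p m))"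
      by (rule poly_mapping_eqI) (simp add: lookup_sum lookup_single when_def in_keys_iff)
    also have "\<dots> \<in> span ?G"
    proof (rule span_sum)
      fix m assume "m \<in> Poly_Mapping.keys p"
      then have nf: "mono_support m \<notin> vertex_labels ` \<C>" using p by blast
      have "m = (m - squarefree_mono (mono_support m)) + squarefree_mono (mono_support m)"
        by (rule poly_mapping_eqI) (auto simp: lookup_add lookup_minus lookup_squarefree_mono mono_support_def)
      then have "Poly_Mapping.single m (Poly_Mapping.lookup p m)
          = Poly_Mapping.single (m - squarefree_mono (mono_support m)) (Poly_Mapping.lookup p m) * (\<Prod>v\<in>mono_support m. var v)"
        by (simp add: prod_var mult_single)
      moreover have "(\<Prod>v\<in>mono_support m. var v) \<in> span ?G" using nf by (intro span_base) blast
      ultimately show "Poly_Mapping.single m (Poly_Mapping.lookup p m) \<in> span ?G" by (simp only: span_scale)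
    qed
    finally show "p \<in> span ?G" .
  qed
  ultimately show ?thesis unfolding stanley_reisner_ideal_def by blast
qed

lemma prod_var_in_ideal:
  assumes down: "down_closed (vertex_labels ` \<C>)"
  shows "Poly_Mapping.single (squarefree_mono \<sigma>) (1::'k::field) \<in> stanley_reisner_ideal \<C>
    \<longleftrightarrow> \<sigma> \<notin> vertex_labels ` \<C>"
  by (simp add: stanley_reisner_ideal_eq[OF down] mono_support_squarefree)

lemma map_key_squarefree:
  assumes "bij \<pi>" shows "Poly_Mapping.map_key \<pi> (squarefree_mono \<sigma>) = squarefree_mono (\<pi> -` \<sigma>)"
  by (rule poly_mapping_eqI) (simp add: map_key.rep_eq bij_is_inj[OF assms] lookup_squarefree_mono)

lemma lookup_rename_vars:
  assumes "bij \<pi>"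
  shows "Poly_Mapping.lookup (rename_vars \<pi> p) m = Poly_Mapping.lookup p (Poly_Mapping.map_key \<pi> m)"
  unfolding rename_vars_def by (simp add: map_key.rep_eq inj_map_key[OF assms])

lemma mono_support_map_key:
  assumes "bij \<pi>" shows "mono_support (Poly_Mapping.map_key \<pi> m) = \<pi> -` mono_support m"
  by (auto simp: mono_support_def map_key.rep_eq bij_is_inj[OF assms])

lemma map_key_inverse:
  assumes "bij \<pi>" shows "Poly_Mapping.map_key (inv \<pi>) (Poly_Mapping.map_key \<pi> m) = m"
    and "Poly_Mapping.map_key \<pi> (Poly_Mapping.map_key (inv \<pi>) m) = m"
  using assms bij_imp_bij_inv[OF assms]
  by (auto intro!: poly_mapping_eqI simp: map_key.rep_eq bij_is_inj bij_is_surj surj_f_inv_f inv_f_f)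

lemma rename_vars_inverse:
  assumes "bij \<pi>" shows "rename_vars \<pi> (rename_vars (inv \<pi>) p) = p"
proof (rule poly_mapping_eqI)
  fix m
  have "bij (inv \<pi>)" using assms by (rule bij_imp_bij_inv)
  then show "Poly_Mapping.lookup (rename_vars \<pi> (rename_vars (inv \<pi>) p)) m = Poly_Mapping.lookup p m"
    by (simp add: lookup_rename_vars assms map_key_inverse)
qed

lemma mem_image_family:
  assumes "bij \<pi>" shows "\<sigma> \<in> (`) \<pi> ` S \<longleftrightarrow> \<pi> -` \<sigma> \<in> S"
proof
  assume "\<sigma> \<in> (`) \<pi> ` S"
  then show "\<pi> -` \<sigma> \<in> S" using inj_vimage_image_eq[OF bij_is_inj[OF assms]] by auto
next
  assume "\<pi> -` \<sigma> \<in> S"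
  moreover have "\<pi> ` (\<pi> -` \<sigma>) = \<sigma>" by (rule surj_image_vimage_eq[OF bij_is_surj[OF assms]])
  ultimately show "\<sigma> \<in> (`) \<pi> ` S" by (metis imageI)
qed

text \<open>The squarefree monomials outside the ideal are those of the faces, so ideal and complex
  determine each other over any field.\<close>

lemma rename_ideal_iff:
  assumes \<pi>: "bij \<pi>"
    and C: "down_closed (vertex_labels ` \<C>)"
    and D: "down_closed (vertex_labels ` \<D>)"
  shows "(stanley_reisner_ideal \<D> :: 'k::field polyring set) = rename_vars \<pi> ` stanley_reisner_ideal \<C>
    \<longleftrightarrow> vertex_labels ` \<D> = (`) \<pi> ` vertex_labels ` \<C>"
proof
  assume eq: "(stanley_reisner_ideal \<D> :: 'k polyring set) = rename_vars \<pi> ` stanley_reisner_ideal \<C>"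
  have "\<sigma> \<in> vertex_labels ` \<D> \<longleftrightarrow> \<pi> -` \<sigma> \<in> vertex_labels ` \<C>" for \<sigma>
  proof -
    let ?p = "Poly_Mapping.single (squarefree_mono \<sigma>) (1::'k)"
    have "inj (Poly_Mapping.map_key (inv \<pi>) :: (label \<Rightarrow>\<^sub>0 nat) \<Rightarrow> _)" by (rule inj_map_key[OF bij_imp_bij_inv[OF \<pi>]])
    have "rename_vars \<pi> (Poly_Mapping.single (squarefree_mono (\<pi> -` \<sigma>)) (1::'k)) = ?p"
      unfolding rename_vars_def map_key_squarefree[OF \<pi>, symmetric]
      by (rule map_key_single) (rule inj_map_key[OF \<pi>])
    then have "?p \<in> rename_vars \<pi> ` stanley_reisner_ideal \<C>
        \<longleftrightarrow> Poly_Mapping.single (squarefree_mono (\<pi> -` \<sigma>)) (1::'k) \<in> stanley_reisner_ideal \<C>"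
      by (metis (no_types, lifting) image_iff inv_inv_eq[OF \<pi>] rename_vars_inverse[OF bij_imp_bij_inv[OF \<pi>]])
    moreover have "Poly_Mapping.single (squarefree_mono (\<pi> -` \<sigma>)) (1::'k) \<in> stanley_reisner_ideal \<C>
        \<longleftrightarrow> \<pi> -` \<sigma> \<notin> vertex_labels ` \<C>" by (rule prod_var_in_ideal[OF C])
    moreover have "?p \<in> stanley_reisner_ideal \<D> \<longleftrightarrow> \<sigma> \<notin> vertex_labels ` \<D>" by (rule prod_var_in_ideal[OF D])
    ultimately show ?thesis unfolding eq by argo
  qed
  then have "\<sigma> \<in> vertex_labels ` \<D> \<longleftrightarrow> \<sigma> \<in> (`) \<pi> ` vertex_labels ` \<C>" for \<sigma>
    unfolding mem_image_family[OF \<pi>] .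
  then show "vertex_labels ` \<D> = (`) \<pi> ` vertex_labels ` \<C>" by blast
next
  assume eq: "vertex_labels ` \<D> = (`) \<pi> ` vertex_labels ` \<C>"
  have mem: "\<sigma> \<in> vertex_labels ` \<D> \<longleftrightarrow> \<pi> -` \<sigma> \<in> vertex_labels ` \<C>" for \<sigma>
    unfolding eq by (rule mem_image_family[OF \<pi>])
  have keys: "m \<in> Poly_Mapping.keys (rename_vars \<pi> p) \<longleftrightarrow> Poly_Mapping.map_key \<pi> m \<in> Poly_Mapping.keys p"
    for m and p :: "'k polyring"
    by (simp add: in_keys_iff lookup_rename_vars[OF \<pi>])
  have "rename_vars \<pi> p \<in> stanley_reisner_ideal \<D> \<longleftrightarrow> p \<in> stanley_reisner_ideal \<C>" for p :: "'k polyring"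
  proof -
    have "(\<forall>m. Poly_Mapping.map_key \<pi> m \<in> Poly_Mapping.keys p \<longrightarrow> mono_support m \<notin> vertex_labels ` \<D>)
      \<longleftrightarrow> (\<forall>m. Poly_Mapping.map_key \<pi> m \<in> Poly_Mapping.keys p \<longrightarrow> mono_support (Poly_Mapping.map_key \<pi> m) \<notin> vertex_labels ` \<C>)"
      by (simp only: mem mono_support_map_key[OF \<pi>])
    also have "\<dots> \<longleftrightarrow> (\<forall>m\<in>Poly_Mapping.keys p. mono_support m \<notin> vertex_labels ` \<C>)"
      using map_key_inverse(2)[OF \<pi>] by metis
    finally show ?thesis unfolding stanley_reisner_ideal_eq[OF C] stanley_reisner_ideal_eq[OF D] by (simp add: Ball_def keys)
  qed
  note mem' = this
  show "(stanley_reisner_ideal \<D> :: 'k polyring set) = rename_vars \<pi> ` stanley_reisner_ideal \<C>"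
  proof (intro equalityI subsetI)
    fix p :: "'k polyring" assume p: "p \<in> stanley_reisner_ideal \<D>"
    have "rename_vars (inv \<pi>) p \<in> stanley_reisner_ideal \<C>"
      unfolding mem'[symmetric] rename_vars_inverse[OF \<pi>] by (rule p)
    then show "p \<in> rename_vars \<pi> ` stanley_reisner_ideal \<C>"
      by (intro image_eqI[of _ _ "rename_vars (inv \<pi>) p"]) (simp_all only: rename_vars_inverse[OF \<pi>])
  next
    fix p :: "'k polyring" assume "p \<in> rename_vars \<pi> ` stanley_reisner_ideal \<C>"
    then show "p \<in> stanley_reisner_ideal \<D>" using mem' by blast
  qed
qed

subsection \<open>Relabellings\<close>

lemma label_perm_bij: "\<pi> \<in> label_perms \<Longrightarrow> bij \<pi>"
  and label_perm_block: "\<pi> \<in> label_perms \<Longrightarrow> \<exists>\<sigma>. bij \<sigma> \<and> (\<forall>v. fst (\<pi> v) = \<sigma> (fst v))"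
proof -
  assume "\<pi> \<in> label_perms"
  then obtain \<sigma> \<rho> where \<pi>: "\<pi> = (\<lambda>(i, r). (\<sigma> i, \<rho> i r))" "bij \<sigma>" "\<forall>i. bij (\<rho> i)"
    by (auto simp: label_perms_def)
  have "inj \<pi>"
  proof (rule injI)
    fix u v assume "\<pi> u = \<pi> v"
    then have "\<sigma> (fst u) = \<sigma> (fst v)" "\<rho> (fst u) (snd u) = \<rho> (fst v) (snd v)" by (simp_all add: \<pi>(1) case_prod_beta)
    then have "fst u = fst v" "\<rho> (fst u) (snd u) = \<rho> (fst u) (snd v)"
      using \<pi>(2) by (simp_all add: bij_is_inj inj_eq)
    then show "u = v" using \<pi>(3) by (simp add: prod_eq_iff bij_is_inj inj_eq)
  qed
  then show "bij \<pi>" by (simp add: bij_def finite_UNIV_inj_surj)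
  show "\<exists>\<sigma>. bij \<sigma> \<and> (\<forall>v. fst (\<pi> v) = \<sigma> (fst v))" using \<pi>(1,2) by (auto simp: case_prod_beta)
qed

text \<open>A permutation of the four indices acts on left and right vertices at once. It respects
  the missing edges, so the image edge exists, and it is unique.\<close>

definition relabel :: "(4 \<Rightarrow> 4) \<Rightarrow> label \<Rightarrow> label" where
  "relabel \<sigma> v = (SOME w. fst w = \<sigma> (fst v) \<and> right w = \<sigma> (right v))"

lemma relabel:
  assumes "inj \<sigma>" shows "fst (relabel \<sigma> v) = \<sigma> (fst v)" "right (relabel \<sigma> v) = \<sigma> (right v)"
proof -
  have "\<sigma> (fst v) \<noteq> \<sigma> (right v)" using assms right_neq[of v] by (simp add: inj_eq)
  then have "\<exists>w. fst w = \<sigma> (fst v) \<and> right w = \<sigma> (right v)" by (rule ex_label)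
  then have "fst (relabel \<sigma> v) = \<sigma> (fst v) \<and> right (relabel \<sigma> v) = \<sigma> (right v)"
    unfolding relabel_def by (rule someI_ex)
  then show "fst (relabel \<sigma> v) = \<sigma> (fst v)" "right (relabel \<sigma> v) = \<sigma> (right v)" by simp_all
qed

lemma bij_relabel: assumes "bij \<sigma>" shows "bij (relabel \<sigma>)"
proof -
  have i: "inj \<sigma>" using assms by (rule bij_is_inj)
  have "inj (relabel \<sigma>)"
    by (rule injI, rule label_eqI) (metis relabel[OF i] inj_eq[OF i])+
  then show ?thesis by (simp add: bij_def finite_UNIV_inj_surj)
qed

text \<open>The symmetries used in the search belong to the group that defines the symmetry
  classes.\<close>

lemma relabel_label_perm: assumes "bij \<sigma>" shows "relabel \<sigma> \<in> label_perms"
proof -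
  have i: "inj \<sigma>" using assms by (rule bij_is_inj)
  define \<rho> where "\<rho> i r = snd (relabel \<sigma> (i, r))" for i r
  have eq: "relabel \<sigma> = (\<lambda>(i, r). (\<sigma> i, \<rho> i r))"
    by (rule ext) (simp add: \<rho>_def prod_eq_iff case_prod_beta relabel[OF i])
  have "bij (\<rho> i)" for i
  proof -
    have "inj (\<rho> i)"
    proof (rule injI)
      fix r s assume "\<rho> i r = \<rho> i s"
      then have "relabel \<sigma> (i, r) = relabel \<sigma> (i, s)" by (simp add: eq)
      then show "r = s" using bij_is_inj[OF bij_relabel[OF assms]] by (simp add: inj_eq)
    qed
    then show ?thesis by (simp add: bij_def finite_UNIV_inj_surj)
  qed
  then show ?thesis using assms eq unfolding label_perms_def by blast
qed

lemma relabel_comp: "inj \<sigma> \<Longrightarrow> inj \<tau> \<Longrightarrow> relabel \<sigma> (relabel \<tau> v) = relabel (\<sigma> \<circ> \<tau>) v"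
  by (rule label_eqI) (simp_all add: relabel inj_compose)

lemma relabel_id: "relabel id v = v"
  by (rule label_eqI) (simp_all add: relabel)

lemma relabel_inv: assumes "bij \<sigma>"
  shows "relabel \<sigma> (relabel (inv \<sigma>) v) = v" "relabel (inv \<sigma>) (relabel \<sigma> v) = v"
proof -
  have "\<sigma> \<circ> inv \<sigma> = id" "inv \<sigma> \<circ> \<sigma> = id"
    using assms surj_iff[of \<sigma>] inj_iff[of \<sigma>] by (auto simp: bij_def)
  then show "relabel \<sigma> (relabel (inv \<sigma>) v) = v" "relabel (inv \<sigma>) (relabel \<sigma> v) = v"
    using assms by (simp_all add: relabel_comp bij_is_inj bij_imp_bij_inv relabel_id)
qed

lemma inj_image_relabel: "bij \<sigma> \<Longrightarrow> inj ((`) (relabel \<sigma>))"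
  by (rule injI) (simp add: inj_image_eq_iff bij_is_inj bij_relabel)

lemma subset_relabel_image:
  assumes "bij \<sigma>" "m \<subseteq> relabel \<sigma> ` A" obtains n where "n \<subseteq> A" "m = relabel \<sigma> ` n"
  using assms(2) by (auto simp: subset_image_iff)

lemma matching_relabel:
  assumes "bij \<sigma>" shows "matching (relabel \<sigma> ` m) \<longleftrightarrow> matching m"
proof -
  have i: "inj \<sigma>" using assms by (rule bij_is_inj)
  have "inj_on g (relabel \<sigma> ` m) \<longleftrightarrow> inj_on g m" if "\<And>v. g (relabel \<sigma> v) = \<sigma> (g v)" for g :: "label \<Rightarrow> 4"
  proof -
    have "inj_on g (relabel \<sigma> ` m) \<longleftrightarrow> inj_on (g \<circ> relabel \<sigma>) m"
      by (rule comp_inj_on_iff[OF inj_on_subset[OF bij_is_inj[OF bij_relabel[OF assms]] subset_UNIV]])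
    also have "\<dots> \<longleftrightarrow> inj_on g m" unfolding inj_on_def comp_def that inj_eq[OF i] ..
    finally show ?thesis .
  qed
  then show ?thesis unfolding matching_def using relabel[OF i] by simp
qed

lemma same_ends_relabel:
  assumes "bij \<sigma>" shows "same_ends (relabel \<sigma> ` m) (relabel \<sigma> ` n) \<longleftrightarrow> same_ends m n"
proof -
  have i: "inj \<sigma>" using assms by (rule bij_is_inj)
  have "fst ` relabel \<sigma> ` k = \<sigma> ` fst ` k" "right ` relabel \<sigma> ` k = \<sigma> ` right ` k" for k
    by (simp_all add: image_image relabel[OF i])
  then show ?thesis by (simp add: same_ends_def inj_image_eq_iff[OF i])
qed

lemma compatible_relabel:
  assumes s: "bij \<sigma>" and c: "compatible A B" shows "compatible (relabel \<sigma> ` A) (relabel \<sigma> ` B)"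
  unfolding compatible_def
proof (intro allI impI)
  fix m n assume mn: "m \<subseteq> relabel \<sigma> ` A" "n \<subseteq> relabel \<sigma> ` B" "matching m" "matching n" "same_ends m n"
  obtain m' n' where "m' \<subseteq> A" "m = relabel \<sigma> ` m'" "n' \<subseteq> B" "n = relabel \<sigma> ` n'"
    using subset_relabel_image[OF s mn(1)] subset_relabel_image[OF s mn(2)] by metis
  moreover from this have "matching m'" "matching n'" "same_ends m' n'"
    using mn(3-5) by (simp_all add: matching_relabel[OF s] same_ends_relabel[OF s])
  ultimately show "m = n" using c unfolding compatible_def by blast
qed

definition relabel_family :: "(4 \<Rightarrow> 4) \<Rightarrow> label set set \<Rightarrow> label set set" where
  "relabel_family \<sigma> M = (`) (relabel \<sigma>) ` M"

lemma relabel_family_comp: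
  "inj \<sigma> \<Longrightarrow> inj \<tau> \<Longrightarrow> relabel_family \<sigma> (relabel_family \<tau> M) = relabel_family (\<sigma> \<circ> \<tau>) M"
  by (simp add: relabel_family_def image_image relabel_comp)

lemma relabel_family_id: "relabel_family id M = M"
  by (simp add: relabel_family_def relabel_id)

lemma relabel_family_inv:
  assumes "bij \<sigma>" shows "relabel_family (inv \<sigma>) (relabel_family \<sigma> M) = M"
  by (simp add: relabel_family_def image_image relabel_inv[OF assms])

lemma card_relabel: "bij \<sigma> \<Longrightarrow> card (relabel \<sigma> ` A) = card A"
  by (intro card_image inj_on_subset[OF bij_is_inj[OF bij_relabel] subset_UNIV])

lemma tree_relabel: "bij \<sigma> \<Longrightarrow> T \<in> trees \<Longrightarrow> relabel \<sigma> ` T \<in> trees"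
  by (simp add: trees_def card_relabel compatible_relabel)

lemma boundary_relabel:
  assumes s: "bij \<sigma>" and b: "boundary A" shows "boundary (relabel \<sigma> ` A)"
proof -
  have i: "inj \<sigma>" using s by (rule bij_is_inj)
  have "fst ` relabel \<sigma> ` A = \<sigma> ` fst ` A" "right ` relabel \<sigma> ` A = \<sigma> ` right ` A"
    by (simp_all add: image_image relabel[OF i])
  then have 1: "k \<notin> fst ` A \<Longrightarrow> \<sigma> k \<notin> fst ` relabel \<sigma> ` A" and 2: "k \<notin> right ` A \<Longrightarrow> \<sigma> k \<notin> right ` relabel \<sigma> ` A" for k
    by (simp_all add: inj_image_mem_iff[OF i])
  have 3: "\<forall>v\<in>relabel \<sigma> ` A. fst v = \<sigma> k \<or> right v = \<sigma> k" if "\<forall>v\<in>A. fst v = k \<or> right v = k" for k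
    using that by (simp add: relabel[OF i] inj_eq[OF i])
  show ?thesis using b 1 2 3 unfolding boundary_def by meson
qed

lemma good_relabel:
  assumes s: "bij \<sigma>" and M: "good M" shows "good (relabel_family \<sigma> M)"
proof -
  have inj: "inj (relabel \<sigma>)" using bij_is_inj[OF bij_relabel[OF s]] .
  have f: "boundary (relabel \<sigma> ` T - {e}) \<or> (\<exists>U\<in>(`) (relabel \<sigma>) ` M. U \<noteq> relabel \<sigma> ` T \<and> relabel \<sigma> ` T - {e} \<subseteq> U)"
    if T: "T \<in> M" and e: "e \<in> relabel \<sigma> ` T" for T e
  proof -
    obtain d where d: "d \<in> T" "e = relabel \<sigma> d" using e by blast
    then have eq: "relabel \<sigma> ` T - {e} = relabel \<sigma> ` (T - {d})" using inj by (simp add: image_set_diff)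
    consider "boundary (T - {d})" | U where "U \<in> M" "U \<noteq> T" "T - {d} \<subseteq> U"
      using M T d(1) unfolding good_def by blast
    then show ?thesis
    proof cases
      case 1 then show ?thesis unfolding eq using boundary_relabel[OF s] by blast
    next
      case 2
      then have "relabel \<sigma> ` U \<noteq> relabel \<sigma> ` T" by (simp add: inj_image_eq_iff[OF inj])
      then show ?thesis unfolding eq using 2 by blast
    qed
  qed
  show ?thesis unfolding good_def relabel_family_def
  proof (intro conjI ballI)
    show "(`) (relabel \<sigma>) ` M \<subseteq> trees" using M tree_relabel[OF s] by (auto simp: good_def)
    show "(`) (relabel \<sigma>) ` M \<noteq> {}" using M by (simp add: good_def)
  next
    fix T U assume "T \<in> (`) (relabel \<sigma>) ` M" "U \<in> (`) (relabel \<sigma>) ` M"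
    then obtain T' U' where "T' \<in> M" "T = relabel \<sigma> ` T'" "U' \<in> M" "U = relabel \<sigma> ` U'" by blast
    moreover from this have "compatible T' U'" using M by (simp add: good_def)
    ultimately show "compatible T U" using compatible_relabel[OF s] by simp
  next
    fix T e assume "T \<in> (`) (relabel \<sigma>) ` M" "e \<in> T"
    then obtain T' where "T' \<in> M" "T = relabel \<sigma> ` T'" "e \<in> relabel \<sigma> ` T'" by blast
    then show "boundary (T - {e}) \<or> (\<exists>U\<in>(`) (relabel \<sigma>) ` M. U \<noteq> T \<and> T - {e} \<subseteq> U)"
      using f[of T' e] by simp
  qed
qed

lemma faces_relabel: "m \<in> faces (relabel_family \<sigma> M) \<longleftrightarrow> (\<exists>n\<in>faces M. m = relabel \<sigma> ` n)"
  unfolding faces_def relabel_family_def by (auto simp: subset_image_iff)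

lemma lifts_relabel:
  assumes s: "bij \<sigma>" and l: "lifts M \<omega>" shows "lifts (relabel_family \<sigma> M) (\<omega> \<circ> relabel (inv \<sigma>))"
  unfolding lifts_def
proof (intro allI impI)
  fix m n assume mn: "matching m" "matching n" "same_ends m n" "m \<noteq> n" "m \<in> faces (relabel_family \<sigma> M)"
  obtain m' where m': "m' \<in> faces M" "m = relabel \<sigma> ` m'" using mn(5) faces_relabel by blast
  define n' where "n' = relabel (inv \<sigma>) ` n"
  have n': "n = relabel \<sigma> ` n'" by (simp add: n'_def image_image relabel_inv[OF s])
  have "matching m'" "matching n'" "same_ends m' n'" "m' \<noteq> n'"
    using mn(1-4) unfolding m'(2) n' matching_relabel[OF s] same_ends_relabel[OF s] by blast+
  then have "sum \<omega> m' < sum \<omega> n'" using l m'(1) unfolding lifts_def by blast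
  moreover have "sum (\<omega> \<circ> relabel (inv \<sigma>)) (relabel \<sigma> ` k) = sum \<omega> k" for k
    by (subst sum.reindex) (auto intro: inj_on_subset[OF bij_is_inj[OF bij_relabel[OF s]]] simp: relabel_inv[OF s])
  ultimately show "sum (\<omega> \<circ> relabel (inv \<sigma>)) m < sum (\<omega> \<circ> relabel (inv \<sigma>)) n"
    by (simp add: m'(2) n')
qed

lemma marg_relabel:
  assumes s: "bij \<sigma>"
  shows "marg (\<lambda>v. f (relabel \<sigma> v)) $ Inr i = marg f $ Inr (\<sigma> i)"
    and "marg (\<lambda>v. f (relabel \<sigma> v)) $ Inl i = marg f $ Inl (\<sigma> i)"
proof -
  have i: "inj \<sigma>" using s by (rule bij_is_inj)
  have "(\<Sum>v | g v = k. f (relabel \<sigma> v)) = (\<Sum>w | g w = \<sigma> k. f w)" if g: "\<And>v. g (relabel \<sigma> v) = \<sigma> (g v)"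
    for g :: "label \<Rightarrow> 4" and k
  proof (rule sum.reindex_bij_betw)
    show "bij_betw (relabel \<sigma>) {v. g v = k} {w. g w = \<sigma> k}"
      unfolding bij_betw_def
    proof
      show "inj_on (relabel \<sigma>) {v. g v = k}" by (rule inj_on_subset[OF bij_is_inj[OF bij_relabel[OF s]] subset_UNIV])
      show "relabel \<sigma> ` {v. g v = k} = {w. g w = \<sigma> k}"
      proof (intro equalityI subsetI)
        fix w assume "w \<in> {w. g w = \<sigma> k}"
        then have "\<sigma> (g (relabel (inv \<sigma>) w)) = \<sigma> k" using g[of "relabel (inv \<sigma>) w"] by (simp add: relabel_inv[OF s])
        then have "g (relabel (inv \<sigma>) w) = k" using i by (simp add: inj_eq)
        then show "w \<in> relabel \<sigma> ` {v. g v = k}" by (intro image_eqI[of _ _ "relabel (inv \<sigma>) w"]) (simp_all add: relabel_inv[OF s])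
      qed (auto simp: g)
    qed
  qed
  then show "marg (\<lambda>v. f (relabel \<sigma> v)) $ Inr i = marg f $ Inr (\<sigma> i)"
    "marg (\<lambda>v. f (relabel \<sigma> v)) $ Inl i = marg f $ Inl (\<sigma> i)"
    unfolding marg_Inr marg_Inl using relabel[OF i] by blast+
qed

lemma indicator_relabel:
  assumes s: "bij \<sigma>" shows "indicat_real (relabel \<sigma> ` A) (relabel \<sigma> v) = indicat_real A v"
  by (simp add: indicator_def inj_image_mem_iff[OF bij_is_inj[OF bij_relabel[OF s]]])

lemma admissible_trees: "admissible M \<Longrightarrow> M \<subseteq> trees"
  and admissible_deg: "admissible M \<Longrightarrow> attainable r \<Longrightarrow> \<exists>T\<in>M. deg T = r"
  and admissible_unique: "admissible M \<Longrightarrow> T \<in> M \<Longrightarrow> U \<in> M \<Longrightarrow> \<phi> \<subseteq> T \<Longrightarrow> \<psi> \<subseteq> U \<Longrightarrow>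
    marg (indicat_real \<phi>) \<in> level_one \<Longrightarrow> marg (indicat_real \<phi>) = marg (indicat_real \<psi>) \<Longrightarrow> \<phi> = \<psi>"
  by (simp_all only: admissible_def)

text \<open>Both conditions are about vertex sums, whose components a relabelling merely
  permutes.\<close>

lemma admissible_relabel:
  assumes s: "bij \<sigma>" and M: "admissible M" shows "admissible (relabel_family \<sigma> M)"
  unfolding admissible_def
proof (intro conjI allI impI ballI)
  have i: "inj \<sigma>" using s by (rule bij_is_inj)
  show "relabel_family \<sigma> M \<subseteq> trees"
    using admissible_trees[OF M] tree_relabel[OF s] unfolding relabel_family_def by blast
  fix r assume "attainable r"
  then obtain f where f: "nonneg f" "marg f \<in> level_one" "\<And>j. marg f $ Inl j = real (r j) - 3/4"
    unfolding attainable_def edge_cone_def by blast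
  have "marg (\<lambda>v. f (relabel \<sigma> v)) \<in> edge_cone UNIV" using f(1) by (intro coneI) (simp_all add: supported_def nonneg_def)
  moreover have "marg (\<lambda>v. f (relabel \<sigma> v)) \<in> level_one" using f(2) by (simp add: level_one_def marg_relabel[OF s])
  ultimately have "attainable (r \<circ> \<sigma>)" unfolding attainable_def using f(3) marg_relabel(2)[OF s, of f] by auto
  then obtain T where T: "T \<in> M" "deg T = r \<circ> \<sigma>" using admissible_deg[OF M] by blast
  have "deg (relabel \<sigma> ` T) j = r j" for j
  proof -
    have "{v \<in> relabel \<sigma> ` T. right v = j} = relabel \<sigma> ` {v \<in> T. right v = inv \<sigma> j}"
      using s by (auto simp: relabel[OF i] inv_f_f[OF i] surj_f_inv_f[OF bij_is_surj[OF s]] image_iff)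
    then have "deg (relabel \<sigma> ` T) j = deg T (inv \<sigma> j)" by (simp add: deg_def card_relabel[OF s])
    then show ?thesis using T(2) by (simp add: surj_f_inv_f[OF bij_is_surj[OF s]])
  qed
  then have "deg (relabel \<sigma> ` T) = r" by blast
  then show "\<exists>T\<in>relabel_family \<sigma> M. deg T = r" using T(1) unfolding relabel_family_def by blast
next
  fix T U \<phi> \<psi> assume TU: "T \<in> relabel_family \<sigma> M" "U \<in> relabel_family \<sigma> M" "\<phi> \<subseteq> T" "\<psi> \<subseteq> U"
    "marg (indicat_real \<phi>) \<in> level_one" "marg (indicat_real \<phi>) = marg (indicat_real \<psi>)"
  obtain T' U' where T': "T' \<in> M" "T = relabel \<sigma> ` T'" "U' \<in> M" "U = relabel \<sigma> ` U'"
    using TU(1,2) unfolding relabel_family_def by blast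
  obtain \<phi>' \<psi>' where p: "\<phi>' \<subseteq> T'" "\<phi> = relabel \<sigma> ` \<phi>'" "\<psi>' \<subseteq> U'" "\<psi> = relabel \<sigma> ` \<psi>'"
    using subset_relabel_image[OF s] TU(3,4) T' by metis
  have m: "marg (indicat_real A) $ Inr i = marg (indicat_real (relabel \<sigma> ` A)) $ Inr (\<sigma> i)"
    "marg (indicat_real A) $ Inl i = marg (indicat_real (relabel \<sigma> ` A)) $ Inl (\<sigma> i)" for A i
    using marg_relabel[OF s, of "indicat_real (relabel \<sigma> ` A)" i] by (simp_all add: indicator_relabel[OF s])
  have "marg (indicat_real \<phi>') = marg (indicat_real \<psi>')"
    by (rule vec_sum_eqI) (simp_all only: m[of \<phi>'] m[of \<psi>'] p(2)[symmetric] p(4)[symmetric] TU(6))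
  moreover have "marg (indicat_real \<phi>') \<in> level_one"
    using TU(5) by (simp add: level_one_def m[of \<phi>'] flip: p(2))
  ultimately have "\<phi>' = \<psi>'" using admissible_unique[OF M T'(1,3) p(1,3)] by blast
  then show "\<phi> = \<psi>" by (simp add: p)
qed

text \<open>Only the blocks enter, not the right vertices, so arbitrary permutations inside a block
  do no harm. The summand 1 keeps a block without common edges from annihilating the
  product.\<close>

definition overlap_of :: "label set \<Rightarrow> label set \<Rightarrow> int" where
  "overlap_of T U = (\<Prod>i\<in>UNIV. 1 + int (card (in_block (T \<inter> U) i)))"

text \<open>The row sums of the overlap matrix, squared and added, so that the order of the trees
  does not matter.\<close>

definition invariant_of :: "label set set \<Rightarrow> int" where
  "invariant_of M = (\<Sum>T\<in>M. (\<Sum>U\<in>M. overlap_of T U)\<^sup>2)"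

lemma invariant_of_label_perm:
  assumes "\<pi> \<in> label_perms" shows "invariant_of ((`) \<pi> ` M) = invariant_of M"
proof -
  have inj: "inj \<pi>" using label_perm_bij[OF assms] by (rule bij_is_inj)
  obtain \<sigma> where \<sigma>: "bij \<sigma>" "\<And>v. fst (\<pi> v) = \<sigma> (fst v)" using label_perm_block[OF assms] by blast
  have "overlap_of (\<pi> ` T) (\<pi> ` U) = overlap_of T U" for T U
  proof -
    have "in_block (\<pi> ` T \<inter> \<pi> ` U) (\<sigma> i) = \<pi> ` in_block (T \<inter> U) i" for i
      using \<sigma> by (auto simp: in_block_def image_Int[OF inj, symmetric] bij_is_inj inj_eq)
    then have "card (in_block (\<pi> ` T \<inter> \<pi> ` U) (\<sigma> i)) = card (in_block (T \<inter> U) i)" for i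
      by (simp add: card_image[OF inj_on_subset[OF inj subset_UNIV]])
    then show ?thesis unfolding overlap_of_def
      using prod.reindex_bij_betw[OF \<sigma>(1), of "\<lambda>i. 1 + int (card (in_block (\<pi> ` T \<inter> \<pi> ` U) i))"] by simp
  qed
  moreover have "inj_on ((`) \<pi>) M" using inj by (simp add: inj_on_def inj_image_eq_iff)
  ultimately show ?thesis unfolding invariant_of_def by (simp add: sum.reindex)
qed

subsection \<open>Certificates and their evaluation\<close>

text \<open>An edge set is encoded by its indicator along \<open>labels\<close>, or by four octal digits, the digit of a
  block consisting of its three bits. Weights and flows are lists of twelve digits. The generators
  \<open>S1, S2, S3\<close> are the adjacent transpositions of \<open>S\<^sub>4\<close>.

  The functions below are evaluated by rewriting. Conditionals are avoided in favour of auxiliary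
  functions that match on a Boolean, so that no branch is evaluated in vain.\<close>

datatype octal = O0 | O1 | O2 | O3 | O4 | O5 | O6 | O7
datatype gen = S1 | S2 | S3

text \<open>The classes of matchings with the same ends that have more than one member.\<close>

definition match_groups :: "octal list list list" where
  "match_groups = [
    [[O2,O1,O0,O0],[O1,O2,O0,O0]], [[O4,O0,O1,O0],[O1,O0,O2,O0]], [[O4,O0,O0,O1],[O2,O0,O0,O2]],
    [[O0,O4,O1,O0],[O0,O1,O4,O0]], [[O0,O4,O0,O1],[O0,O2,O0,O4]], [[O0,O0,O4,O2],[O0,O0,O2,O4]],
    [[O4,O4,O1,O0],[O4,O1,O4,O0],[O1,O4,O2,O0]], [[O4,O2,O4,O0],[O2,O4,O2,O0]],
    [[O4,O2,O1,O0],[O2,O1,O2,O0],[O1,O2,O2,O0]], [[O2,O4,O1,O0],[O2,O1,O4,O0],[O1,O2,O4,O0]],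
    [[O4,O4,O0,O1],[O4,O2,O0,O4],[O2,O4,O0,O2]], [[O4,O1,O0,O4],[O1,O4,O0,O2]],
    [[O4,O1,O0,O1],[O2,O1,O0,O2],[O1,O2,O0,O2]], [[O2,O1,O0,O4],[O1,O4,O0,O1],[O1,O2,O0,O4]],
    [[O4,O0,O4,O1],[O2,O0,O4,O2],[O2,O0,O2,O4]], [[O4,O0,O1,O4],[O1,O0,O4,O2],[O1,O0,O2,O4]],
    [[O4,O0,O1,O1],[O2,O0,O1,O2],[O1,O0,O2,O1]], [[O2,O0,O1,O4],[O1,O0,O4,O1]],
    [[O0,O4,O2,O1],[O0,O2,O4,O2],[O0,O2,O2,O4]], [[O0,O4,O1,O2],[O0,O1,O4,O2],[O0,O1,O2,O4]],
    [[O0,O4,O1,O1],[O0,O2,O1,O4],[O0,O1,O4,O1]], [[O0,O2,O1,O2],[O0,O1,O2,O1]],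
    [[O4,O4,O1,O1],[O4,O2,O1,O4],[O4,O1,O4,O1],[O2,O4,O1,O2],[O2,O1,O4,O2],[O2,O1,O2,O4],[O1,O4,O2,O1],[O1,O2,O4,O2],[O1,O2,O2,O4]]]"

text \<open>The lattice points with more than one expression as a sum of four edges, one from each block, are
  given by the lists of these expressions.\<close>

definition point_labels :: "octal list list list" where
  "point_labels = [

    [[O4,O2,O1,O4],[O4,O4,O1,O1],[O4,O1,O4,O1],[O2,O4,O1,O2],[O2,O1,O4,O2],[O2,O1,O2,O4],[O1,O4,O2,O1],[O1,O2,O4,O2],[O1,O2,O2,O4]],
    [[O4,O4,O4,O1],[O4,O2,O4,O4],[O2,O4,O4,O2],[O2,O4,O2,O4]],
    [[O4,O4,O2,O1],[O4,O2,O4,O2],[O4,O2,O2,O4],[O2,O4,O2,O2]],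
    [[O4,O4,O1,O4],[O4,O1,O4,O4],[O1,O4,O4,O2],[O1,O4,O2,O4]],
    [[O4,O4,O1,O2],[O4,O1,O4,O2],[O4,O1,O2,O4],[O1,O4,O2,O2]],
    [[O4,O2,O4,O1],[O2,O4,O2,O1],[O2,O2,O4,O2],[O2,O2,O2,O4]],
    [[O4,O2,O1,O2],[O4,O1,O2,O1],[O2,O1,O2,O2],[O1,O2,O2,O2]],
    [[O4,O2,O1,O1],[O2,O2,O1,O2],[O2,O1,O2,O1],[O1,O2,O2,O1]],
    [[O4,O1,O1,O4],[O1,O4,O1,O2],[O1,O1,O4,O2],[O1,O1,O2,O4]],
    [[O4,O1,O1,O1],[O2,O1,O1,O2],[O1,O2,O1,O2],[O1,O1,O2,O1]],
    [[O2,O4,O1,O4],[O2,O1,O4,O4],[O1,O4,O4,O1],[O1,O2,O4,O4]],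
    [[O2,O4,O1,O1],[O2,O2,O1,O4],[O2,O1,O4,O1],[O1,O2,O4,O1]],
    [[O2,O1,O1,O4],[O1,O4,O1,O1],[O1,O2,O1,O4],[O1,O1,O4,O1]], [[O4,O4,O4,O2],[O4,O4,O2,O4]],
    [[O4,O2,O2,O1],[O2,O2,O2,O2]], [[O4,O1,O1,O2],[O1,O1,O2,O2]], [[O2,O4,O4,O1],[O2,O2,O4,O4]],
    [[O2,O1,O1,O1],[O1,O2,O1,O1]], [[O1,O4,O1,O4],[O1,O1,O4,O4]]]"

text \<open>Representatives of the \<open>S_4\<close>-orbits of regular triangulations, each with
  sixteen trees. Nothing is taken for granted about them: they are tested by
  \<open>good_reps\<close> and \<open>heights_lift\<close>.\<close>

definition reg_reps :: "octal list list list" where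
  "reg_reps = [
    [[O1,O3,O1,O7], [O3,O2,O1,O7], [O1,O3,O3,O6], [O3,O2,O3,O6], [O2,O2,O3,O7], [O5,O3,O2,O6],
    [O7,O2,O2,O6], [O1,O3,O7,O4], [O3,O2,O7,O4], [O2,O2,O7,O5], [O5,O3,O6,O4], [O7,O2,O6,O4],
    [O4,O7,O2,O6], [O5,O7,O4,O4], [O7,O6,O4,O4], [O4,O7,O6,O4]], [[O1,O3,O1,O7], [O3,O2,O3,O5],
    [O1,O3,O3,O6], [O1,O2,O3,O7], [O3,O2,O2,O7], [O5,O3,O2,O6], [O7,O2,O2,O6], [O1,O3,O7,O4],
    [O3,O2,O7,O4], [O2,O2,O7,O5], [O5,O3,O6,O4], [O7,O2,O6,O4], [O4,O7,O2,O6], [O5,O7,O4,O4],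
    [O7,O6,O4,O4], [O4,O7,O6,O4]], [[O1,O3,O3,O5], [O3,O2,O3,O5], [O1,O1,O3,O7], [O1,O3,O2,O7],
    [O3,O2,O2,O7], [O5,O3,O2,O6], [O7,O2,O2,O6], [O1,O3,O7,O4], [O3,O2,O7,O4], [O2,O2,O7,O5],
    [O5,O3,O6,O4], [O7,O2,O6,O4], [O4,O7,O2,O6], [O5,O7,O4,O4], [O7,O6,O4,O4], [O4,O7,O6,O4]],
    [[O1,O3,O1,O7], [O3,O2,O7,O1], [O1,O3,O3,O6], [O1,O2,O3,O7], [O3,O2,O2,O7], [O5,O3,O2,O6],
    [O7,O2,O2,O6], [O1,O3,O7,O4], [O1,O2,O7,O5], [O3,O2,O6,O5], [O5,O3,O6,O4], [O7,O2,O6,O4],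
    [O4,O7,O2,O6], [O5,O7,O4,O4], [O7,O6,O4,O4], [O4,O7,O6,O4]], [[O1,O3,O3,O5], [O3,O2,O7,O1],
    [O1,O1,O3,O7], [O1,O3,O2,O7], [O3,O2,O2,O7], [O5,O3,O2,O6], [O7,O2,O2,O6], [O1,O3,O7,O4],
    [O1,O2,O7,O5], [O3,O2,O6,O5], [O5,O3,O6,O4], [O7,O2,O6,O4], [O4,O7,O2,O6], [O5,O7,O4,O4],
    [O7,O6,O4,O4], [O4,O7,O6,O4]], [[O1,O3,O7,O1], [O3,O2,O7,O1], [O1,O1,O3,O7], [O1,O3,O2,O7],
    [O3,O2,O2,O7], [O5,O3,O2,O6], [O7,O2,O2,O6], [O1,O1,O7,O5], [O1,O3,O6,O5], [O3,O2,O6,O5],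
    [O5,O3,O6,O4], [O7,O2,O6,O4], [O4,O7,O2,O6], [O5,O7,O4,O4], [O7,O6,O4,O4], [O4,O7,O6,O4]],
    [[O1,O3,O1,O7], [O3,O2,O1,O7], [O1,O3,O3,O6], [O3,O2,O3,O6], [O2,O2,O3,O7], [O5,O3,O2,O6],
    [O7,O2,O2,O6], [O1,O7,O3,O4], [O3,O2,O7,O4], [O2,O2,O7,O5], [O5,O7,O2,O4], [O7,O2,O6,O4],
    [O4,O7,O2,O6], [O1,O6,O7,O4], [O7,O6,O4,O4], [O5,O6,O6,O4]], [[O1,O3,O1,O7], [O3,O2,O3,O5],
    [O1,O3,O3,O6], [O1,O2,O3,O7], [O3,O2,O2,O7], [O5,O3,O2,O6], [O7,O2,O2,O6], [O1,O3,O7,O4],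
    [O3,O2,O7,O4], [O2,O2,O7,O5], [O5,O7,O2,O4], [O7,O2,O6,O4], [O4,O7,O2,O6], [O1,O7,O6,O4],
    [O7,O6,O4,O4], [O5,O6,O6,O4]], [[O1,O3,O3,O5], [O3,O2,O3,O5], [O1,O1,O3,O7], [O1,O3,O2,O7],
    [O3,O2,O2,O7], [O5,O3,O2,O6], [O7,O2,O2,O6], [O1,O3,O7,O4], [O3,O2,O7,O4], [O2,O2,O7,O5],
    [O5,O7,O2,O4], [O7,O2,O6,O4], [O4,O7,O2,O6], [O1,O7,O6,O4], [O7,O6,O4,O4], [O5,O6,O6,O4]],
    [[O1,O3,O1,O7], [O3,O2,O3,O5], [O1,O3,O3,O6], [O1,O2,O3,O7], [O3,O2,O2,O7], [O5,O3,O2,O6],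
    [O7,O2,O2,O6], [O1,O7,O3,O4], [O3,O2,O7,O4], [O2,O2,O7,O5], [O5,O7,O2,O4], [O7,O2,O6,O4],
    [O4,O7,O2,O6], [O1,O6,O7,O4], [O7,O6,O4,O4], [O5,O6,O6,O4]], [[O1,O3,O1,O7], [O3,O2,O7,O1],
    [O1,O3,O3,O6], [O1,O2,O3,O7], [O3,O2,O2,O7], [O5,O3,O2,O6], [O7,O2,O2,O6], [O1,O3,O7,O4],
    [O1,O2,O7,O5], [O3,O2,O6,O5], [O5,O7,O2,O4], [O7,O2,O6,O4], [O4,O7,O2,O6], [O1,O7,O6,O4],
    [O7,O6,O4,O4], [O5,O6,O6,O4]], [[O1,O3,O3,O5], [O3,O2,O7,O1], [O1,O1,O3,O7], [O1,O3,O2,O7],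
    [O3,O2,O2,O7], [O5,O3,O2,O6], [O7,O2,O2,O6], [O1,O3,O7,O4], [O1,O2,O7,O5], [O3,O2,O6,O5],
    [O5,O7,O2,O4], [O7,O2,O6,O4], [O4,O7,O2,O6], [O1,O7,O6,O4], [O7,O6,O4,O4], [O5,O6,O6,O4]],
    [[O1,O3,O1,O7], [O3,O2,O1,O7], [O1,O3,O3,O6], [O3,O2,O3,O6], [O2,O2,O3,O7], [O5,O7,O2,O2],
    [O7,O2,O2,O6], [O1,O7,O3,O4], [O3,O2,O7,O4], [O2,O2,O7,O5], [O1,O7,O2,O6], [O7,O2,O6,O4],
    [O5,O6,O2,O6], [O1,O6,O7,O4], [O7,O6,O4,O4], [O5,O6,O6,O4]], [[O1,O3,O1,O7], [O3,O2,O1,O7],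
    [O1,O7,O3,O2], [O3,O2,O3,O6], [O2,O2,O3,O7], [O5,O7,O2,O2], [O7,O2,O2,O6], [O1,O7,O1,O6],
    [O3,O2,O7,O4], [O2,O2,O7,O5], [O1,O6,O3,O6], [O7,O2,O6,O4], [O5,O6,O2,O6], [O1,O6,O7,O4],
    [O7,O6,O4,O4], [O5,O6,O6,O4]], [[O1,O3,O1,O7], [O3,O2,O3,O5], [O1,O3,O3,O6], [O1,O2,O3,O7],
    [O3,O2,O2,O7], [O5,O7,O2,O2], [O7,O2,O2,O6], [O1,O7,O3,O4], [O3,O2,O7,O4], [O2,O2,O7,O5],
    [O1,O7,O2,O6], [O7,O2,O6,O4], [O5,O6,O2,O6], [O1,O6,O7,O4], [O7,O6,O4,O4], [O5,O6,O6,O4]],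
    [[O1,O3,O1,O7], [O3,O2,O3,O5], [O1,O7,O3,O2], [O1,O2,O3,O7], [O3,O2,O2,O7], [O5,O7,O2,O2],
    [O7,O2,O2,O6], [O1,O7,O1,O6], [O3,O2,O7,O4], [O2,O2,O7,O5], [O1,O6,O3,O6], [O7,O2,O6,O4],
    [O5,O6,O2,O6], [O1,O6,O7,O4], [O7,O6,O4,O4], [O5,O6,O6,O4]], [[O1,O3,O1,O7], [O3,O2,O7,O1],
    [O1,O3,O3,O6], [O1,O2,O3,O7], [O3,O2,O2,O7], [O5,O7,O2,O2], [O7,O2,O2,O6], [O1,O3,O7,O4],
    [O1,O2,O7,O5], [O3,O2,O6,O5], [O1,O7,O2,O6], [O7,O2,O6,O4], [O5,O6,O2,O6], [O1,O7,O6,O4],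
    [O7,O6,O4,O4], [O5,O6,O6,O4]], [[O1,O3,O3,O5], [O3,O2,O7,O1], [O1,O1,O3,O7], [O1,O3,O2,O7],
    [O7,O2,O2,O5], [O5,O3,O2,O6], [O5,O2,O2,O7], [O1,O3,O7,O4], [O1,O2,O7,O5], [O3,O2,O6,O5],
    [O5,O3,O6,O4], [O7,O2,O6,O4], [O4,O7,O2,O6], [O5,O7,O4,O4], [O7,O6,O4,O4], [O4,O7,O6,O4]],
    [[O1,O3,O7,O1], [O3,O2,O7,O1], [O1,O1,O3,O7], [O1,O3,O2,O7], [O7,O2,O2,O5], [O5,O3,O2,O6],
    [O5,O2,O2,O7], [O1,O1,O7,O5], [O1,O3,O6,O5], [O3,O2,O6,O5], [O5,O3,O6,O4], [O7,O2,O6,O4],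
    [O4,O7,O2,O6], [O5,O7,O4,O4], [O7,O6,O4,O4], [O4,O7,O6,O4]], [[O1,O3,O3,O5], [O3,O2,O7,O1],
    [O1,O1,O3,O7], [O5,O3,O2,O5], [O7,O2,O2,O5], [O5,O1,O2,O7], [O4,O3,O2,O7], [O1,O3,O7,O4],
    [O1,O2,O7,O5], [O3,O2,O6,O5], [O5,O3,O6,O4], [O7,O2,O6,O4], [O4,O7,O2,O6], [O5,O7,O4,O4],
    [O7,O6,O4,O4], [O4,O7,O6,O4]], [[O1,O3,O7,O1], [O3,O2,O7,O1], [O1,O1,O3,O7], [O5,O3,O2,O5],
    [O7,O2,O2,O5], [O5,O1,O2,O7], [O4,O3,O2,O7], [O1,O1,O7,O5], [O1,O3,O6,O5], [O3,O2,O6,O5],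
    [O5,O3,O6,O4], [O7,O2,O6,O4], [O4,O7,O2,O6], [O5,O7,O4,O4], [O7,O6,O4,O4], [O4,O7,O6,O4]],
    [[O1,O3,O3,O5], [O3,O2,O7,O1], [O1,O1,O3,O7], [O1,O3,O2,O7], [O7,O2,O2,O5], [O5,O3,O2,O6],
    [O5,O2,O2,O7], [O1,O3,O7,O4], [O1,O2,O7,O5], [O3,O2,O6,O5], [O5,O7,O2,O4], [O7,O2,O6,O4],
    [O4,O7,O2,O6], [O1,O7,O6,O4], [O7,O6,O4,O4], [O5,O6,O6,O4]], [[O1,O3,O1,O7], [O3,O2,O1,O7],
    [O1,O3,O7,O2], [O3,O2,O7,O2], [O2,O2,O7,O3], [O5,O3,O6,O2], [O7,O2,O6,O2], [O1,O3,O5,O6],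
    [O3,O2,O5,O6], [O2,O2,O5,O7], [O5,O3,O4,O6], [O7,O2,O4,O6], [O4,O7,O6,O2], [O5,O7,O4,O4],
    [O7,O6,O4,O4], [O4,O7,O4,O6]], [[O1,O3,O1,O7], [O3,O2,O5,O3], [O1,O3,O7,O2], [O3,O2,O7,O2],
    [O2,O2,O7,O3], [O5,O3,O6,O2], [O7,O2,O6,O2], [O1,O3,O5,O6], [O1,O2,O5,O7], [O3,O2,O4,O7],
    [O5,O3,O4,O6], [O7,O2,O4,O6], [O4,O7,O6,O2], [O5,O7,O4,O4], [O7,O6,O4,O4], [O4,O7,O4,O6]],
    [[O1,O3,O5,O3], [O3,O2,O5,O3], [O1,O3,O7,O2], [O3,O2,O7,O2], [O2,O2,O7,O3], [O5,O3,O6,O2],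
    [O7,O2,O6,O2], [O1,O1,O5,O7], [O1,O3,O4,O7], [O3,O2,O4,O7], [O5,O3,O4,O6], [O7,O2,O4,O6],
    [O4,O7,O6,O2], [O5,O7,O4,O4], [O7,O6,O4,O4], [O4,O7,O4,O6]], [[O1,O3,O1,O7], [O3,O2,O7,O1],
    [O1,O3,O7,O2], [O1,O2,O7,O3], [O3,O2,O6,O3], [O5,O3,O6,O2], [O7,O2,O6,O2], [O1,O3,O5,O6],
    [O1,O2,O5,O7], [O3,O2,O4,O7], [O5,O3,O4,O6], [O7,O2,O4,O6], [O4,O7,O6,O2], [O5,O7,O4,O4],
    [O7,O6,O4,O4], [O4,O7,O4,O6]], [[O1,O3,O5,O3], [O3,O2,O7,O1], [O1,O3,O7,O2], [O1,O2,O7,O3],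
    [O3,O2,O6,O3], [O5,O3,O6,O2], [O7,O2,O6,O2], [O1,O1,O5,O7], [O1,O3,O4,O7], [O3,O2,O4,O7],
    [O5,O3,O4,O6], [O7,O2,O4,O6], [O4,O7,O6,O2], [O5,O7,O4,O4], [O7,O6,O4,O4], [O4,O7,O4,O6]],
    [[O1,O3,O1,O7], [O3,O2,O5,O3], [O1,O3,O7,O2], [O3,O2,O7,O2], [O2,O2,O7,O3], [O5,O3,O6,O2],
    [O7,O2,O6,O2], [O1,O3,O5,O6], [O1,O2,O5,O7], [O3,O2,O4,O7], [O5,O7,O4,O2], [O7,O2,O4,O6],
    [O4,O7,O6,O2], [O1,O7,O4,O6], [O7,O6,O4,O4], [O5,O6,O4,O6]], [[O1,O3,O5,O3], [O3,O2,O5,O3],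
    [O1,O3,O7,O2], [O3,O2,O7,O2], [O2,O2,O7,O3], [O5,O3,O6,O2], [O7,O2,O6,O2], [O1,O1,O5,O7],
    [O1,O3,O4,O7], [O3,O2,O4,O7], [O5,O7,O4,O2], [O7,O2,O4,O6], [O4,O7,O6,O2], [O1,O7,O4,O6],
    [O7,O6,O4,O4], [O5,O6,O4,O6]], [[O1,O3,O1,O7], [O3,O2,O7,O1], [O1,O3,O7,O2], [O1,O2,O7,O3],
    [O3,O2,O6,O3], [O5,O3,O6,O2], [O7,O2,O6,O2], [O1,O3,O5,O6], [O1,O2,O5,O7], [O3,O2,O4,O7],
    [O5,O7,O4,O2], [O7,O2,O4,O6], [O4,O7,O6,O2], [O1,O7,O4,O6], [O7,O6,O4,O4], [O5,O6,O4,O6]],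
    [[O1,O3,O1,O7], [O3,O2,O1,O7], [O1,O7,O3,O2], [O3,O2,O7,O2], [O2,O2,O7,O3], [O5,O7,O2,O2],
    [O7,O2,O6,O2], [O1,O7,O1,O6], [O3,O2,O5,O6], [O2,O2,O5,O7], [O1,O6,O7,O2], [O7,O2,O4,O6],
    [O5,O6,O6,O2], [O1,O6,O5,O6], [O7,O6,O4,O4], [O5,O6,O4,O6]], [[O1,O3,O1,O7], [O3,O2,O5,O3],
    [O1,O7,O3,O2], [O3,O2,O7,O2], [O2,O2,O7,O3], [O5,O7,O2,O2], [O7,O2,O6,O2], [O1,O7,O1,O6],
    [O1,O2,O5,O7], [O3,O2,O4,O7], [O1,O6,O7,O2], [O7,O2,O4,O6], [O5,O6,O6,O2], [O1,O6,O5,O6],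
    [O7,O6,O4,O4], [O5,O6,O4,O6]], [[O1,O3,O1,O7], [O3,O2,O7,O1], [O1,O3,O7,O2], [O1,O2,O7,O3],
    [O3,O2,O6,O3], [O5,O7,O2,O2], [O7,O2,O6,O2], [O1,O3,O5,O6], [O1,O2,O5,O7], [O3,O2,O4,O7],
    [O1,O7,O6,O2], [O7,O2,O4,O6], [O5,O6,O6,O2], [O1,O7,O4,O6], [O7,O6,O4,O4], [O5,O6,O4,O6]],
    [[O1,O3,O1,O7], [O3,O2,O7,O1], [O1,O7,O3,O2], [O1,O2,O7,O3], [O3,O2,O6,O3], [O5,O7,O2,O2],
    [O7,O2,O6,O2], [O1,O7,O1,O6], [O1,O2,O5,O7], [O3,O2,O4,O7], [O1,O6,O7,O2], [O7,O2,O4,O6],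
    [O5,O6,O6,O2], [O1,O6,O5,O6], [O7,O6,O4,O4], [O5,O6,O4,O6]], [[O1,O3,O7,O1], [O3,O2,O7,O1],
    [O1,O1,O3,O7], [O5,O3,O2,O5], [O7,O2,O6,O1], [O5,O1,O2,O7], [O4,O3,O2,O7], [O1,O1,O7,O5],
    [O1,O3,O6,O5], [O7,O2,O4,O5], [O5,O3,O6,O4], [O5,O2,O6,O5], [O4,O7,O2,O6], [O5,O7,O4,O4],
    [O7,O6,O4,O4], [O4,O7,O6,O4]], [[O1,O3,O1,O7], [O3,O2,O7,O1], [O1,O3,O7,O2], [O1,O2,O7,O3],
    [O7,O2,O6,O1], [O5,O3,O6,O2], [O5,O2,O6,O3], [O1,O3,O5,O6], [O1,O2,O5,O7], [O7,O2,O4,O5],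
    [O5,O3,O4,O6], [O5,O2,O4,O7], [O4,O7,O6,O2], [O5,O7,O4,O4], [O7,O6,O4,O4], [O4,O7,O4,O6]],
    [[O1,O3,O5,O3], [O3,O2,O7,O1], [O1,O3,O7,O2], [O1,O2,O7,O3], [O7,O2,O6,O1], [O5,O3,O6,O2],
    [O5,O2,O6,O3], [O1,O1,O5,O7], [O1,O3,O4,O7], [O7,O2,O4,O5], [O5,O3,O4,O6], [O5,O2,O4,O7],
    [O4,O7,O6,O2], [O5,O7,O4,O4], [O7,O6,O4,O4], [O4,O7,O4,O6]], [[O1,O3,O7,O1], [O3,O2,O7,O1],
    [O1,O1,O7,O3], [O1,O3,O6,O3], [O7,O2,O6,O1], [O5,O3,O6,O2], [O5,O2,O6,O3], [O1,O1,O5,O7],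
    [O1,O3,O4,O7], [O7,O2,O4,O5], [O5,O3,O4,O6], [O5,O2,O4,O7], [O4,O7,O6,O2], [O5,O7,O4,O4],
    [O7,O6,O4,O4], [O4,O7,O4,O6]], [[O1,O3,O7,O1], [O3,O2,O7,O1], [O1,O1,O3,O7], [O5,O3,O6,O1],
    [O7,O2,O6,O1], [O5,O1,O2,O7], [O4,O3,O2,O7], [O1,O1,O7,O5], [O5,O3,O4,O5], [O7,O2,O4,O5],
    [O5,O1,O6,O5], [O4,O3,O6,O5], [O4,O7,O2,O6], [O5,O7,O4,O4], [O7,O6,O4,O4], [O4,O7,O6,O4]],
    [[O1,O3,O7,O1], [O3,O2,O7,O1], [O1,O1,O7,O3], [O5,O3,O6,O1], [O7,O2,O6,O1], [O5,O1,O6,O3],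
    [O4,O3,O6,O3], [O1,O1,O5,O7], [O5,O3,O4,O5], [O7,O2,O4,O5], [O5,O1,O4,O7], [O4,O3,O4,O7],
    [O4,O7,O6,O2], [O5,O7,O4,O4], [O7,O6,O4,O4], [O4,O7,O4,O6]], [[O1,O3,O1,O7], [O3,O2,O7,O1],
    [O1,O3,O7,O2], [O1,O2,O7,O3], [O7,O2,O6,O1], [O5,O3,O6,O2], [O5,O2,O6,O3], [O1,O3,O5,O6],
    [O1,O2,O5,O7], [O7,O2,O4,O5], [O5,O7,O4,O2], [O5,O2,O4,O7], [O4,O7,O6,O2], [O1,O7,O4,O6],
    [O7,O6,O4,O4], [O5,O6,O4,O6]], [[O1,O3,O5,O3], [O3,O2,O7,O1], [O1,O3,O7,O2], [O1,O2,O7,O3],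
    [O7,O2,O6,O1], [O5,O3,O6,O2], [O5,O2,O6,O3], [O1,O1,O5,O7], [O1,O3,O4,O7], [O7,O2,O4,O5],
    [O5,O7,O4,O2], [O5,O2,O4,O7], [O4,O7,O6,O2], [O1,O7,O4,O6], [O7,O6,O4,O4], [O5,O6,O4,O6]],
    [[O1,O3,O7,O1], [O3,O2,O7,O1], [O1,O1,O7,O3], [O1,O3,O6,O3], [O7,O2,O6,O1], [O5,O3,O6,O2],
    [O5,O2,O6,O3], [O1,O1,O5,O7], [O1,O3,O4,O7], [O7,O2,O4,O5], [O5,O7,O4,O2], [O5,O2,O4,O7],
    [O4,O7,O6,O2], [O1,O7,O4,O6], [O7,O6,O4,O4], [O5,O6,O4,O6]], [[O1,O3,O1,O7], [O3,O2,O7,O1],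
    [O1,O7,O3,O2], [O1,O2,O7,O3], [O7,O2,O6,O1], [O5,O7,O2,O2], [O5,O2,O6,O3], [O1,O7,O1,O6],
    [O1,O2,O5,O7], [O7,O2,O4,O5], [O1,O6,O7,O2], [O5,O2,O4,O7], [O5,O6,O6,O2], [O1,O6,O5,O6],
    [O7,O6,O4,O4], [O5,O6,O4,O6]], [[O1,O3,O1,O7], [O3,O2,O1,O7], [O5,O3,O1,O6], [O7,O2,O1,O6],
    [O2,O2,O7,O3], [O4,O7,O3,O2], [O6,O2,O7,O2], [O5,O7,O1,O4], [O7,O2,O5,O4], [O2,O2,O5,O7],
    [O4,O7,O1,O6], [O6,O2,O5,O6], [O4,O6,O7,O2], [O5,O6,O5,O4], [O7,O6,O4,O4], [O4,O6,O5,O6]],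
    [[O1,O3,O1,O7], [O3,O2,O1,O7], [O5,O7,O1,O2], [O7,O2,O1,O6], [O2,O2,O7,O3], [O4,O7,O3,O2],
    [O6,O2,O7,O2], [O1,O7,O1,O6], [O7,O2,O5,O4], [O2,O2,O5,O7], [O5,O6,O1,O6], [O6,O2,O5,O6],
    [O4,O6,O7,O2], [O5,O6,O5,O4], [O7,O6,O4,O4], [O4,O6,O5,O6]], [[O1,O3,O1,O7], [O7,O2,O1,O5],
    [O5,O3,O1,O6], [O5,O2,O1,O7], [O6,O2,O7,O1], [O4,O3,O7,O2], [O4,O2,O7,O3], [O5,O3,O5,O4],
    [O7,O2,O5,O4], [O6,O2,O5,O5], [O4,O3,O5,O6], [O4,O2,O5,O7], [O4,O7,O6,O2], [O5,O7,O4,O4],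
    [O7,O6,O4,O4], [O4,O7,O4,O6]], [[O1,O3,O1,O7], [O3,O2,O1,O7], [O5,O7,O1,O2], [O7,O2,O5,O2],
    [O2,O2,O7,O3], [O4,O7,O3,O2], [O6,O2,O7,O2], [O1,O7,O1,O6], [O3,O2,O5,O6], [O2,O2,O5,O7],
    [O5,O6,O5,O2], [O7,O2,O4,O6], [O4,O6,O7,O2], [O1,O6,O5,O6], [O7,O6,O4,O4], [O5,O6,O4,O6]]]"

definition nonreg_reps :: "octal list list list" where
  "nonreg_reps = [
    [[O1,O3,O3,O5], [O3,O2,O3,O5], [O1,O1,O3,O7], [O1,O3,O2,O7], [O3,O2,O2,O7], [O5,O3,O2,O6],
    [O7,O2,O2,O6], [O1,O7,O3,O4], [O3,O2,O7,O4], [O2,O2,O7,O5], [O5,O7,O2,O4], [O7,O2,O6,O4],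
    [O4,O7,O2,O6], [O1,O6,O7,O4], [O7,O6,O4,O4], [O5,O6,O6,O4]], [[O1,O3,O3,O5], [O3,O2,O7,O1],
    [O1,O1,O3,O7], [O1,O3,O2,O7], [O3,O2,O2,O7], [O5,O3,O2,O6], [O7,O2,O2,O6], [O1,O7,O3,O4],
    [O1,O2,O7,O5], [O3,O2,O6,O5], [O5,O7,O2,O4], [O7,O2,O6,O4], [O4,O7,O2,O6], [O1,O6,O7,O4],
    [O7,O6,O4,O4], [O5,O6,O6,O4]], [[O1,O3,O3,O5], [O3,O2,O3,O5], [O1,O1,O3,O7], [O1,O3,O2,O7],
    [O3,O2,O2,O7], [O5,O7,O2,O2], [O7,O2,O2,O6], [O1,O3,O7,O4], [O3,O2,O7,O4], [O2,O2,O7,O5],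
    [O1,O7,O2,O6], [O7,O2,O6,O4], [O5,O6,O2,O6], [O1,O7,O6,O4], [O7,O6,O4,O4], [O5,O6,O6,O4]],
    [[O1,O3,O3,O5], [O3,O2,O3,O5], [O1,O1,O3,O7], [O1,O3,O2,O7], [O3,O2,O2,O7], [O5,O7,O2,O2],
    [O7,O2,O2,O6], [O1,O7,O3,O4], [O3,O2,O7,O4], [O2,O2,O7,O5], [O1,O7,O2,O6], [O7,O2,O6,O4],
    [O5,O6,O2,O6], [O1,O6,O7,O4], [O7,O6,O4,O4], [O5,O6,O6,O4]], [[O1,O3,O3,O5], [O3,O2,O3,O5],
    [O1,O1,O3,O7], [O1,O3,O2,O7], [O7,O2,O2,O5], [O5,O7,O2,O2], [O5,O2,O2,O7], [O1,O7,O3,O4],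
    [O3,O2,O7,O4], [O2,O2,O7,O5], [O1,O7,O2,O6], [O7,O2,O6,O4], [O5,O6,O2,O6], [O1,O6,O7,O4],
    [O7,O6,O4,O4], [O5,O6,O6,O4]], [[O1,O3,O5,O3], [O3,O2,O5,O3], [O1,O3,O7,O2], [O3,O2,O7,O2],
    [O2,O2,O7,O3], [O5,O7,O2,O2], [O7,O2,O6,O2], [O1,O1,O5,O7], [O1,O3,O4,O7], [O3,O2,O4,O7],
    [O1,O7,O6,O2], [O7,O2,O4,O6], [O5,O6,O6,O2], [O1,O7,O4,O6], [O7,O6,O4,O4], [O5,O6,O4,O6]],
    [[O5,O3,O1,O5], [O7,O2,O1,O5], [O5,O1,O1,O7], [O4,O3,O1,O7], [O6,O2,O3,O5], [O4,O7,O3,O2],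
    [O4,O2,O3,O7], [O5,O7,O1,O4], [O7,O2,O5,O4], [O2,O2,O7,O5], [O4,O7,O1,O6], [O6,O2,O7,O4],
    [O4,O6,O3,O6], [O5,O6,O5,O4], [O7,O6,O4,O4], [O4,O6,O7,O4]]]"

text \<open>Solutions of the inequalities in \<open>lifts\<close>, one list for each entry of
  \<open>reg_reps\<close>.\<close>

definition heights :: "octal list list" where
  "heights = [
    [O0,O0,O0,O5,O0,O1,O0,O1,O2,O0,O2,O4], [O0,O1,O0,O5,O0,O2,O1,O0,O4,O0,O2,O5],
    [O2,O1,O0,O5,O0,O0,O2,O0,O5,O0,O4,O5], [O2,O4,O0,O5,O0,O2,O0,O0,O4,O0,O1,O5],
    [O1,O2,O0,O5,O0,O2,O1,O0,O5,O0,O3,O5], [O2,O1,O0,O3,O0,O0,O0,O0,O3,O0,O1,O2],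
    [O0,O0,O0,O5,O0,O5,O3,O0,O1,O0,O2,O5], [O2,O1,O0,O4,O0,O2,O1,O0,O2,O0,O2,O4],
    [O3,O1,O0,O5,O0,O2,O2,O0,O5,O0,O4,O5], [O2,O2,O0,O5,O0,O5,O3,O0,O2,O0,O4,O5],
    [O3,O3,O0,O5,O0,O4,O1,O0,O4,O0,O4,O5], [O4,O2,O0,O5,O0,O1,O1,O0,O5,O0,O2,O4],
    [O2,O1,O0,O5,O0,O5,O2,O0,O1,O0,O1,O5], [O1,O1,O0,O4,O0,O5,O2,O0,O0,O0,O0,O5],
    [O3,O3,O0,O4,O0,O5,O2,O0,O1,O0,O2,O4], [O3,O5,O0,O3,O0,O5,O3,O0,O1,O0,O0,O5],
    [O3,O3,O0,O3,O0,O3,O1,O0,O2,O0,O1,O2], [O1,O2,O0,O5,O0,O1,O0,O0,O3,O0,O3,O3],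
    [O2,O4,O0,O5,O0,O1,O1,O0,O5,O0,O4,O2], [O0,O3,O0,O4,O0,O0,O1,O0,O3,O0,O5,O3],
    [O1,O1,O0,O5,O0,O0,O1,O0,O5,O0,O4,O1], [O1,O2,O0,O2,O0,O1,O1,O0,O2,O0,O2,O1],
    [O0,O0,O0,O5,O0,O1,O0,O2,O3,O0,O0,O5], [O0,O0,O0,O5,O0,O2,O0,O4,O5,O1,O0,O5],
    [O1,O2,O0,O5,O0,O1,O0,O5,O5,O1,O0,O4], [O0,O4,O0,O5,O0,O3,O0,O1,O4,O1,O0,O5],
    [O1,O2,O0,O4,O0,O1,O0,O3,O5,O0,O0,O3], [O3,O3,O0,O5,O0,O4,O0,O3,O3,O2,O0,O4],
    [O2,O3,O0,O5,O0,O2,O0,O5,O5,O3,O0,O5], [O2,O5,O0,O5,O0,O5,O0,O4,O5,O1,O0,O4],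
    [O4,O2,O0,O4,O0,O5,O0,O0,O0,O1,O0,O5], [O5,O5,O0,O4,O0,O5,O0,O1,O0,O1,O0,O5],
    [O3,O3,O0,O3,O0,O3,O0,O1,O2,O1,O0,O2], [O3,O3,O0,O2,O0,O4,O0,O0,O0,O1,O0,O2],
    [O0,O2,O0,O5,O0,O0,O1,O0,O5,O0,O5,O0], [O0,O5,O0,O5,O0,O2,O0,O1,O3,O0,O0,O2],
    [O0,O4,O0,O5,O0,O3,O0,O4,O5,O0,O0,O1], [O1,O2,O0,O3,O0,O0,O0,O2,O4,O0,O0,O0],
    [O0,O5,O1,O3,O0,O0,O0,O0,O3,O1,O5,O0], [O0,O3,O0,O3,O0,O0,O0,O2,O4,O1,O2,O0],
    [O1,O5,O0,O5,O0,O5,O0,O3,O5,O1,O0,O2], [O2,O4,O0,O3,O0,O3,O0,O3,O3,O2,O0,O1],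
    [O0,O5,O0,O3,O0,O2,O0,O2,O5,O2,O0,O0], [O2,O4,O0,O2,O0,O4,O0,O2,O1,O2,O0,O1],
    [O0,O1,O2,O5,O0,O4,O2,O4,O0,O0,O1,O5], [O0,O2,O2,O2,O0,O5,O1,O5,O0,O0,O0,O4],
    [O0,O4,O3,O5,O0,O2,O0,O4,O0,O0,O3,O5], [O0,O2,O0,O4,O0,O5,O0,O5,O0,O1,O0,O5]]"

text \<open>In each pair the first matching belongs to the family and has the same ends as the second one, so
  it would have to be strictly lighter; but both sides cover every edge equally often.\<close>

definition farkas_pairs :: "(octal list \<times> octal list) list list" where
  "farkas_pairs = [

    [([O2,O0,O0,O2],[O4,O0,O0,O1]),([O0,O4,O1,O0],[O0,O1,O4,O0]),([O4,O2,O4,O0],[O2,O4,O2,O0]),([O0,O1,O2,O1],[O0,O2,O1,O2])],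
    [([O2,O0,O0,O2],[O4,O0,O0,O1]),([O0,O4,O1,O0],[O0,O1,O4,O0]),([O4,O2,O4,O0],[O2,O4,O2,O0]),([O0,O1,O2,O1],[O0,O2,O1,O2])],
    [([O4,O2,O4,O0],[O2,O4,O2,O0]),([O1,O4,O0,O2],[O4,O1,O0,O4]),([O2,O0,O1,O4],[O1,O0,O4,O1]),([O0,O1,O2,O1],[O0,O2,O1,O2])],
    [([O2,O0,O0,O2],[O4,O0,O0,O1]),([O0,O4,O1,O0],[O0,O1,O4,O0]),([O4,O2,O4,O0],[O2,O4,O2,O0]),([O0,O1,O2,O1],[O0,O2,O1,O2])],
    [([O4,O2,O4,O0],[O2,O4,O2,O0]),([O1,O4,O0,O2],[O4,O1,O0,O4]),([O2,O0,O1,O4],[O1,O0,O4,O1]),([O0,O1,O2,O1],[O0,O2,O1,O2])],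
    [([O1,O4,O2,O0],[O4,O1,O4,O0]),([O4,O2,O0,O4],[O2,O4,O0,O2]),([O2,O0,O1,O2],[O1,O0,O2,O1]),([O0,O1,O4,O1],[O0,O2,O1,O4])],
    [([O1,O2,O4,O0],[O2,O4,O1,O0]),([O4,O1,O0,O1],[O1,O2,O0,O2]),([O2,O0,O2,O4],[O4,O0,O4,O1]),([O0,O4,O1,O2],[O0,O1,O2,O4])]]"

text \<open>The leaves of the search in the order in which they are found: \<open>(a, b, w)\<close> stands for the image
  under \<open>w\<close> of representative number \<open>8a + b\<close>.\<close>

definition leaf_classes :: "(octal \<times> octal \<times> gen list) list" where
  "leaf_classes = [
    (O5,O3,[S2,S1]), (O4,O1,[S2,S3]), (O5,O0,[S2,S1]), (O4,O3,[S2,S1]), (O3,O7,[S2,S3]),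
    (O5,O1,[S2,S1]), (O4,O4,[S2,S1]), (O3,O6,[S2,S3]), (O5,O2,[S2,S1]), (O4,O5,[S2,S1]),
    (O4,O7,[S2,S3,S2,S1]), (O5,O6,[S1,S2,S3]), (O5,O4,[]), (O5,O7,[S2,S3]), (O5,O5,[]),
    (O4,O7,[S1,S2]), (O5,O4,[S3,S2,S1]), (O5,O5,[S3,S2,S1]), (O5,O6,[]), (O5,O7,[S1,S2,S3,S2,S1]),
    (O4,O6,[S3]), (O4,O7,[S1,S2,S3,S1,S2]), (O4,O1,[S2,S1]), (O4,O0,[S2,S1]), (O3,O5,[S2,S1]),
    (O3,O1,[S2,S1]), (O3,O4,[S1,S2,S3,S2,S1]), (O3,O3,[S1,S2,S3,S2,S1]), (O3,O2,[S2,S1]),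
    (O3,O0,[S1,S2,S3,S2,S1]), (O2,O7,[S1,S2,S3,S2,S1]), (O2,O6,[S1,S2,S3,S2,S1]), (O5,O0,[S2,S3]),
    (O3,O5,[S2,S3]), (O6,O6,[]), (O3,O3,[S2,S3]), (O3,O5,[S1,S2,S3,S2,S1]),
    (O3,O2,[S1,S2,S3,S2,S1]), (O3,O1,[S1,S2,S3,S2,S1]), (O5,O4,[S1,S2,S3]),
    (O5,O1,[S1,S2,S3,S2,S1]), (O5,O0,[S1,S2,S3,S2,S1]), (O4,O4,[S1,S2,S3,S2,S1]),
    (O4,O3,[S1,S2,S3,S2,S1]), (O3,O7,[S2,S1]), (O3,O4,[S3,S1,S2]), (O3,O3,[S2,S1]), (O2,O7,[S2,S1]),
    (O6,O5,[S2,S1]), (O3,O4,[S2,S1]), (O3,O0,[S2,S1]), (O3,O6,[S2,S1]), (O3,O0,[S3,S1,S2]),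
    (O3,O2,[S3,S1,S2]), (O2,O6,[S2,S1]), (O5,O1,[S2,S3]), (O3,O3,[S3,S1,S2]), (O3,O5,[S3,S1,S2]),
    (O3,O4,[S2,S3]), (O4,O0,[S3,S1,S2]), (O5,O6,[S2,S3,S1,S2]), (O3,O7,[S3,S1,S2]),
    (O4,O1,[S3,S1,S2]), (O5,O2,[S2,S3]), (O2,O7,[S3,S1,S2]), (O3,O1,[S3,S1,S2]), (O5,O6,[S3,S2,S1]),
    (O5,O1,[S3,S1,S2]), (O5,O2,[S3,S1,S2]), (O3,O7,[S1,S2,S3,S2,S1]), (O3,O6,[S1,S2,S3,S2,S1]),
    (O5,O7,[S2,S1]), (O4,O4,[S3,S1,S2]), (O4,O5,[S3,S1,S2]), (O5,O4,[S2,S3,S1,S2]),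
    (O5,O0,[S3,S1,S2]), (O4,O1,[S1,S2,S3,S2,S1]), (O4,O7,[S3]), (O5,O3,[S3,S1,S2]),
    (O5,O5,[S2,S3,S1,S2]), (O4,O3,[S3,S1,S2]), (O4,O3,[S2,S3]), (O3,O1,[S2,S3]), (O2,O7,[S2,S3]),
    (O2,O6,[S2,S3]), (O5,O5,[S1,S2,S3]), (O5,O2,[S1,S2,S3,S2,S1]), (O4,O5,[S1,S2,S3,S2,S1]),
    (O4,O4,[S2,S3]), (O3,O2,[S2,S3]), (O3,O0,[S2,S3]), (O5,O7,[S3,S1,S2]), (O3,O6,[S3,S1,S2]),
    (O4,O5,[S2,S3]), (O2,O6,[S3,S1,S2]), (O0,O1,[S3,S2,S1]), (O0,O6,[S1,S2,S3]), (O0,O7,[S3,S2,S1]),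
    (O1,O1,[S3,S2,S1]), (O1,O1,[S1,S2,S3]), (O2,O0,[S2,S1]), (O1,O0,[S1,S2,S3]), (O1,O6,[S3,S2,S1]),
    (O6,O0,[S1,S2,S3]), (O1,O2,[S2,S1]), (O1,O7,[S3,S2,S1]), (O0,O3,[S2,S1]), (O1,O2,[S1,S2,S3]),
    (O1,O6,[S2,S3]), (O6,O0,[S3,S1,S2,S1]), (O1,O0,[S3,S1,S2,S1]), (O1,O3,[S2,S3,S2]),
    (O2,O5,[S2,S1]), (O6,O1,[S2,S1]), (O1,O3,[S2,S1]), (O2,O1,[S2,S1]), (O0,O4,[S2,S1]),
    (O1,O4,[S2,S3]), (O0,O2,[S3,S1,S2,S1]), (O2,O1,[S3,S1,S2,S1]), (O0,O4,[S3,S1,S2,S1]),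
    (O2,O2,[S2,S1]), (O0,O5,[S2,S1]), (O0,O3,[S3,S2,S1]), (O1,O7,[S2,S1]), (O1,O2,[S3,S2,S1]),
    (O6,O0,[S1,S2,S3,S2]), (O1,O6,[S2,S1]), (O1,O0,[S1,S2,S3,S2]), (O2,O0,[S3,S2,S1]),
    (O1,O1,[S1,S2,S3,S2]), (O1,O1,[S2,S1]), (O0,O7,[S2,S1]), (O0,O6,[S1,S2,S3,S2]), (O0,O1,[S2,S1]),
    (O6,O4,[S2,S1]), (O6,O3,[S2,S3]), (O6,O3,[S2,S1]), (O6,O2,[S2,S1]), (O1,O2,[S2,S3,S2]),
    (O1,O6,[S1,S2,S3,S2]), (O6,O0,[S2,S1]), (O1,O0,[S2,S1]), (O1,O4,[S1,S2,S3,S2]), (O0,O2,[S2,S1]),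
    (O0,O2,[S3,S2,S1]), (O1,O4,[S1,S2,S3]), (O1,O0,[S3,S2,S1]), (O6,O0,[S3,S2,S1]),
    (O1,O6,[S1,S2,S3]), (O1,O2,[S2,S3]), (O6,O2,[S1,S2,S1]), (O6,O3,[S1,S2,S1]), (O6,O3,[S2,S3,S2]),
    (O6,O4,[S1,S2,S1]), (O2,O0,[S1,S2,S1]), (O1,O1,[S2,S3]), (O1,O1,[S3,S1,S2,S1]), (O0,O7,[S2,S3]),
    (O1,O0,[S2,S3,S2]), (O1,O6,[S1,S2,S1]), (O6,O0,[S2,S3,S2]), (O1,O2,[S3,S1,S2,S1]),
    (O0,O6,[S2,S3]), (O0,O1,[S3,S1,S2,S1]), (O1,O7,[S1,S2,S1]), (O0,O3,[S3,S1,S2,S1]),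
    (O0,O4,[S3,S2,S1]), (O2,O1,[S3,S2,S1]), (O1,O3,[S1,S2,S1]), (O6,O1,[S2,S3]), (O2,O5,[S2,S3]),
    (O1,O3,[S2,S3]), (O1,O0,[S1,S2,S1]), (O6,O0,[S1,S2,S1]), (O1,O6,[S2,S3,S2]),
    (O1,O2,[S1,S2,S3,S2]), (O1,O2,[S1,S2,S1]), (O6,O0,[S2,S3]), (O1,O6,[S3,S1,S2,S1]),
    (O1,O0,[S2,S3]), (O0,O7,[S1,S2,S1]), (O1,O1,[S1,S2,S1]), (O1,O1,[S2,S3,S2]),
    (O2,O0,[S3,S1,S2,S1]), (O0,O5,[S1,S2,S1]), (O2,O2,[S1,S2,S1]), (O0,O4,[S1,S2,S1]),
    (O2,O1,[S1,S2,S1]), (O0,O2,[S1,S2,S1]), (O1,O4,[S2,S3,S2]), (O0,O3,[S1,S2,S1]),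
    (O1,O7,[S3,S1,S2,S1]), (O0,O1,[S1,S2,S1]), (O0,O6,[S2,S3,S2]), (O1,O5,[S2,S1]), (O1,O4,[S2,S1]),
    (O0,O2,[S1,S2,S3,S2]), (O0,O6,[S2,S1]), (O0,O1,[S1,S2,S3,S2]), (O0,O0,[S2,S1]),
    (O2,O3,[S1,S2,S3,S2]), (O2,O1,[S1,S2,S3,S2]), (O0,O4,[S1,S2,S3,S2]), (O1,O7,[S2,S3,S2]),
    (O0,O3,[S1,S2,S3,S2]), (O2,O4,[S1,S2,S1]), (O2,O3,[S1,S2,S1]), (O1,O5,[S2,S3,S2]),
    (O0,O4,[S2,S3,S2]), (O2,O1,[S2,S3,S2]), (O2,O3,[S2,S1]), (O2,O3,[S2,S3,S2]), (O2,O4,[S2,S1]),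
    (O0,O3,[S2,S3,S2]), (O1,O7,[S1,S2,S3,S2]), (O1,O5,[S1,S2,S3,S2]), (O0,O2,[S2,S3,S2]),
    (O1,O4,[S1,S2,S1]), (O1,O5,[S1,S2,S1]), (O0,O1,[S2,S3,S2]), (O0,O6,[S1,S2,S1]),
    (O0,O0,[S1,S2,S1]), (O0,O0,[S3,S2,S1]), (O0,O1,[S1,S2,S3]), (O0,O6,[S3,S2,S1]),
    (O0,O2,[S1,S2,S3]), (O1,O4,[S3,S2,S1]), (O1,O5,[S3,S2,S1]), (O0,O3,[S1,S2,S3]), (O1,O7,[S2,S3]),
    (O0,O4,[S1,S2,S3]), (O2,O1,[S1,S2,S3]), (O2,O3,[S1,S2,S3]), (O1,O5,[S2,S3]),
    (O2,O3,[S3,S1,S2,S1]), (O2,O4,[S3,S1,S2,S1]), (O0,O5,[S2,S3,S2]), (O2,O2,[S2,S3,S2]),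
    (O2,O4,[S1,S2,S3]), (O2,O4,[S2,S3,S2]), (O4,O2,[S2,S1]), (O1,O5,[S1,S2,S3]), (O1,O7,[S1,S2,S3]),
    (O0,O3,[S2,S3]), (O0,O6,[S3,S1,S2,S1]), (O0,O1,[S2,S3]), (O0,O0,[S2,S3]), (O2,O3,[S3,S2,S1]),
    (O2,O1,[S2,S3]), (O0,O4,[S2,S3]), (O1,O4,[S3,S1,S2,S1]), (O0,O2,[S2,S3]), (O2,O4,[S3,S2,S1]),
    (O2,O3,[S2,S3]), (O1,O5,[S3,S1,S2,S1]), (O2,O4,[S1,S2,S3,S2]), (O2,O2,[S2,S3]), (O0,O5,[S2,S3]),
    (O4,O2,[S2,S3]), (O2,O4,[S2,S3])]"

text \<open>One word for each element of the symmetric group, by increasing length.\<close>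

definition perm_words :: "gen list list" where
  "perm_words = [
    [], [S1], [S2], [S3], [S1,S2], [S2,S1], [S2,S3], [S3,S1], [S3,S2], [S1,S2,S1], [S1,S2,S3],
    [S2,S3,S1], [S2,S3,S2], [S3,S1,S2], [S3,S2,S1], [S1,S2,S3,S1], [S1,S2,S3,S2], [S2,S3,S1,S2],
    [S2,S3,S2,S1], [S3,S1,S2,S1], [S1,S2,S3,S1,S2], [S1,S2,S3,S2,S1], [S2,S3,S1,S2,S1],
    [S1,S2,S3,S1,S2,S1]]"

text \<open>The ordered sums of four numbers between 1 and 3 with value 7.\<close>

definition degs :: "octal list list" where
  "degs = [
    [O1,O1,O2,O3], [O1,O1,O3,O2], [O1,O2,O1,O3], [O1,O2,O2,O2], [O1,O2,O3,O1], [O1,O3,O1,O2],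
    [O1,O3,O2,O1], [O2,O1,O1,O3], [O2,O1,O2,O2], [O2,O1,O3,O1], [O2,O2,O1,O2], [O2,O2,O2,O1],
    [O2,O3,O1,O1], [O3,O1,O1,O2], [O3,O1,O2,O1], [O3,O2,O1,O1]]"

text \<open>Orders of the stabilisers in \<open>S_4\<close>, which divide 24 into the sizes of the
  orbits.\<close>

definition reg_stabs :: "octal list" where
  "reg_stabs = [
    O2, O1, O1, O1, O1, O2, O1, O2, O1, O1, O1, O2, O1, O1, O1, O1, O2, O1, O2, O1, O1, O4, O1,
    O1, O1, O1, O1, O1, O1, O1, O1, O1, O2, O1, O4, O1, O1, O1, O4, O1, O1, O1, O1, O2, O1, O1,
    O1, O1]"

definition nonreg_stabs :: "octal list" where
  "nonreg_stabs = [O1,O4,O4,O2,O4,O4,O4]"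

section \<open>Basic programs on bit lists\<close>

fun row_bits :: "octal \<Rightarrow> bool list \<Rightarrow> bool list" where
  "row_bits O0 xs = False # False # False # xs"
| "row_bits O1 xs = False # False # True # xs"
| "row_bits O2 xs = False # True # False # xs"
| "row_bits O3 xs = False # True # True # xs"
| "row_bits O4 xs = True # False # False # xs"
| "row_bits O5 xs = True # False # True # xs"
| "row_bits O6 xs = True # True # False # xs"
| "row_bits O7 xs = True # True # True # xs"

fun bits_of :: "octal list \<Rightarrow> bool list" where
  "bits_of [] = []"
| "bits_of (x # xs) = row_bits x (bits_of xs)"

fun oct_nat :: "octal \<Rightarrow> nat" where
  "oct_nat O0 = 0"
| "oct_nat O1 = Suc 0"
| "oct_nat O2 = Suc (Suc 0)"
| "oct_nat O3 = Suc (Suc (Suc 0))"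
| "oct_nat O4 = Suc (Suc (Suc (Suc 0)))"
| "oct_nat O5 = Suc (Suc (Suc (Suc (Suc 0))))"
| "oct_nat O6 = Suc (Suc (Suc (Suc (Suc (Suc 0)))))"
| "oct_nat O7 = Suc (Suc (Suc (Suc (Suc (Suc (Suc 0))))))"

fun subvec :: "bool list \<Rightarrow> bool list \<Rightarrow> bool" where
  "subvec [] ys = True"
| "subvec (x # xs) [] = True"
| "subvec (True # xs) (True # ys) = subvec xs ys"
| "subvec (True # xs) (False # ys) = False"
| "subvec (False # xs) (y # ys) = subvec xs ys"

fun beq :: "bool list \<Rightarrow> bool list \<Rightarrow> bool" where
  "beq [] [] = True"
| "beq [] (y # ys) = False"
| "beq (x # xs) [] = False"
| "beq (True # xs) (True # ys) = beq xs ys"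
| "beq (False # xs) (False # ys) = beq xs ys"
| "beq (True # xs) (False # ys) = False"
| "beq (False # xs) (True # ys) = False"

fun keep_if :: "bool \<Rightarrow> 'a \<Rightarrow> 'a list \<Rightarrow> 'a list" where
  "keep_if True x xs = x # xs"
| "keep_if False x xs = xs"

primrec select :: "('a \<Rightarrow> bool) \<Rightarrow> 'a list \<Rightarrow> 'a list" where
  "select P [] = []"
| "select P (x # xs) = keep_if (P x) x (select P xs)"

fun some_or :: "bool \<Rightarrow> ('a \<Rightarrow> bool) \<Rightarrow> 'a list \<Rightarrow> bool"
  and some_in :: "('a \<Rightarrow> bool) \<Rightarrow> 'a list \<Rightarrow> bool" where
  "some_or True P xs = True"
| "some_or False P xs = some_in P xs"
| "some_in P [] = False"
| "some_in P (x # xs) = some_or (P x) P xs"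

fun all_and :: "bool \<Rightarrow> ('a \<Rightarrow> bool) \<Rightarrow> 'a list \<Rightarrow> bool"
  and all_in :: "('a \<Rightarrow> bool) \<Rightarrow> 'a list \<Rightarrow> bool" where
  "all_and True P xs = all_in P xs"
| "all_and False P xs = False"
| "all_in P [] = True"
| "all_in P (x # xs) = all_and (P x) P xs"

fun short :: "'a list \<Rightarrow> bool" where
  "short [] = True"
| "short [x] = True"
| "short (x # y # xs) = False"

fun count_true :: "bool list \<Rightarrow> nat" where
  "count_true [] = 0"
| "count_true (True # xs) = Suc (count_true xs)"
| "count_true (False # xs) = count_true xs"

section \<open>Enumeration of the trees and the search\<close>

definition groups :: "bool list list list" where
  "groups = map (map bits_of) match_groups"

fun column_sets :: "octal \<Rightarrow> bool list list" where
  "column_sets O1 = [[True, False, False], [False, True, False], [False, False, True]]"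
| "column_sets O2 = [[True, True, False], [True, False, True], [False, True, True]]"
| "column_sets O3 = [[True, True, True]]"
| "column_sets _ = []"

text \<open>In these patterns the letter is the left vertex and the digit the right one:
  \<open>b3\<close> is the edge from 2 to 3. The columns collect equal digits, the result is ordered
  by letters as in \<open>labels\<close>.\<close>

fun from_columns :: "bool list \<Rightarrow> bool list \<Rightarrow> bool list \<Rightarrow> bool list \<Rightarrow> bool list" where
  "from_columns [b1, c1, d1] [a2, c2, d2] [a3, b3, d3] [a4, b4, c4] =
     [a2, a3, a4, b1, b3, b4, c1, c2, c4, d1, d2, d3]"
| "from_columns _ _ _ _ = []"

fun edge_sets :: "octal list \<Rightarrow> bool list list" where
  "edge_sets [p, q, r, s] = concat (map (\<lambda>a. concat (map (\<lambda>b. concat (map (\<lambda>c.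
     map (\<lambda>d. from_columns a b c d) (column_sets s)) (column_sets r))) (column_sets q))) (column_sets p))"
| "edge_sets _ = []"

definition acyclic_bits :: "bool list \<Rightarrow> bool" where
  "acyclic_bits x = all_in (\<lambda>g. short (select (\<lambda>m. subvec m x) g)) groups"

fun index_step :: "bool \<Rightarrow> nat \<Rightarrow> nat" where
  "index_step True n = Suc 0"
| "index_step False 0 = 0"
| "index_step False (Suc n) = Suc (Suc n)"

primrec index_of :: "bool list list \<Rightarrow> bool list \<Rightarrow> nat" where
  "index_of [] x = 0"
| "index_of (l # ls) x = index_step (subvec l x) (index_of ls x)"

definition point_bits :: "bool list list list" where
  "point_bits = map (map bits_of) point_labels"

definition tree_classes :: "(bool list \<times> nat list) list list" where
  "tree_classes = map (\<lambda>r. map (\<lambda>x. (x, map (\<lambda>ls. index_of ls x) point_bits)) (select acyclic_bits (edge_sets r))) degs"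

fun same_index :: "nat \<Rightarrow> nat \<Rightarrow> bool" where
  "same_index 0 0 = True"
| "same_index 0 (Suc l) = False"
| "same_index (Suc k) 0 = False"
| "same_index (Suc k) (Suc l) = same_index k l"

text \<open>The chosen position \<open>k\<close> counts from 0, the stored index from 1, hence the
  shift; a tree containing no expression of the point is never excluded.\<close>

fun allowed :: "nat \<Rightarrow> nat \<Rightarrow> bool" where
  "allowed k 0 = True"
| "allowed k (Suc l) = same_index k l"

fun restrict_class :: "nat \<Rightarrow> ('a \<times> nat list) list \<Rightarrow> ('a \<times> nat list) list" where
  "restrict_class k [] = []"
| "restrict_class k ((x, []) # ts) = (x, []) # restrict_class k ts"
| "restrict_class k ((x, l # ls) # ts) = keep_if (allowed k l) (x, ls) (restrict_class k ts)"

text \<open>The empty list marks a class that does not hold exactly one tree. As trees have twelve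
  bits, the marker cannot be confused with one.\<close>

fun leaf_of :: "('a list \<times> nat list) list list \<Rightarrow> 'a list list" where
  "leaf_of [] = []"
| "leaf_of ([] # cs) = [] # leaf_of cs"
| "leaf_of ([(x, ls)] # cs) = x # leaf_of cs"
| "leaf_of ((t # u # ts) # cs) = [] # leaf_of cs"

text \<open>A class without remaining trees cannot be completed; the empty state then ends the
  branch.\<close>

fun restrict_or_stop :: "('a list \<times> nat list) list \<Rightarrow> nat \<Rightarrow> ('a list \<times> nat list) list list
      \<Rightarrow> ('a list \<times> nat list) list list \<Rightarrow> ('a list \<times> nat list) list list"
  and restrict_all :: "nat \<Rightarrow> ('a list \<times> nat list) list list \<Rightarrow> ('a list \<times> nat list) list list
      \<Rightarrow> ('a list \<times> nat list) list list" where
  "restrict_or_stop [] k cs acc = []"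
| "restrict_or_stop (t # ts) k cs acc = restrict_all k cs ((t # ts) # acc)"
| "restrict_all k [] acc = acc"
| "restrict_all k (c # cs) acc = restrict_or_stop (restrict_class k c) k cs acc"

text \<open>A state contains, for every vector of right degrees, the trees that are still possible; each tree
  carries the positions of its expressions of the lattice points not yet treated, counted from
  \<open>1\<close>, with \<open>0\<close> if it has none.\<close>

function branch :: "nat list \<Rightarrow> nat list list \<Rightarrow> ('a list \<times> nat list) list list \<Rightarrow> 'a list list list"
  and search :: "nat list list \<Rightarrow> ('a list \<times> nat list) list list \<Rightarrow> 'a list list list" where
  "branch [] kss C = []"
| "branch (k # ks) kss C = search kss (restrict_all k C []) @ branch ks kss C"
| "search kss [] = []"
| "search [] (c # cs) = [leaf_of (c # cs)]"
| "search (ks # kss) (c # cs) = branch ks kss (c # cs)"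
  by pat_completeness auto
termination
  by (relation "measures [\<lambda>s. case s of Inl (ks, kss, C) \<Rightarrow> 2 * length kss + 1 | Inr (kss, C) \<Rightarrow> 2 * length kss,
        \<lambda>s. case s of Inl (ks, kss, C) \<Rightarrow> length ks | Inr (kss, C) \<Rightarrow> 0]") auto

primrec upto_from :: "'a list \<Rightarrow> nat \<Rightarrow> nat list" where
  "upto_from [] n = []"
| "upto_from (x # xs) n = n # upto_from xs (Suc n)"

primrec branch_lists :: "'a list list \<Rightarrow> nat list list" where
  "branch_lists [] = []"
| "branch_lists (l # ls) = upto_from l 0 # branch_lists ls"

text \<open>By symmetry the first point needs two of its nine positions only; see
  \<open>conj_words\<close>.\<close>

definition search_lists :: "nat list list" where
  "search_lists = [0, Suc 0] # tl (branch_lists point_labels)"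

definition leaves :: "bool list list list" where
  "leaves = search search_lists tree_classes"

text \<open>Letters and digits undergo the same transposition, and the result is put back into the
  order of \<open>labels\<close>.\<close>

fun act_gen :: "gen \<Rightarrow> bool list \<Rightarrow> bool list" where
  "act_gen S1 [a2,a3,a4,b1,b3,b4,c1,c2,c4,d1,d2,d3] = [b1,b3,b4,a2,a3,a4,c2,c1,c4,d2,d1,d3]"
| "act_gen S2 [a2,a3,a4,b1,b3,b4,c1,c2,c4,d1,d2,d3] = [a3,a2,a4,c1,c2,c4,b1,b3,b4,d1,d3,d2]"
| "act_gen S3 [a2,a3,a4,b1,b3,b4,c1,c2,c4,d1,d2,d3] = [a2,a4,a3,b1,b4,b3,d1,d2,d3,c1,c2,c4]"
| "act_gen _ xs = xs"

primrec act_word :: "gen list \<Rightarrow> bool list \<Rightarrow> bool list" where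
  "act_word [] x = x"
| "act_word (g # gs) x = act_gen g (act_word gs x)"

primrec member :: "bool list \<Rightarrow> bool list list \<Rightarrow> bool" where
  "member x [] = False"
| "member x (y # ys) = some_or (beq x y) (beq x) ys"

fun subset_of :: "bool list list \<Rightarrow> bool list list \<Rightarrow> bool" where
  "subset_of xs ys = all_in (\<lambda>x. member x ys) xs"

text \<open>Lookup by one octal digit. The default stays inside a nonempty list, so membership of
  the result does not depend on the digit.\<close>

fun oct_nth :: "octal \<Rightarrow> 'a list \<Rightarrow> 'a" where
  "oct_nth O0 (x # xs) = x"
| "oct_nth O1 (x0 # x # xs) = x"
| "oct_nth O2 (x0 # x1 # x # xs) = x"
| "oct_nth O3 (x0 # x1 # x2 # x # xs) = x"
| "oct_nth O4 (x0 # x1 # x2 # x3 # x # xs) = x"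
| "oct_nth O5 (x0 # x1 # x2 # x3 # x4 # x # xs) = x"
| "oct_nth O6 (x0 # x1 # x2 # x3 # x4 # x5 # x # xs) = x"
| "oct_nth O7 (x0 # x1 # x2 # x3 # x4 # x5 # x6 # x # xs) = x"
| "oct_nth _ xs = hd xs"

text \<open>Blocks of eight, so that entry 8a + b is reached by two lookups.\<close>

primrec chunk8_step :: "'a list \<Rightarrow> 'a list \<Rightarrow> octal \<Rightarrow> 'a list list" where
  "chunk8_step [] acc n = [rev acc]"
| "chunk8_step (x # xs) acc n = (case n of O7 \<Rightarrow> rev (x # acc) # chunk8_step xs [] O0
     | O0 \<Rightarrow> chunk8_step xs (x # acc) O1 | O1 \<Rightarrow> chunk8_step xs (x # acc) O2 | O2 \<Rightarrow> chunk8_step xs (x # acc) O3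
     | O3 \<Rightarrow> chunk8_step xs (x # acc) O4 | O4 \<Rightarrow> chunk8_step xs (x # acc) O5 | O5 \<Rightarrow> chunk8_step xs (x # acc) O6
     | O6 \<Rightarrow> chunk8_step xs (x # acc) O7)"

definition reg_bits :: "bool list list list" where
  "reg_bits = map (map bits_of) reg_reps"

definition nonreg_bits :: "bool list list list" where
  "nonreg_bits = map (map bits_of) nonreg_reps"

text \<open>The one-element list turns \<open>all_and\<close> into a conjunction whose second part
  is evaluated only if the first one holds.\<close>

fun set_eq :: "bool list list \<Rightarrow> bool list list \<Rightarrow> bool" where
  "set_eq xs ys = all_and (subset_of xs ys) (\<lambda>_. subset_of ys xs) [()]"

fun all2 :: "('a \<Rightarrow> 'b \<Rightarrow> bool) \<Rightarrow> 'a list \<Rightarrow> 'b list \<Rightarrow> bool" where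
  "all2 P [] [] = True"
| "all2 P (x # xs) (y # ys) = (P x y \<and> all2 P xs ys)"
| "all2 P [] (y # ys) = False"
| "all2 P (x # xs) [] = False"

fun leaf_ok :: "bool list list list list \<Rightarrow> bool list list \<Rightarrow> octal \<times> octal \<times> gen list \<Rightarrow> bool" where
  "leaf_ok tab l (a, b, w) = set_eq l (map (act_word w) (oct_nth b (oct_nth a tab)))"

definition leaves_ok :: bool where
  "leaves_ok = all2 (leaf_ok (chunk8_step (reg_bits @ nonreg_bits) [] O0)) leaves leaf_classes"

text \<open>The nine expressions of the first point are the fixed-point-free permutations of four
  indices, and relabelling acts on them by conjugation. The first two represent the two classes, the
  4-cycles and the products of two transpositions; the words conjugate each expression to one of
  them.\<close>

definition conj_words :: "gen list list" where
  "conj_words = [[], [], [S3], [S1], [S2], [S2], [S3,S1], [S2,S1], [S2,S1]]"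

section \<open>Tests for the representatives\<close>

definition is_face :: "bool list list \<Rightarrow> bool list \<Rightarrow> bool" where
  "is_face R m = some_in (subvec m) R"

definition unique_match :: "bool list list \<Rightarrow> bool list list \<Rightarrow> bool" where
  "unique_match R g = short (select (is_face R) g)"

definition seven :: "bool list \<Rightarrow> bool" where
  "seven x = same_index (count_true x) (Suc (Suc (Suc (Suc (Suc (Suc (Suc 0)))))))"

primrec cons_all :: "bool \<Rightarrow> bool list list \<Rightarrow> bool list list" where
  "cons_all b [] = []"
| "cons_all b (x # xs) = (b # x) # cons_all b xs"

fun dels :: "bool list \<Rightarrow> bool list list" where
  "dels [] = []"
| "dels (True # xs) = (False # xs) # cons_all True (dels xs)"
| "dels (False # xs) = cons_all False (dels xs)"

fun shared :: "bool list \<Rightarrow> bool list \<Rightarrow> bool list list \<Rightarrow> bool"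
  and shared_if :: "bool \<Rightarrow> bool list \<Rightarrow> bool list \<Rightarrow> bool list \<Rightarrow> bool list list \<Rightarrow> bool"
  and shared_unless :: "bool \<Rightarrow> bool list \<Rightarrow> bool list \<Rightarrow> bool list list \<Rightarrow> bool" where
  "shared d t [] = False"
| "shared d t (u # us) = shared_if (subvec d u) d t u us"
| "shared_if False d t u us = shared d t us"
| "shared_if True d t u us = shared_unless (beq u t) d t us"
| "shared_unless False d t us = True"
| "shared_unless True d t us = shared d t us"

text \<open>The maximal boundary sets, four of each kind: a left vertex omitted, a right vertex
  omitted, all edges touching an index \<open>j\<close>.\<close>

definition boundary_masks :: "bool list list" where
  "boundary_masks = map bits_of
    [[O0,O7,O7,O7], [O7,O0,O7,O7], [O7,O7,O0,O7], [O7,O7,O7,O0],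
     [O7,O3,O3,O3], [O3,O7,O5,O5], [O5,O5,O7,O6], [O6,O6,O6,O7],
     [O7,O4,O4,O4], [O4,O7,O2,O2], [O2,O2,O7,O1], [O1,O1,O1,O7]]"

fun facet_ok_or :: "bool \<Rightarrow> bool list \<Rightarrow> bool" where
  "facet_ok_or True d = True"
| "facet_ok_or False d = some_in (subvec d) boundary_masks"

definition facet_ok :: "bool list list \<Rightarrow> bool list \<Rightarrow> bool list \<Rightarrow> bool" where
  "facet_ok R t d = facet_ok_or (shared d t R) d"

definition tree_facets_ok :: "bool list list \<Rightarrow> bool list \<Rightarrow> bool" where
  "tree_facets_ok R t = all_in (facet_ok R t) (dels t)"

definition good_rep :: "bool list list \<Rightarrow> bool" where
  "good_rep R = (all_in seven R \<and> all_in (unique_match R) groups \<and> all_in (tree_facets_ok R) R)"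

fun weight :: "bool list \<Rightarrow> nat list \<Rightarrow> nat \<Rightarrow> nat" where
  "weight (True # xs) (w # ws) acc = weight xs ws (w + acc)"
| "weight (False # xs) (w # ws) acc = weight xs ws acc"
| "weight _ _ acc = acc"

fun lt :: "nat \<Rightarrow> nat \<Rightarrow> bool" where
  "lt 0 0 = False"
| "lt 0 (Suc n) = True"
| "lt (Suc m) 0 = False"
| "lt (Suc m) (Suc n) = lt m n"

fun lighter_or :: "bool \<Rightarrow> nat list \<Rightarrow> nat \<Rightarrow> bool list \<Rightarrow> bool" where
  "lighter_or True ws k n = True"
| "lighter_or False ws k n = lt k (weight n ws 0)"

definition lighter :: "nat list \<Rightarrow> bool list \<Rightarrow> nat \<Rightarrow> bool list \<Rightarrow> bool" where
  "lighter ws m k n = lighter_or (beq m n) ws k n"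

definition lightest :: "nat list \<Rightarrow> bool list list \<Rightarrow> bool list \<Rightarrow> bool" where
  "lightest ws g m = all_in (lighter ws m (weight m ws 0)) g"

definition group_lifted :: "bool list list \<Rightarrow> nat list \<Rightarrow> bool list list \<Rightarrow> bool" where
  "group_lifted R ws g = all_in (lightest ws g) (select (is_face R) g)"

definition lifted :: "bool list list \<Rightarrow> octal list \<Rightarrow> bool" where
  "lifted R ws = all_in (group_lifted R (map oct_nat ws)) groups"

fun tally :: "bool list \<Rightarrow> nat list \<Rightarrow> nat list" where
  "tally (True # xs) (n # ns) = Suc n # tally xs ns"
| "tally (False # xs) (n # ns) = n # tally xs ns"
| "tally _ _ = []"

fun tallies :: "octal list list \<Rightarrow> nat list" where
  "tallies [] = [0,0,0,0,0,0,0,0,0,0,0,0]"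
| "tallies (x # xs) = tally (bits_of x) (tallies xs)"

fun farkas_pair :: "bool list list \<Rightarrow> octal list \<times> octal list \<Rightarrow> bool" where
  "farkas_pair R (m, n) = (is_face R (bits_of m) \<and> \<not> beq (bits_of m) (bits_of n)
     \<and> some_in (subset_of [bits_of m, bits_of n]) groups)"

definition farkas :: "bool list list \<Rightarrow> (octal list \<times> octal list) list \<Rightarrow> bool" where
  "farkas R ps = (all_in (farkas_pair R) ps \<and> tallies (map fst ps) = tallies (map snd ps) \<and> \<not> short ps)"

fun ov :: "bool \<Rightarrow> bool \<Rightarrow> int" where
  "ov True True = 1"
| "ov True False = 0"
| "ov False b = 0"

fun overlap :: "bool list \<Rightarrow> bool list \<Rightarrow> int" where
  "overlap (x1 # x2 # x3 # xs) (y1 # y2 # y3 # ys) = (1 + ov x1 y1 + ov x2 y2 + ov x3 y3) * overlap xs ys"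
| "overlap _ _ = 1"

primrec overlap_sum :: "bool list list \<Rightarrow> bool list \<Rightarrow> int" where
  "overlap_sum [] t = 0"
| "overlap_sum (u # us) t = overlap t u + overlap_sum us t"

definition square :: "int \<Rightarrow> int" where
  "square k = k * k"

primrec square_sum :: "bool list list \<Rightarrow> bool list list \<Rightarrow> int" where
  "square_sum R [] = 0"
| "square_sum R (t # ts) = square (overlap_sum R t) + square_sum R ts"

definition invariant :: "bool list list \<Rightarrow> int" where
  "invariant R = square_sum R R"

text \<open>An inclusion suffices, because a permutation preserves the number of trees.\<close>

definition fixes_rep :: "bool list list \<Rightarrow> gen list \<Rightarrow> bool" where
  "fixes_rep R w = subset_of (map (act_word w) R) R"

definition stab_ok :: "bool list list \<Rightarrow> octal \<Rightarrow> bool" where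
  "stab_ok R s = same_index (length (select (fixes_rep R) perm_words)) (oct_nat s)"

section \<open>Tests for the tables\<close>

definition row_choices :: "bool list list" where
  "row_choices = [[False, False, False], [True, False, False], [False, True, False], [False, False, True]]"

fun three_short :: "bool \<Rightarrow> bool \<Rightarrow> bool \<Rightarrow> bool" where
  "three_short True True b = False"
| "three_short True False b = (\<not> b)"
| "three_short False True b = (\<not> b)"
| "three_short False False b = True"

fun columns_short :: "bool list \<Rightarrow> bool" where
  "columns_short [a2,a3,a4,b1,b3,b4,c1,c2,c4,d1,d2,d3] =
     (three_short b1 c1 d1 \<and> three_short a2 c2 d2 \<and> three_short a3 b3 d3 \<and> three_short a4 b4 c4)"
| "columns_short _ = False"

fun ends :: "bool list \<Rightarrow> bool list" where
  "ends [a2,a3,a4,b1,b3,b4,c1,c2,c4,d1,d2,d3] =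
    [a2 \<or> a3 \<or> a4, b1 \<or> b3 \<or> b4, c1 \<or> c2 \<or> c4, d1 \<or> d2 \<or> d3,
     b1 \<or> c1 \<or> d1, a2 \<or> c2 \<or> d2, a3 \<or> b3 \<or> d3, a4 \<or> b4 \<or> c4]"
| "ends _ = []"

definition matchings :: "bool list list" where
  "matchings = select columns_short (concat (map (\<lambda>a. concat (map (\<lambda>b. concat (map (\<lambda>c.
     map (\<lambda>d. a @ b @ c @ d) row_choices) row_choices)) row_choices)) row_choices))"

fun grouped_if :: "bool \<Rightarrow> bool list \<Rightarrow> bool list \<Rightarrow> bool"
  and grouped_unless :: "bool \<Rightarrow> bool list \<Rightarrow> bool list \<Rightarrow> bool" where
  "grouped_if False m n = True"
| "grouped_if True m n = grouped_unless (beq m n) m n"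
| "grouped_unless True m n = True"
| "grouped_unless False m n = some_in (subset_of [m, n]) groups"

fun grouped :: "bool list \<times> bool list \<Rightarrow> bool list \<times> bool list \<Rightarrow> bool" where
  "grouped (m, em) (n, en) = grouped_if (beq em en) m n"

primrec with_ends :: "bool list list \<Rightarrow> (bool list \<times> bool list) list" where
  "with_ends [] = []"
| "with_ends (m # ms) = (m, ends m) # with_ends ms"

definition all_grouped :: "(bool list \<times> bool list) list \<Rightarrow> bool list \<times> bool list \<Rightarrow> bool" where
  "all_grouped ms m = all_in (grouped m) ms"

text \<open>The completeness of \<open>match_groups\<close>, by comparing all pairs of
  matchings.\<close>

definition matchings_grouped :: bool where
  "matchings_grouped = all_in (all_grouped (with_ends matchings)) (with_ends matchings)"

fun twelve :: "bool list \<Rightarrow> bool" where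
  "twelve [a2,a3,a4,b1,b3,b4,c1,c2,c4,d1,d2,d3] = True"
| "twelve _ = False"

fun uniq :: "bool list list \<Rightarrow> bool" where
  "uniq [] = True"
| "uniq (x # xs) = (\<not> member x xs \<and> uniq xs)"

definition rep_shape :: "bool list list \<Rightarrow> bool" where
  "rep_shape R = (all_in twelve R \<and> uniq R)"

fun nat_of_bool :: "bool \<Rightarrow> nat" where
  "nat_of_bool True = Suc 0"
| "nat_of_bool False = 0"

fun sum3 :: "nat \<Rightarrow> nat \<Rightarrow> nat \<Rightarrow> nat" where
  "sum3 x y z = x + y + z"

fun row_sums :: "nat list \<Rightarrow> nat list" where
  "row_sums [a2,a3,a4,b1,b3,b4,c1,c2,c4,d1,d2,d3] =
    [sum3 a2 a3 a4, sum3 b1 b3 b4, sum3 c1 c2 c4, sum3 d1 d2 d3]"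
| "row_sums _ = []"

fun column_sums :: "nat list \<Rightarrow> nat list" where
  "column_sums [a2,a3,a4,b1,b3,b4,c1,c2,c4,d1,d2,d3] =
    [sum3 b1 c1 d1, sum3 a2 c2 d2, sum3 a3 b3 d3, sum3 a4 b4 c4]"
| "column_sums _ = []"

fun row_short :: "bool list \<Rightarrow> bool" where
  "row_short [a2,a3,a4,b1,b3,b4,c1,c2,c4,d1,d2,d3] =
     (three_short a2 a3 a4 \<and> three_short b1 b3 b4 \<and> three_short c1 c2 c4 \<and> three_short d1 d2 d3)"
| "row_short _ = False"

definition group_member_ok :: "bool list \<Rightarrow> bool list \<Rightarrow> bool" where
  "group_member_ok h m = (twelve m \<and> row_short m \<and> columns_short m \<and> beq (ends m) (ends h))"

definition group_ok :: "bool list list \<Rightarrow> bool" where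
  "group_ok g = (uniq g \<and> all_in (group_member_ok (hd g)) g)"

definition point_label_ok :: "bool list \<Rightarrow> bool list \<Rightarrow> bool" where
  "point_label_ok h l = (twelve l \<and> row_sums (map nat_of_bool l) = [Suc 0, Suc 0, Suc 0, Suc 0]
     \<and> column_sums (map nat_of_bool l) = column_sums (map nat_of_bool h))"

fun nonnull :: "'a list \<Rightarrow> bool" where
  "nonnull [] = False"
| "nonnull (x # xs) = True"

definition point_ok :: "bool list list \<Rightarrow> bool" where
  "point_ok ls = (nonnull ls \<and> uniq ls \<and> all_in (point_label_ok (hd ls)) ls)"

definition conj_ok :: "bool list \<Rightarrow> gen list \<Rightarrow> bool" where
  "conj_ok l w = member (act_word w l) (take (Suc (Suc 0)) (hd point_bits))"

text \<open>In units of 1/4 the left sums are 4 and the right sums \<open>4 r - 3\<close>, written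
  without subtraction.\<close>

definition quarter_ok :: "octal list \<Rightarrow> octal list \<Rightarrow> bool" where
  "quarter_ok r ws = (row_sums (map oct_nat ws) = map oct_nat [O4, O4, O4, O4]
     \<and> map (\<lambda>n. Suc (Suc (Suc n))) (column_sums (map oct_nat ws)) = map (\<lambda>x. oct_nat x + oct_nat x + oct_nat x + oct_nat x) r)"

text \<open>Flows in units of \<open>1/4\<close>, which show that the right degrees in \<open>degs\<close> are attainable.\<close>

definition quarter_flows :: "octal list list" where
  "quarter_flows = [
    [O0,O0,O4,O0,O1,O3,O1,O1,O2,O0,O0,O4],
    [O0,O1,O3,O0,O4,O0,O1,O1,O2,O0,O0,O4],
    [O0,O0,O4,O0,O0,O4,O0,O3,O1,O1,O2,O1],
    [O0,O0,O4,O0,O3,O1,O0,O4,O0,O1,O1,O2],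
    [O0,O3,O1,O0,O4,O0,O0,O4,O0,O1,O1,O2],
    [O1,O0,O3,O1,O1,O2,O0,O4,O0,O0,O4,O0],
    [O1,O2,O1,O1,O3,O0,O0,O4,O0,O0,O4,O0],
    [O0,O0,O4,O0,O0,O4,O2,O1,O1,O3,O0,O1],
    [O0,O0,O4,O0,O3,O1,O3,O1,O0,O2,O0,O2],
    [O0,O3,O1,O0,O4,O0,O3,O1,O0,O2,O0,O2],
    [O0,O0,O4,O2,O1,O1,O0,O4,O0,O3,O1,O0],
    [O0,O3,O1,O2,O2,O0,O0,O4,O0,O3,O1,O0],
    [O2,O1,O1,O4,O0,O0,O0,O4,O0,O1,O3,O0],
    [O0,O0,O4,O2,O1,O1,O3,O1,O0,O4,O0,O0],
    [O0,O3,O1,O2,O2,O0,O3,O1,O0,O4,O0,O0],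
    [O2,O1,O1,O4,O0,O0,O1,O3,O0,O4,O0,O0]]"

subsection \<open>Edge sets as bit vectors\<close>

definition bits :: "label set \<Rightarrow> bool list" where
  "bits A = map (\<lambda>v. v \<in> A) labels"

definition lset :: "bool list \<Rightarrow> label set" where
  "lset xs = {v. \<exists>k<12. labels ! k = v \<and> xs ! k}"

lemma length_labels: "length labels = 12"
  by (simp add: labels_def)

lemma length_bits [simp]: "length (bits A) = 12"
  by (simp add: bits_def length_labels)

lemma label_nth: "\<exists>k<12. labels ! k = v"
  using set_labels length_labels by (metis UNIV_I in_set_conv_nth)

lemma bits_nth: "k < 12 \<Longrightarrow> bits A ! k \<longleftrightarrow> labels ! k \<in> A"
  by (simp add: bits_def length_labels)

lemma lset_bits: "lset (bits A) = A"
proof (intro equalityI subsetI)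
  fix v assume "v \<in> A"
  then show "v \<in> lset (bits A)" using label_nth[of v] by (auto simp: lset_def bits_nth)
qed (auto simp: lset_def bits_nth)

lemma bits_inj: "bits A = bits B \<longleftrightarrow> A = B"
  by (metis lset_bits)

lemma bits_lset: assumes "length xs = 12" shows "bits (lset xs) = xs"
proof (rule nth_equalityI)
  fix k assume "k < length (bits (lset xs))"
  then have k: "k < 12" by simp
  have "labels ! k \<in> lset xs \<longleftrightarrow> xs ! k"
  proof
    assume "labels ! k \<in> lset xs"
    then obtain l where "l < 12" "labels ! l = labels ! k" "xs ! l" by (auto simp: lset_def)
    then show "xs ! k" using k nth_eq_iff_index_eq[OF distinct_labels] length_labels by metis
  qed (use k in \<open>auto simp: lset_def\<close>)
  then show "bits (lset xs) ! k = xs ! k" using k by (simp add: bits_nth)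
qed (simp add: assms)

lemma bits_explicit:
  "bits A = [(1,1) \<in> A, (1,2) \<in> A, (1,3) \<in> A, (2,1) \<in> A, (2,2) \<in> A, (2,3) \<in> A,
    (3,1) \<in> A, (3,2) \<in> A, (3,3) \<in> A, (4,1) \<in> A, (4,2) \<in> A, (4,3) \<in> A]"
  by (simp add: bits_def labels_def)

lemma sub_map: "subvec (map f l) (map g l) \<longleftrightarrow> (\<forall>v\<in>set l. f v \<longrightarrow> g v)"
proof (induction l)
  case (Cons v l)
  then show ?case by (cases "f v"; cases "g v") simp_all
qed simp

lemma sub_bits: "subvec (bits A) (bits B) \<longleftrightarrow> A \<subseteq> B"
  unfolding bits_def sub_map set_labels by blast

lemma beq_iff: "beq xs ys \<longleftrightarrow> xs = ys"
  by (induction xs ys rule: beq.induct) auto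

lemma some_in_iff [simp]: "some_in P xs \<longleftrightarrow> (\<exists>x\<in>set xs. P x)"
proof (induction xs)
  case (Cons x xs)
  then show ?case by (cases "P x") simp_all
qed simp

lemma some_or_iff [simp]: "some_or b P xs \<longleftrightarrow> b \<or> (\<exists>x\<in>set xs. P x)"
  by (cases b) simp_all

lemma all_in_iff [simp]: "all_in P xs \<longleftrightarrow> (\<forall>x\<in>set xs. P x)"
proof (induction xs)
  case (Cons x xs)
  then show ?case by (cases "P x") simp_all
qed simp

lemma all_and_iff [simp]: "all_and b P xs \<longleftrightarrow> b \<and> (\<forall>x\<in>set xs. P x)"
  by (cases b) simp_all

lemma select_filter: "select P xs = filter P xs"
proof (induction xs)
  case (Cons x xs)
  then show ?case by (cases "P x") simp_all
qed simp

lemma short_iff: "short xs \<longleftrightarrow> length xs \<le> 1"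
  by (cases xs rule: short.cases) simp_all

lemma short_filter_unique:
  assumes "short (select P xs)" "x \<in> set xs" "y \<in> set xs" "P x" "P y" shows "x = y"
proof -
  have "x \<in> set (filter P xs)" "y \<in> set (filter P xs)" "length (filter P xs) \<le> 1"
    using assms by (simp_all add: short_iff select_filter)
  then show ?thesis by (cases "filter P xs") (auto simp: le_Suc_eq)
qed

lemma member_iff [simp]: "member x ys \<longleftrightarrow> x \<in> set ys"
  by (cases ys) (auto simp: beq_iff)

lemma subset_of_iff: "subset_of xs ys \<longleftrightarrow> set xs \<subseteq> set ys"
  by auto

lemma set_eq_list_iff: "set_eq xs ys \<longleftrightarrow> set xs = set ys"
  by (auto simp: subset_of_iff simp del: subset_of.simps)

lemma all2_iff: "all2 P xs ys \<longleftrightarrow> list_all2 P xs ys"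
  by (induction P xs ys rule: all2.induct) simp_all

lemma same_index_iff: "same_index k l \<longleftrightarrow> k = l"
  by (induction k l rule: same_index.induct) simp_all

lemma lt_iff: "lt k l \<longleftrightarrow> k < l"
  by (induction k l rule: lt.induct) simp_all

lemma uniq_iff: "uniq xs \<longleftrightarrow> distinct xs"
  by (induction xs) simp_all

lemma twelve_iff: "twelve xs \<Longrightarrow> length xs = 12"
  by (cases xs rule: twelve.cases) simp_all

lemma nonnull_iff: "nonnull xs \<longleftrightarrow> xs \<noteq> []"
  by (cases xs) simp_all

lemma count_true_map: "count_true (map f l) = length (filter f l)"
proof (induction l)
  case (Cons v l)
  then show ?case by (cases "f v") simp_all
qed simp

lemma count_true_bits: "count_true (bits A) = card A"
proof -
  have "card A = card (set (filter (\<lambda>v. v \<in> A) labels))" by (simp add: set_labels)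
  also have "\<dots> = length (filter (\<lambda>v. v \<in> A) labels)"
    by (rule distinct_card) (simp add: distinct_labels)
  finally show ?thesis by (simp add: bits_def count_true_map)
qed

subsection \<open>Right degrees, matchings and their ends\<close>

lemma sum_label_cases:
  fixes g :: "label \<Rightarrow> 'a::comm_monoid_add"
  shows "sum g UNIV = g (1,1) + (g (1,2) + (g (1,3) + (g (2,1) + (g (2,2) + (g (2,3) +
    (g (3,1) + (g (3,2) + (g (3,3) + (g (4,1) + (g (4,2) + g (4,3)))))))))))"
proof -
  have "sum g UNIV = sum_list (map g labels)"
    unfolding set_labels[symmetric] by (rule sum.distinct_set_conv_list[OF distinct_labels])
  then show ?thesis by (simp add: labels_def)
qed

lemma marg_sums:
  "marg f $ Inr 1 = f (1,1) + f (1,2) + f (1,3)" "marg f $ Inr 2 = f (2,1) + f (2,2) + f (2,3)"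
  "marg f $ Inr 3 = f (3,1) + f (3,2) + f (3,3)" "marg f $ Inr 4 = f (4,1) + f (4,2) + f (4,3)"
  "marg f $ Inl 1 = f (2,1) + f (3,1) + f (4,1)" "marg f $ Inl 2 = f (1,1) + f (3,2) + f (4,2)"
  "marg f $ Inl 3 = f (1,2) + f (2,2) + f (4,3)" "marg f $ Inl 4 = f (1,3) + f (2,3) + f (3,3)"
proof -
  have "marg f $ Inr i = (\<Sum>v\<in>UNIV. if fst v = i then f v else 0)"
    "marg f $ Inl i = (\<Sum>v\<in>UNIV. if right v = i then f v else 0)" for i
    unfolding marg_Inr marg_Inl by (simp_all add: sum.If_cases)
  then show "marg f $ Inr 1 = f (1,1) + f (1,2) + f (1,3)" "marg f $ Inr 2 = f (2,1) + f (2,2) + f (2,3)"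
    "marg f $ Inr 3 = f (3,1) + f (3,2) + f (3,3)" "marg f $ Inr 4 = f (4,1) + f (4,2) + f (4,3)"
    "marg f $ Inl 1 = f (2,1) + f (3,1) + f (4,1)" "marg f $ Inl 2 = f (1,1) + f (3,2) + f (4,2)"
    "marg f $ Inl 3 = f (1,2) + f (2,2) + f (4,3)" "marg f $ Inl 4 = f (1,3) + f (2,3) + f (3,3)"
    unfolding sum_label_cases by (simp_all add: right_def)
qed

lemma deg_sums:
  "deg A 1 = nat_of_bool ((2,1) \<in> A) + nat_of_bool ((3,1) \<in> A) + nat_of_bool ((4,1) \<in> A)"
  "deg A 2 = nat_of_bool ((1,1) \<in> A) + nat_of_bool ((3,2) \<in> A) + nat_of_bool ((4,2) \<in> A)"
  "deg A 3 = nat_of_bool ((1,2) \<in> A) + nat_of_bool ((2,2) \<in> A) + nat_of_bool ((4,3) \<in> A)"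
  "deg A 4 = nat_of_bool ((1,3) \<in> A) + nat_of_bool ((2,3) \<in> A) + nat_of_bool ((3,3) \<in> A)"
proof -
  have nb: "nat_of_bool b = (if b then 1 else 0)" for b by (cases b) simp_all
  have "deg A j = (\<Sum>v\<in>UNIV. if right v = j then nat_of_bool (v \<in> A) else 0)" for j
  proof -
    have "(\<Sum>v\<in>UNIV. if right v = j then nat_of_bool (v \<in> A) else 0) = (\<Sum>v\<in>UNIV. if v \<in> A \<and> right v = j then 1 else 0)"
      by (intro sum.cong) (simp_all add: nb)
    also have "\<dots> = card {v. v \<in> A \<and> right v = j}" by (simp add: sum.If_cases)
    finally show ?thesis by (simp add: deg_def)
  qed
  then show "deg A 1 = nat_of_bool ((2,1) \<in> A) + nat_of_bool ((3,1) \<in> A) + nat_of_bool ((4,1) \<in> A)"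
  "deg A 2 = nat_of_bool ((1,1) \<in> A) + nat_of_bool ((3,2) \<in> A) + nat_of_bool ((4,2) \<in> A)"
  "deg A 3 = nat_of_bool ((1,2) \<in> A) + nat_of_bool ((2,2) \<in> A) + nat_of_bool ((4,3) \<in> A)"
  "deg A 4 = nat_of_bool ((1,3) \<in> A) + nat_of_bool ((2,3) \<in> A) + nat_of_bool ((3,3) \<in> A)"
    unfolding sum_label_cases by (simp_all add: right_def)
qed

lemma three_short_iff: "three_short a b c \<longleftrightarrow> \<not> (a \<and> b) \<and> \<not> (a \<and> c) \<and> \<not> (b \<and> c)"
  by (cases a; cases b) simp_all

lemma all_label_cases:
  fixes P :: "label \<Rightarrow> bool"
  shows "(\<forall>v. P v) \<longleftrightarrow> P (1,1) \<and> P (1,2) \<and> P (1,3) \<and> P (2,1) \<and> P (2,2) \<and> P (2,3) \<and>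
    P (3,1) \<and> P (3,2) \<and> P (3,3) \<and> P (4,1) \<and> P (4,2) \<and> P (4,3)"
  unfolding all_label by (simp add: labels_def)

lemma matching_bits: "matching A \<longleftrightarrow> row_short (bits A) \<and> columns_short (bits A)"
proof -
  have "inj_on g A \<longleftrightarrow> (\<forall>u. \<forall>v. u \<in> A \<longrightarrow> v \<in> A \<longrightarrow> g u = g v \<longrightarrow> u = v)" for g :: "label \<Rightarrow> 4"
    unfolding inj_on_def by blast
  then show ?thesis
    unfolding matching_def bits_explicit row_short.simps columns_short.simps three_short_iff all_label_cases
    by (simp add: right_def) argo
qed

lemma ends_bits: "ends (bits A) = ends (bits B) \<longleftrightarrow> same_ends A B"
proof -
  have 1: "(k \<in> fst ` A) = (\<exists>v. v \<in> A \<and> fst v = k)" "(k \<in> right ` A) = (\<exists>v. v \<in> A \<and> right v = k)" for k A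
    by blast+
  have ex: "(\<exists>v. P v) \<longleftrightarrow> P (1,1) \<or> P (1,2) \<or> P (1,3) \<or> P (2,1) \<or> P (2,2) \<or> P (2,3) \<or>
    P (3,1) \<or> P (3,2) \<or> P (3,3) \<or> P (4,1) \<or> P (4,2) \<or> P (4,3)" for P :: "label \<Rightarrow> bool"
    using all_label_cases[of "\<lambda>v. \<not> P v"] by blast
  show ?thesis
    unfolding same_ends_def set_eq_iff forall_4 1 ex bits_explicit
    by (simp add: right_def)
qed

lemma row_option:
  assumes "three_short a b c" shows "[a, b, c] \<in> set row_choices"
  using assms by (cases a; cases b; cases c) (simp_all add: row_choices_def)

lemma matchings_complete: assumes "matching A" shows "bits A \<in> set matchings"
proof -
  have s: "row_short (bits A)" "columns_short (bits A)" using assms by (simp_all add: matching_bits)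
  note r = s(1)[unfolded bits_explicit row_short.simps]
  have "bits A = [(1,1) \<in> A, (1,2) \<in> A, (1,3) \<in> A] @ [(2,1) \<in> A, (2,2) \<in> A, (2,3) \<in> A] @
    [(3,1) \<in> A, (3,2) \<in> A, (3,3) \<in> A] @ [(4,1) \<in> A, (4,2) \<in> A, (4,3) \<in> A]"
    by (simp add: bits_explicit)
  then show ?thesis using s(2) r row_option
    unfolding matchings_def select_filter by (simp del: append.simps) blast
qed

lemma with_ends_map: "with_ends ms = map (\<lambda>m. (m, ends m)) ms"
  by (induction ms) simp_all

subsection \<open>The symmetric group\<close>

fun gen_perm :: "gen \<Rightarrow> 4 \<Rightarrow> 4" where
  "gen_perm S1 = Transposition.transpose 1 2"
| "gen_perm S2 = Transposition.transpose 2 3"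
| "gen_perm S3 = Transposition.transpose 3 4"

primrec word_perm :: "gen list \<Rightarrow> 4 \<Rightarrow> 4" where
  "word_perm [] = id"
| "word_perm (g # gs) = gen_perm g \<circ> word_perm gs"

lemma bij_gen_perm: "bij (gen_perm g)"
  by (cases g) simp_all

lemma bij_word_perm: "bij (word_perm w)"
proof (induction w)
  case Nil show ?case by (simp only: word_perm.simps bij_id)
next
  case (Cons g w) then show ?case unfolding word_perm.simps by (rule bij_comp[OF _ bij_gen_perm])
qed

lemma relabelI:
  assumes "inj \<sigma>" "fst w = \<sigma> (fst v)" "right w = \<sigma> (right v)" shows "relabel \<sigma> v = w"
  by (rule label_eqI) (simp_all add: relabel assms)

lemma relabel_gen:
  "map (relabel (gen_perm S1)) labels = [(2,1),(2,2),(2,3),(1,1),(1,2),(1,3),(3,2),(3,1),(3,3),(4,2),(4,1),(4,3)]"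
  "map (relabel (gen_perm S2)) labels = [(1,2),(1,1),(1,3),(3,1),(3,2),(3,3),(2,1),(2,2),(2,3),(4,1),(4,3),(4,2)]"
  "map (relabel (gen_perm S3)) labels = [(1,1),(1,3),(1,2),(2,1),(2,3),(2,2),(4,1),(4,2),(4,3),(3,1),(3,2),(3,3)]"
  unfolding labels_def list.map
  by (intro list.inject[THEN iffD2] conjI refl relabelI bij_is_inj bij_gen_perm; simp add: right_def Transposition.transpose_def)+

text \<open>A generator is an involution, so a label lies in the image of \<open>A\<close> exactly
  if its own image lies in \<open>A\<close>.\<close>

lemma act_gen_bits: "act_gen g (bits A) = bits (relabel (gen_perm g) ` A)"
proof -
  have invol: "relabel (gen_perm g) (relabel (gen_perm g) v) = v" for v
  proof -
    have "gen_perm g \<circ> gen_perm g = id" by (cases g) (simp_all add: transpose_comp_involutory)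
    then show ?thesis by (simp add: relabel_comp bij_is_inj bij_gen_perm relabel_id)
  qed
  have mem: "v \<in> relabel (gen_perm g) ` A \<longleftrightarrow> relabel (gen_perm g) v \<in> A" for v
    by (metis invol imageE imageI)
  have "bits (relabel (gen_perm g) ` A) = map (\<lambda>v. v \<in> A) (map (relabel (gen_perm g)) labels)"
    by (simp add: bits_def mem)
  then show ?thesis
    by (cases g) (simp_all only: relabel_gen list.map, simp_all add: bits_explicit)
qed

lemma act_word_bits: "act_word w (bits A) = bits (relabel (word_perm w) ` A)"
proof (induction w)
  case Nil
  have "relabel id ` A = A" by (simp add: relabel_id)
  then show ?case by (simp only: act_word.simps word_perm.simps)
next
  case (Cons g w)
  have "relabel (gen_perm g) ` relabel (word_perm w) ` A = relabel (gen_perm g \<circ> word_perm w) ` A"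
    by (simp only: image_image relabel_comp bij_is_inj bij_gen_perm bij_word_perm)
  then show ?case by (simp only: act_word.simps word_perm.simps Cons act_gen_bits)
qed

definition family :: "bool list list \<Rightarrow> label set set" where
  "family R = lset ` set R"

definition bit_vectors :: "bool list list \<Rightarrow> bool" where
  "bit_vectors R \<longleftrightarrow> (\<forall>x\<in>set R. length x = 12)"

lemma bits_family: "bit_vectors R \<Longrightarrow> bits ` family R = set R"
  unfolding family_def bit_vectors_def image_image by (simp add: bits_lset cong: image_cong)

lemma inj_bits: "inj bits"
  by (simp add: inj_def bits_inj)

lemma mem_family: "bit_vectors R \<Longrightarrow> T \<in> family R \<longleftrightarrow> bits T \<in> set R"
  using bits_family[of R] inj_image_mem_iff[OF inj_bits] by metis

lemma act_word_family:
  assumes "bit_vectors R" shows "set (map (act_word w) R) = bits ` relabel_family (word_perm w) (family R)"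
proof -
  have "set (map (act_word w) R) = act_word w ` bits ` family R" by (simp add: bits_family[OF assms])
  then show ?thesis by (simp add: image_image act_word_bits relabel_family_def)
qed

subsection \<open>Checking a family of trees\<close>

lemma is_face_iff: "bit_vectors R \<Longrightarrow> is_face R (bits A) \<longleftrightarrow> A \<in> faces (family R)"
  unfolding is_face_def some_in_iff faces_def
  by (simp add: bits_family[symmetric] sub_bits)

definition groups_correct :: bool where
  "groups_correct \<longleftrightarrow> all_in group_ok groups \<and> matchings_grouped"

lemma group_members:
  assumes "groups_correct" "g \<in> set groups" "m \<in> set g"
  shows "bits (lset m) = m" "matching (lset m)"
    and "n \<in> set g \<Longrightarrow> same_ends (lset m) (lset n)" "distinct g"
proof -
  have ok: "group_ok g" using assms(1,2) by (simp add: groups_correct_def)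
  then have 1: "group_member_ok (hd g) k" if "k \<in> set g" for k using that by (simp add: group_ok_def)
  have b: "bits (lset k) = k" if "k \<in> set g" for k
    using 1[OF that] twelve_iff bits_lset by (simp add: group_member_ok_def)
  show "bits (lset m) = m" by (rule b[OF assms(3)])
  show "matching (lset m)" using 1[OF assms(3)] by (simp add: matching_bits b[OF assms(3)] group_member_ok_def)
  show "distinct g" using ok by (simp add: group_ok_def uniq_iff)
  show "same_ends (lset m) (lset n)" if "n \<in> set g"
    using 1[OF assms(3)] 1[OF that] unfolding ends_bits[symmetric] b[OF assms(3)] b[OF that]
    by (simp add: group_member_ok_def beq_iff)
qed

lemma matchings_in_group:
  assumes c: "groups_correct" and m: "matching m" "matching n" "same_ends m n" "m \<noteq> n"
  obtains g where "g \<in> set groups" "bits m \<in> set g" "bits n \<in> set g"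
proof -
  have "\<forall>x\<in>set (with_ends matchings). \<forall>y\<in>set (with_ends matchings). grouped x y"
    using c by (simp add: groups_correct_def matchings_grouped_def all_grouped_def)
  moreover have "(bits m, ends (bits m)) \<in> set (with_ends matchings)" "(bits n, ends (bits n)) \<in> set (with_ends matchings)"
    using matchings_complete m by (simp_all add: with_ends_map)
  ultimately have "grouped (bits m, ends (bits m)) (bits n, ends (bits n))" by blast
  moreover have "beq (ends (bits m)) (ends (bits n))" using m(3) by (simp add: beq_iff ends_bits)
  moreover have "\<not> beq (bits m) (bits n)" using m(4) by (simp add: beq_iff bits_inj)
  ultimately show ?thesis using that by auto
qed

text \<open>A violation would consist of two faces in one group of matchings with the same
  ends.\<close>

lemma unique_match_compatible:
  assumes c: "groups_correct" and R: "bit_vectors R" "all_in (unique_match R) groups"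
    and T: "T \<in> family R" "U \<in> family R"
  shows "compatible T U"
  unfolding compatible_def
proof (intro allI impI, rule ccontr)
  fix m n assume mn: "m \<subseteq> T" "n \<subseteq> U" "matching m" "matching n" "same_ends m n" "m \<noteq> n"
  obtain g where g: "g \<in> set groups" "bits m \<in> set g" "bits n \<in> set g"
    using matchings_in_group[OF c mn(3-6)] by blast
  have sh: "short (select (is_face R) g)" using R(2) g(1) by (simp add: unique_match_def)
  have "m \<in> faces (family R)" "n \<in> faces (family R)" using mn(1,2) T unfolding faces_def by blast+
  then have f: "is_face R (bits m)" "is_face R (bits n)" by (simp_all add: is_face_iff[OF R(1)])
  have "bits m = bits n" by (rule short_filter_unique[OF sh g(2,3) f])
  then show False using mn(6) by (simp add: bits_inj)
qed

lemma cons_all_map: "cons_all b xs = map ((#) b) xs"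
  by (induction xs) simp_all

lemma dels_map:
  "distinct l \<Longrightarrow> e \<in> set l \<Longrightarrow> f e \<Longrightarrow> map (\<lambda>v. f v \<and> v \<noteq> e) l \<in> set (dels (map f l))"
proof (induction l)
  case (Cons v l)
  show ?case
  proof (cases "v = e")
    case True
    then have "map (\<lambda>v. f v \<and> v \<noteq> e) l = map f l" using Cons.prems by (intro map_cong) auto
    then show ?thesis using True Cons.prems by (simp add: cons_all_map)
  next
    case False
    then have "map (\<lambda>v. f v \<and> v \<noteq> e) l \<in> set (dels (map f l))" using Cons by simp
    then show ?thesis using False by (cases "f v") (simp_all add: cons_all_map)
  qed
qed simp

lemma dels_bits: "e \<in> T \<Longrightarrow> bits (T - {e}) \<in> set (dels (bits T))"
  using dels_map[OF distinct_labels, of e "\<lambda>v. v \<in> T"] by (simp add: bits_def set_labels)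

lemma shared_iff: "shared d t us \<longleftrightarrow> (\<exists>u\<in>set us. subvec d u \<and> u \<noteq> t)"
proof (induction us)
  case (Cons u us)
  show ?case
  proof (cases "subvec d u")
    case True
    then show ?thesis using Cons by (cases "beq u t") (simp_all add: beq_iff)
  next
    case False
    then show ?thesis using Cons by simp
  qed
qed simp

lemma boundary_mono: "A \<subseteq> B \<Longrightarrow> boundary B \<Longrightarrow> boundary A"
  unfolding boundary_def by (meson image_mono subsetD)

lemma boundary_masks_boundary: "m \<in> set boundary_masks \<Longrightarrow> bits A = m \<Longrightarrow> boundary A"
proof -
  assume m: "m \<in> set boundary_masks" "bits A = m"
  have b1: "boundary A" if "\<forall>v. v \<in> A \<longrightarrow> fst v \<noteq> k" for k
  proof -
    have "k \<notin> fst ` A" using that by auto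
    then show ?thesis unfolding boundary_def by blast
  qed
  have b2: "boundary A" if "\<forall>v. v \<in> A \<longrightarrow> right v \<noteq> k" for k
  proof -
    have "k \<notin> right ` A" using that by auto
    then show ?thesis unfolding boundary_def by blast
  qed
  have b3: "boundary A" if "\<forall>v. v \<in> A \<longrightarrow> fst v = k \<or> right v = k" for k using that unfolding boundary_def by blast
  show "boundary A"
    using m(1) unfolding boundary_masks_def list.map list.set insert_iff empty_iff
    apply (elim disjE)
    subgoal using m(2) by (intro b1[of 1]) (unfold all_label_cases bits_explicit, simp add: right_def)
    subgoal using m(2) by (intro b1[of 2]) (unfold all_label_cases bits_explicit, simp add: right_def)
    subgoal using m(2) by (intro b1[of 3]) (unfold all_label_cases bits_explicit, simp add: right_def)
    subgoal using m(2) by (intro b1[of 4]) (unfold all_label_cases bits_explicit, simp add: right_def)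
    subgoal using m(2) by (intro b2[of 1]) (unfold all_label_cases bits_explicit, simp add: right_def)
    subgoal using m(2) by (intro b2[of 2]) (unfold all_label_cases bits_explicit, simp add: right_def)
    subgoal using m(2) by (intro b2[of 3]) (unfold all_label_cases bits_explicit, simp add: right_def)
    subgoal using m(2) by (intro b2[of 4]) (unfold all_label_cases bits_explicit, simp add: right_def)
    subgoal using m(2) by (intro b3[of 1]) (unfold all_label_cases bits_explicit, simp add: right_def)
    subgoal using m(2) by (intro b3[of 2]) (unfold all_label_cases bits_explicit, simp add: right_def)
    subgoal using m(2) by (intro b3[of 3]) (unfold all_label_cases bits_explicit, simp add: right_def)
    subgoal using m(2) by (intro b3[of 4]) (unfold all_label_cases bits_explicit, simp add: right_def)
    by simp
qed

lemma good_rep_good: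
  assumes c: "groups_correct" and R: "bit_vectors R" "R \<noteq> []" "good_rep R"
  shows "good (family R)"
  unfolding good_def
proof (intro conjI ballI)
  have g: "all_in seven R" "all_in (unique_match R) groups" "all_in (tree_facets_ok R) R"
    using R(3) by (simp_all add: good_rep_def)
  show comp: "compatible T U" if "T \<in> family R" "U \<in> family R" for T U
    by (rule unique_match_compatible[OF c R(1) g(2) that])
  show "family R \<subseteq> trees"
  proof
    fix T assume T: "T \<in> family R"
    then have "seven (bits T)" using g(1) by (simp add: mem_family[OF R(1)])
    then have "card T = 7" by (simp add: seven_def same_index_iff count_true_bits)
    then show "T \<in> trees" using comp[OF T T] by (simp add: trees_def)
  qed
  show "family R \<noteq> {}" using R(2) by (simp add: family_def)
  fix T e assume T: "T \<in> family R" and e: "e \<in> T"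
  have "facet_ok R (bits T) (bits (T - {e}))"
    using g(3) T dels_bits[OF e] by (simp add: mem_family[OF R(1)] tree_facets_ok_def)
  then consider "shared (bits (T - {e})) (bits T) R" | "some_in (subvec (bits (T - {e}))) boundary_masks"
    by (cases "shared (bits (T - {e})) (bits T) R") (simp_all add: facet_ok_def del: some_in_iff)
  then show "boundary (T - {e}) \<or> (\<exists>U\<in>family R. U \<noteq> T \<and> T - {e} \<subseteq> U)"
  proof cases
    case 1
    then obtain u where u: "u \<in> set R" "subvec (bits (T - {e})) u" "u \<noteq> bits T" by (auto simp: shared_iff)
    then obtain U where "U \<in> family R" "u = bits U" using bits_family[OF R(1)] by blast
    then show ?thesis using u by (auto simp: sub_bits)
  next
    case 2
    then obtain m where m: "m \<in> set boundary_masks" "subvec (bits (T - {e})) m" by auto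
    then have "length m = 12" by (auto simp: boundary_masks_def)
    then have "boundary (lset m)" "T - {e} \<subseteq> lset m"
      using boundary_masks_boundary[OF m(1)] m(2) by (simp_all add: bits_lset sub_bits[symmetric])
    then show ?thesis using boundary_mono by blast
  qed
qed

subsection \<open>Heights\<close>

lemma ex_map_labels: assumes "length ws = 12" obtains w where "ws = map w labels"
proof -
  define w where "w v = ws ! (THE k. k < 12 \<and> labels ! k = v)" for v
  have "ws = map w labels"
  proof (rule nth_equalityI)
    fix k assume "k < length ws"
    then have k: "k < 12" using assms by simp
    have "(THE l. l < 12 \<and> labels ! l = labels ! k) = k"
    proof (rule the_equality)
      fix l assume "l < 12 \<and> labels ! l = labels ! k"
      then show "l = k" using k nth_eq_iff_index_eq[OF distinct_labels, of l k] by (simp add: length_labels)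
    qed (use k in simp)
    then show "ws ! k = map w labels ! k" using k by (simp add: w_def length_labels)
  qed (simp add: assms length_labels)
  then show ?thesis using that by blast
qed

lemma map_labels_inj: "map w labels = map w' labels \<Longrightarrow> w = w'"
  using set_labels by (auto simp: map_eq_conv)

lemma weight_map: "weight (map f l) (map w l) acc = acc + sum_list (map (\<lambda>v. if f v then w v else 0) l)"
proof (induction l arbitrary: acc)
  case (Cons v l)
  then show ?case by (cases "f v") simp_all
qed simp

lemma weight_bits: "weight (bits A) (map w labels) 0 = sum w A"
  unfolding bits_def weight_map sum_labels[symmetric] by (simp add: sum.If_cases)

lemma lifted_lifts:
  assumes c: "groups_correct" and R: "bit_vectors R" "lifted R ws" and ws: "length ws = 12"
  obtains \<omega> where "lifts (family R) \<omega>"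
proof -
  obtain w where w: "map oct_nat ws = map w labels" using ex_map_labels[of "map oct_nat ws"] ws by auto
  have "lifts (family R) (\<lambda>v. real (w v))" unfolding lifts_def
  proof (intro allI impI)
    fix m n assume mn: "matching m" "matching n" "same_ends m n" "m \<noteq> n" "m \<in> faces (family R)"
    obtain g where g: "g \<in> set groups" "bits m \<in> set g" "bits n \<in> set g"
      using matchings_in_group[OF c mn(1-4)] by blast
    have "group_lifted R (map w labels) g" using R(2) g(1) by (simp add: lifted_def w)
    moreover have "is_face R (bits m)" using mn(5) by (simp add: is_face_iff[OF R(1)])
    ultimately have "lightest (map w labels) g (bits m)" using g(2) by (simp add: group_lifted_def select_filter)
    then have "lighter (map w labels) (bits m) (weight (bits m) (map w labels) 0) (bits n)"
      using g(3) by (simp add: lightest_def)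
    moreover have "beq (bits m) (bits n) = False" using mn(4) by (simp add: beq_iff bits_inj)
    ultimately have "sum w m < sum w n" by (simp add: lighter_def lt_iff weight_bits)
    then show "(\<Sum>v\<in>m. real (w v)) < (\<Sum>v\<in>n. real (w v))" by (simp flip: of_nat_sum)
  qed
  then show ?thesis using that by blast
qed

lemma tally_map: "tally (map f l) (map t l) = map (\<lambda>v. if f v then Suc (t v) else t v) l"
proof (induction l)
  case (Cons v l)
  then show ?case by (cases "f v") simp_all
qed simp

text \<open>The total height of a list of matchings depends only on how often each edge
  occurs.\<close>

lemma tallies_map:
  assumes "\<And>x. x \<in> set xs \<Longrightarrow> bits (lset (bits_of x)) = bits_of x"
  shows "\<exists>t. tallies xs = map t labels \<and>
    (\<Sum>v\<in>UNIV. real (t v) * \<omega> v) = (\<Sum>x\<leftarrow>xs. sum \<omega> (lset (bits_of x)))"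
  using assms
proof (induction xs)
  case Nil
  show ?case by (rule exI[of _ "\<lambda>v. 0"]) (simp add: labels_def)
next
  case (Cons x xs)
  then obtain t where t: "tallies xs = map t labels"
    "(\<Sum>v\<in>UNIV. real (t v) * \<omega> v) = (\<Sum>x\<leftarrow>xs. sum \<omega> (lset (bits_of x)))" by auto
  let ?A = "lset (bits_of x)"
  have "tallies (x # xs) = tally (bits ?A) (map t labels)" using Cons.prems t(1) by simp
  then have "tallies (x # xs) = map (\<lambda>v. if v \<in> ?A then Suc (t v) else t v) labels"
    by (simp add: bits_def tally_map)
  moreover have "(\<Sum>v\<in>UNIV. real (if v \<in> ?A then Suc (t v) else t v) * \<omega> v)
      = (\<Sum>v\<in>UNIV. real (t v) * \<omega> v + (if v \<in> ?A then \<omega> v else 0))"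
    by (intro sum.cong) (simp_all add: algebra_simps)
  then have "(\<Sum>v\<in>UNIV. real (if v \<in> ?A then Suc (t v) else t v) * \<omega> v) = sum \<omega> ?A + (\<Sum>v\<in>UNIV. real (t v) * \<omega> v)"
    by (simp add: sum.distrib sum.If_cases)
  ultimately show ?case using t(2) by (intro exI[of _ "\<lambda>v. if v \<in> ?A then Suc (t v) else t v"]) simp
qed

lemma farkas_pair_iff:
  "farkas_pair R p \<longleftrightarrow> is_face R (bits_of (fst p)) \<and> \<not> beq (bits_of (fst p)) (bits_of (snd p))
    \<and> some_in (subset_of [bits_of (fst p), bits_of (snd p)]) groups"
  by (cases p) (simp only: farkas_pair.simps fst_conv snd_conv)

text \<open>The strict inequalities of the pairs would add up to a number smaller than itself, as
  both sides use every edge equally often.\<close>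

lemma farkas_not_lifts:
  assumes c: "groups_correct" and R: "bit_vectors R" "farkas R ps"
  shows "\<not> lifts (family R) \<omega>"
proof
  assume l: "lifts (family R) \<omega>"
  have less: "sum \<omega> (lset (bits_of (fst p))) < sum \<omega> (lset (bits_of (snd p)))"
    and b: "bits (lset (bits_of (fst p))) = bits_of (fst p)" "bits (lset (bits_of (snd p))) = bits_of (snd p)"
    if p: "p \<in> set ps" for p
  proof -
    have "farkas_pair R p" using R(2) p by (simp add: farkas_def)
    then have f: "is_face R (bits_of (fst p))" "bits_of (fst p) \<noteq> bits_of (snd p)"
      "some_in (subset_of [bits_of (fst p), bits_of (snd p)]) groups"
      unfolding farkas_pair_iff beq_iff by blast+
    then obtain g where g: "g \<in> set groups" "bits_of (fst p) \<in> set g" "bits_of (snd p) \<in> set g" by auto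
    note m = group_members[OF c g(1,2)] and n = group_members[OF c g(1,3)]
    show b: "bits (lset (bits_of (fst p))) = bits_of (fst p)" "bits (lset (bits_of (snd p))) = bits_of (snd p)"
      by (rule m(1), rule n(1))
    have "lset (bits_of (fst p)) \<noteq> lset (bits_of (snd p))" using f(2) b by metis
    moreover have "lset (bits_of (fst p)) \<in> faces (family R)" using f(1) is_face_iff[OF R(1)] b(1) by metis
    ultimately show "sum \<omega> (lset (bits_of (fst p))) < sum \<omega> (lset (bits_of (snd p)))"
      using l m(2) n(2) m(3)[OF g(3)] unfolding lifts_def by blast
  qed
  have b': "bits (lset (bits_of x)) = bits_of x" if x: "x \<in> set (map fst ps) \<union> set (map snd ps)" for x
  proof -
    obtain p where "p \<in> set ps" "x = fst p \<or> x = snd p" using x by fastforce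
    then show ?thesis using b by metis
  qed
  obtain t where t: "tallies (map fst ps) = map t labels"
    "(\<Sum>v\<in>UNIV. real (t v) * \<omega> v) = (\<Sum>x\<leftarrow>map fst ps. sum \<omega> (lset (bits_of x)))"
    using tallies_map[of "map fst ps" \<omega>, OF b'[OF UnI1]] by blast
  obtain t' where t': "tallies (map snd ps) = map t' labels"
    "(\<Sum>v\<in>UNIV. real (t' v) * \<omega> v) = (\<Sum>x\<leftarrow>map snd ps. sum \<omega> (lset (bits_of x)))"
    using tallies_map[of "map snd ps" \<omega>, OF b'[OF UnI2]] by blast
  have "tallies (map fst ps) = tallies (map snd ps)" "ps \<noteq> []" using R(2) by (auto simp: farkas_def)
  then have "t = t'" using t(1) t'(1) map_labels_inj by metis
  then have eq: "(\<Sum>p\<leftarrow>ps. sum \<omega> (lset (bits_of (fst p)))) = (\<Sum>p\<leftarrow>ps. sum \<omega> (lset (bits_of (snd p))))"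
    using t(2) t'(2) by (simp add: comp_def)
  have "qs \<noteq> [] \<Longrightarrow> set qs \<subseteq> set ps \<Longrightarrow>
    (\<Sum>p\<leftarrow>qs. sum \<omega> (lset (bits_of (fst p)))) < (\<Sum>p\<leftarrow>qs. sum \<omega> (lset (bits_of (snd p))))" for qs
  proof (induction qs)
    case (Cons q qs)
    then show ?case using less[of q] by (cases "qs = []") (simp_all add: add_strict_mono)
  qed simp
  then show False using eq \<open>ps \<noteq> []\<close> by force
qed

subsection \<open>The invariant\<close>

lemma overlap_bits: "overlap (bits T) (bits U) = overlap_of T U"
proof -
  have ov: "ov a b = (if a \<and> b then 1 else 0)" for a b by (cases a; cases b) simp_all
  have c: "int (card (in_block A i)) = (\<Sum>v\<in>UNIV. if fst v = i then (if v \<in> A then 1 else 0) else 0)" for A i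
  proof -
    have "(\<Sum>v\<in>UNIV. if fst v = i then (if v \<in> A then 1 else 0) else (0::int)) = (\<Sum>v\<in>UNIV. if v \<in> A \<and> fst v = i then 1 else 0)"
      by (intro sum.cong) auto
    also have "\<dots> = int (card {v. v \<in> A \<and> fst v = i})" by (simp add: sum.If_cases)
    finally show ?thesis by (simp add: in_block_def)
  qed
  have p: "(\<Prod>i\<in>UNIV. h i) = h 1 * (h 2 * (h 3 * h 4))" for h :: "4 \<Rightarrow> int"
    unfolding UNIV_4 by simp
  show ?thesis
    unfolding overlap_of_def p c sum_label_cases bits_explicit
    by (simp add: ov add.assoc)
qed

lemma overlap_sum_list: "overlap_sum us t = (\<Sum>u\<leftarrow>us. overlap t u)"
  by (induction us) simp_all

lemma square_sum_list: "square_sum R ts = (\<Sum>t\<leftarrow>ts. (\<Sum>u\<leftarrow>R. overlap t u)\<^sup>2)"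
  by (induction ts) (simp_all add: square_def overlap_sum_list power2_eq_square)

lemma invariant_family:
  assumes R: "bit_vectors R" "distinct R" shows "invariant R = invariant_of (family R)"
proof -
  have s: "(\<Sum>x\<leftarrow>R. h x) = (\<Sum>T\<in>family R. h (bits T))" for h :: "bool list \<Rightarrow> int"
  proof -
    have "(\<Sum>x\<leftarrow>R. h x) = sum h (set R)" by (rule sum.distinct_set_conv_list[OF R(2), symmetric])
    also have "\<dots> = sum h (bits ` family R)" by (simp only: bits_family[OF R(1)])
    also have "\<dots> = (\<Sum>T\<in>family R. h (bits T))"
      using inj_on_subset[OF inj_bits subset_UNIV] by (simp add: sum.reindex)
    finally show ?thesis .
  qed
  show ?thesis unfolding invariant_def square_sum_list s overlap_bits invariant_of_def ..
qed

subsection \<open>Correctness of the search\<close>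

definition index_vec :: "bool list \<Rightarrow> nat list" where
  "index_vec x = map (\<lambda>ls. index_of ls x) point_bits"

lemma index_of_0: "index_of ls x = 0 \<Longrightarrow> l \<in> set ls \<Longrightarrow> \<not> subvec l x"
proof (induction ls)
  case (Cons a ls)
  then show ?case by (cases "subvec a x"; cases "index_of ls x") auto
qed simp

lemma index_of_Suc: "index_of ls x = Suc k \<Longrightarrow> k < length ls \<and> subvec (ls ! k) x"
proof (induction ls arbitrary: k)
  case (Cons a ls)
  then show ?case by (cases "subvec a x"; cases "index_of ls x") auto
qed simp

lemma restrict_class_mem: "(x, l # ls) \<in> set c \<Longrightarrow> allowed k l \<Longrightarrow> (x, ls) \<in> set (restrict_class k c)"
proof (induction k c rule: restrict_class.induct)
  case (3 k y m ms ts)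
  then show ?case by (cases "allowed k m") auto
qed auto

text \<open>Stated for sets, because the accumulator reverses the order of the classes.\<close>

lemma set_restrict_all:
  "\<forall>c\<in>set C. restrict_class k c \<noteq> [] \<Longrightarrow> set (restrict_all k C acc) = restrict_class k ` set C \<union> set acc"
proof (induction C arbitrary: acc)
  case (Cons c C)
  then obtain t ts where "restrict_class k c = t # ts" by (cases "restrict_class k c") auto
  then show ?case using Cons by auto
qed simp

text \<open>The invariant of the search after \<open>d\<close> points: each class still holds a tree
  of \<open>M\<close>, and each tree of \<open>M\<close> is still in some class.\<close>

definition state_ok :: "label set set \<Rightarrow> nat \<Rightarrow> (bool list \<times> nat list) list list \<Rightarrow> bool" where
  "state_ok M d C \<longleftrightarrow> C \<noteq> [] \<and>
     (\<forall>c\<in>set C. \<exists>T\<in>M. (bits T, drop d (index_vec (bits T))) \<in> set c) \<and>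
     (\<forall>T\<in>M. \<exists>c\<in>set C. (bits T, drop d (index_vec (bits T))) \<in> set c)"

lemma restrict_state_ok:
  assumes C: "state_ok M d C" and d: "d < length point_bits"
    and k: "\<And>T. T \<in> M \<Longrightarrow> allowed k (index_vec (bits T) ! d)"
  shows "state_ok M (Suc d) (restrict_all k C [])"
proof -
  have step: "(bits T, drop (Suc d) (index_vec (bits T))) \<in> set (restrict_class k c)"
    if "T \<in> M" "(bits T, drop d (index_vec (bits T))) \<in> set c" for T c
  proof (rule restrict_class_mem[OF _ k[OF that(1)]])
    show "(bits T, index_vec (bits T) ! d # drop (Suc d) (index_vec (bits T))) \<in> set c"
      using that(2) d Cons_nth_drop_Suc[of d "index_vec (bits T)"] unfolding index_vec_def length_map by metis
  qed
  have "restrict_class k c \<noteq> []" if c: "c \<in> set C" for c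
  proof -
    obtain T where "T \<in> M" "(bits T, drop d (index_vec (bits T))) \<in> set c" using C c unfolding state_ok_def by blast
    then show ?thesis using step[of T c] by auto
  qed
  then have s: "set (restrict_all k C []) = restrict_class k ` set C" by (simp add: set_restrict_all)
  then have "restrict_all k C [] \<noteq> []" using C unfolding state_ok_def by (metis image_is_empty set_empty)
  moreover have "\<exists>T\<in>M. (bits T, drop (Suc d) (index_vec (bits T))) \<in> set c'" if c': "c' \<in> restrict_class k ` set C" for c'
  proof -
    obtain c where c: "c \<in> set C" "c' = restrict_class k c" using c' by blast
    then obtain T where "T \<in> M" "(bits T, drop d (index_vec (bits T))) \<in> set c" using C unfolding state_ok_def by blast
    then show ?thesis using step c by blast
  qed
  moreover have "\<exists>c'\<in>restrict_class k ` set C. (bits T, drop (Suc d) (index_vec (bits T))) \<in> set c'" if T: "T \<in> M" for T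
  proof -
    obtain c where "c \<in> set C" "(bits T, drop d (index_vec (bits T))) \<in> set c" using C T unfolding state_ok_def by blast
    then show ?thesis using step[OF T] by blast
  qed
  ultimately show ?thesis unfolding state_ok_def s by blast
qed

lemma branch_mem: "k \<in> set ks \<Longrightarrow> l \<in> set (search kss (restrict_all k C [])) \<Longrightarrow> l \<in> set (branch ks kss C)"
  by (induction ks) auto

lemma leaf_of_singletons:
  "[] \<notin> set (leaf_of C) \<Longrightarrow> c \<in> set C \<Longrightarrow> \<exists>x ls. c = [(x, ls)]"
  by (induction C rule: leaf_of.induct) auto

lemma leaf_of_mem:
  "[] \<notin> set (leaf_of C) \<Longrightarrow> x \<in> set (leaf_of C) \<longleftrightarrow> (\<exists>ls. [(x, ls)] \<in> set C)"
  by (induction C rule: leaf_of.induct) auto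

text \<open>The only tree of a class must belong to \<open>M\<close>, and no tree of
  \<open>M\<close> has been lost.\<close>

lemma leaf_of_state:
  assumes C: "state_ok M d C" and no: "[] \<notin> set (leaf_of C)" shows "set (leaf_of C) = bits ` M"
proof (intro equalityI subsetI)
  fix x assume "x \<in> set (leaf_of C)"
  then obtain ls where ls: "[(x, ls)] \<in> set C" using leaf_of_mem[OF no] by blast
  then obtain T where "T \<in> M" "(bits T, drop d (index_vec (bits T))) \<in> set [(x, ls)]"
    using C unfolding state_ok_def by blast
  then show "x \<in> bits ` M" by auto
next
  fix x assume "x \<in> bits ` M"
  then obtain T where T: "T \<in> M" "x = bits T" by blast
  then obtain c where c: "c \<in> set C" "(bits T, drop d (index_vec (bits T))) \<in> set c"
    using C unfolding state_ok_def by blast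
  then obtain y ls where "c = [(y, ls)]" using leaf_of_singletons[OF no] by blast
  then show "x \<in> set (leaf_of C)" using leaf_of_mem[OF no] c T by auto
qed

text \<open>Following at each point the position allowed by \<open>M\<close> preserves the invariant
  down to a leaf. The alternative with \<open>[]\<close> covers leaves at which a class is still
  undecided.\<close>

lemma search_complete:
  assumes "state_ok M d C" "d + length kss \<le> length point_bits"
    "\<And>i. i < length kss \<Longrightarrow> \<exists>k\<in>set (kss ! i). \<forall>T\<in>M. allowed k (index_vec (bits T) ! (d + i))"
  shows "\<exists>l\<in>set (search kss C). [] \<in> set l \<or> set l = bits ` M"
  using assms
proof (induction kss arbitrary: d C)
  case Nil
  then obtain c cs where C: "C = c # cs" unfolding state_ok_def by (cases C) auto
  then show ?case using leaf_of_state[OF Nil(1)] by (auto simp del: leaf_of.simps)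
next
  case (Cons ks kss)
  then obtain c cs where C: "C = c # cs" unfolding state_ok_def by (cases C) auto
  obtain k where k: "k \<in> set ks" "\<And>T. T \<in> M \<Longrightarrow> allowed k (index_vec (bits T) ! d)"
    using Cons.prems(3)[of 0] by auto
  have "state_ok M (Suc d) (restrict_all k C [])"
    using restrict_state_ok[OF Cons.prems(1) _ k(2)] Cons.prems(2) by simp
  moreover have "\<exists>k\<in>set (kss ! i). \<forall>T\<in>M. allowed k (index_vec (bits T) ! (Suc d + i))" if "i < length kss" for i
    using Cons.prems(3)[of "Suc i"] that by simp
  ultimately obtain l where "l \<in> set (search kss (restrict_all k C []))" "[] \<in> set l \<or> set l = bits ` M"
    using Cons.IH[of "Suc d" "restrict_all k C []"] Cons.prems(2) by auto
  then show ?case using branch_mem[OF k(1)] unfolding C search.simps by blast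
qed

definition points_correct :: bool where
  "points_correct \<longleftrightarrow> all_in point_ok point_bits"

lemma indicator_nat_of_bool: "indicat_real A v = real (nat_of_bool (v \<in> A))"
  by (cases "v \<in> A") simp_all

lemma row_column_sums_bits:
  "row_sums (map nat_of_bool (bits A)) = [Suc 0, Suc 0, Suc 0, Suc 0] \<Longrightarrow> marg (indicat_real A) \<in> level_one"
  "row_sums (map nat_of_bool (bits A)) = row_sums (map nat_of_bool (bits B)) \<Longrightarrow>
   column_sums (map nat_of_bool (bits A)) = column_sums (map nat_of_bool (bits B)) \<Longrightarrow>
   marg (indicat_real A) = marg (indicat_real B)"
proof -
  show "marg (indicat_real A) \<in> level_one"
    if "row_sums (map nat_of_bool (bits A)) = [Suc 0, Suc 0, Suc 0, Suc 0]"
    using that unfolding level_one_def mem_Collect_eq forall_4 marg_sums indicator_nat_of_bool bits_explicit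
    by (simp flip: of_nat_add)
  assume eq: "row_sums (map nat_of_bool (bits A)) = row_sums (map nat_of_bool (bits B))"
    "column_sums (map nat_of_bool (bits A)) = column_sums (map nat_of_bool (bits B))"
  have "(\<forall>i. marg (indicat_real A) $ Inr i = marg (indicat_real B) $ Inr i) \<and>
    (\<forall>i. marg (indicat_real A) $ Inl i = marg (indicat_real B) $ Inl i)"
    using eq unfolding forall_4 marg_sums indicator_nat_of_bool bits_explicit
    by (simp flip: of_nat_add)
  then show "marg (indicat_real A) = marg (indicat_real B)" by (intro vec_sum_eqI) blast+
qed

lemma point_labels_unique:
  assumes p: "points_correct" "ls \<in> set point_bits" and M: "admissible M" "T \<in> M" "U \<in> M"
    and j: "j < length ls" "subvec (ls ! j) (bits T)" and k: "k < length ls" "subvec (ls ! k) (bits U)"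
  shows "j = k"
proof -
  have ok: "point_ok ls" using p by (simp add: points_correct_def)
  then have d: "distinct ls" by (simp add: point_ok_def uniq_iff)
  have lab: "point_label_ok (hd ls) (ls ! i)" if "i < length ls" for i using ok that by (simp add: point_ok_def)
  define \<phi> where "\<phi> = lset (ls ! j)"
  define \<psi> where "\<psi> = lset (ls ! k)"
  have b: "bits \<phi> = ls ! j" "bits \<psi> = ls ! k"
    using lab[OF j(1)] lab[OF k(1)] by (simp_all add: \<phi>_def \<psi>_def point_label_ok_def twelve_iff bits_lset)
  have "\<phi> \<subseteq> T" "\<psi> \<subseteq> U" using j(2) k(2) by (simp_all add: b[symmetric] sub_bits)
  moreover have "marg (indicat_real \<phi>) \<in> level_one"
    using lab[OF j(1)] by (intro row_column_sums_bits(1)) (simp add: b point_label_ok_def)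
  moreover have "marg (indicat_real \<phi>) = marg (indicat_real \<psi>)"
    using lab[OF j(1)] lab[OF k(1)] by (intro row_column_sums_bits(2)) (simp_all add: b point_label_ok_def)
  ultimately have "\<phi> = \<psi>" using admissible_unique[OF M] by blast
  then have "ls ! j = ls ! k" using b by metis
  then show ?thesis using d j(1) k(1) by (simp add: nth_eq_iff_index_eq)
qed

text \<open>If some tree contains an expression of the point, its position is right for all trees;
  otherwise all indices are 0 and position 0 will do.\<close>

lemma point_allowed:
  assumes p: "points_correct" "ls \<in> set point_bits" and M: "admissible M"
  shows "\<exists>k<length ls. \<forall>T\<in>M. allowed k (index_of ls (bits T))"
proof (cases "\<exists>T\<in>M. index_of ls (bits T) \<noteq> 0")
  case True
  then obtain T k where T: "T \<in> M" "index_of ls (bits T) = Suc k" by (metis not0_implies_Suc)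
  have "allowed k (index_of ls (bits U))" if "U \<in> M" for U
  proof (cases "index_of ls (bits U)")
    case (Suc j)
    then show ?thesis
      using point_labels_unique[OF p M T(1) that] index_of_Suc[OF T(2)] index_of_Suc[OF Suc]
      by (simp add: same_index_iff)
  qed simp
  then show ?thesis using index_of_Suc[OF T(2)] by blast
next
  case False
  have "ls \<noteq> []" using p by (auto simp: points_correct_def point_ok_def nonnull_iff)
  then show ?thesis using False by (intro exI[of _ 0]) auto
qed

lemma set_upto_from: "set (upto_from xs n) = {n..<n + length xs}"
  by (induction xs arbitrary: n) auto

lemma branch_lists_map: "branch_lists ls = map (\<lambda>l. upto_from l 0) ls"
  by (induction ls) simp_all

lemma search_lists_nth:
  "0 < i \<Longrightarrow> i < length point_labels \<Longrightarrow> set (search_lists ! i) = {..<length (point_bits ! i)}"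
  by (cases i) (simp_all add: search_lists_def branch_lists_map set_upto_from nth_tl point_bits_def atLeast0LessThan)

lemma length_point_bits: "length point_bits = 19" "length search_lists = 19"
  by (simp_all add: point_bits_def search_lists_def branch_lists_map point_labels_def)

text \<open>An expression of the first point contained in a tree of \<open>M\<close> can be moved to
  one of the first two by a relabelling, which replaces \<open>M\<close> by an equivalent
  family.\<close>

lemma first_branch:
  assumes p: "points_correct" "all2 conj_ok (hd point_bits) conj_words" and M: "admissible M"
  obtains w k where "k < 2" "\<And>T. T \<in> relabel_family (word_perm w) M \<Longrightarrow> allowed k (index_of (hd point_bits) (bits T))"
proof -
  let ?ls = "hd point_bits"
  have ls: "?ls \<in> set point_bits" using length_point_bits(1) by (intro hd_in_set) auto
  show ?thesis
  proof (cases "\<exists>T\<in>M. index_of ?ls (bits T) \<noteq> 0")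
    case True
    then obtain T k where T: "T \<in> M" "index_of ?ls (bits T) = Suc k" by (metis not0_implies_Suc)
    then have k: "k < length ?ls" "subvec (?ls ! k) (bits T)" using index_of_Suc by blast+
    define w where "w = conj_words ! k"
    have "conj_ok (?ls ! k) w" using p(2) k(1) unfolding all2_iff w_def by (simp add: list_all2_conv_all_nth)
    then have "act_word w (?ls ! k) \<in> set (take 2 ?ls)" by (simp add: conj_ok_def numeral_2_eq_2)
    then obtain j where j: "j < 2" "j < length ?ls" "act_word w (?ls ! k) = ?ls ! j"
      by (auto simp: in_set_conv_nth)
    have "point_ok ?ls" using p(1) ls by (simp add: points_correct_def)
    then have "twelve (?ls ! k)" using k(1) by (simp add: point_ok_def point_label_ok_def)
    then have b: "bits (lset (?ls ! k)) = ?ls ! k" by (simp add: twelve_iff bits_lset)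
    let ?M = "relabel_family (word_perm w) M"
    have M': "admissible ?M" by (rule admissible_relabel[OF bij_word_perm M])
    let ?T = "relabel (word_perm w) ` T"
    have T': "?T \<in> ?M" using T(1) by (simp add: relabel_family_def)
    have "lset (?ls ! k) \<subseteq> T" using k(2) b sub_bits by metis
    then have "relabel (word_perm w) ` lset (?ls ! k) \<subseteq> ?T" by blast
    then have "subvec (act_word w (?ls ! k)) (bits ?T)" using b act_word_bits sub_bits by metis
    then have jT: "subvec (?ls ! j) (bits ?T)" by (simp add: j(3))
    obtain l where l: "\<forall>U\<in>?M. allowed l (index_of ?ls (bits U))"
      using point_allowed[OF p(1) ls M'] by blast
    have "index_of ?ls (bits ?T) \<noteq> 0" using index_of_0 jT j(2) nth_mem by blast
    then obtain i where i: "index_of ?ls (bits ?T) = Suc i" by (metis not0_implies_Suc)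
    have "i = j" using point_labels_unique[OF p(1) ls M' T' T'] index_of_Suc[OF i] j(2) jT by blast
    moreover have "allowed l (Suc i)" using l T' i by metis
    ultimately have "l = j" by (simp add: same_index_iff)
    then show ?thesis using that[of j w] j(1) l by blast
  next
    case False
    have "relabel_family (word_perm []) M = M" by (simp only: word_perm.simps relabel_family_id)
    then show ?thesis using that[of 0 "[]"] False by auto
  qed
qed

section \<open>Completeness of the initial state\<close>

lemma tree_deg_pos: assumes "T \<in> trees" shows "deg T j \<noteq> 0"
proof
  assume "deg T j = 0"
  then have empty: "{v \<in> T. right v = j} = {}" by (simp add: deg_def)
  obtain i where "i \<noteq> j" using right_neq by metis
  then obtain v where v: "right v = j" using ex_label by blast
  obtain f where f: "supported T f" "marg f = cayley_point v" using tree_flow[OF assms] marg_single by metis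
  have "(\<Sum>u | right u = j. f u) = 0"
    using supportedD[OF f(1)] empty by (intro sum.neutral) blast
  moreover have "marg f $ Inl j = 1" by (simp add: f(2) cayley_point_Inl v)
  ultimately show False by (simp add: marg_Inl)
qed

definition deg_list :: "label set \<Rightarrow> nat list" where
  "deg_list T = [deg T 1, deg T 2, deg T 3, deg T 4]"

text \<open>A right vertex of a spanning tree meets at least one of its three possible edges, and
  the degrees add up to 7.\<close>

lemma tree_deg_list: assumes "T \<in> trees" obtains r where "r \<in> set degs" "map oct_nat r = deg_list T"
proof -
  have le: "nat_of_bool b \<le> 1" for b by (cases b) simp_all
  have 3: "deg T 1 \<le> 3" "deg T 2 \<le> 3" "deg T 3 \<le> 3" "deg T 4 \<le> 3"
    unfolding deg_sums
    using add_mono[OF add_mono[OF le le] le] by (simp_all add: numeral_3_eq_3)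
  have range: "d \<in> {1, 2, 3}" if "d \<noteq> 0" "d \<le> 3" for d :: nat using that by auto
  have s: "deg T 1 + deg T 2 + deg T 3 + deg T 4 = 7"
    using sum_deg[of T] assms by (simp add: sum_4 trees_def)
  have "\<exists>r\<in>set degs. map oct_nat r = [a, b, c, d]"
    if "a \<in> {1, 2, 3}" "b \<in> {1, 2, 3}" "c \<in> {1, 2, 3}" "a + b + c + d = 7" "d \<in> {1, 2, 3}" for a b c d :: nat
    using that unfolding degs_def by (elim insertE emptyE) simp_all
  from this[OF range[OF tree_deg_pos[OF assms] 3(1)] range[OF tree_deg_pos[OF assms] 3(2)]
      range[OF tree_deg_pos[OF assms] 3(3)] s range[OF tree_deg_pos[OF assms] 3(4)]]
  obtain r where "r \<in> set degs" "map oct_nat r = [deg T 1, deg T 2, deg T 3, deg T 4]" by (rule bexE)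
  then show ?thesis by (intro that[of r]) (simp_all only: deg_list_def)
qed

lemma column_sets_mem:
  "nat_of_bool x + nat_of_bool y + nat_of_bool z = oct_nat p \<Longrightarrow> p \<in> {O1, O2, O3} \<Longrightarrow> [x, y, z] \<in> set (column_sets p)"
  by (cases x; cases y; cases z) auto

lemma acyclic_tree: assumes c: "groups_correct" and T: "compatible T T" shows "acyclic_bits (bits T)"
proof -
  have "short (select (\<lambda>m. subvec m (bits T)) g)" if g: "g \<in> set groups" for g
  proof (cases g)
    case (Cons a l)
    then have dg: "distinct g" using group_members(4)[OF c g, of a] by simp
    have eq: "m = n" if "m \<in> set g" "n \<in> set g" "subvec m (bits T)" "subvec n (bits T)" for m n
    proof -
      note m = group_members[OF c g that(1)] and n = group_members[OF c g that(2)]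
      have "lset m \<subseteq> T" "lset n \<subseteq> T" using that(3,4) m(1) n(1) sub_bits by metis+
      then have "lset m = lset n" using T m(2) n(2) m(3)[OF that(2)] unfolding compatible_def by blast
      then show ?thesis using m(1) n(1) by metis
    qed
    let ?f = "filter (\<lambda>m. subvec m (bits T)) g"
    have "\<not> 2 \<le> length ?f"
    proof
      assume "2 \<le> length ?f"
      then obtain m n l' where "?f = m # n # l'" by (metis Suc_le_length_iff numeral_2_eq_2)
      moreover have "distinct ?f" using dg by simp
      ultimately have "m \<noteq> n" "m \<in> set ?f" "n \<in> set ?f" by auto
      then show False using eq by auto
    qed
    then show ?thesis by (simp add: short_iff select_filter)
  qed simp
  then show ?thesis by (simp add: acyclic_bits_def)
qed

lemma mem_concat_map: "x \<in> set xs \<Longrightarrow> y \<in> set (f x) \<Longrightarrow> y \<in> set (concat (map f xs))"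
  by auto

lemma edge_sets_mem:
  assumes "a \<in> set (column_sets p)" "b \<in> set (column_sets q)" "c \<in> set (column_sets s)" "d \<in> set (column_sets t)"
  shows "from_columns a b c d \<in> set (edge_sets [p, q, s, t])"
  unfolding edge_sets.simps
  by (rule mem_concat_map[OF assms(1)], rule mem_concat_map[OF assms(2)], rule mem_concat_map[OF assms(3)],
    unfold set_map, rule imageI, rule assms(4))

lemma tree_in_class:
  assumes c: "groups_correct" and T: "T \<in> trees" and r: "r \<in> set degs" "map oct_nat r = deg_list T"
  shows "bits T \<in> set (select acyclic_bits (edge_sets r))"
proof -
  obtain p q s t where pq: "r = [p, q, s, t]" "p \<in> {O1, O2, O3}" "q \<in> {O1, O2, O3}" "s \<in> {O1, O2, O3}" "t \<in> {O1, O2, O3}"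
    using r(1) unfolding degs_def by auto
  have d: "oct_nat p = deg T 1" "oct_nat q = deg T 2" "oct_nat s = deg T 3" "oct_nat t = deg T 4"
    using r(2) pq(1) by (simp_all add: deg_list_def)
  have col: "[(2,1) \<in> T, (3,1) \<in> T, (4,1) \<in> T] \<in> set (column_sets p)" "[(1,1) \<in> T, (3,2) \<in> T, (4,2) \<in> T] \<in> set (column_sets q)"
    "[(1,2) \<in> T, (2,2) \<in> T, (4,3) \<in> T] \<in> set (column_sets s)" "[(1,3) \<in> T, (2,3) \<in> T, (3,3) \<in> T] \<in> set (column_sets t)"
    by (rule column_sets_mem; simp only: d deg_sums pq)+
  have "bits T = from_columns [(2,1) \<in> T, (3,1) \<in> T, (4,1) \<in> T] [(1,1) \<in> T, (3,2) \<in> T, (4,2) \<in> T]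
    [(1,2) \<in> T, (2,2) \<in> T, (4,3) \<in> T] [(1,3) \<in> T, (2,3) \<in> T, (3,3) \<in> T]" by (simp add: bits_explicit)
  then have "bits T \<in> set (edge_sets r)" using edge_sets_mem[OF col] by (simp only: pq(1))
  then show ?thesis using acyclic_tree[OF c] T by (simp add: select_filter trees_def)
qed

lemma quarter_attainable:
  assumes q: "quarter_ok r ws" "r = [p1, p2, p3, p4]"
  shows "attainable (\<lambda>j. if j = 1 then oct_nat p1 else if j = 2 then oct_nat p2 else if j = 3 then oct_nat p3 else oct_nat p4)"
proof -
  have rs: "row_sums (map oct_nat ws) = [4, 4, 4, 4]" using q(1) by (simp add: quarter_ok_def)
  then have "length (map oct_nat ws) = 12" by (cases "map oct_nat ws" rule: row_sums.cases) simp_all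
  then obtain w where w: "map oct_nat ws = map w labels" by (rule ex_map_labels)
  define f where "f v = real (w v) / 4" for v
  have row: "w (1,1) + w (1,2) + w (1,3) = 4" "w (2,1) + w (2,2) + w (2,3) = 4"
    "w (3,1) + w (3,2) + w (3,3) = 4" "w (4,1) + w (4,2) + w (4,3) = 4"
    using rs unfolding w labels_def by simp_all
  have col: "w (2,1) + w (3,1) + w (4,1) + 3 = 4 * oct_nat p1" "w (1,1) + w (3,2) + w (4,2) + 3 = 4 * oct_nat p2"
    "w (1,2) + w (2,2) + w (4,3) + 3 = 4 * oct_nat p3" "w (1,3) + w (2,3) + w (3,3) + 3 = 4 * oct_nat p4"
    using q(1) unfolding quarter_ok_def w labels_def q(2) by simp_all
  have "\<forall>i. marg f $ Inr i = 1"
    unfolding forall_4 marg_sums f_def using row[THEN arg_cong[of _ _ real]] by simp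
  then have "marg f \<in> level_one" by (simp add: level_one_def)
  moreover have "marg f \<in> edge_cone UNIV" by (rule coneI) (simp_all add: supported_def nonneg_def f_def)
  moreover have "\<forall>j. marg f $ Inl j = real (if j = 1 then oct_nat p1 else if j = 2 then oct_nat p2 else if j = 3 then oct_nat p3 else oct_nat p4) - 3/4"
    unfolding forall_4 marg_sums f_def using col[THEN arg_cong[of _ _ real]] by simp
  ultimately show ?thesis unfolding attainable_def by blast
qed

text \<open>Every vector in \<open>degs\<close> is attainable, so each class contains a tree of
  \<open>M\<close>; every tree has its degrees in \<open>degs\<close>, so each tree of
  \<open>M\<close> is in a class.\<close>

lemma initial_state:
  assumes c: "groups_correct" "all2 quarter_ok degs quarter_flows" and M: "admissible M"
  shows "state_ok M 0 tree_classes"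
proof -
  define cls where "cls r = map (\<lambda>x. (x, index_vec x)) (select acyclic_bits (edge_sets r))" for r
  have tc: "tree_classes = map cls degs" by (simp add: tree_classes_def cls_def index_vec_def)
  have mem: "(bits T, index_vec (bits T)) \<in> set (cls r)" if "T \<in> M" "r \<in> set degs" "map oct_nat r = deg_list T" for T r
    using tree_in_class[OF c(1) _ that(2,3)] admissible_trees[OF M] that(1) by (auto simp: cls_def)
  have "\<exists>T\<in>M. (bits T, index_vec (bits T)) \<in> set (cls r)" if r: "r \<in> set degs" for r
  proof -
    obtain ws where ws: "quarter_ok r ws" using c(2) r unfolding all2_iff by (metis list_all2_conv_all_nth in_set_conv_nth)
    obtain p1 p2 p3 p4 where p: "r = [p1, p2, p3, p4]" using r unfolding degs_def by auto
    obtain T where T: "T \<in> M"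
      "deg T = (\<lambda>j. if j = 1 then oct_nat p1 else if j = 2 then oct_nat p2 else if j = 3 then oct_nat p3 else oct_nat p4)"
      using admissible_deg[OF M quarter_attainable[OF ws p]] by blast
    have "map oct_nat r = deg_list T" by (simp add: p deg_list_def T(2))
    then show ?thesis using mem[OF T(1) r] T(1) by blast
  qed
  moreover have "\<exists>r\<in>set degs. (bits T, index_vec (bits T)) \<in> set (cls r)" if T: "T \<in> M" for T
  proof -
    have "T \<in> trees" using admissible_trees[OF M] T by blast
    then obtain r where "r \<in> set degs" "map oct_nat r = deg_list T" by (rule tree_deg_list)
    then show ?thesis using mem[OF T] by blast
  qed
  moreover have "tree_classes \<noteq> []" by (simp add: tc degs_def)
  ultimately show ?thesis unfolding state_ok_def tc by simp
qed

lemma leaves_complete: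
  assumes c: "groups_correct" "points_correct" "all2 conj_ok (hd point_bits) conj_words"
    "all2 quarter_ok degs quarter_flows" and M: "admissible M"
  obtains w l where "l \<in> set leaves" "[] \<in> set l \<or> set l = bits ` relabel_family (word_perm w) M"
proof -
  obtain w k where k: "k < 2"
    "\<And>T. T \<in> relabel_family (word_perm w) M \<Longrightarrow> allowed k (index_of (hd point_bits) (bits T))"
    using first_branch[OF c(2,3) M] by blast
  let ?M = "relabel_family (word_perm w) M"
  have M': "admissible ?M" by (rule admissible_relabel[OF bij_word_perm M])
  have "\<exists>k\<in>set (search_lists ! i). \<forall>T\<in>?M. allowed k (index_vec (bits T) ! (0 + i))" if i: "i < length search_lists" for i
  proof (cases "i = 0")
    case True
    have "k \<in> set (search_lists ! 0)" using k(1) by (auto simp: search_lists_def)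
    moreover have "point_bits \<noteq> []" using length_point_bits(1) by auto
    then have "index_vec (bits T) ! 0 = index_of (hd point_bits) (bits T)" for T
      by (simp add: index_vec_def hd_conv_nth)
    ultimately show ?thesis using True k(2) by auto
  next
    case False
    have i': "i < length point_bits" using i by (simp add: length_point_bits)
    then obtain j where "j < length (point_bits ! i)" "\<forall>T\<in>?M. allowed j (index_of (point_bits ! i) (bits T))"
      using point_allowed[OF c(2) _ M', of "point_bits ! i"] by auto
    moreover have "set (search_lists ! i) = {..<length (point_bits ! i)}"
      using False i' by (intro search_lists_nth) (simp_all add: point_bits_def)
    ultimately show ?thesis using i' by (intro bexI[of _ j]) (simp_all add: index_vec_def)
  qed
  then have "\<exists>l\<in>set leaves. [] \<in> set l \<or> set l = bits ` ?M"
    unfolding leaves_def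
    by (intro search_complete[OF initial_state[OF c(1,4) M']]) (simp_all add: length_point_bits)
  then show ?thesis using that by blast
qed

subsection \<open>The computation\<close>

lemma groups_correct: "groups_correct"
  by code_simp

lemma points_correct: "points_correct"
  by code_simp

lemma conj_words_ok: "all2 conj_ok (hd point_bits) conj_words"
  by code_simp

lemma quarter_flows_ok: "all2 quarter_ok degs quarter_flows"
  by code_simp

text \<open>This runs the whole search and compares every leaf with the relabelled representative
  that \<open>leaf_classes\<close> names.\<close>

lemma leaves_ok: "leaves_ok"
  by code_simp

lemma chunks_nonnull: "all_in nonnull (chunk8_step (reg_bits @ nonreg_bits) [] O0)"
  by code_simp

lemma rep_shapes: "all_in rep_shape (reg_bits @ nonreg_bits)" "all_in nonnull (reg_bits @ nonreg_bits)"
  by code_simp+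

lemma good_reps: "all_in good_rep reg_bits" "all_in good_rep nonreg_bits"
  by code_simp+

lemma heights_lift: "all2 lifted reg_bits heights"
  by code_simp

lemma heights_length: "all_in (\<lambda>ws. twelve (map (\<lambda>_. True) ws)) heights"
  by code_simp

lemma farkas_pairs_ok: "all2 farkas nonreg_bits farkas_pairs"
  by code_simp

text \<open>The source of three facts: the representatives are distinct, their orbits are disjoint,
  and their symmetry classes are different.\<close>

lemma distinct_invariants: "distinct (map invariant (reg_bits @ nonreg_bits))"
  by code_simp

lemma stabs_ok: "all2 stab_ok reg_bits reg_stabs" "all2 stab_ok nonreg_bits nonreg_stabs"
  by code_simp+

text \<open>The bits describe the tree used for \<open>dim_points\<close>, which no nontrivial
  permutation of the indices fixes; different images therefore reveal different
  permutations.\<close>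

lemma perm_words_images:
  "uniq (map (\<lambda>w. act_word w [True,True,True,True,True,False,True,False,False,True,False,False]) perm_words)"
  by code_simp

lemma length_reps: "length reg_bits = 48" "length nonreg_bits = 7" "length perm_words = 24"
  by (simp_all add: reg_bits_def nonreg_bits_def reg_reps_def nonreg_reps_def perm_words_def)

lemma stab_sums:
  "(\<Sum>s\<leftarrow>reg_stabs. 24 div oct_nat s) = 1002" "(\<Sum>s\<leftarrow>nonreg_stabs. 24 div oct_nat s) = 66"
proof -
  have "24 div Suc (Suc 0) = (12::nat)" by (simp flip: numeral_2_eq_2)
  then show "(\<Sum>s\<leftarrow>reg_stabs. 24 div oct_nat s) = 1002" "(\<Sum>s\<leftarrow>nonreg_stabs. 24 div oct_nat s) = 66"
    by (simp_all add: reg_stabs_def nonreg_stabs_def)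
qed

subsection \<open>Orbits of the representatives\<close>

lemma oct_nth_mem: "xs \<noteq> [] \<Longrightarrow> oct_nth n xs \<in> set xs"
  by (induction n xs rule: oct_nth.induct) simp_all

lemma set_chunk8_step: "\<Union>(set ` set (chunk8_step xs acc n)) = set acc \<union> set xs"
  by (induction xs arbitrary: acc n) (auto split: octal.split)

lemma chunk8_step_nonempty: "chunk8_step xs acc n \<noteq> []"
  by (induction xs arbitrary: acc n) (auto split: octal.split)

lemma rep_props:
  assumes R: "R \<in> set (reg_bits @ nonreg_bits)"
  shows "bit_vectors R" "distinct R" "R \<noteq> []" "good (family R)"
proof -
  have s: "rep_shape R" "nonnull R" using rep_shapes R unfolding all_in_iff by blast+
  show bit_vectors: "bit_vectors R" unfolding bit_vectors_def
  proof
    fix x assume "x \<in> set R"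
    then have "twelve x" using s(1) by (simp add: rep_shape_def)
    then show "length x = 12" by (rule twelve_iff)
  qed
  show "distinct R" using s(1) by (simp add: rep_shape_def uniq_iff)
  show ne: "R \<noteq> []" using s(2) by (simp add: nonnull_iff)
  have "good_rep R" using R good_reps unfolding all_in_iff set_append by blast
  then show "good (family R)" by (rule good_rep_good[OF groups_correct bit_vectors ne])
qed

definition orbit :: "label set set \<Rightarrow> label set set set" where
  "orbit M = (\<lambda>\<sigma>. relabel_family \<sigma> M) ` {\<sigma>. bij \<sigma>}"

lemma admissible_orbit:
  assumes M: "admissible M" obtains R where "R \<in> set (reg_bits @ nonreg_bits)" "M \<in> orbit (family R)"
proof -
  obtain w l where l: "l \<in> set leaves" "[] \<in> set l \<or> set l = bits ` relabel_family (word_perm w) M"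
    by (rule leaves_complete[OF groups_correct points_correct conj_words_ok quarter_flows_ok M])
  let ?tab = "chunk8_step (reg_bits @ nonreg_bits) [] O0"
  have "list_all2 (leaf_ok ?tab) leaves leaf_classes" using leaves_ok unfolding leaves_ok_def all2_iff .
  then obtain p where p: "leaf_ok ?tab l p" using l(1) by (metis list_all2_conv_all_nth in_set_conv_nth)
  obtain a b w' where abw: "p = (a, b, w')" by (rule prod_cases3)
  define R where "R = oct_nth b (oct_nth a ?tab)"
  have eq: "set l = set (map (act_word w') R)"
    using p unfolding abw leaf_ok.simps set_eq_list_iff R_def .
  have chunk: "oct_nth a ?tab \<in> set ?tab" by (rule oct_nth_mem[OF chunk8_step_nonempty])
  then have "nonnull (oct_nth a ?tab)" using chunks_nonnull unfolding all_in_iff by blast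
  then have "R \<in> set (oct_nth a ?tab)" unfolding R_def nonnull_iff by (rule oct_nth_mem)
  then have "R \<in> \<Union>(set ` set ?tab)" by (rule UnionI[OF imageI[OF chunk]])
  then have R: "R \<in> set (reg_bits @ nonreg_bits)" by (simp only: set_chunk8_step list.set Un_empty_left)
  have leq: "set l = bits ` relabel_family (word_perm w') (family R)"
    using act_word_family[OF rep_props(1)[OF R]] eq by blast
  \<comment> \<open>The leaf equals a relabelled representative, whose trees have twelve bits, so
    the marker of an undecided class does not occur.\<close>
  have "[] \<notin> set l"
  proof
    assume "[] \<in> set l"
    then obtain A where "[] = bits A" unfolding leq by blast
    then show False using length_bits[of A] by (metis list.size(3) zero_neq_numeral)
  qed
  then have "bits ` relabel_family (word_perm w) M = bits ` relabel_family (word_perm w') (family R)"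
    using l(2) leq by blast
  then have "relabel_family (word_perm w) M = relabel_family (word_perm w') (family R)"
    by (simp only: inj_image_eq_iff[OF inj_bits])
  then have "M = relabel_family (inv (word_perm w)) (relabel_family (word_perm w') (family R))"
    using relabel_family_inv[OF bij_word_perm] by metis
  also have "\<dots> = relabel_family (inv (word_perm w) \<circ> word_perm w') (family R)"
    by (intro relabel_family_comp bij_is_inj bij_imp_bij_inv bij_word_perm)
  finally have "M = relabel_family (inv (word_perm w) \<circ> word_perm w') (family R)" .
  moreover have "bij (inv (word_perm w) \<circ> word_perm w')"
    by (intro bij_comp bij_imp_bij_inv bij_word_perm)
  ultimately have "M \<in> orbit (family R)" unfolding orbit_def by blast
  then show ?thesis using that R by blast
qed

lemma card_bij: "card {\<sigma>::4 \<Rightarrow> 4. bij \<sigma>} = 24"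
proof -
  have "{\<sigma>::4 \<Rightarrow> 4. bij \<sigma>} = {\<sigma>. \<sigma> permutes UNIV}" by (simp add: permutes_univ bij_iff)
  then show ?thesis using card_permutations[of "UNIV :: 4 set" 4] by (simp add: fact_numeral)
qed

text \<open>The fibres of the orbit map are the left cosets of the stabiliser.\<close>

lemma orbit_stabilizer:
  "card (orbit M) * card {\<sigma>. bij \<sigma> \<and> relabel_family \<sigma> M = M} = 24"
proof -
  let ?f = "\<lambda>\<sigma>. relabel_family \<sigma> M"
  let ?P = "{\<sigma>::4 \<Rightarrow> 4. bij \<sigma>}" and ?S = "{\<sigma>. bij \<sigma> \<and> relabel_family \<sigma> M = M}"
  have fin: "finite ?P" by simp
  have fiber: "card {\<sigma> \<in> ?P. ?f \<sigma> = y} = card ?S" if y: "y \<in> orbit M" for y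
  proof -
    obtain \<tau> where \<tau>: "bij \<tau>" "y = ?f \<tau>" using y unfolding orbit_def by blast
    have "{\<sigma> \<in> ?P. ?f \<sigma> = y} = (\<lambda>\<rho>. \<tau> \<circ> \<rho>) ` ?S"
    proof (intro equalityI subsetI)
      fix \<sigma> assume "\<sigma> \<in> {\<sigma> \<in> ?P. ?f \<sigma> = y}"
      then have \<sigma>: "bij \<sigma>" "?f \<sigma> = ?f \<tau>" using \<tau>(2) by simp_all
      have b: "bij (inv \<tau> \<circ> \<sigma>)" using \<sigma>(1) \<tau>(1) by (intro bij_comp bij_imp_bij_inv)
      have "?f (inv \<tau> \<circ> \<sigma>) = relabel_family (inv \<tau>) (?f \<sigma>)"
        using \<sigma>(1) \<tau>(1) by (intro relabel_family_comp[symmetric] bij_is_inj bij_imp_bij_inv)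
      also have "\<dots> = M" by (simp only: \<sigma>(2) relabel_family_inv[OF \<tau>(1)])
      finally have "inv \<tau> \<circ> \<sigma> \<in> ?S" using b by simp
      moreover have "\<sigma> = \<tau> \<circ> (inv \<tau> \<circ> \<sigma>)"
        using \<tau>(1) by (simp add: fun_eq_iff bij_is_surj surj_f_inv_f)
      ultimately show "\<sigma> \<in> (\<lambda>\<rho>. \<tau> \<circ> \<rho>) ` ?S" by blast
    next
      fix \<sigma> assume "\<sigma> \<in> (\<lambda>\<rho>. \<tau> \<circ> \<rho>) ` ?S"
      then obtain \<rho> where \<rho>: "bij \<rho>" "?f \<rho> = M" "\<sigma> = \<tau> \<circ> \<rho>" by blast
      have "?f \<sigma> = relabel_family \<tau> (?f \<rho>)"
        unfolding \<rho>(3) using \<rho>(1) \<tau>(1) by (intro relabel_family_comp[symmetric] bij_is_inj)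
      then show "\<sigma> \<in> {\<sigma> \<in> ?P. ?f \<sigma> = y}" using \<rho> \<tau> by (simp add: bij_comp)
    qed
    moreover have "inj_on (\<lambda>\<rho>. \<tau> \<circ> \<rho>) ?S"
      using bij_is_inj[OF \<tau>(1)] by (intro inj_onI) (simp add: fun_eq_iff inj_eq)
    ultimately show ?thesis by (simp add: card_image)
  qed
  have "24 = card ?P" by (simp only: card_bij)
  also have "\<dots> = (\<Sum>y\<in>?f ` ?P. card {\<sigma> \<in> ?P. ?f \<sigma> = y})"
    using sum.image_gen[OF fin, of "\<lambda>_. 1::nat" ?f] by simp
  also have "\<dots> = (\<Sum>y\<in>orbit M. card ?S)" using fiber by (intro sum.cong) (simp_all add: orbit_def)
  finally show ?thesis by simp
qed

lemma perm_words: "distinct perm_words" "inj_on word_perm (set perm_words)"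
  "word_perm ` set perm_words = {\<sigma>. bij \<sigma>}"
proof -
  let ?a = "[True,True,True,True,True,False,True,False,False,True,False,False]"
  have d: "distinct (map (\<lambda>w. act_word w ?a) perm_words)" using perm_words_images by (simp only: uniq_iff)
  then show dw: "distinct perm_words" by (simp only: distinct_map)
  have a: "act_word w ?a = bits (relabel (word_perm w) ` lset ?a)" for w
    using act_word_bits[of w "lset ?a"] by (simp add: bits_lset)
  show inj: "inj_on word_perm (set perm_words)"
  proof (rule inj_onI)
    fix v w assume "v \<in> set perm_words" "w \<in> set perm_words" "word_perm v = word_perm w"
    moreover from this have "act_word v ?a = act_word w ?a" by (simp only: a)
    ultimately show "v = w" using d by (simp only: distinct_map inj_on_def)
  qed
  have "card (word_perm ` set perm_words) = 24"
    using card_image[OF inj] distinct_card[OF dw] length_reps(3) by simp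
  then show "word_perm ` set perm_words = {\<sigma>. bij \<sigma>}"
    using bij_word_perm by (intro card_subset_eq) (auto simp: card_bij)
qed

lemma fixes_rep_iff:
  assumes R: "bit_vectors R" shows "fixes_rep R w \<longleftrightarrow> relabel_family (word_perm w) (family R) = family R"
proof -
  let ?N = "relabel_family (word_perm w) (family R)"
  have "fixes_rep R w \<longleftrightarrow> bits ` ?N \<subseteq> bits ` family R"
    unfolding fixes_rep_def subset_of_iff act_word_family[OF R] bits_family[OF R] ..
  also have "\<dots> \<longleftrightarrow> ?N \<subseteq> family R" by (rule inj_image_subset_iff[OF inj_bits])
  also have "\<dots> \<longleftrightarrow> ?N = family R"
  proof
    assume "?N \<subseteq> family R"
    moreover have "card ?N = card (family R)"
      unfolding relabel_family_def
      by (rule card_image[OF inj_on_subset[OF inj_image_relabel[OF bij_word_perm] subset_UNIV]])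
    ultimately show "?N = family R" by (intro card_subset_eq) simp_all
  qed blast
  finally show ?thesis .
qed

lemma card_orbit_rep:
  assumes R: "bit_vectors R" and s: "stab_ok R s" shows "card (orbit (family R)) = 24 div oct_nat s"
proof -
  let ?W = "{w \<in> set perm_words. fixes_rep R w}"
  have "{\<sigma>. bij \<sigma> \<and> relabel_family \<sigma> (family R) = family R} = word_perm ` ?W"
  proof (intro equalityI subsetI)
    fix \<sigma> assume \<sigma>: "\<sigma> \<in> {\<sigma>. bij \<sigma> \<and> relabel_family \<sigma> (family R) = family R}"
    then have "\<sigma> \<in> word_perm ` set perm_words" unfolding perm_words(3) by simp
    then obtain w where w: "w \<in> set perm_words" "\<sigma> = word_perm w" by (rule imageE)
    have "fixes_rep R w" using \<sigma> unfolding fixes_rep_iff[OF R] w(2) by simp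
    then show "\<sigma> \<in> word_perm ` ?W" unfolding w(2) using w(1) by (intro imageI) simp
  next
    fix \<sigma> assume "\<sigma> \<in> word_perm ` ?W"
    then obtain w where "w \<in> ?W" "\<sigma> = word_perm w" by (rule imageE)
    then show "\<sigma> \<in> {\<sigma>. bij \<sigma> \<and> relabel_family \<sigma> (family R) = family R}"
      using bij_word_perm fixes_rep_iff[OF R] by simp
  qed
  moreover have "inj_on word_perm ?W" by (rule inj_on_subset[OF perm_words(2)]) simp
  ultimately have "card {\<sigma>. bij \<sigma> \<and> relabel_family \<sigma> (family R) = family R} = card ?W"
    by (simp only: card_image)
  also have "\<dots> = length (filter (fixes_rep R) perm_words)"
    using distinct_card[of "filter (fixes_rep R) perm_words"] perm_words(1) by simp
  also have "\<dots> = oct_nat s"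
    using s unfolding stab_ok_def same_index_iff select_filter .
  finally have eq: "card (orbit (family R)) * oct_nat s = 24"
    using orbit_stabilizer[of "family R"] by simp
  then have "oct_nat s \<noteq> 0" by (intro notI) simp
  then show ?thesis using eq nonzero_mult_div_cancel_right[of "oct_nat s" "card (orbit (family R))"] by simp
qed

lemma invariant_of_relabel:
  assumes "bij \<sigma>" shows "invariant_of (relabel_family \<sigma> M) = invariant_of M"
  unfolding relabel_family_def by (rule invariant_of_label_perm[OF relabel_label_perm[OF assms]])

lemma invariant_of_orbit:
  assumes "R \<in> set (reg_bits @ nonreg_bits)" "M \<in> orbit (family R)"
  shows "invariant_of M = invariant R"
proof -
  obtain \<sigma> where "bij \<sigma>" "M = relabel_family \<sigma> (family R)" using assms(2) unfolding orbit_def by blast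
  then have "invariant_of M = invariant_of (family R)" using invariant_of_relabel by simp
  then show ?thesis using invariant_family[OF rep_props(1,2)[OF assms(1)]] by simp
qed

lemma invariant_inj: "inj_on invariant (set (reg_bits @ nonreg_bits))"
  using distinct_invariants unfolding distinct_map by blast

lemma distinct_reps: "distinct (reg_bits @ nonreg_bits)"
  using distinct_invariants unfolding distinct_map by blast

definition families :: "bool list list list \<Rightarrow> label set set set" where
  "families Rs = (\<Union>R\<in>set Rs. orbit (family R))"

text \<open>The invariant is constant on orbits and differs between representatives, so the orbits
  are disjoint and their sizes add up.\<close>

lemma card_families:
  assumes Rs: "set Rs \<subseteq> set (reg_bits @ nonreg_bits)" "distinct Rs" and s: "all2 stab_ok Rs ss"
  shows "card (families Rs) = (\<Sum>s\<leftarrow>ss. 24 div oct_nat s)"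
proof -
  have "card (families Rs) = (\<Sum>R\<in>set Rs. card (orbit (family R)))"
    unfolding families_def
  proof (rule card_UN_disjoint)
    show "\<forall>R\<in>set Rs. \<forall>R'\<in>set Rs. R \<noteq> R' \<longrightarrow> orbit (family R) \<inter> orbit (family R') = {}"
    proof (intro ballI impI equals0I)
      fix R R' M assume RR: "R \<in> set Rs" "R' \<in> set Rs" "R \<noteq> R'" "M \<in> orbit (family R) \<inter> orbit (family R')"
      have m: "R \<in> set (reg_bits @ nonreg_bits)" "R' \<in> set (reg_bits @ nonreg_bits)" using RR Rs by blast+
      have "invariant_of M = invariant R" by (rule invariant_of_orbit[OF m(1)]) (use RR in blast)
      moreover have "invariant_of M = invariant R'" by (rule invariant_of_orbit[OF m(2)]) (use RR in blast)
      ultimately have "R = R'" using inj_onD[OF invariant_inj _ m] by simp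
      then show False using RR(3) by blast
    qed
  qed simp_all
  also have "\<dots> = (\<Sum>R\<leftarrow>Rs. card (orbit (family R)))" by (rule sum.distinct_set_conv_list[OF Rs(2)])
  also have "map (\<lambda>R. card (orbit (family R))) Rs = map (\<lambda>s. 24 div oct_nat s) ss"
  proof (rule nth_equalityI)
    have l: "list_all2 stab_ok Rs ss" using s by (simp only: all2_iff)
    then show len: "length (map (\<lambda>R. card (orbit (family R))) Rs) = length (map (\<lambda>s. 24 div oct_nat s) ss)"
      by (simp add: list_all2_lengthD)
    fix i assume "i < length (map (\<lambda>R. card (orbit (family R))) Rs)"
    then have i: "i < length Rs" by simp
    have "Rs ! i \<in> set (reg_bits @ nonreg_bits)" using Rs(1) nth_mem[OF i] by blast
    then have "card (orbit (family (Rs ! i))) = 24 div oct_nat (ss ! i)"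
      by (rule card_orbit_rep[OF rep_props(1) list_all2_nthD[OF l i]])
    then show "map (\<lambda>R. card (orbit (family R))) Rs ! i = map (\<lambda>s. 24 div oct_nat s) ss ! i"
      using i list_all2_lengthD[OF l] by simp
  qed
  finally show ?thesis .
qed

lemma families_good:
  assumes "M \<in> families (reg_bits @ nonreg_bits)" shows "good M"
proof -
  obtain R \<sigma> where R: "R \<in> set (reg_bits @ nonreg_bits)" "bij \<sigma>" "M = relabel_family \<sigma> (family R)"
    using assms unfolding families_def orbit_def by blast
  then show ?thesis using good_relabel[OF R(2) rep_props(4)[OF R(1)]] by simp
qed

lemma families_append: "families (xs @ ys) = families xs \<union> families ys"
  by (simp add: families_def)

lemma families_trees: "M \<in> families (reg_bits @ nonreg_bits) \<Longrightarrow> M \<subseteq> trees"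
  using families_good unfolding good_def by blast

lemma admissible_families: "admissible M \<Longrightarrow> M \<in> families (reg_bits @ nonreg_bits)"
  using admissible_orbit unfolding families_def by blast

subsection \<open>Counting\<close>

text \<open>The trees of a triangulation form an admissible, hence a listed, hence a good family,
  and then the triangulation consists of their faces.\<close>

lemma triangulations_eq: "cayley_triangulations = complex_of ` families (reg_bits @ nonreg_bits)"
proof (intro equalityI subsetI)
  fix \<C> assume C: "\<C> \<in> cayley_triangulations"
  then have t: "tree_sets \<C> \<in> families (reg_bits @ nonreg_bits)"
    by (intro admissible_families triangulation_admissible)
  then have "\<C> = complex_of (tree_sets \<C>)" by (intro triangulation_pure[OF C] families_good)
  then show "\<C> \<in> complex_of ` families (reg_bits @ nonreg_bits)" using t by blast
next
  fix \<C> assume "\<C> \<in> complex_of ` families (reg_bits @ nonreg_bits)"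
  then show "\<C> \<in> cayley_triangulations" using good_triangulation families_good by blast
qed

lemma mixed_subdivisions_eq: "mixed_subdivisions = (`) mcell ` families (reg_bits @ nonreg_bits)"
proof (intro equalityI subsetI)
  fix \<M> assume "\<M> \<in> mixed_subdivisions"
  then obtain M where "admissible M" "\<M> = mcell ` M" by (rule mixed_admissible)
  then show "\<M> \<in> (`) mcell ` families (reg_bits @ nonreg_bits)" using admissible_families by blast
next
  fix \<M> assume "\<M> \<in> (`) mcell ` families (reg_bits @ nonreg_bits)"
  then show "\<M> \<in> mixed_subdivisions" using good_mixed families_good by blast
qed

lemma inj_complex_of: "inj_on complex_of (families (reg_bits @ nonreg_bits))"
  using tree_sets_complex_of families_trees by (metis inj_on_def)

lemma inj_mcell_image: "inj ((`) mcell)"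
  by (rule injI) (metis inj_image_eq_iff injI mcell_inj)

lemma families_sub: "families reg_bits \<subseteq> families (reg_bits @ nonreg_bits)"
  "families nonreg_bits \<subseteq> families (reg_bits @ nonreg_bits)"
  by (simp_all add: families_append)

text \<open>Both sides are indexed injectively by the same families, and the Cayley trick preserves
  the index.\<close>

lemma cayley_trick_bij: "bij_betw cayley_trick cayley_triangulations mixed_subdivisions"
proof -
  let ?F = "families (reg_bits @ nonreg_bits)"
  have ct: "cayley_trick (complex_of M) = mcell ` M" if "M \<in> ?F" for M
    using cayley_trick_complex_of families_trees that by blast
  have "inj_on cayley_trick (complex_of ` ?F)"
  proof (rule inj_onI)
    fix \<C> \<D> assume C: "\<C> \<in> complex_of ` ?F" "\<D> \<in> complex_of ` ?F" and eq: "cayley_trick \<C> = cayley_trick \<D>"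
    obtain M N where M: "M \<in> ?F" "\<C> = complex_of M" and N: "N \<in> ?F" "\<D> = complex_of N" using C by blast
    have "mcell ` M = mcell ` N" using eq M N ct by metis
    then show "\<C> = \<D>" using injD[OF inj_mcell_image] M N by metis
  qed
  moreover have "cayley_trick ` complex_of ` ?F = (`) mcell ` ?F"
    using ct by (simp add: image_image)
  ultimately show ?thesis unfolding triangulations_eq mixed_subdivisions_eq bij_betw_def by blast
qed

lemma regular_families:
  assumes "M \<in> families reg_bits" shows "regular_triangulation (complex_of M)"
proof -
  obtain R \<sigma> where R: "R \<in> set reg_bits" "bij \<sigma>" "M = relabel_family \<sigma> (family R)"
    using assms unfolding families_def orbit_def by blast
  obtain ws where ws: "ws \<in> set heights" "lifted R ws"
    using heights_lift R(1) unfolding all2_iff by (metis list_all2_conv_all_nth in_set_conv_nth)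
  have "twelve (map (\<lambda>_. True) ws)" using heights_length ws(1) unfolding all_in_iff by blast
  then have "length ws = 12" using twelve_iff by fastforce
  then obtain \<omega> where "lifts (family R) \<omega>"
    using lifted_lifts[OF groups_correct _ ws(2)] rep_props(1) R(1) by (metis UnI1 set_append)
  then have "lifts M (\<omega> \<circ> relabel (inv \<sigma>))" unfolding R(3) by (rule lifts_relabel[OF R(2)])
  moreover have "good M" using families_good families_sub(1) assms by blast
  ultimately show ?thesis using regular_iff by blast
qed

lemma nonregular_families:
  assumes "M \<in> families nonreg_bits" shows "\<not> regular_triangulation (complex_of M)"
proof
  assume reg: "regular_triangulation (complex_of M)"
  obtain R \<sigma> where R: "R \<in> set nonreg_bits" "bij \<sigma>" "M = relabel_family \<sigma> (family R)"
    using assms unfolding families_def orbit_def by blast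
  have R': "R \<in> set (reg_bits @ nonreg_bits)" using R(1) by simp
  obtain ps where ps: "farkas R ps"
    using farkas_pairs_ok R(1) unfolding all2_iff by (metis list_all2_conv_all_nth in_set_conv_nth)
  have "good M" using families_good families_sub(2) assms by blast
  then obtain \<omega> where "lifts M \<omega>" using reg regular_iff by blast
  \<comment> \<open>The heights are carried back to the representative, where the certificate
    applies.\<close>
  then have "lifts (relabel_family (inv \<sigma>) M) (\<omega> \<circ> relabel (inv (inv \<sigma>)))"
    by (rule lifts_relabel[OF bij_imp_bij_inv[OF R(2)]])
  then show False
    using farkas_not_lifts[OF groups_correct rep_props(1)[OF R'] ps]
    by (simp only: R(3) relabel_family_inv[OF R(2)])
qed

lemma regular_triangulations_eq:
  "{\<C> \<in> cayley_triangulations. regular_triangulation \<C>} = complex_of ` families reg_bits"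
  "{\<C> \<in> cayley_triangulations. \<not> regular_triangulation \<C>} = complex_of ` families nonreg_bits"
  using regular_families nonregular_families unfolding triangulations_eq families_append by blast+

lemma card_regular_families: "card (families reg_bits) = 1002" "card (families nonreg_bits) = 66"
  using card_families[OF _ _ stabs_ok(1)] card_families[OF _ _ stabs_ok(2)] distinct_reps stab_sums by simp_all

lemma card_all_families: "card (families (reg_bits @ nonreg_bits)) = 1068"
proof -
  have "families reg_bits \<inter> families nonreg_bits = {}"
    using regular_families nonregular_families by blast
  then show ?thesis
    using card_Un_disjoint[of "families reg_bits" "families nonreg_bits"] card_regular_families
    by (simp add: families_append)
qed

subsection \<open>Symmetry classes\<close>

text \<open>Trees are the faces with seven elements, so a complex determines its family.\<close>

lemma families_card_7:
  assumes "M \<subseteq> trees" shows "M = {A \<in> faces M. card A = 7}"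
proof (intro equalityI subsetI)
  fix T assume T: "T \<in> M"
  then have "card T = 7" using assms by (auto simp: trees_def)
  then show "T \<in> {A \<in> faces M. card A = 7}" using T by (auto simp: faces_def)
next
  fix A assume A: "A \<in> {A \<in> faces M. card A = 7}"
  then obtain T where T: "T \<in> M" "A \<subseteq> T" by (auto simp: faces_def)
  then have "card T = 7" using assms by (auto simp: trees_def)
  then have "A = T" using A T by (intro card_subset_eq) auto
  then show "A \<in> M" using T by simp
qed

lemma faces_down_closed: "down_closed (faces M)"
  unfolding down_closed_def faces_def by blast

lemma faces_relabel_family:
  "faces (relabel_family \<sigma> M) = (`) (relabel \<sigma>) ` faces M"
  using faces_relabel by blast

lemma image_faces_family:
  assumes N: "N \<subseteq> trees" and M: "M \<subseteq> trees" and \<pi>: "bij \<pi>" and eq: "faces N = (`) \<pi> ` faces M"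
  shows "N = (`) \<pi> ` M"
proof -
  have c: "card (\<pi> ` A) = card A" for A using \<pi> by (intro card_image) (auto simp: bij_def inj_on_def)
  have "N = {A \<in> (`) \<pi> ` faces M. card A = 7}" using families_card_7[OF N] eq by simp
  also have "\<dots> = (`) \<pi> ` {A \<in> faces M. card A = 7}" using c by force
  also have "\<dots> = (`) \<pi> ` M" using families_card_7[OF M] by simp
  finally show ?thesis .
qed

lemma same_orbit_relabel:
  assumes "M \<in> orbit F" "N \<in> orbit F" obtains \<sigma> where "bij \<sigma>" "N = relabel_family \<sigma> M"
proof -
  obtain \<sigma> \<tau> where \<sigma>: "bij \<sigma>" "M = relabel_family \<sigma> F" and \<tau>: "bij \<tau>" "N = relabel_family \<tau> F"
    using assms unfolding orbit_def by blast
  have "N = relabel_family \<tau> (relabel_family (inv \<sigma>) M)" unfolding \<sigma>(2) relabel_family_inv[OF \<sigma>(1)] by (rule \<tau>(2))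
  also have "\<dots> = relabel_family (\<tau> \<circ> inv \<sigma>) M"
    using \<sigma>(1) \<tau>(1) by (intro relabel_family_comp bij_is_inj bij_imp_bij_inv)
  finally show ?thesis using that[of "\<tau> \<circ> inv \<sigma>"] \<sigma>(1) \<tau>(1) by (simp add: bij_comp bij_imp_bij_inv)
qed

text \<open>A permutation of the large group matching the ideals matches the families and preserves
  the invariant. Equal invariants mean a common representative, so a permutation of the four indices
  already relates the families.\<close>

lemma symmetric_iff:
  assumes M: "M \<in> families (reg_bits @ nonreg_bits)" and N: "N \<in> families (reg_bits @ nonreg_bits)"
  shows "(\<exists>\<pi>\<in>label_perms. (stanley_reisner_ideal (complex_of N) :: 'k::field polyring set) =
      rename_vars \<pi> ` stanley_reisner_ideal (complex_of M)) \<longleftrightarrow> invariant_of M = invariant_of N"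
proof -
  have t: "M \<subseteq> trees" "N \<subseteq> trees" using families_trees M N by blast+
  have ideal: "(stanley_reisner_ideal (complex_of N) :: 'k polyring set) =
      rename_vars \<pi> ` stanley_reisner_ideal (complex_of M) \<longleftrightarrow> faces N = (`) \<pi> ` faces M"
    if "\<pi> \<in> label_perms" for \<pi>
    using rename_ideal_iff[OF label_perm_bij[OF that], of "complex_of M" "complex_of N"] faces_down_closed
    unfolding vertex_labels_complex_of[OF t(1)] vertex_labels_complex_of[OF t(2)] by blast
  show ?thesis
  proof
    assume "\<exists>\<pi>\<in>label_perms. (stanley_reisner_ideal (complex_of N) :: 'k polyring set) =
      rename_vars \<pi> ` stanley_reisner_ideal (complex_of M)"
    then obtain \<pi> where \<pi>: "\<pi> \<in> label_perms" "faces N = (`) \<pi> ` faces M" using ideal by blast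
    have "N = (`) \<pi> ` M" by (rule image_faces_family[OF t(2,1) label_perm_bij[OF \<pi>(1)] \<pi>(2)])
    then show "invariant_of M = invariant_of N" using invariant_of_label_perm[OF \<pi>(1)] by simp
  next
    assume eq: "invariant_of M = invariant_of N"
    obtain R where R: "R \<in> set (reg_bits @ nonreg_bits)" "M \<in> orbit (family R)" using M unfolding families_def by blast
    obtain R' where R': "R' \<in> set (reg_bits @ nonreg_bits)" "N \<in> orbit (family R')" using N unfolding families_def by blast
    have "invariant R = invariant R'" using eq invariant_of_orbit[OF R] invariant_of_orbit[OF R'] by simp
    then have "R = R'" using inj_onD[OF invariant_inj _ R(1) R'(1)] by blast
    then obtain \<sigma> where \<sigma>: "bij \<sigma>" "N = relabel_family \<sigma> M" using same_orbit_relabel R(2) R'(2) by metis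
    have "faces N = (`) (relabel \<sigma>) ` faces M" unfolding \<sigma>(2) by (rule faces_relabel_family)
    then show "\<exists>\<pi>\<in>label_perms. (stanley_reisner_ideal (complex_of N) :: 'k polyring set) =
      rename_vars \<pi> ` stanley_reisner_ideal (complex_of M)"
      using ideal relabel_label_perm[OF \<sigma>(1)] by blast
  qed
qed

text \<open>The relation becomes the kernel of an integer function, in which the field no longer
  occurs.\<close>

lemma symmetry_rel_eq:
  "symmetry_rel TYPE('k::field) = {(\<C>, \<D>). \<C> \<in> cayley_triangulations \<and> \<D> \<in> cayley_triangulations \<and>
     invariant_of (tree_sets \<C>) = invariant_of (tree_sets \<D>)}"
proof -
  have "(\<exists>\<pi>\<in>label_perms. (stanley_reisner_ideal \<D> :: 'k polyring set) = rename_vars \<pi> ` stanley_reisner_ideal \<C>)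
      \<longleftrightarrow> invariant_of (tree_sets \<C>) = invariant_of (tree_sets \<D>)"
    if C: "\<C> \<in> cayley_triangulations" and D: "\<D> \<in> cayley_triangulations" for \<C> \<D>
  proof -
    obtain M where M: "M \<in> families (reg_bits @ nonreg_bits)" "\<C> = complex_of M" using C unfolding triangulations_eq by blast
    obtain N where N: "N \<in> families (reg_bits @ nonreg_bits)" "\<D> = complex_of N" using D unfolding triangulations_eq by blast
    show ?thesis
      unfolding M(2) N(2) tree_sets_complex_of[OF families_trees[OF M(1)]] tree_sets_complex_of[OF families_trees[OF N(1)]]
      by (rule symmetric_iff[OF M(1) N(1)])
  qed
  then show ?thesis unfolding symmetry_rel_def by blast
qed

lemma card_quotient_kernel:
  assumes "A \<subseteq> X" shows "card (A // {(x, y). x \<in> X \<and> y \<in> X \<and> h x = h y}) = card (h ` A)"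
proof -
  let ?r = "{(x, y). x \<in> X \<and> y \<in> X \<and> h x = h y}"
  let ?g = "\<lambda>k. {y \<in> X. h y = k}"
  have "?r `` {x} = ?g (h x)" if "x \<in> A" for x using assms that by auto
  then have "A // ?r = ?g ` h ` A" unfolding quotient_def by auto
  moreover have "inj_on ?g (h ` A)"
  proof (rule inj_onI)
    fix k l assume k: "k \<in> h ` A" and eq: "?g k = ?g l"
    obtain x where "x \<in> A" "k = h x" using k by blast
    then have "x \<in> ?g l" using eq assms by blast
    then show "k = l" using \<open>k = h x\<close> by simp
  qed
  ultimately show ?thesis by (simp add: card_image)
qed

lemma card_symmetry_classes:
  assumes Rs: "set Rs \<subseteq> set (reg_bits @ nonreg_bits)" "distinct Rs"
  shows "card (complex_of ` families Rs // symmetry_rel TYPE('k::field)) = length Rs"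
proof -
  have subvec: "families Rs \<subseteq> families (reg_bits @ nonreg_bits)" using Rs(1) unfolding families_def by blast
  have "card (complex_of ` families Rs // symmetry_rel TYPE('k)) = card ((\<lambda>\<C>. invariant_of (tree_sets \<C>)) ` complex_of ` families Rs)"
    unfolding symmetry_rel_eq
    by (rule card_quotient_kernel) (use subvec in \<open>unfold triangulations_eq, blast\<close>)
  also have "(\<lambda>\<C>. invariant_of (tree_sets \<C>)) ` complex_of ` families Rs = invariant_of ` families Rs"
    unfolding image_image
    using subvec tree_sets_complex_of families_trees by (intro image_cong refl) (metis subsetD)
  also have "\<dots> = invariant ` set Rs"
  proof (intro equalityI subsetI)
    fix k assume "k \<in> invariant_of ` families Rs"
    then obtain R M where "R \<in> set Rs" "M \<in> orbit (family R)" "k = invariant_of M" unfolding families_def by blast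
    then show "k \<in> invariant ` set Rs" using invariant_of_orbit Rs(1) by blast
  next
    fix k assume "k \<in> invariant ` set Rs"
    then obtain R where R: "R \<in> set Rs" "k = invariant R" by blast
    have "relabel_family id (family R) \<in> orbit (family R)" unfolding orbit_def by (intro imageI CollectI bij_id)
    then have f: "family R \<in> orbit (family R)" by (simp only: relabel_family_id)
    then have "invariant_of (family R) = k" using invariant_of_orbit R Rs(1) by blast
    then show "k \<in> invariant_of ` families Rs" using f R(1) unfolding families_def by blast
  qed
  also have "card \<dots> = card (set Rs)" by (rule card_image[OF inj_on_subset[OF invariant_inj Rs(1)]])
  also have "\<dots> = length Rs" by (rule distinct_card[OF Rs(2)])
  finally show ?thesis .
qed

theorem theorem4p3:
  shows "card mixed_subdivisions = 1068 \<and>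
    card cayley_triangulations = 1068 \<and>
    bij_betw cayley_trick cayley_triangulations mixed_subdivisions \<and>
    card {\<C> \<in> cayley_triangulations. regular_triangulation \<C>} = 1002 \<and>
    card ({\<C> \<in> cayley_triangulations. regular_triangulation \<C>}
          // symmetry_rel TYPE('k::field)) = 48 \<and>
    card ({\<C> \<in> cayley_triangulations. \<not> regular_triangulation \<C>}
          // symmetry_rel TYPE('k::field)) = 7"
proof (intro conjI)
  show card: "card cayley_triangulations = 1068"
    unfolding triangulations_eq card_image[OF inj_complex_of] by (rule card_all_families)
  show "bij_betw cayley_trick cayley_triangulations mixed_subdivisions" by (rule cayley_trick_bij)
  then show "card mixed_subdivisions = 1068" using bij_betw_same_card card by metis
  show "card {\<C> \<in> cayley_triangulations. regular_triangulation \<C>} = 1002"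
    unfolding regular_triangulations_eq card_image[OF inj_on_subset[OF inj_complex_of families_sub(1)]]
    by (rule card_regular_families)
  show "card ({\<C> \<in> cayley_triangulations. regular_triangulation \<C>} // symmetry_rel TYPE('k)) = 48"
    unfolding regular_triangulations_eq using card_symmetry_classes[of reg_bits] distinct_reps
    by (simp add: length_reps)
  show "card ({\<C> \<in> cayley_triangulations. \<not> regular_triangulation \<C>} // symmetry_rel TYPE('k)) = 7"
    unfolding regular_triangulations_eq using card_symmetry_classes[of nonreg_bits] distinct_reps
    by (simp add: length_reps)
qed

end
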